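(* For $\omega\in\{0,1\}^{\mathbb Z_{\ge0}}$ let $(X^\omega,\mu^\omega,(T^\omega_n)_{n\in\mathbb Z})$ be the associated infinite Chacon like system. Then: (i) For each $\omega$, the dynamical system $(X^\omega,\mu^\omega,T_1^\omega)$ is totally ergodic, it has Radon MSJ, and $C(T_1^\omega)=\{T_n^\omega: n\in\mathbb Z\}$. (ii) If $\omega\sim\omega'$ (i.e. there is $N>0$ with $\omega(n)=\omega'(n)$ for all $n>N$), then $(X^\omega,\mu^\omega,T_1^\omega)$ is isomorphic to $(X^{\omega'},\mu^{\omega'},T_1^{\omega'})$. (iii) If $\omega\not\sim\omega'$, then $(X^\omega,\mu^\omega,T_1^\omega)$ and $(X^{\omega'},\mu^{\omega'},T_1^{\omega'})$ are Radon disjoint.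
   Context: **Infinite Chacon like systems.** Put $h_0:=1$, $h_{n+1}:=6h_n+1$ for $n\ge 0$. Given $\omega\in\{0,1\}^{\mathbb Z_{\ge0}}$, for $n\ge 0$ let $$F_n:=\left\{-\tfrac{h_n-1}2,-\tfrac{h_n-3}2,\dots,\tfrac{h_n-1}2\right\}\subset\mathbb Z,\qquad C^\omega_{n+1}:=\{-h_n-1+\omega(n),\,0,\,h_n+\omega(n)\}.$$ Let $X^\omega_n:=F_n\times C^\omega_{n+1}\times C^\omega_{n+2}\times\cdots$ with the product topology. The map $(f_n,c_{n+1},c_{n+2},\dots)\mapsto(f_n+c_{n+1},c_{n+2},\dots)$ is a topological embedding $X^\omega_n\to X^\omega_{n+1}$, by which $X^\omega_n$ is regarded as a (compact open) subset of $X^\omega_{n+1}$; $X^\omega=\bigcup_nX^\omega_n$ is the inductive limit, a locally compact non-compact Cantor space. For $f\in F_n$ let $[f]_n:=\{(f_n,c_{n+1},\dots)\in X^\omega_n: f_n=f\}$. For $g\in\mathbb Z$ and $x\in X^\omega$, for all large $n$ one has $x=(f_n,c_{n+1},\dots)\in X^\omega_n$ with $g+f_n\in F_n$, and $T^\omega_gx:=(g+f_n,c_{n+1},\dots)\in X^\omega_n$; this is a well-defined free continuous $\mathbb Z$-action. $\mu^\omega$ is the unique Borel measure on $X^\omega$ with $\mu^\omega([f]_n)=3^{-n}$ for all $f\in F_n$, $n\ge0$; it is infinite, Radon, $T_1^\omega$-invariant and ergodic. **Notions.** A Borel measure on a locally compact space is Radon if it is finite on compact sets. Below $(X,T,\mu)$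 and $(Y,S,\nu)$ are ergodic Radon systems (a homeomorphism of a locally compact Cantor space together with an invariant ergodic Radon measure). $T$ is totally ergodic if $T^m$ is ergodic for every $m\neq0$. Isomorphic means isomorphic as measure preserving systems. For $d>1$, a $d$-fold Radon self-joining of $T$ is a Radon $T^{\times d}$-invariant measure on $X^d$ all of whose coordinate projections (which need not be $\sigma$-finite) are equivalent to $\mu$, i.e. have the same null sets. $C(T)$ is the group of all invertible $\mu$-nonsingular transformations commuting with $T$ (mod null sets). For $S_1,\dots,S_{d-1}\in C(T)$ the graph-joining $\mu_{S_1,\dots,S_{d-1}}$ is given by $\mu_{S_1,\dots,S_{d-1}}(A_1\times\cdots\times A_d)=\mu(A_1\cap S_1^{-1}A_2\cap\cdots\cap S_{d-1}^{-1}A_d)$. $T$ has Radon MSJ$_d$ if $C(T)=\{T^n:n\in\mathbb Z\}$ and for each ergodic $d$-fold Radon self-joining $\lambda$ there is a partition of $\{1,\dots,d\}$ into $J_1,\dots,J_k$ such that $\lambda$ is the direct product of its marginals $\lambda_i$ on $X^{J_i}$, where (up to a multiplicative constant) $\lambda_i$ is a graph-joining of $T$ if $\#J_i>1$ and $\lambda_i=\mu$ if $\#J_i=1$. $T$ has Radon MSJ if it has Radon MSJ$_d$ for every $d>1$. $(X,T,\mu)$ and $(Y,S,\nu)$ are Radon disjoint if $\mu\times\nu$ is the only (up to a multiplicative constant) ergodic Radon $(T\times S)$-invariant measure on $X\times Y$ whose coordinate projections are equivalent to $\mu$ and $\nu$ respectively. *)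

theory Defs
  imports "HOL-Analysis.Analysis" "HOL-Library.Disjoint_Sets"
begin

section \<open>Radon systems, joinings and disjointness\<close>

text \<open>
  A space is given by an abstract topology; measures on it live on its Borel sigma-algebra.
  Self-maps only matter on the space of the measure, and their values outside it are ignored.
\<close>

definition borel_of :: "'a topology \<Rightarrow> 'a measure" where
  "borel_of X = sigma (topspace X) {U. openin X U}"

definition radon_measure :: "'a topology \<Rightarrow> 'a measure \<Rightarrow> bool" where
  "radon_measure X M \<longleftrightarrow>
     space M = topspace X \<and> sets M = sets (borel_of X) \<and>
     (\<forall>K. compactin X K \<longrightarrow> emeasure M K < \<infinity>)"

definition invariant_measure :: "'a measure \<Rightarrow> ('a \<Rightarrow> 'a) \<Rightarrow> bool" where
  "invariant_measure M T \<longleftrightarrow> T \<in> M \<rightarrow>\<^sub>M M \<and> distr M M T = M"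

definition ergodic :: "'a measure \<Rightarrow> ('a \<Rightarrow> 'a) \<Rightarrow> bool" where
  "ergodic M T \<longleftrightarrow>
     (\<forall>A \<in> sets M. T -` A \<inter> space M = A \<longrightarrow> A \<in> null_sets M \<or> space M - A \<in> null_sets M)"

definition int_iter :: "'a set \<Rightarrow> ('a \<Rightarrow> 'a) \<Rightarrow> int \<Rightarrow> 'a \<Rightarrow> 'a" where
  "int_iter X T n = (if n \<ge> 0 then T ^^ nat n else inv_into X T ^^ nat (- n))"

definition totally_ergodic :: "'a measure \<Rightarrow> ('a \<Rightarrow> 'a) \<Rightarrow> bool" where
  "totally_ergodic M T \<longleftrightarrow> (\<forall>m. m \<noteq> 0 \<longrightarrow> ergodic M (int_iter (space M) T m))"

definition isomorphic_systems ::
    "'a measure \<Rightarrow> ('a \<Rightarrow> 'a) \<Rightarrow> 'b measure \<Rightarrow> ('b \<Rightarrow> 'b) \<Rightarrow> bool" where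
  "isomorphic_systems M T N S \<longleftrightarrow>
     (\<exists>\<phi> \<in> M \<rightarrow>\<^sub>M N. \<exists>\<psi> \<in> N \<rightarrow>\<^sub>M M.
        (AE x in M. \<psi> (\<phi> x) = x) \<and> (AE y in N. \<phi> (\<psi> y) = y) \<and>
        distr M N \<phi> = N \<and> (AE x in M. \<phi> (T x) = S (\<phi> x)))"

text \<open>
  Transformations are identified modulo null sets by working with saturated sets: the
  centralizer contains all representatives of its elements, and \<open>mod_null M \<T>\<close> is
  the set of all representatives of the members of \<open>\<T>\<close>.  Nonsingularity of the
  almost everywhere inverse \<open>R\<close> follows from that of \<open>S\<close>.
\<close>

definition centralizer :: "'a measure \<Rightarrow> ('a \<Rightarrow> 'a) \<Rightarrow> ('a \<Rightarrow> 'a) set" where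
  "centralizer M T =
     {S \<in> M \<rightarrow>\<^sub>M M.
        (\<exists>R \<in> M \<rightarrow>\<^sub>M M. (AE x in M. R (S x) = x) \<and> (AE x in M. S (R x) = x)) \<and>
        null_sets (distr M M S) = null_sets M \<and>
        (AE x in M. S (T x) = T (S x))}"

definition mod_null :: "'a measure \<Rightarrow> ('a \<Rightarrow> 'a) set \<Rightarrow> ('a \<Rightarrow> 'a) set" where
  "mod_null M \<T> = {S \<in> M \<rightarrow>\<^sub>M M. \<exists>R \<in> \<T>. AE x in M. S x = R x}"

definition power_space :: "'a topology \<Rightarrow> nat set \<Rightarrow> (nat \<Rightarrow> 'a) topology" where
  "power_space X J = product_topology (\<lambda>_. X) J"

definition power_map :: "('a \<Rightarrow> 'a) \<Rightarrow> nat set \<Rightarrow> (nat \<Rightarrow> 'a) \<Rightarrow> nat \<Rightarrow> 'a" where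
  "power_map T J x = (\<lambda>j\<in>J. T (x j))"

definition radon_self_joining ::
    "'a topology \<Rightarrow> 'a measure \<Rightarrow> ('a \<Rightarrow> 'a) \<Rightarrow> nat \<Rightarrow> (nat \<Rightarrow> 'a) measure \<Rightarrow> bool" where
  "radon_self_joining X M T d L \<longleftrightarrow>
     radon_measure (power_space X {1..d}) L \<and>
     invariant_measure L (power_map T {1..d}) \<and>
     (\<forall>j \<in> {1..d}. null_sets (distr L M (\<lambda>x. x j)) = null_sets M)"

text \<open>
  On \<open>X\<^sup>J\<close> the least index of \<open>J\<close> plays the role of the first coordinate, which carries no
  transformation; the transformation at another index \<open>j\<close> is \<open>S j\<close>.
\<close>

definition graph_joining ::
    "'a topology \<Rightarrow> 'a measure \<Rightarrow> ('a \<Rightarrow> 'a) \<Rightarrow> nat set \<Rightarrow> (nat \<Rightarrow> 'a) measure \<Rightarrow> bool" where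
  "graph_joining X M T J L \<longleftrightarrow>
     space L = topspace (power_space X J) \<and> sets L = sets (borel_of (power_space X J)) \<and>
     (\<exists>S. (\<forall>j \<in> J - {Min J}. S j \<in> centralizer M T) \<and>
        (\<forall>A. (\<forall>j \<in> J. A j \<in> sets M) \<longrightarrow>
           emeasure L (\<Pi>\<^sub>E j\<in>J. A j) =
           emeasure M (A (Min J) \<inter> (\<Inter>j \<in> J - {Min J}. S j -` A j \<inter> space M))))"

text \<open>
  The second alternative is the measure \<open>M\<close> transported along the identification of
  \<open>X\<close> with \<open>X\<^sup>J\<close> for a singleton \<open>J\<close>.
\<close>

definition msj_factor ::
    "'a topology \<Rightarrow> 'a measure \<Rightarrow> ('a \<Rightarrow> 'a) \<Rightarrow> nat set \<Rightarrow> (nat \<Rightarrow> 'a) measure \<Rightarrow> bool" where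
  "msj_factor X M T J L \<longleftrightarrow>
     (\<exists>c>0. \<exists>L'. L = scale_measure (ennreal c) L' \<and>
        (if card J > 1 then graph_joining X M T J L'
         else L' = distr M (borel_of (power_space X J)) (\<lambda>x. \<lambda>j\<in>J. x)))"

text \<open>
  The direct product of measures \<open>L J\<close> on the spaces \<open>X\<^sup>J\<close>, where \<open>J\<close> runs through a partition
  \<open>P\<close> of \<open>I\<close>, as a measure on \<open>X\<^sup>I\<close>: the index \<open>i\<close> is read off in the block containing it.
\<close>

definition block_product ::
    "'a topology \<Rightarrow> nat set \<Rightarrow> nat set set \<Rightarrow> (nat set \<Rightarrow> (nat \<Rightarrow> 'a) measure)
      \<Rightarrow> (nat \<Rightarrow> 'a) measure" where
  "block_product X I P L =
     distr (PiM P L) (borel_of (power_space X I)) (\<lambda>y. \<lambda>i\<in>I. y (THE J. J \<in> P \<and> i \<in> J) i)"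

definition radon_msj_d :: "'a topology \<Rightarrow> 'a measure \<Rightarrow> ('a \<Rightarrow> 'a) \<Rightarrow> nat \<Rightarrow> bool" where
  "radon_msj_d X M T d \<longleftrightarrow>
     centralizer M T = mod_null M (range (int_iter (space M) T)) \<and>
     (\<forall>L. radon_self_joining X M T d L \<and> ergodic L (power_map T {1..d}) \<longrightarrow>
        (\<exists>P F. partition_on {1..d} P \<and> (\<forall>J \<in> P. msj_factor X M T J (F J)) \<and>
           L = block_product X {1..d} P F))"

definition radon_msj :: "'a topology \<Rightarrow> 'a measure \<Rightarrow> ('a \<Rightarrow> 'a) \<Rightarrow> bool" where
  "radon_msj X M T \<longleftrightarrow> (\<forall>d>1. radon_msj_d X M T d)"

definition radon_joining ::
    "'a topology \<Rightarrow> 'a measure \<Rightarrow> ('a \<Rightarrow> 'a) \<Rightarrow> 'b topology \<Rightarrow> 'b measure \<Rightarrow> ('b \<Rightarrow> 'b)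
      \<Rightarrow> ('a \<times> 'b) measure \<Rightarrow> bool" where
  "radon_joining X M T Y N S L \<longleftrightarrow>
     radon_measure (prod_topology X Y) L \<and> invariant_measure L (map_prod T S) \<and>
     null_sets (distr L M fst) = null_sets M \<and> null_sets (distr L N snd) = null_sets N"

definition radon_disjoint ::
    "'a topology \<Rightarrow> 'a measure \<Rightarrow> ('a \<Rightarrow> 'a) \<Rightarrow> 'b topology \<Rightarrow> 'b measure \<Rightarrow> ('b \<Rightarrow> 'b) \<Rightarrow> bool" where
  "radon_disjoint X M T Y N S \<longleftrightarrow>
     (\<forall>L. radon_joining X M T Y N S L \<and> ergodic L (map_prod T S) \<longleftrightarrow>
        (\<exists>c>0. L = scale_measure (ennreal c) (M \<Otimes>\<^sub>M N)))"


section \<open>Infinite Chacon like systems\<close>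

fun height :: "nat \<Rightarrow> int" where
  "height 0 = 1"
| "height (Suc n) = 6 * height n + 1"

definition F_set :: "nat \<Rightarrow> int set" where
  "F_set n = {- ((height n - 1) div 2) .. (height n - 1) div 2}"

text \<open>The parameter \<open>\<omega>\<close> is a Boolean sequence; the set with index \<open>0\<close> is never used.\<close>

fun C_set :: "(nat \<Rightarrow> bool) \<Rightarrow> nat \<Rightarrow> int set" where
  "C_set \<omega> 0 = {}"
| "C_set \<omega> (Suc n) = {- height n - 1 + of_bool (\<omega> n), 0, height n + of_bool (\<omega> n)}"

text \<open>
  A point \<open>(f\<^sub>n, c\<^sub>n\<^sub>+\<^sub>1, c\<^sub>n\<^sub>+\<^sub>2, \<dots>)\<close> of level \<open>n\<close> is the sequence \<open>x\<close> with \<open>x 0 = f\<^sub>n\<close> and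
  \<open>x k = c\<^sub>n\<^sub>+\<^sub>k\<close> for \<open>k \<ge> 1\<close>.
\<close>

definition level_space :: "(nat \<Rightarrow> bool) \<Rightarrow> nat \<Rightarrow> (nat \<Rightarrow> int) topology" where
  "level_space \<omega> n =
     product_topology (\<lambda>k. discrete_topology (if k = 0 then F_set n else C_set \<omega> (n + k))) UNIV"

definition embed :: "(nat \<Rightarrow> int) \<Rightarrow> nat \<Rightarrow> int" where
  "embed x = (\<lambda>k. if k = 0 then x 0 + x 1 else x (Suc k))"

text \<open>
  The inductive limit is realised as the disjoint union of the levels modulo the relation
  that identifies every point with its images under the embeddings.
\<close>

type_synonym chacon_point = "(nat \<times> (nat \<Rightarrow> int)) set"

definition limit_rel :: "(nat \<Rightarrow> bool) \<Rightarrow> ((nat \<times> (nat \<Rightarrow> int)) \<times> (nat \<times> (nat \<Rightarrow> int))) set" where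
  "limit_rel \<omega> = {((n, x), (m, y)).
     x \<in> topspace (level_space \<omega> n) \<and> y \<in> topspace (level_space \<omega> m) \<and>
     (\<exists>i j. n + i = m + j \<and> (embed ^^ i) x = (embed ^^ j) y)}"

definition to_limit :: "(nat \<Rightarrow> bool) \<Rightarrow> nat \<Rightarrow> (nat \<Rightarrow> int) \<Rightarrow> chacon_point" where
  "to_limit \<omega> n x = limit_rel \<omega> `` {(n, x)}"

definition chacon_points :: "(nat \<Rightarrow> bool) \<Rightarrow> chacon_point set" where
  "chacon_points \<omega> = (SIGMA n : UNIV. topspace (level_space \<omega> n)) // limit_rel \<omega>"

definition chacon_space :: "(nat \<Rightarrow> bool) \<Rightarrow> chacon_point topology" where
  "chacon_space \<omega> = topology (\<lambda>U. U \<subseteq> chacon_points \<omega> \<and>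
     (\<forall>n. openin (level_space \<omega> n) {x \<in> topspace (level_space \<omega> n). to_limit \<omega> n x \<in> U}))"

lemma openin_chacon_space:
  "openin (chacon_space \<omega>) U \<longleftrightarrow> U \<subseteq> chacon_points \<omega> \<and>
     (\<forall>n. openin (level_space \<omega> n) {x \<in> topspace (level_space \<omega> n). to_limit \<omega> n x \<in> U})"
proof -
  let ?op = "\<lambda>U. U \<subseteq> chacon_points \<omega> \<and>
     (\<forall>n. openin (level_space \<omega> n) {x \<in> topspace (level_space \<omega> n). to_limit \<omega> n x \<in> U})"
  have "istopology ?op"
    unfolding istopology_def
  proof (intro conjI allI impI)
    fix U V n assume U: "?op U" and V: "?op V"
    show "U \<inter> V \<subseteq> chacon_points \<omega>" using U by blast
    have "{x \<in> topspace (level_space \<omega> n). to_limit \<omega> n x \<in> U \<inter> V} =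
        {x \<in> topspace (level_space \<omega> n). to_limit \<omega> n x \<in> U} \<inter>
        {x \<in> topspace (level_space \<omega> n). to_limit \<omega> n x \<in> V}" by blast
    then show "openin (level_space \<omega> n)
        {x \<in> topspace (level_space \<omega> n). to_limit \<omega> n x \<in> U \<inter> V}"
      using U V by (metis (no_types, lifting) openin_Int)
  next
    fix \<U> n assume *: "\<forall>U\<in>\<U>. ?op U"
    show "\<Union>\<U> \<subseteq> chacon_points \<omega>" using * by blast
    have "{x \<in> topspace (level_space \<omega> n). to_limit \<omega> n x \<in> \<Union>\<U>} =
        (\<Union>U\<in>\<U>. {x \<in> topspace (level_space \<omega> n). to_limit \<omega> n x \<in> U})" by blast
    moreover have "openin (level_space \<omega> n)
        (\<Union>U\<in>\<U>. {x \<in> topspace (level_space \<omega> n). to_limit \<omega> n x \<in> U})"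
      using * by (intro openin_Union) blast
    ultimately show "openin (level_space \<omega> n)
        {x \<in> topspace (level_space \<omega> n). to_limit \<omega> n x \<in> \<Union>\<U>}" by simp
  qed
  then show ?thesis
    unfolding chacon_space_def by (simp add: topology_inverse')
qed

lemma topspace_chacon_space: "topspace (chacon_space \<omega>) = chacon_points \<omega>"
proof -
  have "to_limit \<omega> n x \<in> chacon_points \<omega>" if "x \<in> topspace (level_space \<omega> n)" for n x
    using that unfolding to_limit_def chacon_points_def by (blast intro: quotientI)
  then have "openin (chacon_space \<omega>) (chacon_points \<omega>)"
    unfolding openin_chacon_space
    by (metis (mono_tags, lifting) Collect_cong Collect_mem_eq openin_topspace subset_refl)
  then show ?thesis
    by (metis openin_chacon_space openin_subset openin_topspace subset_antisym)
qed

definition cylinder :: "(nat \<Rightarrow> bool) \<Rightarrow> nat \<Rightarrow> int \<Rightarrow> chacon_point set" where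
  "cylinder \<omega> n f = to_limit \<omega> n ` {x \<in> topspace (level_space \<omega> n). x 0 = f}"

definition chacon_action :: "(nat \<Rightarrow> bool) \<Rightarrow> int \<Rightarrow> chacon_point \<Rightarrow> chacon_point" where
  "chacon_action \<omega> g p = (THE q. \<exists>n x. x \<in> topspace (level_space \<omega> n) \<and> p = to_limit \<omega> n x \<and>
     g + x 0 \<in> F_set n \<and> q = to_limit \<omega> n (x(0 := g + x 0)))"

definition chacon_measure :: "(nat \<Rightarrow> bool) \<Rightarrow> chacon_point measure" where
  "chacon_measure \<omega> = (THE M.
     space M = topspace (chacon_space \<omega>) \<and> sets M = sets (borel_of (chacon_space \<omega>)) \<and>
     (\<forall>n. \<forall>f \<in> F_set n. emeasure M (cylinder \<omega> n f) = ennreal ((1 / 3) ^ n)))"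

definition tail_equivalent :: "(nat \<Rightarrow> bool) \<Rightarrow> (nat \<Rightarrow> bool) \<Rightarrow> bool" where
  "tail_equivalent \<omega> \<omega>' \<longleftrightarrow> (\<exists>N>0. \<forall>n>N. \<omega> n = \<omega>' n)"

end

theory Submission imports "HOL-Probability.Probability" Defs
begin

text \<open>
  A point is given by its position at some level together with a symbol \<open>s \<in> {-1, 0, 1}\<close> at every
  higher level, and a Radon measure on a product of systems is determined by its values on boxes.
  Let \<open>L\<close> be an ergodic joining that is invariant under the simultaneous translation of the
  coordinates in \<open>J\<close>.  Replacing the symbols \<open>s\<^sub>j\<close> of level \<open>n\<close> by \<open>s\<^sub>j + t\<close>, \<open>t = \<plusminus>1\<close>, moves coordinate
  \<open>j\<close> by \<open>t h\<^sub>n + v\<^sub>j\<close> with \<open>v\<^sub>j \<in> {0, t}\<close>, and the common part \<open>t h\<^sub>n\<close> does not affect \<open>L\<close>.  If moves with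
  non-constant \<open>v\<close> are almost everywhere possible at infinitely many levels, then \<open>L\<close> is dominated by
  the finite sum of its translates by such \<open>v\<close>.  Since ergodic measures are proportional or mutually
  singular, some translate is a multiple of \<open>L\<close>; the factor is \<open>1\<close>, so \<open>J\<close> splits into two smaller
  blocks.  Otherwise, from some level on the differences between the coordinates in \<open>J\<close> are so rigid
  that all of them carry the same symbols, hence lie on one orbit.  Iterating this yields a partition
  into graphs of powers of the action, and a measure that is invariant under each coordinate
  separately is a multiple of the product measure.  If two parameters differ at level \<open>n\<close>, equal symbols
  of level \<open>n\<close> always admit a move with non-constant \<open>v\<close>, which excludes a graph and gives disjointness.
  The same domination, applied to restrictions of the product measure, shows that products are
  ergodic.
\<close>

section \<open>Coordinates of points\<close>

text \<open>The gaps between neighbouring elements of \<open>C_set \<omega> (Suc n)\<close> have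
  lengths h_n and h_n + 1, and \<omega>(n) decides only their order; this extra unit is the
  \<open>v\<close> of the overview. The factor 6 in \<open>height\<close>, against three copies,
  leaves room at both ends of a level: every translation is eventually admissible, and the mass is
  infinite.

  Projections of a joining need not be sigma-finite, so disintegrating over them is no option.
  Domination works because each point is moved at its first good level: the reversed move is good as
  well, so images from different levels are disjoint.

  The factor is 1 because a contraction would make visits to a box summable; almost every point
  would have a last visit, last visits meet each orbit at most once, and ergodicity would confine a
  coordinate to one point, a null set. Rigid differences vanish because a nonzero one at infinitely
  many levels would forbid some symbol there, again a null event. Total ergodicity comes from pairs:
  independent points would share their itinerary through a set invariant under a power.\<close>

definition radius :: "nat \<Rightarrow> int" where
  "radius n = (height n - 1) div 2"

definition symbols :: "int set" where
  "symbols = {-1, 0, 1}"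

text \<open>The element of \<open>C_set \<omega> (Suc n)\<close> with sign \<open>s\<close>. The
  step from -1 to 0 has length h_n + 1 - \<omega>(n), the step from 0 to 1 has length h_n +
  \<omega>(n), so one of them is longer by exactly one.\<close>

definition digit :: "(nat \<Rightarrow> bool) \<Rightarrow> nat \<Rightarrow> int \<Rightarrow> int" where
  "digit \<omega> n s = height n * s + (if s = -1 then of_bool (\<omega> n) - 1 else if s = 1 then of_bool (\<omega> n) else 0)"

lemma height_pos: "height n \<ge> 1"
  by (induction n) auto

lemma height_gt: "height n > int n"
proof (induction n)
  case (Suc n)
  then show ?case using height_pos[of n] by simp
qed simp

lemma height_radius: "height n = 2 * radius n + 1"
proof -
  have "odd (height n)" by (induction n) auto
  then show ?thesis by (auto simp: radius_def elim!: oddE)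
qed

lemma radius_Suc: "radius (Suc n) = 3 * height n"
  by (simp add: radius_def)

lemma radius_nonneg: "radius n \<ge> 0"
  using height_pos[of n] height_radius[of n] by linarith

lemma mem_F_set: "f \<in> F_set n \<longleftrightarrow> \<bar>f\<bar> \<le> radius n"
  by (auto simp: F_set_def radius_def)

lemma C_set_Suc: "C_set \<omega> (Suc n) = digit \<omega> n ` symbols"
  by (auto simp: digit_def symbols_def)

lemma digit_bounds: "s \<in> symbols \<Longrightarrow> \<bar>digit \<omega> n s\<bar> \<le> height n + 1"
  using height_pos[of n] by (auto simp: digit_def symbols_def)

text \<open>The correction never opposes \<open>s\<close>, so nothing cancels against
  \<open>height n * s\<close>. This is how \<open>symb\<close> reads a symbol off two successive
  positions.\<close>

lemma sgn_digit: "s \<in> symbols \<Longrightarrow> sgn (digit \<omega> n s) = s"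
  using height_pos[of n] by (auto simp: digit_def symbols_def)

text \<open>Digits are at least \<open>height n = 2 * radius n + 1\<close> apart, so the three
  copies of level n inside level n + 1 are disjoint. Injectivity of the embeddings rests on
  this.\<close>

lemma add_digit_unique:
  assumes "\<bar>f\<bar> \<le> radius n" "\<bar>g\<bar> \<le> radius n" "s \<in> symbols" "t \<in> symbols"
    and "f + digit \<omega> n s = g + digit \<omega> n t"
  shows "f = g \<and> s = t"
  using assms radius_nonneg[of n]
  by (auto simp: digit_def symbols_def height_radius of_bool_def split: if_splits)

text \<open>Since \<open>radius (Suc n) = 3 * height n\<close>, a point coming from level n keeps a
  full height of distance from the ends of level n + 1. Every fixed translation is therefore
  possible at high levels.\<close>

lemma add_digit_margin:
  assumes "\<bar>f\<bar> \<le> radius n" "s \<in> symbols"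
  shows "\<bar>f + digit \<omega> n s\<bar> + height n \<le> radius (Suc n)"
  using assms digit_bounds[of s \<omega> n] height_radius[of n] height_pos[of n] by (simp add: radius_Suc)

lemma add_digit_bound:
  assumes "\<bar>f\<bar> \<le> radius n" "s \<in> symbols"
  shows "\<bar>f + digit \<omega> n s\<bar> \<le> radius (Suc n)"
  using add_digit_margin[OF assms, of \<omega>] height_pos[of n] by linarith

section \<open>Levels and their embeddings\<close>

lemma level_space_iff:
  "x \<in> topspace (level_space \<omega> n) \<longleftrightarrow>
     \<bar>x 0\<bar> \<le> radius n \<and> (\<forall>k. x (Suc k) \<in> digit \<omega> (n + k) ` symbols)"
proof -
  have "x \<in> topspace (level_space \<omega> n) \<longleftrightarrow> (\<forall>k. x k \<in> (if k = 0 then F_set n else C_set \<omega> (n + k)))"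
    by (simp add: level_space_def PiE_UNIV_domain Pi_iff)
  also have "\<dots> \<longleftrightarrow> x 0 \<in> F_set n \<and> (\<forall>k. x (Suc k) \<in> C_set \<omega> (Suc (n + k)))"
    by (metis add_Suc_right nat.distinct(1) not0_implies_Suc)
  finally show ?thesis by (simp add: mem_F_set C_set_Suc del: C_set.simps)
qed

lemma embed_level:
  assumes "x \<in> topspace (level_space \<omega> n)"
  shows "embed x \<in> topspace (level_space \<omega> (Suc n))"
proof -
  obtain s where "x 1 = digit \<omega> n s" "s \<in> symbols"
    using assms unfolding level_space_iff by (metis One_nat_def add_0_right imageE)
  moreover have "x (Suc (Suc k)) \<in> digit \<omega> (Suc (n + k)) ` symbols" for k
    using assms unfolding level_space_iff by (metis add_Suc_right)
  ultimately show ?thesis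
    using assms add_digit_bound[of "x 0" n s \<omega>] by (simp add: level_space_iff embed_def)
qed

lemma embed_inj:
  assumes "x \<in> topspace (level_space \<omega> n)" "y \<in> topspace (level_space \<omega> n)" "embed x = embed y"
  shows "x = y"
proof
  fix k
  have 1: "x 1 \<in> digit \<omega> n ` symbols" "y 1 \<in> digit \<omega> n ` symbols"
    using assms(1,2) unfolding level_space_iff by (metis One_nat_def add_0_right)+
  have eq: "x 0 + x 1 = y 0 + y 1" using fun_cong[OF assms(3), of 0] by (simp add: embed_def)
  then have 2: "x 0 = y 0"
    using 1 assms(1,2) add_digit_unique[of "x 0" n "y 0" _ _ \<omega>] unfolding level_space_iff by auto
  have "x (Suc (Suc j)) = y (Suc (Suc j))" for j
    using fun_cong[OF assms(3), of "Suc j"] by (simp add: embed_def)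
  then show "x k = y k"
    using 2 eq by (cases k; cases "k - 1") auto
qed

lemma embed_pow_level:
  "x \<in> topspace (level_space \<omega> n) \<Longrightarrow> (embed ^^ k) x \<in> topspace (level_space \<omega> (n + k))"
  by (induction k) (auto simp: embed_level)

lemma embed_pow_inj:
  assumes "x \<in> topspace (level_space \<omega> n)" "y \<in> topspace (level_space \<omega> n)"
    and "(embed ^^ k) x = (embed ^^ k) y"
  shows "x = y"
  using assms(3)
proof (induction k)
  case (Suc k)
  then show ?case
    using embed_inj[OF embed_pow_level[OF assms(1)] embed_pow_level[OF assms(2)], of k] by simp
qed simp

text \<open>Injectivity of \<open>embed\<close> cancels the common part of the two iterations in
  \<open>limit_rel\<close>, so only the passage from the lower to the higher level remains.\<close>

lemma limit_rel_le:
  assumes "n \<le> m"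
  shows "((n, x), (m, y)) \<in> limit_rel \<omega> \<longleftrightarrow>
    x \<in> topspace (level_space \<omega> n) \<and> y = (embed ^^ (m - n)) x"
proof
  assume "((n, x), (m, y)) \<in> limit_rel \<omega>"
  then obtain i j where x: "x \<in> topspace (level_space \<omega> n)" and y: "y \<in> topspace (level_space \<omega> m)"
    and ij: "n + i = m + j" and eq: "(embed ^^ i) x = (embed ^^ j) y"
    by (auto simp: limit_rel_def)
  have i: "i = j + (m - n)" using ij assms by simp
  have "(embed ^^ j) ((embed ^^ (m - n)) x) = (embed ^^ j) y"
    using eq unfolding i by (simp add: funpow_add)
  moreover have "(embed ^^ (m - n)) x \<in> topspace (level_space \<omega> m)"
    using embed_pow_level[OF x, of "m - n"] assms by simp
  ultimately show "x \<in> topspace (level_space \<omega> n) \<and> y = (embed ^^ (m - n)) x"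
    using embed_pow_inj y x by metis
next
  assume *: "x \<in> topspace (level_space \<omega> n) \<and> y = (embed ^^ (m - n)) x"
  then have "y \<in> topspace (level_space \<omega> m)"
    using embed_pow_level[of x \<omega> n "m - n"] assms by simp
  moreover have "n + (m - n) = m + 0" "(embed ^^ (m - n)) x = (embed ^^ 0) y"
    using assms * by auto
  ultimately show "((n, x), (m, y)) \<in> limit_rel \<omega>"
    using * unfolding limit_rel_def by blast
qed

lemma limit_rel_sym: "(a, b) \<in> limit_rel \<omega> \<Longrightarrow> (b, a) \<in> limit_rel \<omega>"
  by (auto simp: limit_rel_def) metis

lemma limit_rel_trans:
  assumes "(a, b) \<in> limit_rel \<omega>" "(b, c) \<in> limit_rel \<omega>"
  shows "(a, c) \<in> limit_rel \<omega>"
proof -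
  obtain n x m y l z where abc: "a = (n, x)" "b = (m, y)" "c = (l, z)" by (metis prod.exhaust)
  obtain i j where 1: "x \<in> topspace (level_space \<omega> n)" "n + i = m + j" "(embed ^^ i) x = (embed ^^ j) y"
    using assms(1) unfolding abc by (auto simp: limit_rel_def)
  obtain i' j' where 2: "z \<in> topspace (level_space \<omega> l)" "m + i' = l + j'"
      "(embed ^^ i') y = (embed ^^ j') z"
    using assms(2) unfolding abc by (auto simp: limit_rel_def)
  have "(embed ^^ (i' + i)) x = (embed ^^ (j + i')) y"
    using 1(3) by (simp add: funpow_add flip: add.commute)
  also have "\<dots> = (embed ^^ (j + j')) z"
    using 2(3) by (simp add: funpow_add)
  finally have "(embed ^^ (i' + i)) x = (embed ^^ (j + j')) z" .
  moreover have "n + (i' + i) = l + (j + j')" using 1(2) 2(2) by simp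
  ultimately show ?thesis using 1(1) 2(1) unfolding abc limit_rel_def by blast
qed

lemma limit_rel_equiv: "equiv (SIGMA n : UNIV. topspace (level_space \<omega> n)) (limit_rel \<omega>)"
proof (intro equivI)
  show "refl_on (SIGMA n : UNIV. topspace (level_space \<omega> n)) (limit_rel \<omega>)"
    by (auto simp: refl_on_def limit_rel_def)
  show "sym (limit_rel \<omega>)" by (auto intro: symI limit_rel_sym)
  show "trans (limit_rel \<omega>)" by (auto intro: transI limit_rel_trans)
qed (auto simp: limit_rel_def)

lemma mem_to_limit: "(m, y) \<in> to_limit \<omega> n x \<longleftrightarrow> ((n, x), (m, y)) \<in> limit_rel \<omega>"
  by (simp add: to_limit_def)

lemma to_limit_eqI: "((n, x), (m, y)) \<in> limit_rel \<omega> \<Longrightarrow> to_limit \<omega> n x = to_limit \<omega> m y"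
  unfolding to_limit_def by (rule equiv_class_eq[OF limit_rel_equiv])

lemma to_limit_embed:
  "x \<in> topspace (level_space \<omega> n) \<Longrightarrow> to_limit \<omega> (Suc n) (embed x) = to_limit \<omega> n x"
  by (rule sym, rule to_limit_eqI) (simp add: limit_rel_le)

section \<open>Position and symbols as coordinates on the inductive limit\<close>

definition has_level :: "nat \<Rightarrow> chacon_point \<Rightarrow> bool" where
  "has_level n p \<longleftrightarrow> (\<exists>x. (n, x) \<in> p)"

definition coords :: "nat \<Rightarrow> chacon_point \<Rightarrow> nat \<Rightarrow> int" where
  "coords n p = (THE x. (n, x) \<in> p)"

definition pos :: "nat \<Rightarrow> chacon_point \<Rightarrow> int" where
  "pos n p = coords n p 0"

text \<open>Being read off from positions, the symbol depends on the point alone; neither the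
  parameter nor the level of a chosen representative enters.\<close>

definition symb :: "nat \<Rightarrow> chacon_point \<Rightarrow> int" where
  "symb n p = sgn (pos (Suc n) p - pos n p)"

lemma to_limit_in: "x \<in> topspace (level_space \<omega> n) \<Longrightarrow> to_limit \<omega> n x \<in> chacon_points \<omega>"
  unfolding to_limit_def chacon_points_def by (blast intro: quotientI)

lemma mem_point:
  assumes "p \<in> chacon_points \<omega>" "(n, x) \<in> p"
  shows "x \<in> topspace (level_space \<omega> n) \<and> p = to_limit \<omega> n x"
proof -
  obtain m y where p: "p = to_limit \<omega> m y"
    using assms(1) by (auto simp: chacon_points_def to_limit_def elim!: quotientE)
  then have *: "((m, y), (n, x)) \<in> limit_rel \<omega>" using assms(2) by (simp add: mem_to_limit)
  then have "x \<in> topspace (level_space \<omega> n)" by (auto simp: limit_rel_def)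
  with * p show ?thesis by (simp add: to_limit_eqI)
qed

lemma coords_eq:
  assumes "p \<in> chacon_points \<omega>" "(n, x) \<in> p"
  shows "coords n p = x"
proof -
  have "y = x" if "(n, y) \<in> p" for y
  proof -
    have "((n, x), (n, y)) \<in> limit_rel \<omega>"
      using mem_point[OF assms] that by (simp flip: mem_to_limit)
    then show ?thesis by (simp add: limit_rel_le)
  qed
  then show ?thesis unfolding coords_def using assms(2) by blast
qed

lemma coords_mem:
  assumes "p \<in> chacon_points \<omega>" "has_level n p"
  shows "(n, coords n p) \<in> p" "coords n p \<in> topspace (level_space \<omega> n)" "p = to_limit \<omega> n (coords n p)"
  using assms coords_eq mem_point unfolding has_level_def by metis+

lemma to_limit_props:
  assumes "x \<in> topspace (level_space \<omega> n)"
  shows "has_level n (to_limit \<omega> n x)" "coords n (to_limit \<omega> n x) = x"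
proof -
  have *: "(n, x) \<in> to_limit \<omega> n x" using assms by (simp add: mem_to_limit limit_rel_le)
  show "has_level n (to_limit \<omega> n x)" using * unfolding has_level_def by blast
  show "coords n (to_limit \<omega> n x) = x" using coords_eq[OF to_limit_in[OF assms] *] .
qed

lemma coords_Suc:
  assumes "p \<in> chacon_points \<omega>" "has_level n p"
  shows "has_level (Suc n) p" "coords (Suc n) p = embed (coords n p)"
proof -
  have "((n, coords n p), (Suc n, embed (coords n p))) \<in> limit_rel \<omega>"
    using coords_mem[OF assms] by (simp add: limit_rel_le)
  then have *: "(Suc n, embed (coords n p)) \<in> p"
    using coords_mem(3)[OF assms] mem_to_limit by metis
  then show "has_level (Suc n) p" by (auto simp: has_level_def)
  show "coords (Suc n) p = embed (coords n p)" using coords_eq[OF assms(1) *] .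
qed

lemma has_level_mono:
  assumes "p \<in> chacon_points \<omega>" "has_level n p" "n \<le> m"
  shows "has_level m p"
  using assms(3) by (induction m rule: dec_induct) (auto intro: assms coords_Suc(1))

lemma coords_add:
  assumes "p \<in> chacon_points \<omega>" "has_level n p"
  shows "coords (n + k) p = (embed ^^ k) (coords n p)"
  by (induction k) (auto simp: coords_Suc(2)[OF assms(1)] has_level_mono[OF assms])

lemma embed_pow_Suc: "(embed ^^ k) x (Suc i) = x (k + Suc i)"
proof (induction k arbitrary: i)
  case (Suc k)
  then show ?case by (simp add: embed_def)
qed simp

lemma pos_step:
  assumes "p \<in> chacon_points \<omega>" "has_level n p"
  shows "\<bar>pos n p\<bar> \<le> radius n" "symb n p \<in> symbols" "pos (Suc n) p = pos n p + digit \<omega> n (symb n p)"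
    "coords n p 1 = digit \<omega> n (symb n p)"
proof -
  have *: "coords n p \<in> topspace (level_space \<omega> n)" using coords_mem[OF assms] by simp
  then show "\<bar>pos n p\<bar> \<le> radius n" by (simp add: level_space_iff pos_def)
  have 2: "pos (Suc n) p = pos n p + coords n p 1"
    by (simp add: pos_def coords_Suc(2)[OF assms] embed_def)
  obtain s where s: "coords n p 1 = digit \<omega> n s" "s \<in> symbols"
    using * unfolding level_space_iff by (metis One_nat_def add_0_right imageE)
  have "symb n p = s" using 2 s by (simp add: symb_def sgn_digit)
  with 2 s show "symb n p \<in> symbols" "pos (Suc n) p = pos n p + digit \<omega> n (symb n p)"
    "coords n p 1 = digit \<omega> n (symb n p)" by auto
qed

lemma coords_symb:
  assumes "p \<in> chacon_points \<omega>" "has_level n p"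
  shows "coords n p (Suc k) = digit \<omega> (n + k) (symb (n + k) p)"
proof -
  have "coords n p (Suc k) = coords (n + k) p 1"
    using embed_pow_Suc[of k "coords n p" 0] by (simp add: coords_add[OF assms])
  then show ?thesis using pos_step(4)[OF assms(1) has_level_mono[OF assms, of "n + k"]] by simp
qed

text \<open>A splitting of the position at level n + 1 supplies a preimage under
  \<open>embed\<close>, and representatives at a level are unique. So this one position already
  decides membership in the smaller level.\<close>

lemma level_back:
  assumes "p \<in> chacon_points \<omega>" "has_level (Suc n) p" "pos (Suc n) p = f + digit \<omega> n s"
    "\<bar>f\<bar> \<le> radius n" "s \<in> symbols"
  shows "has_level n p" "pos n p = f" "symb n p = s"
proof -
  define x where "x = coords (Suc n) p"
  define y where "y = (\<lambda>k. if k = 0 then f else if k = 1 then digit \<omega> n s else x (k - 1))"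
  have x: "x \<in> topspace (level_space \<omega> (Suc n))" "(Suc n, x) \<in> p" "p = to_limit \<omega> (Suc n) x"
    using coords_mem[OF assms(1,2)] by (auto simp: x_def)
  have x0: "x 0 = f + digit \<omega> n s" using assms(3) by (simp add: pos_def x_def)
  have "y (Suc k) \<in> digit \<omega> (n + k) ` symbols" for k
  proof (cases k)
    case 0
    then show ?thesis using assms(5) by (simp add: y_def)
  next
    case (Suc j)
    then show ?thesis using x(1) unfolding level_space_iff y_def by simp
  qed
  then have y: "y \<in> topspace (level_space \<omega> n)" using assms(4) by (simp add: level_space_iff y_def)
  have "embed y = x" by (auto simp: embed_def y_def x0)
  then have "((n, y), (Suc n, x)) \<in> limit_rel \<omega>" using y by (simp add: limit_rel_le)
  then have *: "(n, y) \<in> p" using x(3) limit_rel_sym mem_to_limit by metis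
  then show lev: "has_level n p" by (auto simp: has_level_def)
  show pos: "pos n p = f" using coords_eq[OF assms(1) *] by (simp add: pos_def y_def)
  show "symb n p = s" using pos assms(3,5) by (simp add: symb_def sgn_digit)
qed

lemma point_eqI:
  assumes "p \<in> chacon_points \<omega>" "q \<in> chacon_points \<omega>" "has_level n p" "has_level n q"
    "pos n p = pos n q" "\<And>N. N \<ge> n \<Longrightarrow> symb N p = symb N q"
  shows "p = q"
proof -
  have "coords n p k = coords n q k" for k
    using assms(5,6) coords_symb[OF assms(1,3)] coords_symb[OF assms(2,4)]
    by (cases k) (simp_all add: pos_def)
  then have "coords n p = coords n q" by blast
  then show ?thesis using coords_mem(3)[OF assms(1,3)] coords_mem(3)[OF assms(2,4)] by simp
qed

lemma point_eqI_pos: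
  assumes "p \<in> chacon_points \<omega>" "q \<in> chacon_points \<omega>" "has_level n p" "has_level n q"
    "\<And>N. N \<ge> n \<Longrightarrow> pos N p = pos N q"
  shows "p = q"
  by (rule point_eqI[OF assms(1-4)]) (simp_all add: assms(5) symb_def)

text \<open>The inverse of the chart given by \<open>pos n\<close> and the symbols from level
  \<open>n\<close> on; values of \<open>s\<close> below \<open>n\<close> are ignored.\<close>

definition point_of :: "(nat \<Rightarrow> bool) \<Rightarrow> nat \<Rightarrow> int \<Rightarrow> (nat \<Rightarrow> int) \<Rightarrow> chacon_point" where
  "point_of \<omega> n f s = to_limit \<omega> n (\<lambda>k. if k = 0 then f else digit \<omega> (n + k - 1) (s (n + k - 1)))"

lemma point_of:
  assumes "\<bar>f\<bar> \<le> radius n" "\<And>N. s N \<in> symbols"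
  shows "point_of \<omega> n f s \<in> chacon_points \<omega>" "has_level n (point_of \<omega> n f s)"
    "pos n (point_of \<omega> n f s) = f" "N \<ge> n \<Longrightarrow> symb N (point_of \<omega> n f s) = s N"
proof -
  define x where "x = (\<lambda>k. if k = 0 then f else digit \<omega> (n + k - 1) (s (n + k - 1)))"
  have x: "x \<in> topspace (level_space \<omega> n)" using assms by (auto simp: level_space_iff x_def)
  have eq: "point_of \<omega> n f s = to_limit \<omega> n x" by (simp add: point_of_def x_def)
  show 1: "point_of \<omega> n f s \<in> chacon_points \<omega>" "has_level n (point_of \<omega> n f s)"
    using to_limit_in[OF x] to_limit_props[OF x] eq by auto
  show "pos n (point_of \<omega> n f s) = f"
    using to_limit_props(2)[OF x] by (simp add: eq pos_def) (simp add: x_def)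
  assume "N \<ge> n"
  then have "digit \<omega> N (symb N (point_of \<omega> n f s)) = coords n (point_of \<omega> n f s) (Suc (N - n))"
    using coords_symb[OF 1, of "N - n"] by simp
  also have "\<dots> = digit \<omega> N (s N)"
    using to_limit_props(2)[OF x] \<open>N \<ge> n\<close> by (simp add: eq) (simp add: x_def)
  finally show "symb N (point_of \<omega> n f s) = s N"
    using sgn_digit pos_step(2)[OF 1(1) has_level_mono[OF 1 \<open>N \<ge> n\<close>]] assms(2) by metis
qed

lemma has_some_level:
  assumes "p \<in> chacon_points \<omega>"
  shows "\<exists>n. has_level n p"
proof -
  obtain n y where "p = to_limit \<omega> n y" "y \<in> topspace (level_space \<omega> n)"
    using assms by (auto simp: chacon_points_def to_limit_def elim!: quotientE)
  then show ?thesis using to_limit_props by blast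
qed

text \<open>Only unbounded growth of the margin matters later, so the true margin of one height is
  weakened to \<open>int n\<close> by \<open>height_gt\<close>.\<close>

lemma pos_margin:
  assumes "p \<in> chacon_points \<omega>" "has_level m p" "m < n"
  shows "\<bar>pos n p\<bar> + int n \<le> radius n"
proof -
  obtain k where n: "n = Suc k" "m \<le> k" using assms(3) by (cases n) auto
  have k: "has_level k p" using has_level_mono[OF assms(1,2) n(2)] .
  show ?thesis
    using add_digit_margin[OF pos_step(1,2)[OF assms(1) k], of \<omega>] pos_step(3)[OF assms(1) k] height_gt[of k]
    unfolding n by linarith
qed

lemma mem_cylinder: "p \<in> cylinder \<omega> n f \<longleftrightarrow> p \<in> chacon_points \<omega> \<and> has_level n p \<and> pos n p = f"
proof
  assume "p \<in> cylinder \<omega> n f"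
  then show "p \<in> chacon_points \<omega> \<and> has_level n p \<and> pos n p = f"
    by (auto simp: cylinder_def to_limit_in to_limit_props pos_def)
next
  assume "p \<in> chacon_points \<omega> \<and> has_level n p \<and> pos n p = f"
  then show "p \<in> cylinder \<omega> n f"
    unfolding cylinder_def pos_def using coords_mem[of p \<omega> n] by blast
qed

text \<open>Repeated use of \<open>level_back\<close>: a position fixes everything below it, down to
  any level that contains the reference point. This makes cylinders nested.\<close>

lemma same_cylinder:
  assumes "p \<in> chacon_points \<omega>" "q \<in> chacon_points \<omega>" "has_level n p" "n \<le> m"
    "has_level m q" "pos m q = pos m p"
  shows "has_level n q" "pos n q = pos n p" "n \<le> N \<Longrightarrow> N < m \<Longrightarrow> symb N q = symb N p"
proof -
  have "has_level n q \<and> pos n q = pos n p \<and> (\<forall>N. n \<le> N \<and> N < m \<longrightarrow> symb N q = symb N p)"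
    using assms(4-6)
  proof (induction m rule: dec_induct)
    case (step m)
    have m: "has_level m p" using has_level_mono[OF assms(1,3)] step(1) by blast
    have "pos (Suc m) q = pos m p + digit \<omega> m (symb m p)" using step(5) pos_step(3)[OF assms(1) m] by simp
    from level_back[OF assms(2) step(4) this] pos_step(1,2)[OF assms(1) m]
    have "has_level m q" "pos m q = pos m p" "symb m q = symb m p" by auto
    with step(3) show ?case by (auto simp: less_Suc_eq)
  qed auto
  then show "has_level n q" "pos n q = pos n p" "n \<le> N \<Longrightarrow> N < m \<Longrightarrow> symb N q = symb N p" by auto
qed

section \<open>The action\<close>

lemma chacon_action:
  assumes p: "p \<in> chacon_points \<omega>" and n: "has_level n p" and g: "\<bar>pos n p + g\<bar> \<le> radius n"
  shows "chacon_action \<omega> g p \<in> chacon_points \<omega>" "has_level n (chacon_action \<omega> g p)"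
    "pos n (chacon_action \<omega> g p) = pos n p + g" "N \<ge> n \<Longrightarrow> symb N (chacon_action \<omega> g p) = symb N p"
proof -
  define Q where "Q n = to_limit \<omega> n ((coords n p)(0 := g + pos n p))" for n
  define ok where "ok n \<longleftrightarrow> has_level n p \<and> \<bar>g + pos n p\<bar> \<le> radius n" for n
  have lev: "(coords n p)(0 := g + pos n p) \<in> topspace (level_space \<omega> n)" if "ok n" for n
    using that coords_mem(2)[OF p, of n] by (auto simp: ok_def level_space_iff)
  \<comment> \<open>\<open>embed\<close> adds the same digit before and after the translation, so
    the candidates \<open>Q n\<close> agree at all admissible levels and the \<open>THE\<close> in
    \<open>chacon_action\<close> is determined.\<close>
  have step: "ok (Suc n) \<and> Q (Suc n) = Q n" if "ok n" for n
  proof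
    from that have l: "has_level n p" and b: "\<bar>g + pos n p\<bar> \<le> radius n" by (auto simp: ok_def)
    note ps = pos_step[OF p l] coords_Suc[OF p l]
    show "ok (Suc n)"
      using ps(5) add_digit_bound[OF b ps(2), of \<omega>] unfolding ok_def ps(3) by (simp add: algebra_simps)
    have "(coords (Suc n) p)(0 := g + pos (Suc n) p) = embed ((coords n p)(0 := g + pos n p))"
      unfolding ps(6) by (auto simp: embed_def pos_def ps(6))
    then show "Q (Suc n) = Q n" unfolding Q_def using to_limit_embed[OF lev[OF that]] by simp
  qed
  have le: "Q m = Q n" if "ok n" "n \<le> m" for n m
  proof -
    have "ok m \<and> Q m = Q n" using that(2) by (induction m rule: dec_induct) (use that(1) step in auto)
    then show ?thesis ..
  qed
  have all: "Q m = Q n" if "ok n" "ok m" for n m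
    using le[of n m] le[of m n] that by (cases "n \<le> m") auto
  have okn: "ok n" using n g by (simp add: ok_def add.commute)
  have "chacon_action \<omega> g p = Q n"
    unfolding chacon_action_def
  proof (rule the_equality)
    show "\<exists>n' x. x \<in> topspace (level_space \<omega> n') \<and> p = to_limit \<omega> n' x \<and> g + x 0 \<in> F_set n' \<and>
        Q n = to_limit \<omega> n' (x(0 := g + x 0))"
      using okn coords_mem(2,3)[OF p n] unfolding ok_def Q_def mem_F_set pos_def by blast
  next
    fix q assume "\<exists>n' x. x \<in> topspace (level_space \<omega> n') \<and> p = to_limit \<omega> n' x \<and> g + x 0 \<in> F_set n' \<and>
        q = to_limit \<omega> n' (x(0 := g + x 0))"
    then obtain n' x where x: "x \<in> topspace (level_space \<omega> n')" "p = to_limit \<omega> n' x"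
      "\<bar>g + x 0\<bar> \<le> radius n'" "q = to_limit \<omega> n' (x(0 := g + x 0))"
      by (auto simp: mem_F_set)
    have "coords n' p = x" "has_level n' p" using to_limit_props[OF x(1)] x(2) by auto
    then have "ok n'" "q = Q n'" using x by (auto simp: ok_def Q_def pos_def)
    then show "q = Q n" using all[OF okn \<open>ok n'\<close>] by simp
  qed
  then have eq: "chacon_action \<omega> g p = to_limit \<omega> n ((coords n p)(0 := g + pos n p))"
    by (simp add: Q_def)
  note props = to_limit_in[OF lev[OF okn]] to_limit_props[OF lev[OF okn]]
  show 1: "chacon_action \<omega> g p \<in> chacon_points \<omega>" "has_level n (chacon_action \<omega> g p)"
    using props by (auto simp: eq)
  show "pos n (chacon_action \<omega> g p) = pos n p + g"
    using props(3) by (simp add: eq pos_def)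
  assume N: "N \<ge> n"
  have "digit \<omega> N (symb N (chacon_action \<omega> g p)) = digit \<omega> N (symb N p)"
    using coords_symb[OF 1, of "N - n"] coords_symb[OF p n, of "N - n"] props(3) N by (simp add: eq)
  then show "symb N (chacon_action \<omega> g p) = symb N p"
    using sgn_digit pos_step(2)[OF p has_level_mono[OF p n N]] pos_step(2)[OF 1(1) has_level_mono[OF 1 N]]
    by metis
qed

lemma chacon_action_pos:
  assumes "p \<in> chacon_points \<omega>" "has_level n p" "\<bar>pos n p + g\<bar> \<le> radius n" "N \<ge> n"
  shows "has_level N (chacon_action \<omega> g p)" "pos N (chacon_action \<omega> g p) = pos N p + g"
    "\<bar>pos N p + g\<bar> \<le> radius N"
proof -
  note act = chacon_action[OF assms(1-3)]
  show 1: "has_level N (chacon_action \<omega> g p)" using has_level_mono[OF act(1,2) assms(4)] .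
  show 2: "pos N (chacon_action \<omega> g p) = pos N p + g"
    using assms(4)
  proof (induction N rule: dec_induct)
    case (step N)
    then show ?case
      using pos_step(3)[OF act(1) has_level_mono[OF act(1,2) step(1)]] act(4)[OF step(1)]
        pos_step(3)[OF assms(1) has_level_mono[OF assms(1,2) step(1)]] by simp
  qed (rule act(3))
  show "\<bar>pos N p + g\<bar> \<le> radius N" using pos_step(1)[OF act(1) 1] 2 by simp
qed

lemma exists_margin_level:
  assumes "p \<in> chacon_points \<omega>"
  shows "\<exists>n\<ge>m. has_level n p \<and> \<bar>pos n p + g\<bar> \<le> radius n"
proof -
  obtain k where k: "has_level k p" using has_some_level[OF assms] by blast
  define n where "n = Suc (max m (max k (nat \<bar>g\<bar>)))"
  have "k < n" "m \<le> n" "\<bar>g\<bar> \<le> int n" by (auto simp: n_def)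
  then show ?thesis
    using pos_margin[OF assms k, of n] has_level_mono[OF assms k, of n] by (intro exI[of _ n]) auto
qed

lemma chacon_action_in: "p \<in> chacon_points \<omega> \<Longrightarrow> chacon_action \<omega> g p \<in> chacon_points \<omega>"
  using exists_margin_level[of p \<omega> 0 g] chacon_action(1)[of p \<omega> _ g] by blast

lemma chacon_action_0:
  assumes "p \<in> chacon_points \<omega>"
  shows "chacon_action \<omega> 0 p = p"
proof -
  obtain n where n: "has_level n p" "\<bar>pos n p + 0\<bar> \<le> radius n" using exists_margin_level[OF assms] by metis
  note act = chacon_action[OF assms this]
  show ?thesis by (rule point_eqI[OF act(1) assms act(2) n(1)]) (use act in auto)
qed

lemma chacon_action_add:
  assumes "p \<in> chacon_points \<omega>"
  shows "chacon_action \<omega> a (chacon_action \<omega> b p) = chacon_action \<omega> (a + b) p"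
proof -
  obtain n1 where n1: "has_level n1 p" "\<bar>pos n1 p + b\<bar> \<le> radius n1"
    using exists_margin_level[OF assms] by metis
  obtain n where n: "n \<ge> n1" "has_level n p" "\<bar>pos n p + (a + b)\<bar> \<le> radius n"
    using exists_margin_level[OF assms] by metis
  have b: "\<bar>pos n p + b\<bar> \<le> radius n" using chacon_action_pos[OF assms n1 n(1)] by simp
  note B = chacon_action[OF assms n(2) b]
  have "\<bar>pos n (chacon_action \<omega> b p) + a\<bar> \<le> radius n" using n(3) B(3) by (simp add: algebra_simps)
  note A = chacon_action[OF B(1,2) this]
  note AB = chacon_action[OF assms n(2,3)]
  show ?thesis by (rule point_eqI[OF A(1) AB(1) A(2) AB(2)]) (use A B AB in auto)
qed

section \<open>The topology\<close>

text \<open>An open set of a level restricts finitely many coordinates near each point, and a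
  position at a high level fixes any finite number of them; conversely, finitely many coordinates
  fix a position. So the cylinders form a base.\<close>

lemma openin_chacon_cylinders:
  "openin (chacon_space \<omega>) U \<longleftrightarrow>
    U \<subseteq> chacon_points \<omega> \<and> (\<forall>p\<in>U. \<exists>n. has_level n p \<and> cylinder \<omega> n (pos n p) \<subseteq> U)"
proof
  assume U: "openin (chacon_space \<omega>) U"
  then have sub: "U \<subseteq> chacon_points \<omega>" by (simp add: openin_chacon_space)
  moreover have "\<exists>n. has_level n p \<and> cylinder \<omega> n (pos n p) \<subseteq> U" if pU: "p \<in> U" for p
  proof -
    have p: "p \<in> chacon_points \<omega>" using sub pU by blast
    then obtain n where n: "has_level n p" using has_some_level by blast
    note x = coords_mem[OF p n]
    have "openin (level_space \<omega> n) {x \<in> topspace (level_space \<omega> n). to_limit \<omega> n x \<in> U}"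
      using U by (simp add: openin_chacon_space)
    moreover have "coords n p \<in> {x \<in> topspace (level_space \<omega> n). to_limit \<omega> n x \<in> U}" using x pU by simp
    ultimately obtain V where V: "finite {i. V i \<noteq> (if i = 0 then F_set n else C_set \<omega> (n + i))}"
      "coords n p \<in> PiE UNIV V" "PiE UNIV V \<subseteq> {x \<in> topspace (level_space \<omega> n). to_limit \<omega> n x \<in> U}"
      unfolding level_space_def openin_product_topology_alt by (auto simp: level_space_def)
    obtain K where K: "\<And>i. i > K \<Longrightarrow> V i = (if i = 0 then F_set n else C_set \<omega> (n + i))"
      using V(1) unfolding finite_nat_set_iff_bounded_le by (metis (mono_tags, lifting) linorder_not_le mem_Collect_eq)
    have "q \<in> U" if "q \<in> cylinder \<omega> (n + K) (pos (n + K) p)" for q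
    proof -
      from that have q: "q \<in> chacon_points \<omega>" "has_level (n + K) q" "pos (n + K) q = pos (n + K) p"
        by (auto simp: mem_cylinder)
      note sc = same_cylinder[OF p q(1) n le_add1 q(2,3)]
      note y = coords_mem[OF q(1) sc(1)]
      have "coords n q i \<in> V i" for i
      proof (cases "i > K")
        case True
        then show ?thesis
          using K[OF True] y(2) by (auto simp: level_space_def PiE_UNIV_domain Pi_iff split: if_splits)
      next
        case False
        then have "coords n q i = coords n p i"
          using coords_symb[OF p n] coords_symb[OF q(1) sc(1)] sc(2,3) by (cases i) (auto simp: pos_def)
        then show ?thesis using V(2) by auto
      qed
      then have "to_limit \<omega> n (coords n q) \<in> U" using V(3) by auto
      then show ?thesis using y(3) by simp
    qed
    then show ?thesis using has_level_mono[OF p n le_add1] by blast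
  qed
  ultimately show "U \<subseteq> chacon_points \<omega> \<and> (\<forall>p\<in>U. \<exists>n. has_level n p \<and> cylinder \<omega> n (pos n p) \<subseteq> U)"
    by blast
next
  assume U: "U \<subseteq> chacon_points \<omega> \<and> (\<forall>p\<in>U. \<exists>n. has_level n p \<and> cylinder \<omega> n (pos n p) \<subseteq> U)"
  have "openin (level_space \<omega> n) {x \<in> topspace (level_space \<omega> n). to_limit \<omega> n x \<in> U}" for n
  proof (subst openin_subopen, intro ballI)
    fix x assume "x \<in> {x \<in> topspace (level_space \<omega> n). to_limit \<omega> n x \<in> U}"
    then have x: "x \<in> topspace (level_space \<omega> n)" and xU: "to_limit \<omega> n x \<in> U" by auto
    define p where "p = to_limit \<omega> n x"
    have p: "p \<in> chacon_points \<omega>" "has_level n p" "coords n p = x"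
      using to_limit_in[OF x] to_limit_props[OF x] by (auto simp: p_def)
    obtain m where m: "has_level m p" "cylinder \<omega> m (pos m p) \<subseteq> U" using U xU p_def by blast
    \<comment> \<open>Whatever \<open>n\<close> is, n + m is at least m; fixing the coordinates up
      to index m therefore pins down the position at a level not below m.\<close>
    define K where "K = m"
    define V where "V = (\<lambda>i. if i \<le> K then {x i} else (if i = 0 then F_set n else C_set \<omega> (n + i)))"
    have Vsub: "V i \<subseteq> (if i = 0 then F_set n else C_set \<omega> (n + i))" for i
      using x unfolding level_space_def V_def by (auto simp: PiE_UNIV_domain Pi_iff split: if_splits)
    have "openin (level_space \<omega> n) (PiE UNIV V)"
      unfolding level_space_def
    proof (subst openin_PiE_gen, intro disjI2 conjI)
      have "{i \<in> UNIV. V i \<noteq> topspace (discrete_topology (if i = 0 then F_set n else C_set \<omega> (n + i)))} \<subseteq> {..K}"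
        by (auto simp: V_def)
      then show "finite {i \<in> UNIV. V i \<noteq> topspace (discrete_topology (if i = 0 then F_set n else C_set \<omega> (n + i)))}"
        by (rule finite_subset) simp
    qed (use Vsub in auto)
    moreover have "x \<in> PiE UNIV V"
      using x unfolding level_space_def V_def by (auto simp: PiE_UNIV_domain Pi_iff split: if_splits)
    moreover have "PiE UNIV V \<subseteq> {x \<in> topspace (level_space \<omega> n). to_limit \<omega> n x \<in> U}"
    proof
      fix y assume "y \<in> PiE UNIV V"
      then have yV: "\<And>i. y i \<in> V i" by (simp add: PiE_UNIV_domain Pi_iff)
      then have y: "y \<in> topspace (level_space \<omega> n)"
        using subsetD[OF Vsub yV] by (simp add: level_space_def PiE_UNIV_domain Pi_iff)
      define q where "q = to_limit \<omega> n y"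
      have q: "q \<in> chacon_points \<omega>" "has_level n q" "coords n q = y"
        using to_limit_in[OF y] to_limit_props[OF y] by (auto simp: q_def)
      have yx: "y i = x i" if "i \<le> K" for i using yV[of i] that by (simp add: V_def)
      have "pos (n + k) q = pos (n + k) p" if "k \<le> K" for k
        using that
      proof (induction k)
        case 0
        then show ?case using yx[of 0] p q by (simp add: pos_def)
      next
        case (Suc k)
        have "pos (Suc (n + k)) r = pos (n + k) r + coords n r (Suc k)"
          if "r \<in> chacon_points \<omega>" "has_level n r" for r
          using pos_step(3)[OF that(1) has_level_mono[OF that, of "n + k"]] coords_symb[OF that] by simp
        then show ?case using Suc yx[of "Suc k"] p q by simp
      qed
      then have "pos (n + K) q = pos (n + K) p" by simp
      from same_cylinder[OF p(1) q(1) m(1) _ has_level_mono[OF q(1,2)] this]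
      have "q \<in> cylinder \<omega> m (pos m p)" using q(1) by (simp add: mem_cylinder K_def)
      then show "y \<in> {x \<in> topspace (level_space \<omega> n). to_limit \<omega> n x \<in> U}"
        using m(2) y by (auto simp: q_def)
    qed
    ultimately show "\<exists>T. openin (level_space \<omega> n) T \<and> x \<in> T \<and>
        T \<subseteq> {x \<in> topspace (level_space \<omega> n). to_limit \<omega> n x \<in> U}" by blast
  qed
  then show "openin (chacon_space \<omega>) U" using U by (simp add: openin_chacon_space)
qed

lemma openin_cylinder: "openin (chacon_space \<omega>) (cylinder \<omega> n f)"
  unfolding openin_chacon_cylinders by (auto simp: mem_cylinder)

lemma compactin_cylinder: "compactin (chacon_space \<omega>) (cylinder \<omega> n f)"
proof -
  have cont: "continuous_map (level_space \<omega> n) (chacon_space \<omega>) (to_limit \<omega> n)"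
    unfolding continuous_map_def
    by (auto simp: topspace_chacon_space to_limit_in openin_chacon_space)
  have "finite (if k = 0 then F_set n else C_set \<omega> (n + k))" for k
    by (cases "n + k") (auto simp: F_set_def)
  then have comp: "compact_space (level_space \<omega> n)"
    unfolding level_space_def
    by (intro compact_space_product_topology[THEN iffD2] disjI2) (simp add: compact_space_discrete_topology)
  have "continuous_map (level_space \<omega> n) (discrete_topology (F_set n)) (\<lambda>x. x 0)"
    using continuous_map_product_projection[of 0 UNIV "\<lambda>k. discrete_topology (if k = 0 then F_set n else C_set \<omega> (n + k))"]
    by (simp add: level_space_def)
  then have "closedin (level_space \<omega> n) {x \<in> topspace (level_space \<omega> n). x 0 \<in> {f} \<inter> F_set n}"
    by (rule closedin_continuous_map_preimage) simp
  moreover have "{x \<in> topspace (level_space \<omega> n). x 0 \<in> {f} \<inter> F_set n} = {x \<in> topspace (level_space \<omega> n). x 0 = f}"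
    by (auto simp: level_space_iff mem_F_set)
  ultimately have "compactin (level_space \<omega> n) {x \<in> topspace (level_space \<omega> n). x 0 = f}"
    using comp closedin_compact_space by metis
  then show ?thesis unfolding cylinder_def by (rule image_compactin[OF _ cont])
qed

section \<open>Measures on spaces with a tree of cells\<close>

definition sum_measure :: "'a measure \<Rightarrow> 'i set \<Rightarrow> ('i \<Rightarrow> 'a measure) \<Rightarrow> 'a measure" where
  "sum_measure S Q m = measure_of (space S) (sets S) (\<lambda>E. \<Sum>q\<in>Q. emeasure (m q) E)"

lemma sets_sum_measure [simp]: "sets (sum_measure S Q m) = sets S"
  by (simp add: sum_measure_def)

lemma space_sum_measure [simp]: "space (sum_measure S Q m) = space S"
  by (simp add: sum_measure_def)

lemma emeasure_sum_measure:
  assumes "\<And>q. q \<in> Q \<Longrightarrow> sets (m q) = sets S" "E \<in> sets S"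
  shows "emeasure (sum_measure S Q m) E = (\<Sum>q\<in>Q. emeasure (m q) E)"
  unfolding sum_measure_def
proof (rule emeasure_measure_of_sigma)
  show "countably_additive (sets S) (\<lambda>E. \<Sum>q\<in>Q. emeasure (m q) E)"
  proof (rule countably_additiveI)
    fix A :: "nat \<Rightarrow> _" assume A: "range A \<subseteq> sets S" "disjoint_family A"
    have "(\<lambda>n. emeasure (m q) (A n)) sums emeasure (m q) (\<Union> (range A))" if "q \<in> Q" for q
      using suminf_emeasure[of A "m q"] A assms(1)[OF that] summable_sums[OF summableI, of "\<lambda>n. emeasure (m q) (A n)"]
      by simp
    then have "(\<lambda>n. \<Sum>q\<in>Q. emeasure (m q) (A n)) sums (\<Sum>q\<in>Q. emeasure (m q) (\<Union> (range A)))"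
      by (rule sums_sum)
    then show "(\<Sum>n. \<Sum>q\<in>Q. emeasure (m q) (A n)) = (\<Sum>q\<in>Q. emeasure (m q) (\<Union> (range A)))"
      by (rule sums_unique[symmetric])
  qed
qed (use assms in \<open>auto simp: positive_def sets.sigma_algebra_axioms\<close>)

text \<open>Refining partitions into countably many cells, each defined only on the part of the
  space selected by \<open>lev n\<close>, where these parts exhaust the space. Single systems and
  finite products are instances, each with a margin \<open>g\<close> that keeps cells on which
  translations by at most \<open>g\<close> still act.\<close>

locale cell_tree =
  fixes \<Omega> :: "'a set" and lev :: "nat \<Rightarrow> 'a \<Rightarrow> bool" and key :: "nat \<Rightarrow> 'a \<Rightarrow> 'k"
  assumes countable_keys: "countable (key n ` {z \<in> \<Omega>. lev n z})"
    and exists_lev: "z \<in> \<Omega> \<Longrightarrow> \<exists>n. lev n z"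
    and lev_Suc: "z \<in> \<Omega> \<Longrightarrow> lev n z \<Longrightarrow> lev (Suc n) z"
    and key_Suc: "z \<in> \<Omega> \<Longrightarrow> z' \<in> \<Omega> \<Longrightarrow> lev n z \<Longrightarrow> lev (Suc n) z' \<Longrightarrow> key (Suc n) z' = key (Suc n) z \<Longrightarrow>
      lev n z' \<and> key n z' = key n z"
begin

definition cell :: "nat \<Rightarrow> 'a \<Rightarrow> 'a set" where
  "cell n z = {z' \<in> \<Omega>. lev n z' \<and> key n z' = key n z}"

definition cells :: "'a set set" where
  "cells = {cell n z | n z. z \<in> \<Omega> \<and> lev n z}"

lemma cellsI: "z \<in> \<Omega> \<Longrightarrow> lev n z \<Longrightarrow> cell n z \<in> cells"
  by (auto simp: cells_def)

lemma lev_mono: "n \<le> m \<Longrightarrow> z \<in> \<Omega> \<Longrightarrow> lev n z \<Longrightarrow> lev m z"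
  by (induction m rule: dec_induct) (auto intro: lev_Suc)

lemma cell_mono:
  assumes "n \<le> m" "z \<in> \<Omega>" "lev n z"
  shows "cell m z \<subseteq> cell n z"
  using assms(1)
proof (induction m rule: dec_induct)
  case (step m)
  have "cell (Suc m) z \<subseteq> cell m z"
    using key_Suc[OF assms(2) _ lev_mono[OF step(1) assms(2,3)]] by (auto simp: cell_def)
  with step(3) show ?case by blast
qed simp

lemma cell_self: "z \<in> \<Omega> \<Longrightarrow> lev n z \<Longrightarrow> z \<in> cell n z"
  by (simp add: cell_def)

lemma cell_eq: "z' \<in> cell n z \<Longrightarrow> cell n z' = cell n z"
  by (auto simp: cell_def)

lemma cell_subset: "cell n z \<subseteq> \<Omega>"
  by (auto simp: cell_def)

lemma countable_cells: "countable cells"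
proof -
  have "cells \<subseteq> (\<Union>n. (\<lambda>k. {z \<in> \<Omega>. lev n z \<and> key n z = k}) ` (key n ` {z \<in> \<Omega>. lev n z}))"
    by (auto simp: cells_def cell_def)
  then show ?thesis by (rule countable_subset) (auto intro: countable_keys)
qed

lemma cells_nested:
  assumes "C \<in> cells" "D \<in> cells"
  shows "C \<inter> D = {} \<or> C \<subseteq> D \<or> D \<subseteq> C"
proof (rule ccontr)
  assume *: "\<not> ?thesis"
  obtain n x m y where C: "C = cell n x" and D: "D = cell m y" using assms by (auto simp: cells_def)
  obtain z where z: "z \<in> cell n x" "z \<in> cell m y" using * C D by blast
  then have zz: "z \<in> \<Omega>" "lev n z" "lev m z" by (auto simp: cell_def)
  have "C = cell n z" "D = cell m z" using z C D cell_eq by auto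
  then show False using * cell_mono[of n m z] cell_mono[of m n z] zz by (cases "n \<le> m") auto
qed

lemma Union_cells: "\<Union> cells = \<Omega>"
proof -
  have "z \<in> \<Union> cells" if "z \<in> \<Omega>" for z
    using exists_lev[OF that] cell_self[OF that] cellsI[OF that] by blast
  then show ?thesis using cell_subset by (auto simp: cells_def)
qed

lemma cells_sub: "cells \<subseteq> Pow \<Omega>"
  using Union_cells by auto

lemma open_union_cells:
  assumes "U \<subseteq> \<Omega>" "\<And>z. z \<in> U \<Longrightarrow> \<exists>n. lev n z \<and> cell n z \<subseteq> U"
  shows "U \<in> sigma_sets \<Omega> cells"
proof -
  have "U = \<Union> {C \<in> cells. C \<subseteq> U}"
  proof
    show "U \<subseteq> \<Union> {C \<in> cells. C \<subseteq> U}"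
    proof
      fix z assume z: "z \<in> U"
      then obtain n where "lev n z" "cell n z \<subseteq> U" using assms(2) by blast
      moreover have "z \<in> \<Omega>" using assms(1) z by blast
      ultimately show "z \<in> \<Union> {C \<in> cells. C \<subseteq> U}" using cell_self cellsI by blast
    qed
  qed auto
  moreover have "countable {C \<in> cells. C \<subseteq> U}" by (rule countable_subset[OF _ countable_cells]) auto
  moreover have "\<Union> {C \<in> cells. C \<subseteq> U} \<in> sigma_sets \<Omega> cells"
    if "countable {C \<in> cells. C \<subseteq> U}"
    using sigma_algebra.countable_Union[OF sigma_algebra_sigma_sets[OF cells_sub] that] by auto
  ultimately show ?thesis by simp
qed

text \<open>Cells are nested or disjoint, so together with the empty set they are closed under
  intersection; their countability supplies the exhausting family of sets of finite measure.\<close>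

lemma measure_eq_cells:
  assumes "sets M = sigma_sets \<Omega> cells" "sets N = sigma_sets \<Omega> cells"
    and eq: "\<And>z n. z \<in> \<Omega> \<Longrightarrow> lev n z \<Longrightarrow> emeasure M (cell n z) = emeasure N (cell n z)"
    and fin: "\<And>z n. z \<in> \<Omega> \<Longrightarrow> lev n z \<Longrightarrow> emeasure M (cell n z) \<noteq> \<infinity>"
  shows "M = N"
proof (rule measure_eqI_generator_eq_countable[of "insert {} cells" \<Omega> M N cells])
  show "Int_stable (insert {} cells)"
  proof (rule Int_stableI)
    fix a b assume ab: "a \<in> insert {} cells" "b \<in> insert {} cells"
    then have "a \<inter> b = {} \<or> a \<subseteq> b \<or> b \<subseteq> a" using cells_nested[of a b] by blast
    then have "a \<inter> b = {} \<or> a \<inter> b = a \<or> a \<inter> b = b" by blast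
    then show "a \<inter> b \<in> insert {} cells" using ab by fastforce
  qed
  have *: "sigma_sets \<Omega> (insert {} cells) = sigma_sets \<Omega> cells"
    by (rule sigma_sets_eqI) (auto intro: sigma_sets.Empty)
  show "sets M = sigma_sets \<Omega> (insert {} cells)" "sets N = sigma_sets \<Omega> (insert {} cells)"
    using assms(1,2) by (simp_all add: *)
qed (use cells_sub countable_cells Union_cells eq fin in \<open>auto simp: cells_def\<close>)

text \<open>Inside the fixed cell, \<open>U\<close> is a union of cells of level \<open>n\<close>.
  There may be countably many of them, hence the integral over a counting measure in place of a
  finite sum.\<close>

lemma emeasure_eqI_cell_sets:
  assumes MA: "sets A = sigma_sets \<Omega> cells" and K: "z0 \<in> \<Omega>" "lev n0 z0"
    and U: "\<And>z z'. z \<in> cell n0 z0 \<Longrightarrow> z' \<in> cell n0 z0 \<Longrightarrow> key n z = key n z' \<Longrightarrow> z \<in> U \<longleftrightarrow> z' \<in> U"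
    and n: "n \<ge> n0"
  shows "cell n0 z0 \<inter> U \<in> sets A"
    "emeasure A (cell n0 z0 \<inter> U) = (\<integral>\<^sup>+ D. emeasure A D \<partial>count_space (cell n ` (cell n0 z0 \<inter> U)))"
proof -
  let ?K = "cell n0 z0"
  have lev: "z \<in> \<Omega>" "lev n z" "cell n z \<subseteq> ?K" if "z \<in> ?K" for z
  proof -
    from that have z: "z \<in> \<Omega>" "lev n0 z" by (auto simp: cell_def)
    then show "z \<in> \<Omega>" "lev n z" using lev_mono[OF n] by auto
    show "cell n z \<subseteq> ?K" using cell_mono[OF n z] cell_eq[OF that] by simp
  qed
  have "z' \<in> ?K \<inter> U" if "z \<in> ?K \<inter> U" "z' \<in> cell n z" for z z'
  proof -
    have "z \<in> ?K" "z' \<in> ?K" "key n z = key n z'" "z \<in> U"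
      using that lev(3)[of z] by (auto simp: cell_def[of n])
    then show ?thesis using U by blast
  qed
  then have eq: "?K \<inter> U = \<Union> (cell n ` (?K \<inter> U))"
    using lev(1,2) cell_self[of _ n] by blast
  have sub: "cell n ` (?K \<inter> U) \<subseteq> cells" using lev cellsI by blast
  have count: "countable (cell n ` (?K \<inter> U))" by (rule countable_subset[OF sub countable_cells])
  have setsD: "D \<in> sets A" if "D \<in> cell n ` (?K \<inter> U)" for D using that sub MA by auto
  show "?K \<inter> U \<in> sets A"
    by (subst eq, rule sets.countable_Union[OF count]) (use setsD in blast)
  have "disjoint_family_on (\<lambda>D. D) (cell n ` (?K \<inter> U))"
  proof (unfold disjoint_family_on_def, intro ballI impI)
    fix C D assume "C \<in> cell n ` (?K \<inter> U)" "D \<in> cell n ` (?K \<inter> U)" "C \<noteq> D"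
    then show "C \<inter> D = {}" using cell_eq by blast
  qed
  then show "emeasure A (?K \<inter> U) = (\<integral>\<^sup>+ D. emeasure A D \<partial>count_space (cell n ` (?K \<inter> U)))"
    using emeasure_UN_countable[of "cell n ` (?K \<inter> U)" "\<lambda>D. D" A] setsD count eq by simp
qed

text \<open>The condition on \<open>U\<close> makes it a union of cells of one level inside the
  fixed cell. Stated through keys, it survives complements, finite unions and a change to a finer
  level, as the induction over the generated sigma-algebra requires.\<close>

lemma approximation_by_cells:
  assumes MA: "sets A = sigma_sets \<Omega> cells" and K: "z0 \<in> \<Omega>" "lev n0 z0"
    and fin: "emeasure A (cell n0 z0) < \<infinity>" and E: "E \<in> sigma_sets \<Omega> cells"
  shows "e > 0 \<Longrightarrow> \<exists>U n. n > n0 \<and>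
    (\<forall>z\<in>cell n0 z0. \<forall>z'\<in>cell n0 z0. key n z = key n z' \<longrightarrow> (z \<in> U \<longleftrightarrow> z' \<in> U)) \<and>
    measure A (cell n0 z0 \<inter> (E - U \<union> (U - E))) < e"
  using E
proof (induction arbitrary: e rule: sigma_sets.induct)
  let ?K = "cell n0 z0"
  define sat where "sat U n \<longleftrightarrow> (\<forall>z\<in>?K. \<forall>z'\<in>?K. key n z = key n z' \<longrightarrow> (z \<in> U \<longleftrightarrow> z' \<in> U))" for U n
  have levK: "z \<in> \<Omega>" "lev n z" if "z \<in> ?K" "n \<ge> n0" for z n
    using that lev_mono[OF that(2)] by (auto simp: cell_def)
  have key_le: "key n z = key n z'"
    if "z \<in> ?K" "z' \<in> ?K" "n0 \<le> n" "n \<le> m" "key m z = key m z'" for z z' n m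
    using cell_mono[OF that(4) levK(1)[OF that(1,3)] levK(2)[OF that(1,3)]] that
      levK[OF that(2), of m] levK[OF that(2,3)] by (auto simp: cell_def)
  have sat_mono: "sat U m" if "sat U n" "n0 \<le> n" "n \<le> m" for U n m
    using that key_le unfolding sat_def by blast
  have Kset: "?K \<in> sets A" using MA K cellsI by auto
  have sat_set: "?K \<inter> U \<in> sets A" if "sat U n" "n > n0" for U n
    by (rule emeasure_eqI_cell_sets(1)[OF MA K _ less_imp_le[OF that(2)]])
      (rule that(1)[unfolded sat_def, rule_format])
  {
    case (Basic C)
    then obtain m y where C: "C = cell m y" "y \<in> \<Omega>" "lev m y" by (auto simp: cells_def)
    define n where "n = max m (Suc n0)"
    have imp: "z' \<in> C" if "z \<in> ?K" "z' \<in> ?K" "key n z = key n z'" "z \<in> C" for z z'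
    proof -
      have z: "z \<in> \<Omega>" "lev m z" using that(4) C by (auto simp: cell_def)
      have "z' \<in> cell n z" using levK[OF that(2), of n] that(3) by (auto simp: cell_def n_def)
      then show "z' \<in> C" using cell_mono[OF _ z, of n] cell_eq[of z m y] that(4) C by (auto simp: n_def)
    qed
    have "sat C n" unfolding sat_def
    proof (intro ballI impI)
      fix z z' assume "z \<in> ?K" "z' \<in> ?K" "key n z = key n z'"
      then show "z \<in> C \<longleftrightarrow> z' \<in> C" using imp[of z z'] imp[of z' z] by argo
    qed
    then show ?case unfolding sat_def
    proof (intro exI[of _ C] exI[of _ n] conjI)
      show "measure A (?K \<inter> (C - C \<union> (C - C))) < e" using Basic.prems by simp
    qed (simp add: n_def)
  next
    case Empty
    then show ?case by (intro exI[of _ "{}"] exI[of _ "Suc n0"]) auto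
  next
    case (Compl E)
    obtain U n where U: "n > n0" "sat U n" "measure A (?K \<inter> (E - U \<union> (U - E))) < e"
      using Compl.IH[OF Compl.prems] unfolding sat_def by blast
    have "?K \<inter> ((\<Omega> - E) - (\<Omega> - U) \<union> ((\<Omega> - U) - (\<Omega> - E))) = ?K \<inter> (E - U \<union> (U - E))"
      using cell_subset by blast
    moreover have "sat (\<Omega> - U) n" using U(2) cell_subset unfolding sat_def by blast
    ultimately show ?case using U(1,3) unfolding sat_def by metis
  next
    case (Union E)
    have Eset: "E i \<in> sets A" for i using Union.hyps MA by simp
    have finK: "emeasure A X < \<infinity>" if "X \<subseteq> ?K" for X
      using emeasure_mono[OF that Kset] fin by (simp add: order_le_less_trans)
    \<comment> \<open>Half of \<open>e\<close> pays for the tail of the union, small by continuity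
      from above; the other half is shared among the first \<open>N\<close> sets, whose
      approximations are brought to one common level \<open>m\<close>.\<close>
    define T where "T N = ?K \<inter> ((\<Union>i. E i) - (\<Union>i<N. E i))" for N
    have Tset: "T N \<in> sets A" for N using Kset Eset unfolding T_def by auto
    have "(\<lambda>N. measure A (T N)) \<longlonglongrightarrow> measure A (\<Inter>N. T N)"
    proof (rule Lim_measure_decseq)
      show "decseq T" unfolding decseq_def T_def by fastforce
    qed (use Tset finK[of "T _"] in \<open>auto simp: T_def less_top\<close>)
    moreover have "(\<Inter>N. T N) = {}" by (auto simp: T_def)
    ultimately have "(\<lambda>N. measure A (T N)) \<longlonglongrightarrow> 0" by simp
    then obtain N where N: "measure A (T N) < e / 2"
      using Union.prems order_tendstoD(2)[of _ 0 sequentially "e/2"] eventually_sequentially by (metis half_gt_zero order_refl)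
    have "\<exists>U n. n > n0 \<and> sat U n \<and> measure A (?K \<inter> (E i - U \<union> (U - E i))) < e / (2 * (N + 1))" for i
      using Union.IH[of "e / (2 * (N + 1))" i] Union.prems unfolding sat_def by simp
    then obtain U n where U: "\<And>i. n i > n0" "\<And>i. sat (U i) (n i)"
      "\<And>i. measure A (?K \<inter> (E i - U i \<union> (U i - E i))) < e / (2 * (N + 1))" by metis
    define m where "m = Max (insert (Suc n0) (n ` {..<N}))"
    have m: "m > n0" "\<And>i. i < N \<Longrightarrow> n i \<le> m" unfolding m_def by (auto simp: less_eq_Suc_le)
    have satm: "sat (U i) m" if "i < N" for i
      using sat_mono[OF U(2) _ m(2)[OF that]] U(1)[of i] by simp
    have sat: "sat (\<Union>i<N. U i) m" using satm unfolding sat_def by blast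
    define D where "D i = ?K \<inter> (E i - U i \<union> (U i - E i))" for i
    have Dset: "D i \<in> sets A" if "i < N" for i
    proof -
      have "?K \<inter> U i \<in> sets A" using sat_set[OF satm[OF that] m(1)] .
      moreover have "D i = (?K \<inter> E i - ?K \<inter> U i) \<union> (?K \<inter> U i - ?K \<inter> E i)" by (auto simp: D_def)
      ultimately show ?thesis using Eset Kset by auto
    qed
    let ?S = "?K \<inter> ((\<Union>i. E i) - (\<Union>i<N. U i) \<union> ((\<Union>i<N. U i) - (\<Union>i. E i)))"
    have "?S \<subseteq> T N \<union> (\<Union>i<N. D i)" by (auto simp: T_def D_def)
    moreover have "?K \<inter> (\<Union>i<N. U i) \<in> sets A"
      using sat_set[OF sat m(1)] .
    ultimately have "measure A ?S \<le> measure A (T N \<union> (\<Union>i<N. D i))"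
      using Tset Dset finK[of "T N \<union> (\<Union>i<N. D i)"]
      by (intro measure_mono_fmeasurable fmeasurableI)
        (auto simp: T_def D_def Int_Un_distrib Diff_Int_distrib intro!: sets.Un sets.Diff Kset Eset)
    also have "\<dots> \<le> measure A (T N) + measure A (\<Union>i<N. D i)"
      using Tset Dset by (intro measure_Un_le) auto
    also have "measure A (\<Union>i<N. D i) \<le> (\<Sum>i<N. measure A (D i))"
      using Dset by (intro measure_UNION_le) auto
    also have "(\<Sum>i<N. measure A (D i)) \<le> (\<Sum>i<N. e / (2 * (N + 1)))"
      using U(3) by (intro sum_mono) (simp add: D_def less_imp_le)
    also have "\<dots> \<le> e / 2" using Union.prems by (simp add: field_simps)
    finally have "measure A ?S < e" using N by simp
    then show ?case using m(1) sat unfolding sat_def by (intro exI[of _ "\<Union>i<N. U i"] exI[of _ m]) blast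
  }
qed

lemma measure_le_cells:
  assumes A: "sets A = sigma_sets \<Omega> cells" and B: "sets B = sigma_sets \<Omega> cells"
    and le: "\<And>z n. z \<in> \<Omega> \<Longrightarrow> lev n z \<Longrightarrow> emeasure A (cell n z) \<le> emeasure B (cell n z)"
    and fA: "\<And>z n. z \<in> \<Omega> \<Longrightarrow> lev n z \<Longrightarrow> emeasure A (cell n z) < \<infinity>"
    and fB: "\<And>z n. z \<in> \<Omega> \<Longrightarrow> lev n z \<Longrightarrow> emeasure B (cell n z) < \<infinity>"
    and E: "E \<in> sets A"
  shows "emeasure A E \<le> emeasure B E"
proof -
  have cell_le: "emeasure A E \<le> emeasure B E" if E: "E \<in> sets A" "E \<subseteq> C" and "C \<in> cells" for E C
  proof -
    obtain n0 z0 where C: "C = cell n0 z0" and K: "z0 \<in> \<Omega>" "lev n0 z0" using \<open>C \<in> cells\<close> by (auto simp: cells_def)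
    \<comment> \<open>Approximating with respect to the sum makes one and the same \<open>U\<close>
      close to \<open>E\<close> for \<open>A\<close> and for \<open>B\<close>.\<close>
    define S where "S = sum_measure A {True, False} (\<lambda>b. if b then A else B)"
    have S: "emeasure S X = emeasure A X + emeasure B X" if "X \<in> sets A" for X
      unfolding S_def using that A B by (subst emeasure_sum_measure) auto
    have setsS: "sets S = sigma_sets \<Omega> cells" by (simp add: S_def A)
    have Cset: "C \<in> sets A" using \<open>C \<in> cells\<close> A by auto
    have finC: "emeasure A X < \<infinity>" "emeasure B X < \<infinity>" if "X \<subseteq> C" for X
      using emeasure_mono[OF that, of A] emeasure_mono[OF that, of B] Cset A B fA[OF K] fB[OF K]
      by (auto simp: C order_le_less_trans)
    have "measure A E \<le> measure B E + e" if "e > 0" for e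
    proof -
      have "emeasure S (cell n0 z0) < \<infinity>" using S[OF Cset] finC[of C] by (simp add: C)
      then obtain U n where n: "n > n0"
        and U: "\<forall>z\<in>C. \<forall>z'\<in>C. key n z = key n z' \<longrightarrow> (z \<in> U \<longleftrightarrow> z' \<in> U)"
        and m: "measure S (C \<inter> (E - U \<union> (U - E))) < e"
        using approximation_by_cells[OF setsS K _ _ \<open>e > 0\<close>, of E] E(1) unfolding A C by blast
      have U': "z \<in> cell n0 z0 \<Longrightarrow> z' \<in> cell n0 z0 \<Longrightarrow> key n z = key n z' \<Longrightarrow> z \<in> U \<longleftrightarrow> z' \<in> U" for z z'
        using U unfolding C by blast
      have UA: "C \<inter> U \<in> sets A" and UB: "C \<inter> U \<in> sets B"
        unfolding C by (rule emeasure_eqI_cell_sets(1)[OF A K U' less_imp_le[OF n]], assumption+)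
          (rule emeasure_eqI_cell_sets(1)[OF B K U' less_imp_le[OF n]], assumption+)
      have "emeasure A D \<le> emeasure B D" if D: "D \<in> cell n ` (C \<inter> U)" for D
      proof -
        obtain z where z: "D = cell n z" "z \<in> C" using D by auto
        then have "z \<in> \<Omega>" "lev n z" using lev_mono[of n0 n z] n by (auto simp: C cell_def)
        then show ?thesis using le z by simp
      qed
      note le = this
      have eA: "emeasure A (C \<inter> U) = (\<integral>\<^sup>+ D. emeasure A D \<partial>count_space (cell n ` (C \<inter> U)))"
        unfolding C by (rule emeasure_eqI_cell_sets(2)[OF A K U' less_imp_le[OF n]], assumption+)
      have eB: "emeasure B (C \<inter> U) = (\<integral>\<^sup>+ D. emeasure B D \<partial>count_space (cell n ` (C \<inter> U)))"
        unfolding C by (rule emeasure_eqI_cell_sets(2)[OF B K U' less_imp_le[OF n]], assumption+)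
      have le: "emeasure A (C \<inter> U) \<le> emeasure B (C \<inter> U)"
        unfolding eA eB by (intro nn_integral_mono) (use le in simp)
      have le': "measure A (C \<inter> U) \<le> measure B (C \<inter> U)"
        using le finC[of "C \<inter> U"] unfolding measure_def by (simp add: enn2real_mono)
      let ?D = "C \<inter> (E - U \<union> (U - E))"
      have Deq: "?D = (E - C \<inter> U) \<union> (C \<inter> U - E)" using E(2) by blast
      have "?D \<in> sets A" unfolding Deq by (intro sets.Un sets.Diff UA E(1))
      then have D: "?D \<in> sets A" "?D \<in> sets B" using A B by auto
      have SD: "measure S ?D = measure A ?D + measure B ?D"
        using S[OF D(1)] finC[of ?D] unfolding measure_def by (simp add: enn2real_plus)
      have "measure A E \<le> measure A (C \<inter> U \<union> ?D)"
        using finC[of "C \<inter> U \<union> ?D"] UA D E by (intro measure_mono_fmeasurable fmeasurableI) auto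
      moreover have "\<dots> \<le> measure A (C \<inter> U) + measure A ?D"
        using UA D by (intro measure_Un_le) auto
      moreover have "measure B (C \<inter> U) \<le> measure B (E \<union> ?D)"
        using finC[of "E \<union> ?D"] UB D E A B by (intro measure_mono_fmeasurable fmeasurableI sets.Un) auto
      moreover have "\<dots> \<le> measure B E + measure B ?D"
        using E D A B by (intro measure_Un_le) auto
      ultimately show ?thesis using le' m SD by linarith
    qed
    then have "measure A E \<le> measure B E" by (rule field_le_epsilon)
    then show ?thesis using finC[OF E(2)] by (simp add: emeasure_eq_ennreal_measure less_top ennreal_leI)
  qed
  show ?thesis
  proof (cases "cells = {}")
    case True
    then have "\<Omega> = {}" using Union_cells by simp
    then have "E = {}" using E A sigma_sets_into_sp[OF cells_sub] by blast
    then show ?thesis by simp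
  next
    case False
    \<comment> \<open>The bound inside a single cell extends to all of \<open>E\<close> by cutting
      \<open>E\<close> along the disjointed sequence of all cells.\<close>
    define C where "C = from_nat_into cells"
    have C: "range C = cells" unfolding C_def using False countable_cells by (rule range_from_nat_into)
    have Cs: "range C \<subseteq> sets A" "range C \<subseteq> sets B" using C A B by auto
    have dset: "disjointed C i \<in> sets A" "disjointed C i \<in> sets B" for i
      using sets.range_disjointed_sets[OF Cs(1)] sets.range_disjointed_sets[OF Cs(2)] by auto
    have cov: "(\<Union>i. E \<inter> disjointed C i) = E"
    proof -
      have "(\<Union>i. disjointed C i) = \<Omega>" using UN_disjointed_eq[of C] C Union_cells by simp
      then show ?thesis using E A sigma_sets_into_sp[OF cells_sub] by auto
    qed
    have disj: "disjoint_family (\<lambda>i. E \<inter> disjointed C i)"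
      using disjoint_family_disjointed[of C] unfolding disjoint_family_on_def by blast
    have Eset: "range (\<lambda>i. E \<inter> disjointed C i) \<subseteq> sets A" "range (\<lambda>i. E \<inter> disjointed C i) \<subseteq> sets B"
      using E dset A B by (blast intro: sets.Int)+
    have "emeasure A E = (\<Sum>i. emeasure A (E \<inter> disjointed C i))"
      using suminf_emeasure[OF _ disj, of A] cov Eset(1) by auto
    also have "\<dots> \<le> (\<Sum>i. emeasure B (E \<inter> disjointed C i))"
    proof (intro suminf_le allI)
      fix i
      show "emeasure A (E \<inter> disjointed C i) \<le> emeasure B (E \<inter> disjointed C i)"
        using E dset disjointed_subset[of C i] C by (intro cell_le[of _ "C i"]) auto
    qed auto
    also have "\<dots> = emeasure B E"
      using suminf_emeasure[OF _ disj, of B] cov Eset(2) by auto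
    finally show ?thesis .
  qed
qed

end

section \<open>Ergodic measures\<close>

lemma AE_preimage:
  assumes T: "T \<in> measurable M M" and inv: "distr M M T = M" and "AE x in M. P x"
  shows "AE x in M. P (T x)"
  by (rule AE_distrD[OF T], subst inv, rule assms(3))

text \<open>The definition of \<open>ergodic\<close> speaks of strictly invariant sets. The set of
  points that visit \<open>A\<close> infinitely often is strictly invariant, and it agrees with
  \<open>A\<close> up to a null set because almost every orbit stays inside or outside
  \<open>A\<close>.\<close>

lemma ergodic_mod_null:
  assumes erg: "ergodic M T" and T: "T \<in> measurable M M" and inv: "distr M M T = M"
    and A: "A \<in> sets M" and AE: "AE x in M. T x \<in> A \<longleftrightarrow> x \<in> A"
  shows "A \<in> null_sets M \<or> space M - A \<in> null_sets M"
proof -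
  define B where "B = {x \<in> space M. \<exists>\<^sub>F n in sequentially. (T ^^ n) x \<in> A}"
  have Tn: "T ^^ n \<in> measurable M M" for n
  proof (induction n)
    case (Suc n)
    then show ?case using measurable_comp[OF Suc T] by (simp add: comp_def)
  qed simp
  have meas: "{x \<in> space M. (T ^^ n) x \<in> A} \<in> sets M" for n
    using measurable_sets[OF Tn[of n] A] by (simp add: vimage_def Int_def conj_commute)
  have B: "B \<in> sets M"
  proof -
    have "B = (\<Inter>m. \<Union>n\<in>{m..}. {x \<in> space M. (T ^^ n) x \<in> A})"
      by (auto simp: B_def frequently_sequentially)
    then show ?thesis using meas by auto
  qed
  have "T -` B \<inter> space M = B"
  proof -
    have "(\<exists>\<^sub>F n in sequentially. (T ^^ n) (T x) \<in> A) \<longleftrightarrow> (\<exists>\<^sub>F n in sequentially. (T ^^ n) x \<in> A)" for x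
      using eventually_sequentially_Suc[of "\<lambda>n. (T ^^ n) x \<notin> A"]
      by (simp add: frequently_def funpow_Suc_right del: funpow.simps)
    then show ?thesis using measurable_space[OF T] by (auto simp: B_def)
  qed
  then have 1: "B \<in> null_sets M \<or> space M - B \<in> null_sets M"
    using erg B by (auto simp: ergodic_def)
  have "AE x in M. (T ^^ n) x \<in> A \<longleftrightarrow> x \<in> A" for n
  proof (induction n)
    case (Suc n)
    from AE_preimage[OF T inv Suc] AE show ?case
      by eventually_elim (simp add: funpow_swap1)
  qed simp
  then have "AE x in M. \<forall>n. (T ^^ n) x \<in> A \<longleftrightarrow> x \<in> A" by (simp add: AE_all_countable)
  then have AB: "AE x in M. x \<in> B \<longleftrightarrow> x \<in> A"
    using AE_space by eventually_elim (simp add: B_def)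
  from 1 show ?thesis
  proof
    assume "B \<in> null_sets M"
    have "AE x in M. x \<notin> A" using AB AE_not_in[OF \<open>B \<in> null_sets M\<close>] by eventually_elim auto
    then show ?thesis using A AE_iff_null_sets by blast
  next
    assume "space M - B \<in> null_sets M"
    have "AE x in M. x \<notin> space M - A"
      using AB AE_not_in[OF \<open>space M - B \<in> null_sets M\<close>] AE_space by eventually_elim auto
    then show ?thesis using A AE_iff_null_sets[of "space M - A" M] by auto
  qed
qed

text \<open>The constant is the essential infimum, reached along countably many lower bounds. Where
  \<open>f\<close> is at least a larger rational is an invariant set; it is null, since otherwise
  that rational would be a lower bound.\<close>

lemma ergodic_constant:
  fixes f :: "'a \<Rightarrow> ennreal"
  assumes erg: "ergodic M T" and T: "T \<in> measurable M M" and inv: "distr M M T = M"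
    and f: "f \<in> borel_measurable M" and AE: "AE x in M. f (T x) = f x"
  shows "\<exists>c. AE x in M. f x = c"
proof -
  define S where "S = {q. AE x in M. q \<le> f x}"
  have "0 \<in> S" by (simp add: S_def)
  then obtain g :: "nat \<Rightarrow> ennreal" where g: "range g \<subseteq> S" "Sup S = (SUP i. g i)"
    using ennreal_Sup_countable_SUP[of S] by blast
  have "AE x in M. \<forall>i. g i \<le> f x" using g(1) by (subst AE_all_countable) (auto simp: S_def)
  then have ge: "AE x in M. Sup S \<le> f x" by eventually_elim (simp add: g(2) SUP_least)
  have "AE x in M. \<not> ennreal (real_of_rat q) \<le> f x" if "Sup S < ennreal (real_of_rat q)" for q
  proof -
    let ?A = "{x \<in> space M. ennreal (real_of_rat q) \<le> f x}"
    have A: "?A \<in> sets M" using f by measurable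
    have "AE x in M. T x \<in> ?A \<longleftrightarrow> x \<in> ?A"
      using AE AE_space by eventually_elim (use measurable_space[OF T] in auto)
    from ergodic_mod_null[OF erg T inv A this] show ?thesis
    proof
      assume "?A \<in> null_sets M"
      from AE_not_in[OF this] AE_space show ?thesis by eventually_elim auto
    next
      assume "space M - ?A \<in> null_sets M"
      from AE_not_in[OF this] AE_space have "AE x in M. ennreal (real_of_rat q) \<le> f x"
        by eventually_elim auto
      then have "ennreal (real_of_rat q) \<le> Sup S" by (auto simp: S_def intro: Sup_upper)
      then show ?thesis using that by simp
    qed
  qed
  then have "AE x in M. \<forall>q. Sup S < ennreal (real_of_rat q) \<longrightarrow> \<not> ennreal (real_of_rat q) \<le> f x"
    by (simp add: AE_all_countable)
  then have "AE x in M. f x = Sup S"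
    using ge
  proof eventually_elim
    case (elim x)
    then have "\<not> Sup S < f x" using ennreal_rat_dense[of "Sup S" "f x"] by (meson less_imp_le)
    with elim show ?case by simp
  qed
  then show ?thesis by blast
qed

text \<open>Composing the density with \<open>T\<close> yields a density of the same measure, and
  densities over a sigma-finite measure are unique almost everywhere.\<close>

lemma density_invariant:
  fixes f :: "'a \<Rightarrow> ennreal"
  assumes \<sigma>: "sigma_finite_measure \<sigma>"
    and T: "T \<in> measurable \<sigma> \<sigma>" and T': "T' \<in> measurable \<sigma> \<sigma>"
    and inv: "\<And>x. x \<in> space \<sigma> \<Longrightarrow> T' (T x) = x"  "\<And>x. x \<in> space \<sigma> \<Longrightarrow> T (T' x) = x"
    and pres: "distr \<sigma> \<sigma> T = \<sigma>"
    and f: "f \<in> borel_measurable \<sigma>" and pres': "distr (density \<sigma> f) \<sigma> T = density \<sigma> f"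
  shows "AE x in \<sigma>. f (T x) = f x"
proof -
  have fT: "(\<lambda>x. f (T x)) \<in> borel_measurable \<sigma>" using f T by measurable
  have "density \<sigma> (\<lambda>x. f (T x)) = density \<sigma> f"
  proof (rule measure_eqI)
    fix E assume "E \<in> sets (density \<sigma> (\<lambda>x. f (T x)))"
    then have E: "E \<in> sets \<sigma>" by simp
    have E': "T' -` E \<inter> space \<sigma> \<in> sets \<sigma>" using measurable_sets[OF T' E] .
    have TE: "T -` (T' -` E \<inter> space \<sigma>) \<inter> space \<sigma> = E"
      using measurable_space[OF T] inv(1) sets.sets_into_space[OF E] by auto
    have "emeasure (density \<sigma> f) E = emeasure (distr (density \<sigma> f) \<sigma> T) (T' -` E \<inter> space \<sigma>)"
      using T E' TE by (subst emeasure_distr) auto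
    also have "\<dots> = (\<integral>\<^sup>+x. f x * indicator (T' -` E \<inter> space \<sigma>) x \<partial>\<sigma>)"
      using f E' unfolding pres' by (rule emeasure_density)
    also have "\<dots> = (\<integral>\<^sup>+x. f x * indicator (T' -` E \<inter> space \<sigma>) x \<partial>distr \<sigma> \<sigma> T)" by (simp add: pres)
    also have "\<dots> = (\<integral>\<^sup>+x. f (T x) * indicator (T' -` E \<inter> space \<sigma>) (T x) \<partial>\<sigma>)"
      using f E' by (intro nn_integral_distr[OF T] borel_measurable_times_ennreal borel_measurable_indicator) auto
    also have "\<dots> = (\<integral>\<^sup>+x. f (T x) * indicator E x \<partial>\<sigma>)"
      using TE by (intro nn_integral_cong arg_cong2[where f="(*)"] refl) (auto simp: indicator_def)
    also have "\<dots> = emeasure (density \<sigma> (\<lambda>x. f (T x))) E"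
      using fT E by (subst emeasure_density) auto
    finally show "emeasure (density \<sigma> (\<lambda>x. f (T x))) E = emeasure (density \<sigma> f) E" by simp
  qed simp
  then show ?thesis using sigma_finite_measure.density_unique_iff[OF \<sigma> fT f] by blast
qed

lemma sigma_finite_sum_measure:
  assumes M: "sigma_finite_measure M" and N: "sigma_finite_measure N" and s: "sets N = sets M"
  shows "sigma_finite_measure (sum_measure M UNIV (\<lambda>b. if b then M else N))"
proof -
  obtain A where A: "countable A" "A \<subseteq> sets M" "\<Union>A = space M" "\<forall>a\<in>A. emeasure M a \<noteq> \<infinity>"
    using sigma_finite_measure.sigma_finite_countable[OF M] by blast
  obtain B where B: "countable B" "B \<subseteq> sets N" "\<Union>B = space N" "\<forall>a\<in>B. emeasure N a \<noteq> \<infinity>"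
    using sigma_finite_measure.sigma_finite_countable[OF N] by blast
  have sp: "space N = space M" using s by (rule sets_eq_imp_space_eq)
  let ?C = "(\<lambda>(a,b). a \<inter> b) ` (A \<times> B)"
  show ?thesis
  proof (unfold_locales, intro exI[of _ ?C] conjI ballI)
    show "countable ?C" using A(1) B(1) by blast
    show "?C \<subseteq> sets (sum_measure M UNIV (\<lambda>b. if b then M else N))" using A(2) B(2) s by auto
    have "\<Union> ?C = \<Union>A \<inter> \<Union>B" by auto
    then show "\<Union> ?C = space (sum_measure M UNIV (\<lambda>b. if b then M else N))"
      unfolding A(3) B(3) sp by simp
    fix c assume "c \<in> ?C"
    then obtain a b where ab: "a \<in> A" "b \<in> B" "c = a \<inter> b" by auto
    have ab': "a \<in> sets M" "b \<in> sets M" using ab A(2) B(2) s by auto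
    have "emeasure M c \<le> emeasure M a" "emeasure N c \<le> emeasure N b"
      using ab' s unfolding ab(3) by (auto intro!: emeasure_mono)
    then have "emeasure M c < \<infinity>" "emeasure N c < \<infinity>"
      using ab A(4) B(4) by (auto simp: less_top order_le_less_trans)
    then show "emeasure (sum_measure M UNIV (\<lambda>b. if b then M else N)) c \<noteq> \<infinity>"
      using ab' s unfolding ab(3) by (subst emeasure_sum_measure) (auto simp: UNIV_bool)
  qed
qed

text \<open>The Radon-Nikodym density is invariant by its uniqueness, hence constant by
  ergodicity.\<close>

lemma ergodic_proportional:
  assumes M: "sigma_finite_measure M" and s: "sets N = sets M"
    and T: "T \<in> measurable M M" and T': "T' \<in> measurable M M"
    and inv: "\<And>x. x \<in> space M \<Longrightarrow> T' (T x) = x" "\<And>x. x \<in> space M \<Longrightarrow> T (T' x) = x"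
    and pM: "distr M M T = M" and pN: "distr N N T = N" and erg: "ergodic M T"
    and ac: "absolutely_continuous M N"
  shows "\<exists>d. N = scale_measure d M"
proof -
  obtain f where f: "f \<in> borel_measurable M" "density M f = N"
    using sigma_finite_measure.Radon_Nikodym[OF M ac s] by blast
  have "distr N M T = N" using pN distr_cong[of N N N M T T] s by simp
  then have "AE x in M. f (T x) = f x"
    using density_invariant[OF M T T' inv pM f(1)] f(2) by simp
  then obtain d where d: "AE x in M. f x = d"
    using ergodic_constant[OF erg T pM f(1)] by blast
  have "N = scale_measure d M"
  proof (rule measure_eqI)
    fix E assume "E \<in> sets N"
    then have E: "E \<in> sets M" using s by simp
    have "emeasure N E = (\<integral>\<^sup>+x. f x * indicator E x \<partial>M)"
      using f E by (subst emeasure_density[symmetric]) auto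
    also have "\<dots> = (\<integral>\<^sup>+x. d * indicator E x \<partial>M)"
      using d by (intro nn_integral_cong_AE) auto
    finally show "emeasure N E = emeasure (scale_measure d M) E"
      using E by (simp add: nn_integral_cmult_indicator)
  qed (simp add: s)
  then show ?thesis ..
qed

text \<open>\<open>M\<close> has a density over M + N, constant M-almost everywhere and constant
  N-almost everywhere. Different constants separate the two measures; a common constant c gives M =
  c (M + N), so \<open>N\<close> is absolutely continuous with respect to \<open>M\<close> unless
  \<open>M\<close> vanishes.\<close>

lemma ergodic_dichotomy:
  assumes M: "sigma_finite_measure M" and N: "sigma_finite_measure N" and s: "sets N = sets M"
    and T: "T \<in> measurable M M" and T': "T' \<in> measurable M M"
    and inv: "\<And>x. x \<in> space M \<Longrightarrow> T' (T x) = x" "\<And>x. x \<in> space M \<Longrightarrow> T (T' x) = x"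
    and pM: "distr M M T = M" and pN: "distr N N T = N"
    and eM: "ergodic M T" and eN: "ergodic N T"
  shows "(\<exists>A\<in>sets M. emeasure M (space M - A) = 0 \<and> emeasure N A = 0) \<or> (\<exists>d. N = scale_measure d M)"
proof -
  define \<sigma> where "\<sigma> = sum_measure M UNIV (\<lambda>b. if b then M else N)"
  have sp: "space N = space M" using s by (rule sets_eq_imp_space_eq)
  have \<sigma>: "sigma_finite_measure \<sigma>" unfolding \<sigma>_def by (rule sigma_finite_sum_measure[OF M N s])
  have ss: "sets \<sigma> = sets M" "space \<sigma> = space M" by (auto simp: \<sigma>_def)
  have em: "emeasure \<sigma> E = emeasure M E + emeasure N E" if "E \<in> sets M" for E
    unfolding \<sigma>_def using that s by (subst emeasure_sum_measure) (auto simp: UNIV_bool)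
  have mc: "measurable \<sigma> \<sigma> = measurable M M" "measurable N N = measurable M M"
    using measurable_cong_sets[OF ss(1) ss(1)] measurable_cong_sets[OF s s] by simp_all
  have inv_em: "emeasure M (T -` E \<inter> space M) = emeasure M E" "emeasure N (T -` E \<inter> space M) = emeasure N E"
    if "E \<in> sets M" for E
    using that emeasure_distr[OF T, of E] emeasure_distr[of T N N E] T s sp pM pN mc by auto
  have pres: "distr \<sigma> \<sigma> T = \<sigma>"
  proof (rule measure_eqI)
    fix E assume "E \<in> sets (distr \<sigma> \<sigma> T)"
    then have E: "E \<in> sets M" by (simp add: ss)
    then show "emeasure (distr \<sigma> \<sigma> T) E = emeasure \<sigma> E"
      using T measurable_sets[OF T E] inv_em[OF E] by (subst emeasure_distr) (auto simp: mc ss em)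
  qed simp
  have "absolutely_continuous \<sigma> M"
    unfolding absolutely_continuous_def null_sets_def by (auto simp: ss em)
  then obtain f where f: "f \<in> borel_measurable \<sigma>" "density \<sigma> f = M"
    using sigma_finite_measure.Radon_Nikodym[OF \<sigma>] ss by metis
  have fM: "f \<in> borel_measurable M" "f \<in> borel_measurable N"
    using f(1) ss s by (auto cong: measurable_cong_sets)
  have "distr M \<sigma> T = M" using pM distr_cong[of M M M \<sigma> T T] ss by simp
  then have fT: "AE x in \<sigma>. f (T x) = f x"
    using density_invariant[OF \<sigma> _ _ _ _ pres f(1), of T'] f(2) T T' inv by (simp add: mc ss)
  have null: "AE x in \<sigma>. P x \<Longrightarrow> (AE x in M. P x) \<and> (AE x in N. P x)" for P
    unfolding eventually_ae_filter by (auto simp: null_sets_def ss em s sp)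
  obtain c where c: "AE x in M. f x = c"
    using ergodic_constant[OF eM T pM fM(1)] null[OF fT] by blast
  obtain c' where c': "AE x in N. f x = c'"
    using ergodic_constant[OF eN _ pN fM(2)] null[OF fT] T mc by auto
  show ?thesis
  proof (cases "c = c'")
    case False
    let ?A = "{x \<in> space M. f x = c}"
    have A: "?A \<in> sets M" using fM(1) by measurable
    have "AE x in M. x \<notin> space M - ?A" using c AE_space by eventually_elim auto
    then have 1: "space M - ?A \<in> null_sets M" using A AE_iff_null_sets[of "space M - ?A" M] by auto
    have "AE x in N. x \<notin> ?A" using c' by eventually_elim (use False in auto)
    then have "?A \<in> null_sets N" using A AE_iff_null_sets[of ?A N] s by auto
    then show ?thesis using A 1 by (intro disjI1 bexI[of _ ?A]) auto
  next
    case True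
    have Mc: "emeasure M E = c * (emeasure M E + emeasure N E)" if E: "E \<in> sets M" for E
    proof -
      have aec: "AE x in \<sigma>. f x = c"
      proof -
        have A: "{x \<in> space M. f x \<noteq> c} \<in> sets M" using fM(1) by measurable
        have "{x \<in> space M. f x \<noteq> c} \<in> null_sets M" using c A by (subst AE_iff_null[symmetric]) auto
        moreover have "{x \<in> space N. f x \<noteq> c} \<in> null_sets N"
          using c' True A s sp by (subst AE_iff_null[symmetric]) auto
        ultimately have "{x \<in> space \<sigma>. f x \<noteq> c} \<in> null_sets \<sigma>" using A by (auto simp: null_sets_def em ss sp)
        then show ?thesis using A by (subst AE_iff_null) (auto simp: ss)
      qed
      have "emeasure M E = (\<integral>\<^sup>+x. f x * indicator E x \<partial>\<sigma>)"
        using f E ss by (subst emeasure_density[symmetric]) auto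
      also have "\<dots> = (\<integral>\<^sup>+x. c * indicator E x \<partial>\<sigma>)" using aec by (intro nn_integral_cong_AE) auto
      finally show ?thesis using E by (simp add: nn_integral_cmult_indicator ss em)
    qed
    show ?thesis
    proof (cases "c = 0")
      case True
      then have "emeasure M (space M) = 0" using Mc[of "space M"] by simp
      then show ?thesis by (intro disjI1 bexI[of _ "{}"]) auto
    next
      case False
      have "emeasure N E = 0" if "E \<in> sets M" "emeasure M E = 0" for E
        using Mc[OF that(1)] that(2) False by auto
      then have "absolutely_continuous M N" by (auto simp: absolutely_continuous_def null_sets_def s)
      then show ?thesis using ergodic_proportional[OF M s T T' inv pM pN eM] by blast
    qed
  qed
qed

section \<open>The measure of a Chacon like system\<close>

text \<open>The extra \<open>g\<close> is room for translations by at most \<open>g\<close>. This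
  room is not lost at higher levels, so deep points again form a tree of cells.\<close>

definition deep :: "int \<Rightarrow> nat \<Rightarrow> chacon_point \<Rightarrow> bool" where
  "deep g n p \<longleftrightarrow> has_level n p \<and> \<bar>pos n p\<bar> + g \<le> radius n"

lemma deep_Suc:
  assumes "p \<in> chacon_points \<omega>" "deep g n p"
  shows "deep g (Suc n) p"
proof -
  have l: "has_level n p" and b: "\<bar>pos n p\<bar> + g \<le> radius n" using assms(2) by (auto simp: deep_def)
  have "g \<le> height n" using b height_radius[of n] radius_nonneg[of n] by linarith
  then show ?thesis
    using add_digit_margin[OF pos_step(1,2)[OF assms(1) l], of \<omega>] pos_step(3)[OF assms(1) l]
      coords_Suc(1)[OF assms(1) l] by (simp add: deep_def)
qed

lemma deep_mono:
  assumes "p \<in> chacon_points \<omega>" "deep g n p" "n \<le> m"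
  shows "deep g m p"
  using assms(3) by (induction m rule: dec_induct) (auto intro: assms deep_Suc)

lemma exists_deep:
  assumes "p \<in> chacon_points \<omega>"
  shows "\<exists>n\<ge>m. deep g n p"
proof -
  obtain k where k: "has_level k p" using has_some_level[OF assms] by blast
  define n where "n = Suc (max m (max k (nat g)))"
  have n: "k < n" "m \<le> n" "g \<le> int n" by (auto simp: n_def)
  have "deep g n p"
    using pos_margin[OF assms k n(1)] has_level_mono[OF assms k, of n] n by (auto simp: deep_def)
  then show ?thesis using n(2) by blast
qed

lemma deep_same:
  assumes "p \<in> chacon_points \<omega>" "q \<in> chacon_points \<omega>" "deep g n p" "has_level (Suc n) q"
    "pos (Suc n) q = pos (Suc n) p"
  shows "deep g n q \<and> pos n q = pos n p"
  using same_cylinder(1,2)[OF assms(1,2) _ _ assms(4,5), of n] assms(3) by (auto simp: deep_def)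

interpretation chacon_cells: cell_tree "chacon_points \<omega>" "deep g" pos for \<omega> g
proof
  fix n z z'
  assume "z \<in> chacon_points \<omega>" "z' \<in> chacon_points \<omega>" "deep g n z" "deep g (Suc n) z'" "pos (Suc n) z' = pos (Suc n) z"
  then show "deep g n z' \<and> pos n z' = pos n z" using deep_same[of z \<omega> z' g n] by (simp add: deep_def)
next
  fix z assume "z \<in> chacon_points \<omega>"
  then show "\<exists>n. deep g n z" using exists_deep by blast
qed (rule countableI_type, rule deep_Suc)

lemma chacon_cell: "deep g n p \<Longrightarrow> chacon_cells.cell \<omega> g n p = cylinder \<omega> n (pos n p)"
  by (auto simp: chacon_cells.cell_def mem_cylinder deep_def)

lemma mem_cylinder_Suc:
  assumes "\<bar>f\<bar> \<le> radius n" "s \<in> symbols"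
  shows "p \<in> cylinder \<omega> (Suc n) (f + digit \<omega> n s) \<longleftrightarrow> p \<in> cylinder \<omega> n f \<and> symb n p = s"
  unfolding mem_cylinder using level_back[of p \<omega> n f s] pos_step(3)[of p \<omega> n] coords_Suc(1)[of p \<omega> n] assms
  by metis

lemma space_borel_of [simp]: "space (borel_of X) = topspace X"
  by (simp add: borel_of_def space_measure_of_conv)

lemma sets_borel_of: "sets (borel_of X) = sigma_sets (topspace X) {U. openin X U}"
  unfolding borel_of_def by (rule sets_measure_of) (auto dest: openin_subset)

lemma openin_borel_of: "openin X U \<Longrightarrow> U \<in> sets (borel_of X)"
  by (auto simp: sets_borel_of)

lemma continuous_map_measurable:
  assumes "continuous_map X Y f"
  shows "f \<in> measurable (borel_of X) (borel_of Y)"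
proof (rule measurable_sigma_sets[OF sets_borel_of])
  show "f \<in> space (borel_of X) \<rightarrow> topspace Y" using assms by (auto simp: continuous_map_def)
  fix y assume "y \<in> {U. openin Y U}"
  then have "openin X {x \<in> topspace X. f x \<in> y}" using assms by (auto simp: continuous_map_def)
  moreover have "f -` y \<inter> space (borel_of X) = {x \<in> topspace X. f x \<in> y}" by auto
  ultimately show "f -` y \<inter> space (borel_of X) \<in> sets (borel_of X)" by (simp add: openin_borel_of)
qed (auto dest: openin_subset)

abbreviation chacon_borel :: "(nat \<Rightarrow> bool) \<Rightarrow> chacon_point measure" where
  "chacon_borel \<omega> \<equiv> borel_of (chacon_space \<omega>)"

lemma space_chacon_borel [simp]: "space (chacon_borel \<omega>) = chacon_points \<omega>"
  by (simp add: topspace_chacon_space)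

text \<open>Each point is deep at arbitrarily high levels, so the deep cylinders are still a
  countable base, whatever the margin \<open>g\<close>.\<close>

lemma sets_chacon_borel: "sets (chacon_borel \<omega>) = sigma_sets (chacon_points \<omega>) (chacon_cells.cells \<omega> g)"
proof -
  have "U \<in> sigma_sets (chacon_points \<omega>) (chacon_cells.cells \<omega> g)" if U: "openin (chacon_space \<omega>) U" for U
  proof (rule chacon_cells.open_union_cells)
    show "U \<subseteq> chacon_points \<omega>" using U by (simp add: openin_chacon_cylinders)
    fix p assume p: "p \<in> U"
    then obtain n where n: "has_level n p" "cylinder \<omega> n (pos n p) \<subseteq> U"
      using U unfolding openin_chacon_cylinders by blast
    have pX: "p \<in> chacon_points \<omega>" using p U by (auto simp: openin_chacon_cylinders)
    then obtain m where m: "m \<ge> n" "deep g m p" using exists_deep by blast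
    have "chacon_cells.cell \<omega> g m p \<subseteq> cylinder \<omega> n (pos n p)"
      using same_cylinder(1,2)[OF pX _ n(1) m(1)]
      by (auto simp: chacon_cell[OF m(2)] mem_cylinder)
    then show "\<exists>n. deep g n p \<and> chacon_cells.cell \<omega> g n p \<subseteq> U" using n(2) m(2) by blast
  qed
  moreover have "openin (chacon_space \<omega>) C" if "C \<in> chacon_cells.cells \<omega> g" for C
    using that by (auto simp: chacon_cells.cells_def chacon_cell openin_cylinder)
  ultimately show ?thesis
    unfolding sets_borel_of topspace_chacon_space by (intro sigma_sets_eqI) auto
qed

lemma cylinder_sets [measurable]: "cylinder \<omega> n f \<in> sets (chacon_borel \<omega>)"
  by (rule openin_borel_of[OF openin_cylinder])

lemma cylinder_empty: "\<bar>f\<bar> > radius n \<Longrightarrow> cylinder \<omega> n f = {}"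
  using pos_step(1) by (fastforce simp: mem_cylinder)

section \<open>Existence and uniqueness of the measure with given values on cylinders\<close>

lemma measure_eq_cylinders:
  assumes "sets M = sets (chacon_borel \<omega>)" "sets N = sets (chacon_borel \<omega>)"
    and "\<And>n f. \<bar>f\<bar> + g \<le> radius n \<Longrightarrow> emeasure M (cylinder \<omega> n f) = emeasure N (cylinder \<omega> n f)"
    and "\<And>n f. \<bar>f\<bar> + g \<le> radius n \<Longrightarrow> emeasure M (cylinder \<omega> n f) \<noteq> \<infinity>"
  shows "M = N"
proof (rule chacon_cells.measure_eq_cells[of M \<omega> g N])
  fix z n assume "z \<in> chacon_points \<omega>" "deep g n z"
  then show "emeasure M (chacon_cells.cell \<omega> g n z) = emeasure N (chacon_cells.cell \<omega> g n z)"
    "emeasure M (chacon_cells.cell \<omega> g n z) \<noteq> \<infinity>"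
    using assms(3,4) by (auto simp: chacon_cell deep_def)
qed (use assms(1,2) sets_chacon_borel in auto)

text \<open>A point lies in exactly one of these cylinders, that of the first level containing it.
  They partition the space, and on each of them the measure can be built from independent
  symbols.\<close>

definition first_level :: "(nat \<Rightarrow> bool) \<Rightarrow> (nat \<times> int) set" where
  "first_level \<omega> = {(n, f). \<bar>f\<bar> \<le> radius n \<and>
     (\<forall>k g s. n = Suc k \<longrightarrow> \<bar>g\<bar> \<le> radius k \<longrightarrow> s \<in> symbols \<longrightarrow> f \<noteq> g + digit \<omega> k s)}"

text \<open>Following a cylinder downwards until its position no longer splits leads to one
  first-level cylinder; inside it, the original cylinder prescribes exactly the symbols passed on
  the way.\<close>

lemma cylinder_ancestor:
  assumes "\<bar>f'\<bar> \<le> radius N"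
  shows "\<exists>n\<le>N. \<exists>f \<sigma>. (n, f) \<in> first_level \<omega> \<and> (\<forall>i. \<sigma> i \<in> symbols) \<and>
    (\<forall>n' g s. (n', g) \<in> first_level \<omega> \<and> (\<forall>i. s i \<in> symbols) \<longrightarrow>
      (point_of \<omega> n' g s \<in> cylinder \<omega> N f' \<longleftrightarrow> n' = n \<and> g = f \<and> (\<forall>i\<in>{n..<N}. s i = \<sigma> i)))"
  using assms
proof (induction N arbitrary: f')
  \<comment> \<open>Serves the base case and all positions that do not split. A point present at a
    lower level has a splitting position, so two first-level cylinders meet only if they
    coincide.\<close>
  have own: "point_of \<omega> n' g s \<in> cylinder \<omega> N f' \<longleftrightarrow> n' = N \<and> g = f'"
    if f': "(N, f') \<in> first_level \<omega>" and g: "(n', g) \<in> first_level \<omega>" and s: "\<forall>i. s i \<in> symbols" for n' g s N f'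
  proof -
    have gr: "\<bar>g\<bar> \<le> radius n'" and fr: "\<bar>f'\<bar> \<le> radius N" using f' g by (auto simp: first_level_def)
    define p where "p = point_of \<omega> n' g s"
    have p: "p \<in> chacon_points \<omega>" "has_level n' p" "pos n' p = g" using point_of[OF gr] s by (auto simp: p_def)
    have no: "\<not> (k < n \<and> has_level k p \<and> pos n p = f)" if "(n, f) \<in> first_level \<omega>" for k n f
    proof
      assume k: "k < n \<and> has_level k p \<and> pos n p = f"
      then obtain j where j: "n = Suc j" by (cases n) auto
      have "has_level j p" using k j has_level_mono[OF p(1), of k j] by simp
      note ps = pos_step[OF p(1) this]
      have "f \<noteq> pos j p + digit \<omega> j (symb j p)" using that j ps(1,2) unfolding first_level_def by blast
      then show False using ps(3) k j by simp
    qed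
    show ?thesis
    proof
      assume "point_of \<omega> n' g s \<in> cylinder \<omega> N f'"
      then have q: "has_level N p" "pos N p = f'" by (auto simp: p_def mem_cylinder)
      have "n' = N" using no[OF f', of n'] no[OF g, of N] p(2,3) q by (meson linorder_neqE_nat)
      then show "n' = N \<and> g = f'" using p q by auto
    next
      assume "n' = N \<and> g = f'"
      then show "point_of \<omega> n' g s \<in> cylinder \<omega> N f'" using p by (auto simp: p_def mem_cylinder)
    qed
  qed
  {
    case 0
    then have *: "(0, f') \<in> first_level \<omega>" by (simp add: first_level_def)
    show ?case
      by (intro exI[of _ 0] conjI exI[of _ f'] exI[of _ "\<lambda>_. 0"]) (use * own[OF *] in \<open>auto simp: symbols_def\<close>)
  next
    case (Suc N)
    show ?case
    proof (cases "(Suc N, f') \<in> first_level \<omega>")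
      case True
      show ?thesis
        by (intro exI[of _ "Suc N"] conjI exI[of _ f'] exI[of _ "\<lambda>_. 0"]) (use True own[OF True] in \<open>auto simp: symbols_def\<close>)
    next
      case False
      then obtain g0 \<tau> where g0: "\<bar>g0\<bar> \<le> radius N" "\<tau> \<in> symbols" "f' = g0 + digit \<omega> N \<tau>"
        using Suc.prems by (auto simp: first_level_def)
      obtain n f \<sigma> where IH: "n \<le> N" "(n, f) \<in> first_level \<omega>" "\<forall>i. \<sigma> i \<in> symbols"
        "\<And>n' g s. (n', g) \<in> first_level \<omega> \<Longrightarrow> (\<forall>i. s i \<in> symbols) \<Longrightarrow>
          point_of \<omega> n' g s \<in> cylinder \<omega> N g0 \<longleftrightarrow> n' = n \<and> g = f \<and> (\<forall>i\<in>{n..<N}. s i = \<sigma> i)"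
        using Suc.IH[OF g0(1)] by blast
      have "point_of \<omega> n' g s \<in> cylinder \<omega> (Suc N) f' \<longleftrightarrow>
          n' = n \<and> g = f \<and> (\<forall>i\<in>{n..<Suc N}. s i = (\<sigma>(N := \<tau>)) i)"
        if g: "(n', g) \<in> first_level \<omega>" and s: "\<forall>i. s i \<in> symbols" for n' g s
      proof -
        have "\<bar>f\<bar> \<le> radius n" using IH(2) by (auto simp: first_level_def)
        then have "symb N (point_of \<omega> n f s) = s N" using point_of(4)[of f n s N \<omega>] s IH(1) by blast
        then show ?thesis
          unfolding g0(3) mem_cylinder_Suc[OF g0(1,2)] IH(4)[OF g s] using IH(1)
          by (auto simp: atLeastLessThanSuc)
      qed
      then show ?thesis
        using IH(1-3) g0(2) by (intro exI[of _ n] conjI exI[of _ f] exI[of _ "\<sigma>(N := \<tau>)"]) auto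
    qed
  }
qed

text \<open>The measure is the image of weights 3^-n on the first-level cylinders times independent
  uniform symbols. By \<open>cylinder_ancestor\<close> a cylinder of level N corresponds to one
  weight and N - n prescribed symbols, which multiply to 3^-N.\<close>

lemma chacon_measure_exists:
  "\<exists>M. sets M = sets (chacon_borel \<omega>) \<and> (\<forall>n f. \<bar>f\<bar> \<le> radius n \<longrightarrow> emeasure M (cylinder \<omega> n f) = ennreal ((1 / 3) ^ n))"
proof -
  define P where "P = PiM (UNIV :: nat set) (\<lambda>_. uniform_count_measure symbols)"
  have sy: "finite symbols" "card symbols = 3" by (auto simp: symbols_def)
  have ps: "prob_space (uniform_count_measure symbols)"
    using sy by (intro prob_space_uniform_count_measure) (auto simp: symbols_def)
  interpret product_prob_space "\<lambda>_. uniform_count_measure symbols" "UNIV :: nat set"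
    by (rule product_prob_spaceI) (rule ps)
  interpret PP: prob_space P unfolding P_def by (rule prob_space_PiM) (rule ps)
  have spP: "space P = {s. \<forall>i. s i \<in> symbols}"
    by (auto simp: P_def space_PiM space_uniform_count_measure PiE_UNIV_domain)
  define D where "D = point_measure (first_level \<omega>) (\<lambda>(n, f). ennreal ((1/3)^n))"
  have spD: "space D = first_level \<omega>" "sets D = Pow (first_level \<omega>)"
    by (auto simp: D_def space_point_measure sets_point_measure)
  have emD: "emeasure D {(n, f)} = ennreal ((1/3)^n)" if "(n, f) \<in> first_level \<omega>" for n f
  proof -
    have *: "{a \<in> {(n, f)}. 0 < (case a of (n, f) \<Rightarrow> ennreal ((1/3)^n))} = {(n, f)}" by auto
    then have "finite {a \<in> {(n, f)}. 0 < (case a of (n, f) \<Rightarrow> ennreal ((1/3)^n))}" by simp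
    then show ?thesis unfolding D_def using that * by (subst emeasure_point_measure) auto
  qed
  define h where "h = (\<lambda>((n, f), s). point_of \<omega> n f s)"
  have pre: "\<exists>n f \<sigma>. n \<le> N \<and> (n, f) \<in> first_level \<omega> \<and> (\<forall>i. \<sigma> i \<in> symbols) \<and> h -` cylinder \<omega> N f' \<inter> space (D \<Otimes>\<^sub>M P) =
      {(n, f)} \<times> prod_emb UNIV (\<lambda>_. uniform_count_measure symbols) {n..<N} (PiE {n..<N} (\<lambda>i. {\<sigma> i}))"
    if f': "\<bar>f'\<bar> \<le> radius N" for N f'
  proof -
    obtain n f \<sigma> where *: "n \<le> N" "(n, f) \<in> first_level \<omega>" "\<forall>i. \<sigma> i \<in> symbols"
      "\<And>n' g s. (n', g) \<in> first_level \<omega> \<Longrightarrow> (\<forall>i. s i \<in> symbols) \<Longrightarrow>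
          point_of \<omega> n' g s \<in> cylinder \<omega> N f' \<longleftrightarrow> n' = n \<and> g = f \<and> (\<forall>i\<in>{n..<N}. s i = \<sigma> i)"
      using cylinder_ancestor[OF f', of \<omega>] by blast
    have "h -` cylinder \<omega> N f' \<inter> space (D \<Otimes>\<^sub>M P) =
      {(n, f)} \<times> prod_emb UNIV (\<lambda>_. uniform_count_measure symbols) {n..<N} (PiE {n..<N} (\<lambda>i. {\<sigma> i}))"
    proof (rule set_eqI)
      fix x :: "(nat \<times> int) \<times> (nat \<Rightarrow> int)"
      obtain n' g s where x: "x = ((n', g), s)" by (metis prod.exhaust)
      have "s \<in> prod_emb UNIV (\<lambda>_. uniform_count_measure symbols) {n..<N} (PiE {n..<N} (\<lambda>i. {\<sigma> i})) \<longleftrightarrow>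
          (\<forall>i. s i \<in> symbols) \<and> (\<forall>i\<in>{n..<N}. s i = \<sigma> i)"
        by (auto simp: prod_emb_iff space_uniform_count_measure)
      then show "x \<in> h -` cylinder \<omega> N f' \<inter> space (D \<Otimes>\<^sub>M P) \<longleftrightarrow> x \<in> {(n, f)} \<times>
          prod_emb UNIV (\<lambda>_. uniform_count_measure symbols) {n..<N} (PiE {n..<N} (\<lambda>i. {\<sigma> i}))"
        using *(2,4) by (auto simp: x h_def space_pair_measure spD spP)
    qed
    then show ?thesis using * by blast
  qed
  have embP: "prod_emb UNIV (\<lambda>_. uniform_count_measure symbols) {n..<N} (PiE {n..<N} (\<lambda>i. {\<sigma> i})) \<in> sets P"
    if "\<forall>i. \<sigma> i \<in> symbols" for n N and \<sigma> :: "nat \<Rightarrow> int"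
    unfolding P_def using that by (intro sets_PiM_I) (auto simp: sets_uniform_count_measure)
  have h: "h \<in> measurable (D \<Otimes>\<^sub>M P) (chacon_borel \<omega>)"
  proof (rule measurable_sigma_sets[OF sets_chacon_borel[of \<omega> 0] chacon_cells.cells_sub])
    show "h \<in> space (D \<Otimes>\<^sub>M P) \<rightarrow> chacon_points \<omega>"
      using point_of(1) by (auto simp: h_def space_pair_measure spD spP first_level_def)
    fix y assume "y \<in> chacon_cells.cells \<omega> 0"
    then obtain N f' where y: "y = cylinder \<omega> N f'" "\<bar>f'\<bar> \<le> radius N"
      by (auto simp: chacon_cells.cells_def chacon_cell deep_def)
    from pre[OF y(2)] obtain n f \<sigma> where *: "(n, f) \<in> first_level \<omega>" "\<forall>i. \<sigma> i \<in> symbols" "h -` cylinder \<omega> N f' \<inter> space (D \<Otimes>\<^sub>M P) =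
      {(n, f)} \<times> prod_emb UNIV (\<lambda>_. uniform_count_measure symbols) {n..<N} (PiE {n..<N} (\<lambda>i. {\<sigma> i}))"
      by blast
    show "h -` y \<inter> space (D \<Otimes>\<^sub>M P) \<in> sets (D \<Otimes>\<^sub>M P)"
      unfolding y(1) *(3) by (intro pair_measureI embP[OF *(2)]) (use *(1) spD in auto)
  qed
  define M where "M = distr (D \<Otimes>\<^sub>M P) (chacon_borel \<omega>) h"
  have "emeasure M (cylinder \<omega> N f') = ennreal ((1/3)^N)" if f': "\<bar>f'\<bar> \<le> radius N" for N f'
  proof -
    obtain n f \<sigma> where *: "n \<le> N" "(n, f) \<in> first_level \<omega>" "\<forall>i. \<sigma> i \<in> symbols" "h -` cylinder \<omega> N f' \<inter> space (D \<Otimes>\<^sub>M P) =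
      {(n, f)} \<times> prod_emb UNIV (\<lambda>_. uniform_count_measure symbols) {n..<N} (PiE {n..<N} (\<lambda>i. {\<sigma> i}))"
      using pre[OF f'] by blast
    have one: "emeasure (uniform_count_measure symbols) {\<sigma> i} = ennreal (1/3)" for i
      using *(3) sy by (subst emeasure_uniform_count_measure) (auto simp: divide_ennreal[symmetric])
    have "emeasure P (prod_emb UNIV (\<lambda>_. uniform_count_measure symbols) {n..<N} (PiE {n..<N} (\<lambda>i. {\<sigma> i})))
        = (\<Prod>i\<in>{n..<N}. emeasure (uniform_count_measure symbols) {\<sigma> i})"
      unfolding P_def using *(3) by (intro emeasure_PiM_emb) (auto simp: sets_uniform_count_measure)
    also have "\<dots> = ennreal ((1/3)^(N-n))" unfolding one by (simp add: ennreal_power)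
    finally have 1: "emeasure P (prod_emb UNIV (\<lambda>_. uniform_count_measure symbols) {n..<N} (PiE {n..<N} (\<lambda>i. {\<sigma> i})))
        = ennreal ((1/3)^(N-n))" .
    have "emeasure M (cylinder \<omega> N f') = emeasure D {(n, f)} * ennreal ((1/3)^(N-n))"
      unfolding M_def emeasure_distr[OF h cylinder_sets] *(4)
      using *(2,3) embP spD(2) 1 by (subst PP.emeasure_pair_measure_Times) auto
    also have "\<dots> = ennreal ((1/3)^N)"
      using *(1) by (simp add: emD[OF *(2)] ennreal_mult[symmetric] power_add[symmetric])
    finally show ?thesis .
  qed
  then show ?thesis by (intro exI[of _ M]) (auto simp: M_def)
qed

lemma
  shows space_chacon_measure [simp]: "space (chacon_measure \<omega>) = chacon_points \<omega>"
    and sets_chacon_measure [simp, measurable_cong]: "sets (chacon_measure \<omega>) = sets (chacon_borel \<omega>)"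
    and emeasure_cylinder: "\<bar>f\<bar> \<le> radius n \<Longrightarrow> emeasure (chacon_measure \<omega>) (cylinder \<omega> n f) = ennreal ((1 / 3) ^ n)"
proof -
  let ?P = "\<lambda>M. space M = topspace (chacon_space \<omega>) \<and> sets M = sets (chacon_borel \<omega>) \<and>
     (\<forall>n. \<forall>f \<in> F_set n. emeasure M (cylinder \<omega> n f) = ennreal ((1 / 3) ^ n))"
  have "\<exists>!M. ?P M"
  proof (rule ex_ex1I)
    obtain M where M: "sets M = sets (chacon_borel \<omega>)"
      "\<forall>n f. \<bar>f\<bar> \<le> radius n \<longrightarrow> emeasure M (cylinder \<omega> n f) = ennreal ((1 / 3) ^ n)"
      using chacon_measure_exists by blast
    show "\<exists>M. ?P M"
      using M sets_eq_imp_space_eq[OF M(1)] by (intro exI[of _ M]) (auto simp: mem_F_set)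
    fix M N assume "?P M" "?P N"
    then show "M = N" by (intro measure_eq_cylinders[of M \<omega> N 0]) (auto simp: mem_F_set)
  qed
  from theI'[OF this] have *: "?P (chacon_measure \<omega>)" unfolding chacon_measure_def .
  show "space (chacon_measure \<omega>) = chacon_points \<omega>"
    "sets (chacon_measure \<omega>) = sets (chacon_borel \<omega>)" using * by (auto simp: topspace_chacon_space)
  show "emeasure (chacon_measure \<omega>) (cylinder \<omega> n f) = ennreal ((1 / 3) ^ n)" if "\<bar>f\<bar> \<le> radius n"
    using * that by (auto simp: mem_F_set)
qed

lemma emeasure_cylinder_finite: "emeasure (chacon_measure \<omega>) (cylinder \<omega> n f) < \<infinity>"
  using emeasure_cylinder[of f n \<omega>] cylinder_empty[of n f \<omega>] by (cases "\<bar>f\<bar> \<le> radius n") auto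

lemma sigma_finite_chacon: "sigma_finite_measure (chacon_measure \<omega>)"
proof (unfold_locales, intro exI[of _ "chacon_cells.cells \<omega> 0"] conjI ballI)
  show "chacon_cells.cells \<omega> 0 \<subseteq> sets (chacon_measure \<omega>)"
    using sets_chacon_borel[of \<omega> 0] by auto
  fix a assume "a \<in> chacon_cells.cells \<omega> 0"
  then obtain n f where "a = cylinder \<omega> n f" by (auto simp: chacon_cells.cells_def chacon_cell)
  then show "emeasure (chacon_measure \<omega>) a \<noteq> \<infinity>"
    using emeasure_cylinder_finite[of \<omega> n f] by simp
qed (auto simp: chacon_cells.countable_cells chacon_cells.Union_cells)

lemma cylinder_action:
  assumes "\<bar>f - g\<bar> \<le> radius n" "\<bar>f\<bar> \<le> radius n"
  shows "chacon_action \<omega> g -` cylinder \<omega> n f \<inter> chacon_points \<omega> = cylinder \<omega> n (f - g)"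
proof (intro set_eqI iffI)
  fix p assume "p \<in> chacon_action \<omega> g -` cylinder \<omega> n f \<inter> chacon_points \<omega>"
  then have p: "p \<in> chacon_points \<omega>" and q: "chacon_action \<omega> g p \<in> cylinder \<omega> n f" by auto
  then have q': "chacon_action \<omega> g p \<in> chacon_points \<omega>" "has_level n (chacon_action \<omega> g p)" "pos n (chacon_action \<omega> g p) = f"
    by (auto simp: mem_cylinder)
  have "\<bar>pos n (chacon_action \<omega> g p) + (- g)\<bar> \<le> radius n" using q'(3) assms by simp
  from chacon_action[OF q'(1,2) this] show "p \<in> cylinder \<omega> n (f - g)"
    using q'(3) p by (simp add: chacon_action_add chacon_action_0 mem_cylinder)
next
  fix p assume "p \<in> cylinder \<omega> n (f - g)"
  then have p: "p \<in> chacon_points \<omega>" "has_level n p" "pos n p = f - g" by (auto simp: mem_cylinder)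
  then show "p \<in> chacon_action \<omega> g -` cylinder \<omega> n f \<inter> chacon_points \<omega>"
    using chacon_action[OF p(1,2), of g] assms by (simp add: mem_cylinder)
qed

lemma chacon_action_continuous: "continuous_map (chacon_space \<omega>) (chacon_space \<omega>) (chacon_action \<omega> g)"
proof (unfold continuous_map_def, intro conjI allI impI)
  show "chacon_action \<omega> g \<in> topspace (chacon_space \<omega>) \<rightarrow> topspace (chacon_space \<omega>)"
    by (auto simp: topspace_chacon_space chacon_action_in)
  fix U assume U: "openin (chacon_space \<omega>) U"
  show "openin (chacon_space \<omega>) {x \<in> topspace (chacon_space \<omega>). chacon_action \<omega> g x \<in> U}"
    unfolding openin_chacon_cylinders topspace_chacon_space
  proof (intro conjI ballI)
    fix p assume "p \<in> {x \<in> chacon_points \<omega>. chacon_action \<omega> g x \<in> U}"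
    then have p: "p \<in> chacon_points \<omega>" "chacon_action \<omega> g p \<in> U" by auto
    then obtain n where n: "has_level n (chacon_action \<omega> g p)" "cylinder \<omega> n (pos n (chacon_action \<omega> g p)) \<subseteq> U"
      using U unfolding openin_chacon_cylinders by blast
    obtain m where m: "m \<ge> n" "has_level m p" "\<bar>pos m p + g\<bar> \<le> radius m"
      using exists_margin_level[OF p(1)] by blast
    note act = chacon_action[OF p(1) m(2,3)]
    have "cylinder \<omega> m (pos m p) \<subseteq> {x \<in> chacon_points \<omega>. chacon_action \<omega> g x \<in> U}"
    proof
      fix q assume "q \<in> cylinder \<omega> m (pos m p)"
      then have q: "q \<in> chacon_points \<omega>" "has_level m q" "pos m q = pos m p" by (auto simp: mem_cylinder)
      note actq = chacon_action[OF q(1,2), of g]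
      have "chacon_action \<omega> g q \<in> cylinder \<omega> n (pos n (chacon_action \<omega> g p))"
        using same_cylinder(1,2)[OF act(1) actq(1) n(1) m(1) actq(2)] q(3) actq m(3) act
        by (auto simp: mem_cylinder)
      then show "q \<in> {x \<in> chacon_points \<omega>. chacon_action \<omega> g x \<in> U}" using q(1) n(2) by auto
    qed
    then show "\<exists>n. has_level n p \<and> cylinder \<omega> n (pos n p) \<subseteq> {x \<in> chacon_points \<omega>. chacon_action \<omega> g x \<in> U}"
      using m(2) by blast
  qed auto
qed

lemma chacon_action_measurable [measurable]: "chacon_action \<omega> g \<in> measurable (chacon_borel \<omega>) (chacon_borel \<omega>)"
  by (rule continuous_map_measurable[OF chacon_action_continuous])

lemma chacon_action_measurable' [measurable]: "chacon_action \<omega> g \<in> measurable (chacon_measure \<omega>) (chacon_measure \<omega>)"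
  using chacon_action_measurable by (simp cong: measurable_cong_sets)

lemma distr_chacon_action: "distr (chacon_measure \<omega>) (chacon_measure \<omega>) (chacon_action \<omega> g) = chacon_measure \<omega>"
\<comment> \<open>With margin |g| the preimage of a cylinder is a cylinder of the same level, hence
  of the same measure.\<close>
proof (rule measure_eq_cylinders[of _ \<omega> _ "\<bar>g\<bar>"])
  fix n f assume f: "\<bar>f\<bar> + \<bar>g\<bar> \<le> radius n"
  then have "emeasure (distr (chacon_measure \<omega>) (chacon_measure \<omega>) (chacon_action \<omega> g)) (cylinder \<omega> n f)
      = emeasure (chacon_measure \<omega>) (cylinder \<omega> n (f - g))"
    by (subst emeasure_distr) (auto simp: cylinder_action)
  then show eq: "emeasure (distr (chacon_measure \<omega>) (chacon_measure \<omega>) (chacon_action \<omega> g)) (cylinder \<omega> n f)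
      = emeasure (chacon_measure \<omega>) (cylinder \<omega> n f)"
    using f by (simp add: emeasure_cylinder)
  then show "emeasure (distr (chacon_measure \<omega>) (chacon_measure \<omega>) (chacon_action \<omega> g)) (cylinder \<omega> n f) \<noteq> \<infinity>"
    using emeasure_cylinder_finite[of \<omega> n f] by simp
qed simp_all

section \<open>Products of Chacon like systems\<close>

declare topspace_chacon_space [simp]

definition restr :: "nat set \<Rightarrow> int \<Rightarrow> nat \<Rightarrow> int" where
  "restr J k = (\<lambda>i. if i \<in> J then k else 0)"

text \<open>The parameter may vary with the coordinate, so self-joinings (constant \<open>w\<close>)
  and joinings of two different systems are treated at once. The free index set allows blocks,
  single coordinates and sets of representatives as instances.\<close>

locale chacon_product =
  fixes w :: "nat \<Rightarrow> nat \<Rightarrow> bool" and I :: "nat set"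
  assumes finite_I: "finite I"
begin

definition points :: "(nat \<Rightarrow> chacon_point) set" where
  "points = (\<Pi>\<^sub>E i\<in>I. chacon_points (w i))"

definition borel_prod :: "(nat \<Rightarrow> chacon_point) measure" where
  "borel_prod = PiM I (\<lambda>i. chacon_borel (w i))"

definition pbox :: "nat \<Rightarrow> (nat \<Rightarrow> int) \<Rightarrow> (nat \<Rightarrow> chacon_point) set" where
  "pbox n f = (\<Pi>\<^sub>E i\<in>I. cylinder (w i) n (f i))"

definition act :: "(nat \<Rightarrow> int) \<Rightarrow> (nat \<Rightarrow> chacon_point) \<Rightarrow> nat \<Rightarrow> chacon_point" where
  "act v z = (\<lambda>i\<in>I. chacon_action (w i) (v i) (z i))"

definition pdeep :: "int \<Rightarrow> nat \<Rightarrow> (nat \<Rightarrow> chacon_point) \<Rightarrow> bool" where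
  "pdeep g n z \<longleftrightarrow> (\<forall>i\<in>I. deep g n (z i))"

definition pkey :: "nat \<Rightarrow> (nat \<Rightarrow> chacon_point) \<Rightarrow> nat \<Rightarrow> int" where
  "pkey n z = (\<lambda>i\<in>I. pos n (z i))"

lemma space_borel_prod [simp]: "space borel_prod = points"
  by (simp add: borel_prod_def points_def space_PiM)

lemma points_mem: "z \<in> points \<Longrightarrow> i \<in> I \<Longrightarrow> z i \<in> chacon_points (w i)"
  by (auto simp: points_def)

lemma mem_box: "z \<in> pbox n f \<longleftrightarrow> z \<in> points \<and> (\<forall>i\<in>I. has_level n (z i) \<and> pos n (z i) = f i)"
  by (auto simp: pbox_def points_def mem_cylinder PiE_iff)

lemma exists_pdeep:
  assumes "z \<in> points"
  shows "\<exists>n\<ge>m. pdeep g n z"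
proof -
  have "\<exists>n. n \<ge> m \<and> deep g n (z i)" if "i \<in> I" for i using exists_deep[OF points_mem[OF assms that]] by blast
  then obtain N where N: "\<And>i. i \<in> I \<Longrightarrow> N i \<ge> m \<and> deep g (N i) (z i)" by metis
  define n where "n = Max (insert m (N ` I))"
  have "m \<le> n" "\<And>i. i \<in> I \<Longrightarrow> N i \<le> n" using finite_I by (auto simp: n_def)
  then show ?thesis using N deep_mono[OF points_mem[OF assms]] unfolding pdeep_def by blast
qed

sublocale tree: cell_tree points "pdeep g" pkey for g
proof
  fix n
  have "pkey n ` {z \<in> points. pdeep g n z} \<subseteq> (\<Pi>\<^sub>E i\<in>I. UNIV)" by (auto simp: pkey_def)
  moreover have "countable (\<Pi>\<^sub>E i\<in>I. (UNIV :: int set))" by (intro countable_PiE finite_I) auto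
  ultimately show "countable (pkey n ` {z \<in> points. pdeep g n z})" using countable_subset by blast
next
  fix z assume "z \<in> points"
  then show "\<exists>n. pdeep g n z" using exists_pdeep by blast
next
  fix z n assume "z \<in> points" "pdeep g n z"
  then show "pdeep g (Suc n) z" using deep_Suc points_mem unfolding pdeep_def by blast
next
  fix z z' n
  assume *: "z \<in> points" "z' \<in> points" "pdeep g n z" "pdeep g (Suc n) z'" "pkey (Suc n) z' = pkey (Suc n) z"
  have "deep g n (z' i) \<and> pos n (z' i) = pos n (z i)" if i: "i \<in> I" for i
  proof (rule deep_same)
    show "pos (Suc n) (z' i) = pos (Suc n) (z i)" using fun_cong[OF *(5), of i] i by (simp add: pkey_def)
    show "has_level (Suc n) (z' i)" using *(4) i by (auto simp: pdeep_def deep_def)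
    show "deep g n (z i)" using *(3) i by (auto simp: pdeep_def)
  qed (use * points_mem i in auto)
  then show "pdeep g n z' \<and> pkey n z' = pkey n z" by (auto simp: pdeep_def pkey_def)
qed

lemma tree_cell: "pdeep g n z \<Longrightarrow> tree.cell g n z = pbox n (\<lambda>i. pos n (z i))"
  unfolding tree.cell_def mem_box set_eq_iff
  by (auto simp: pdeep_def deep_def pkey_def restrict_def fun_eq_iff)

lemma box_sets [measurable]: "pbox n f \<in> sets borel_prod"
  unfolding pbox_def borel_prod_def by (intro sets_PiM_I_finite finite_I cylinder_sets)

lemma box_mono:
  assumes "z \<in> points" "\<And>i. i \<in> I \<Longrightarrow> has_level (n i) (z i)" "\<And>i. i \<in> I \<Longrightarrow> n i \<le> m"
  shows "pbox m (\<lambda>i. pos m (z i)) \<subseteq> (\<Pi>\<^sub>E i\<in>I. cylinder (w i) (n i) (pos (n i) (z i)))"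
proof
  fix z' assume "z' \<in> pbox m (\<lambda>i. pos m (z i))"
  then have z': "z' \<in> points" "\<And>i. i \<in> I \<Longrightarrow> has_level m (z' i) \<and> pos m (z' i) = pos m (z i)"
    by (auto simp: mem_box)
  have "z' i \<in> cylinder (w i) (n i) (pos (n i) (z i))" if i: "i \<in> I" for i
    using same_cylinder(1,2)[OF points_mem[OF assms(1) i] points_mem[OF z'(1) i] assms(2)[OF i] assms(3)[OF i]]
      z'(2)[OF i] points_mem[OF z'(1) i] by (simp add: mem_cylinder)
  then show "z' \<in> (\<Pi>\<^sub>E i\<in>I. cylinder (w i) (n i) (pos (n i) (z i)))"
    using z'(1) by (auto simp: points_def PiE_iff)
qed

lemma open_boxes_sigma:
  assumes "U \<subseteq> points"
    "\<And>z. z \<in> U \<Longrightarrow> \<exists>n. (\<forall>i\<in>I. has_level (n i) (z i)) \<and> (\<Pi>\<^sub>E i\<in>I. cylinder (w i) (n i) (pos (n i) (z i))) \<subseteq> U"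
  shows "U \<in> sigma_sets points (tree.cells g)"
proof (rule tree.open_union_cells[OF assms(1)])
  fix z assume z: "z \<in> U"
  obtain n where n: "\<forall>i\<in>I. has_level (n i) (z i)" "(\<Pi>\<^sub>E i\<in>I. cylinder (w i) (n i) (pos (n i) (z i))) \<subseteq> U"
    using assms(2)[OF z] by blast
  have zp: "z \<in> points" using assms(1) z by blast
  obtain m where m: "m \<ge> Max (insert 0 (n ` I))" "pdeep g m z" using exists_pdeep[OF zp] by blast
  have nm: "n i \<le> m" if "i \<in> I" for i using m(1) that finite_I by auto
  have "tree.cell g m z \<subseteq> (\<Pi>\<^sub>E i\<in>I. cylinder (w i) (n i) (pos (n i) (z i)))"
    unfolding tree_cell[OF m(2)] by (rule box_mono[OF zp]) (use n(1) nm in auto)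
  then have "tree.cell g m z \<subseteq> U" using n(2) by (rule subset_trans)
  then show "\<exists>n. pdeep g n z \<and> tree.cell g n z \<subseteq> U" using m(2) by blast
qed

lemma cells_subset_sets: "tree.cells g \<subseteq> sets borel_prod"
  by (auto simp: tree.cells_def tree_cell)

lemma sets_borel_prod: "sets borel_prod = sigma_sets points (tree.cells g)"
proof
  show "sigma_sets points (tree.cells g) \<subseteq> sets borel_prod"
    using sets.sigma_sets_subset[OF cells_subset_sets] by simp
  define S where "S = sigma points (tree.cells g)"
  have S: "space S = points" "sets S = sigma_sets points (tree.cells g)"
    unfolding S_def using tree.cells_sub by (auto simp: space_measure_of_conv sets_measure_of)
  have "(\<lambda>z. z i) \<in> measurable S (chacon_borel (w i))" if i: "i \<in> I" for i
  proof (rule measurable_sigma_sets[OF sets_chacon_borel[of _ 0] chacon_cells.cells_sub])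
    show "(\<lambda>z. z i) \<in> space S \<rightarrow> chacon_points (w i)" using points_mem i by (auto simp: S)
    fix y assume "y \<in> chacon_cells.cells (w i) 0"
    then obtain n f where y: "y = cylinder (w i) n f" by (auto simp: chacon_cells.cells_def chacon_cell)
    show "(\<lambda>z. z i) -` y \<inter> space S \<in> sets S"
      unfolding S
    proof (rule open_boxes_sigma)
      fix z assume "z \<in> (\<lambda>z. z i) -` y \<inter> points"
      then have z: "z \<in> points" "has_level n (z i)" "pos n (z i) = f" by (auto simp: y mem_cylinder)
      obtain m where "pdeep 0 m z" using exists_pdeep[OF z(1)] by blast
      then have m: "\<forall>j\<in>I. has_level m (z j)" by (auto simp: pdeep_def deep_def)
      have "(\<Pi>\<^sub>E j\<in>I. cylinder (w j) ((if j = i then n else m)) (pos (if j = i then n else m) (z j))) \<subseteq> (\<lambda>z. z i) -` y \<inter> points"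
      proof
        fix x assume x: "x \<in> (\<Pi>\<^sub>E j\<in>I. cylinder (w j) (if j = i then n else m) (pos (if j = i then n else m) (z j)))"
        then have "x i \<in> y" using i z(3) by (auto simp: y PiE_iff split: if_splits)
        moreover have "x \<in> points" using x by (auto simp: points_def PiE_iff mem_cylinder)
        ultimately show "x \<in> (\<lambda>z. z i) -` y \<inter> points" by simp
      qed
      then show "\<exists>n. (\<forall>i\<in>I. has_level (n i) (z i)) \<and> (\<Pi>\<^sub>E i\<in>I. cylinder (w i) (n i) (pos (n i) (z i))) \<subseteq> (\<lambda>z. z i) -` y \<inter> points"
        using z(2) m by (intro exI[of _ "\<lambda>j. if j = i then n else m"]) auto
    qed auto
  qed
  then have "(\<lambda>z i. (if i \<in> I then z i else undefined)) \<in> measurable S borel_prod"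
    unfolding borel_prod_def
    by (intro measurable_PiM_single') (auto simp: S points_def PiE_iff)
  moreover have "(\<lambda>i. if i \<in> I then z i else undefined) = z" if "z \<in> space S" for z
    using that by (auto simp: S points_def PiE_iff extensional_def fun_eq_iff)
  ultimately have "(\<lambda>z. z) \<in> measurable S borel_prod" by (simp cong: measurable_cong)
  then have "A \<in> sets S" if "A \<in> sets borel_prod" for A
    using measurable_sets[of "\<lambda>z. z" S borel_prod A] that sets.sets_into_space[OF that]
    by (simp add: S Int_absorb2)
  then show "sets borel_prod \<subseteq> sigma_sets points (tree.cells g)" by (auto simp: S)
qed

text \<open>Boxes are a countable base of the product topology, so every open set belongs to the
  product sigma-algebra.\<close>

lemma sets_borel_of_product: "sets (borel_of (product_topology (\<lambda>i. chacon_space (w i)) I)) = sets borel_prod"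
proof -
  have top: "topspace (product_topology (\<lambda>i. chacon_space (w i)) I) = points"
    by (simp add: points_def topspace_chacon_space)
  have "U \<in> sigma_sets points (tree.cells 0)" if U: "openin (product_topology (\<lambda>i. chacon_space (w i)) I) U" for U
  proof (rule open_boxes_sigma)
    show "U \<subseteq> points" using openin_subset[OF U] top by simp
    fix z assume z: "z \<in> U"
    from bspec[OF U[unfolded openin_product_topology_alt] z]
    obtain V where V: "\<forall>i\<in>I. openin (chacon_space (w i)) (V i)" "z \<in> PiE I V" "PiE I V \<subseteq> U"
      by (elim exE conjE)
    have "\<forall>i\<in>I. \<exists>n. has_level n (z i) \<and> cylinder (w i) n (pos n (z i)) \<subseteq> V i"
    proof
      fix i assume i: "i \<in> I"
      have "z i \<in> V i" using V(2) i by auto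
      then show "\<exists>n. has_level n (z i) \<and> cylinder (w i) n (pos n (z i)) \<subseteq> V i"
        using V(1) i unfolding openin_chacon_cylinders by blast
    qed
    from bchoice[OF this] obtain n where n: "\<forall>i\<in>I. has_level (n i) (z i) \<and> cylinder (w i) (n i) (pos (n i) (z i)) \<subseteq> V i" ..
    have "(\<Pi>\<^sub>E i\<in>I. cylinder (w i) (n i) (pos (n i) (z i))) \<subseteq> PiE I V"
      by (rule PiE_mono) (use n in blast)
    then have sub: "(\<Pi>\<^sub>E i\<in>I. cylinder (w i) (n i) (pos (n i) (z i))) \<subseteq> U" using V(3) by (rule subset_trans)
    show "\<exists>n. (\<forall>i\<in>I. has_level (n i) (z i)) \<and> (\<Pi>\<^sub>E i\<in>I. cylinder (w i) (n i) (pos (n i) (z i))) \<subseteq> U"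
      by (intro exI conjI, rule ballI) (use n sub in blast)+
  qed
  moreover have "openin (product_topology (\<lambda>i. chacon_space (w i)) I) C" if "C \<in> tree.cells 0" for C
    using that finite_I by (auto simp: tree.cells_def tree_cell pbox_def openin_PiE openin_cylinder)
  ultimately show ?thesis
    unfolding sets_borel_of top sets_borel_prod[of 0] by (intro sigma_sets_eqI) auto
qed

lemma compactin_box: "compactin (product_topology (\<lambda>i. chacon_space (w i)) I) (pbox n f)"
  unfolding pbox_def by (simp add: compactin_PiE compactin_cylinder)

section \<open>Translations of a product\<close>

lemma act_points: "z \<in> points \<Longrightarrow> act v z \<in> points"
  by (auto simp: act_def points_def PiE_iff chacon_action_in)

lemma act_act: "z \<in> points \<Longrightarrow> act u (act v z) = act (\<lambda>i. u i + v i) z"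
  by (auto simp: act_def fun_eq_iff chacon_action_add points_mem)

lemma act_cong: "(\<And>i. i \<in> I \<Longrightarrow> u i = v i) \<Longrightarrow> act u = act v"
  by (auto simp: act_def fun_eq_iff)

lemma act_zero:
  assumes "z \<in> points" "\<And>i. i \<in> I \<Longrightarrow> v i = 0"
  shows "act v z = z"
proof
  fix i show "act v z i = z i"
    using assms points_mem by (cases "i \<in> I") (auto simp: act_def chacon_action_0 points_def PiE_iff extensional_def)
qed

lemma act_measurable [measurable]: "act v \<in> measurable borel_prod borel_prod"
  unfolding act_def borel_prod_def by measurable

lemma act_vimage: "E \<in> sets borel_prod \<Longrightarrow> act v -` E \<inter> points \<in> sets borel_prod"
  using measurable_sets[OF act_measurable] by simp

lemma act_vimage_comp: "act u -` (act v -` E \<inter> points) \<inter> points = act (\<lambda>i. u i + v i) -` E \<inter> points"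
  using act_points act_act by (auto simp: add.commute)

lemma box_act:
  assumes "\<And>i. i \<in> I \<Longrightarrow> \<bar>f i\<bar> \<le> radius n" "\<And>i. i \<in> I \<Longrightarrow> \<bar>f i - v i\<bar> \<le> radius n"
  shows "act v -` pbox n f \<inter> points = pbox n (\<lambda>i. f i - v i)"
proof -
  have "z \<in> points \<Longrightarrow> i \<in> I \<Longrightarrow> chacon_action (w i) (v i) (z i) \<in> cylinder (w i) n (f i) \<longleftrightarrow> z i \<in> cylinder (w i) n (f i - v i)" for z i
    using cylinder_action[OF assms(2,1), of i "w i"] points_mem[of z i] by (auto simp: set_eq_iff mem_cylinder)
  then show ?thesis
    by (auto simp: pbox_def act_def PiE_iff points_def mem_cylinder)
qed

lemma mem_box_Suc:
  assumes "\<And>i. i \<in> I \<Longrightarrow> \<bar>f i\<bar> \<le> radius n" "\<And>i. i \<in> I \<Longrightarrow> s i \<in> symbols"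
  shows "z \<in> pbox (Suc n) (\<lambda>i. f i + digit (w i) n (s i)) \<longleftrightarrow> z \<in> pbox n f \<and> (\<forall>i\<in>I. symb n (z i) = s i)"
  using mem_cylinder_Suc[OF assms] by (auto simp: pbox_def PiE_iff)

lemma emeasure_box_Suc:
  assumes L: "sets L = sets borel_prod" and f: "\<And>i. i \<in> I \<Longrightarrow> \<bar>f i\<bar> \<le> radius n"
  shows "emeasure L (pbox n f) = (\<Sum>s\<in>PiE I (\<lambda>_. symbols). emeasure L (pbox (Suc n) (\<lambda>i. f i + digit (w i) n (s i))))"
proof -
  let ?F = "\<lambda>s. pbox (Suc n) (\<lambda>i. f i + digit (w i) n (s i))"
  let ?S = "PiE I (\<lambda>_. symbols)"
  have mem: "z \<in> ?F s \<longleftrightarrow> z \<in> pbox n f \<and> (\<forall>i\<in>I. symb n (z i) = s i)" if "s \<in> ?S" for s z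
    using mem_box_Suc[of f n s z] f that by auto
  have "pbox n f = (\<Union>s\<in>?S. ?F s)"
  proof (intro set_eqI iffI)
    fix z assume z: "z \<in> pbox n f"
    have "(\<lambda>i\<in>I. symb n (z i)) \<in> ?S"
      using z pos_step(2) by (auto simp: mem_box dest: points_mem)
    moreover from this have "z \<in> ?F (\<lambda>i\<in>I. symb n (z i))" using z by (subst mem) auto
    ultimately show "z \<in> (\<Union>s\<in>?S. ?F s)" by blast
  qed (use mem in blast)
  moreover have "disjoint_family_on ?F ?S"
    unfolding disjoint_family_on_def
  proof (intro ballI impI)
    fix s t assume st: "s \<in> ?S" "t \<in> ?S" "s \<noteq> t"
    have "s = t" if "z \<in> ?F s" "z \<in> ?F t" for z
      using that st mem[of s z] mem[of t z] by (intro PiE_ext[of s I _ t]) auto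
    then show "?F s \<inter> ?F t = {}" using st(3) by blast
  qed
  moreover have "finite ?S" using finite_I by (intro finite_PiE) (auto simp: symbols_def)
  moreover have "?F ` ?S \<subseteq> sets L" using L by auto
  ultimately show ?thesis
    using sum_emeasure[of ?F ?S L] by simp
qed

text \<open>The Radon property in terms of compact open boxes, the form used in all arguments;
  translates and restrictions to measurable sets inherit it.\<close>

definition locally_finite :: "(nat \<Rightarrow> chacon_point) measure \<Rightarrow> bool" where
  "locally_finite L \<longleftrightarrow> sets L = sets borel_prod \<and> (\<forall>n f. emeasure L (pbox n f) < \<infinity>)"

lemma locally_finite_sets: "locally_finite L \<Longrightarrow> sets L = sets borel_prod"
  by (simp add: locally_finite_def)

lemma locally_finite_space: "locally_finite L \<Longrightarrow> space L = points"
  using sets_eq_imp_space_eq[of L borel_prod] by (simp add: locally_finite_def)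

lemma sigma_finite_locally_finite:
  assumes L: "locally_finite L"
  shows "sigma_finite_measure L"
proof (unfold_locales, intro exI[of _ "tree.cells 0"] conjI ballI)
  show "tree.cells 0 \<subseteq> sets L" using L cells_subset_sets by (auto simp: locally_finite_def)
  show "\<Union> (tree.cells 0) = space L" using locally_finite_space[OF L] tree.Union_cells by simp
  fix a assume "a \<in> tree.cells 0"
  then obtain n f where "a = pbox n f" by (auto simp: tree.cells_def tree_cell)
  then show "emeasure L a \<noteq> \<infinity>" using L by (auto simp: locally_finite_def less_top)
qed (rule tree.countable_cells)

lemma measure_eq_boxes:
  assumes L: "locally_finite L" and N: "sets N = sets borel_prod"
    and eq: "\<And>n f. (\<And>i. i \<in> I \<Longrightarrow> \<bar>f i\<bar> + g \<le> radius n) \<Longrightarrow> emeasure L (pbox n f) = emeasure N (pbox n f)"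
  shows "L = N"
proof (rule tree.measure_eq_cells[of L g N])
  fix z n assume "z \<in> points" "pdeep g n z"
  then show "emeasure L (tree.cell g n z) = emeasure N (tree.cell g n z)"
    using eq[of "\<lambda>i. pos n (z i)" n] by (auto simp: tree_cell pdeep_def deep_def)
  have "emeasure L (pbox n (\<lambda>i. pos n (z i))) < \<infinity>" using L by (simp add: locally_finite_def)
  then show "emeasure L (tree.cell g n z) \<noteq> \<infinity>"
    using \<open>pdeep g n z\<close> by (simp add: tree_cell)
qed (use L N sets_borel_prod[of g] in \<open>auto simp: locally_finite_def\<close>)

lemma measure_le_boxes:
  assumes L: "locally_finite L" and N: "locally_finite N"
    and le: "\<And>n f. (\<And>i. i \<in> I \<Longrightarrow> \<bar>f i\<bar> + g \<le> radius n) \<Longrightarrow> emeasure L (pbox n f) \<le> emeasure N (pbox n f)"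
    and E: "E \<in> sets borel_prod"
  shows "emeasure L E \<le> emeasure N E"
proof (rule tree.measure_le_cells[of L g N])
  fix z n assume z: "z \<in> points" "pdeep g n z"
  show "emeasure L (tree.cell g n z) \<le> emeasure N (tree.cell g n z)"
    using le[of "\<lambda>i. pos n (z i)" n] z by (auto simp: tree_cell pdeep_def deep_def)
  show "emeasure L (tree.cell g n z) < \<infinity>" "emeasure N (tree.cell g n z) < \<infinity>"
    using L N z by (auto simp: tree_cell locally_finite_def)
qed (use L N E sets_borel_prod[of g] in \<open>auto simp: locally_finite_def\<close>)

text \<open>The image of \<open>L\<close> under \<open>act v\<close> is \<open>c\<close> times
  \<open>L\<close>. Vectors add while factors multiply, and a factor other than 0 and infinity can
  be inverted; splitting a joining means finding new pairs \<open>v\<close>,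
  \<open>c\<close>.\<close>

definition scales :: "(nat \<Rightarrow> chacon_point) measure \<Rightarrow> (nat \<Rightarrow> int) \<Rightarrow> ennreal \<Rightarrow> bool" where
  "scales L v c \<longleftrightarrow> (\<forall>E\<in>sets borel_prod. emeasure L (act v -` E \<inter> points) = c * emeasure L E)"

lemma scalesD: "scales L v c \<Longrightarrow> E \<in> sets borel_prod \<Longrightarrow> emeasure L (act v -` E \<inter> points) = c * emeasure L E"
  by (simp add: scales_def)

lemma scales_cong: "(\<And>i. i \<in> I \<Longrightarrow> u i = v i) \<Longrightarrow> scales L u c \<longleftrightarrow> scales L v c"
  using act_cong[of u v] by (simp add: scales_def)

lemma scales_zero: "(\<And>i. i \<in> I \<Longrightarrow> v i = 0) \<Longrightarrow> scales L v 1"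
  unfolding scales_def
proof
  fix E assume "\<And>i. i \<in> I \<Longrightarrow> v i = 0" "E \<in> sets borel_prod"
  then have "act v -` E \<inter> points = E" using sets.sets_into_space[of E borel_prod] act_zero by auto
  then show "emeasure L (act v -` E \<inter> points) = 1 * emeasure L E" by simp
qed

lemma scales_add:
  assumes "scales L u a" "scales L v b"
  shows "scales L (\<lambda>i. u i + v i) (a * b)"
  unfolding scales_def
proof
  fix E assume E: "E \<in> sets borel_prod"
  have "emeasure L (act (\<lambda>i. u i + v i) -` E \<inter> points) = emeasure L (act u -` (act v -` E \<inter> points) \<inter> points)"
    unfolding act_vimage_comp ..
  also have "\<dots> = a * (b * emeasure L E)"
    using scalesD[OF assms(1) act_vimage[OF E]] scalesD[OF assms(2) E] by simp
  finally show "emeasure L (act (\<lambda>i. u i + v i) -` E \<inter> points) = a * b * emeasure L E"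
    by (simp add: mult.assoc)
qed

lemma scales_uminus:
  assumes "scales L v c" "c \<noteq> 0" "c \<noteq> \<infinity>"
  shows "scales L (\<lambda>i. - v i) (inverse c)"
  unfolding scales_def
proof
  fix E assume E: "E \<in> sets borel_prod"
  have "act v -` (act (\<lambda>i. - v i) -` E \<inter> points) \<inter> points = E"
    unfolding act_vimage_comp using act_zero[of _ "\<lambda>i. v i + - v i"] sets.sets_into_space[OF E] by auto
  then have "emeasure L E = c * emeasure L (act (\<lambda>i. - v i) -` E \<inter> points)"
    using scalesD[OF assms(1) act_vimage[OF E]] by metis
  then have "inverse c * emeasure L E = (inverse c * c) * emeasure L (act (\<lambda>i. - v i) -` E \<inter> points)"
    by (simp add: mult.assoc)
  also have "inverse c * c = 1" using assms(2,3) using ennreal_divide_self[of c] by (simp add: divide_ennreal_def less_top mult.commute)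
  finally show "emeasure L (act (\<lambda>i. - v i) -` E \<inter> points) = inverse c * emeasure L E" by simp
qed

lemma scales_power: "scales L v c \<Longrightarrow> scales L (\<lambda>i. int n * v i) (c ^ n)"
proof (induction n)
  case (Suc n)
  then show ?case using scales_add[OF Suc(2) Suc(1)] by (simp add: algebra_simps)
qed (simp add: scales_zero)

lemma invariant_multiple:
  assumes "scales L (restr J 1) 1"
  shows "scales L (restr J k) 1"
proof (cases "k \<ge> 0")
  case True
  then show ?thesis using scales_power[OF assms, of "nat k"] scales_cong[of "\<lambda>i. int (nat k) * restr J 1 i" "restr J k"]
    by (simp add: restr_def)
next
  case False
  have "scales L (\<lambda>i. - restr J 1 i) 1" using scales_uminus[OF assms] by simp
  from scales_power[OF this, of "nat (- k)"] show ?thesis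
    using False scales_cong[of "\<lambda>i. int (nat (- k)) * - restr J 1 i" "restr J k"] by (simp add: restr_def)
qed

lemma invariant_all:
  assumes "\<And>i. i \<in> I \<Longrightarrow> scales L (restr {i} 1) 1"
  shows "scales L v 1"
proof -
  have "scales L (\<lambda>i. if i \<in> J then v i else 0) 1" if "finite J" "J \<subseteq> I" for J
    using that
  proof (induction J rule: finite_induct)
    case (insert j J)
    have "scales L (restr {j} (v j)) 1" using insert.prems by (intro invariant_multiple[OF assms]) blast
    moreover have "scales L (\<lambda>i. if i \<in> J then v i else 0) 1" using insert.prems by (intro insert.IH) blast
    ultimately have "scales L (\<lambda>i. restr {j} (v j) i + (if i \<in> J then v i else 0)) (1 * 1)"
      by (rule scales_add)
    moreover have "(\<lambda>i. restr {j} (v j) i + (if i \<in> J then v i else 0)) = (\<lambda>i. if i \<in> insert j J then v i else 0)"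
      using insert(2) by (auto simp: restr_def)
    ultimately show ?case by simp
  qed (rule scales_zero, simp)
  from this[OF finite_I subset_refl] show ?thesis
    by (rule iffD1[OF scales_cong, rotated]) simp
qed

section \<open>The product measure\<close>

definition chacon_prod :: "(nat \<Rightarrow> chacon_point) measure" where
  "chacon_prod = PiM I (\<lambda>i. chacon_measure (w i))"

lemma sets_chacon_prod [simp]: "sets chacon_prod = sets borel_prod"
  unfolding chacon_prod_def borel_prod_def by (intro sets_PiM_cong) auto

lemma space_chacon_prod [simp]: "space chacon_prod = points"
  using sets_eq_imp_space_eq[OF sets_chacon_prod] by simp

lemma emeasure_chacon_prod:
  assumes "\<And>i. i \<in> I \<Longrightarrow> A i \<in> sets (chacon_borel (w i))"
  shows "emeasure chacon_prod (PiE I A) = (\<Prod>i\<in>I. emeasure (chacon_measure (w i)) (A i))"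
proof -
  interpret product_sigma_finite "\<lambda>i. chacon_measure (w i)"
    by (simp add: product_sigma_finite_def sigma_finite_chacon)
  show ?thesis unfolding chacon_prod_def using assms by (intro emeasure_PiM finite_I) auto
qed

lemma emeasure_chacon_prod_box:
  assumes "\<And>i. i \<in> I \<Longrightarrow> \<bar>f i\<bar> \<le> radius n"
  shows "emeasure chacon_prod (pbox n f) = ennreal ((1/3) ^ (n * card I))"
proof -
  have "emeasure chacon_prod (pbox n f) = (\<Prod>i\<in>I. ennreal ((1/3)^n))"
    unfolding pbox_def using assms by (subst emeasure_chacon_prod) (auto intro!: prod.cong simp: emeasure_cylinder)
  then show ?thesis by (simp add: ennreal_power power_mult)
qed

lemma locally_finite_chacon_prod: "locally_finite chacon_prod"
proof -
  have "emeasure chacon_prod (pbox n f) < \<infinity>" for n f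
    unfolding pbox_def using emeasure_cylinder_finite
    by (subst emeasure_chacon_prod) (auto simp: less_top[symmetric] ennreal_prod_eq_top less_le)
  then show ?thesis by (simp add: locally_finite_def)
qed

text \<open>Invariance in each coordinate gives all boxes of one level the same measure, and a box
  splits into 3^|I| boxes of the next level. So the only box of level 0 fixes all values.\<close>

theorem invariant_unique:
  assumes L: "locally_finite L" and inv: "\<And>i. i \<in> I \<Longrightarrow> scales L (restr {i} 1) 1"
  shows "L = scale_measure (emeasure L (pbox 0 (\<lambda>_. 0))) chacon_prod"
proof (rule measure_eq_boxes[OF L, where g = 0])
  have Ls: "sets L = sets borel_prod" using L by (rule locally_finite_sets)
  have shiftf: "emeasure L (pbox n f) = emeasure L (pbox n (\<lambda>_. 0))" if "\<And>i. i \<in> I \<Longrightarrow> \<bar>f i\<bar> \<le> radius n" for n f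
  proof -
    have "act f -` pbox n f \<inter> points = pbox n (\<lambda>_. 0)"
      using box_act[of f n f] that radius_nonneg by simp
    then show ?thesis using scalesD[OF invariant_all[OF inv] box_sets, of f n f] by simp
  qed
  have card: "card (PiE I (\<lambda>_. symbols)) = 3 ^ card I"
    using finite_I by (simp add: card_PiE symbols_def numeral_3_eq_3)
  have step: "emeasure L (pbox n (\<lambda>_. 0)) = 3 ^ card I * emeasure L (pbox (Suc n) (\<lambda>_. 0))" for n
  proof -
    have "emeasure L (pbox n (\<lambda>_. 0)) = (\<Sum>s\<in>PiE I (\<lambda>_. symbols). emeasure L (pbox (Suc n) (\<lambda>_. 0)))"
    proof (subst emeasure_box_Suc[OF Ls])
      fix i show "\<bar>0 :: int\<bar> \<le> radius n" by (simp add: radius_nonneg)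
    next
      have "emeasure L (pbox (Suc n) (\<lambda>i. 0 + digit (w i) n (s i))) = emeasure L (pbox (Suc n) (\<lambda>_. 0))"
        if "s \<in> PiE I (\<lambda>_. symbols)" for s
        using that add_digit_bound[of 0 n] radius_nonneg[of n] by (intro shiftf) (auto simp: PiE_iff)
      then show "(\<Sum>s\<in>PiE I (\<lambda>_. symbols). emeasure L (pbox (Suc n) (\<lambda>i. 0 + digit (w i) n (s i)))) =
          (\<Sum>s\<in>PiE I (\<lambda>_. symbols). emeasure L (pbox (Suc n) (\<lambda>_. 0)))"
        by (rule sum.cong[OF refl])
    qed
    then show ?thesis by (simp add: card)
  qed
  have "emeasure L (pbox 0 (\<lambda>_. 0)) * ennreal ((1/3) ^ (n * card I)) = emeasure L (pbox n (\<lambda>_. 0))" for n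
  proof (induction n)
    case (Suc n)
    have "ennreal ((1/3) ^ (Suc n * card I)) = ennreal ((1/3) ^ (n * card I)) * ennreal ((1/3) ^ card I)"
      by (simp add: ennreal_mult[symmetric] power_add[symmetric] add.commute)
    then have "emeasure L (pbox 0 (\<lambda>_. 0)) * ennreal ((1/3) ^ (Suc n * card I))
        = emeasure L (pbox n (\<lambda>_. 0)) * ennreal ((1/3) ^ card I)"
      using Suc by (simp add: mult.assoc[symmetric])
    also have "\<dots> = emeasure L (pbox (Suc n) (\<lambda>_. 0)) * (ennreal (3 ^ card I) * ennreal ((1/3) ^ card I))"
      unfolding step[of n] by (simp add: ac_simps ennreal_power[symmetric])
    also have "ennreal (3 ^ card I) * ennreal ((1/3) ^ card I) = 1"
      by (simp add: ennreal_mult[symmetric] power_mult_distrib[symmetric])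
    finally show ?case by simp
  qed simp
  then show "emeasure L (pbox n f) = emeasure (scale_measure (emeasure L (pbox 0 (\<lambda>_. 0))) chacon_prod) (pbox n f)"
    if "\<And>i. i \<in> I \<Longrightarrow> \<bar>f i\<bar> + 0 \<le> radius n" for n f
    using that by (simp add: emeasure_chacon_prod_box shiftf)
qed simp

end

section \<open>Domination by translates\<close>

lemma has_level_measurable: "{p \<in> chacon_points \<omega>. has_level n p} \<in> sets (chacon_borel \<omega>)"
proof -
  have "{p \<in> chacon_points \<omega>. has_level n p} = (\<Union>f. cylinder \<omega> n f)" by (auto simp: mem_cylinder)
  then show ?thesis by auto
qed

lemma pred_has_level [measurable]: "Measurable.pred (chacon_borel \<omega>) (has_level n)"
  using has_level_measurable by (simp add: pred_def)

text \<open>Off level \<open>n\<close> the position is the junk value of \<open>THE\<close> on an empty predicate, hence constant.\<close>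

lemma pos_measurable [measurable]: "pos n \<in> measurable (chacon_borel \<omega>) (count_space UNIV)"
proof (rule measurable_count_space_eq2_countable[THEN iffD2], intro conjI ballI)
  fix k :: int
  define c where "c = (THE x :: nat \<Rightarrow> int. False) 0"
  have off: "pos n p = c" if "\<not> has_level n p" for p
    using that by (simp add: pos_def coords_def has_level_def c_def)
  have "pos n -` {k} \<inter> space (chacon_borel \<omega>) =
      cylinder \<omega> n k \<union> (if c = k then chacon_points \<omega> - {p \<in> chacon_points \<omega>. has_level n p} else {})"
  proof (rule set_eqI)
    fix p
    show "p \<in> pos n -` {k} \<inter> space (chacon_borel \<omega>) \<longleftrightarrow>
        p \<in> cylinder \<omega> n k \<union> (if c = k then chacon_points \<omega> - {p \<in> chacon_points \<omega>. has_level n p} else {})"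
      using off[of p] by (cases "has_level n p") (simp_all add: mem_cylinder conj_commute)
  qed
  moreover have "chacon_points \<omega> - {p \<in> chacon_points \<omega>. has_level n p} \<in> sets (chacon_borel \<omega>)"
    using sets.compl_sets[OF has_level_measurable] by simp
  ultimately show "pos n -` {k} \<inter> space (chacon_borel \<omega>) \<in> sets (chacon_borel \<omega>)" by auto
qed auto

lemma symb_measurable [measurable]: "symb n \<in> measurable (chacon_borel \<omega>) (count_space UNIV)"
  unfolding symb_def by measurable

text \<open>Adding the difference of two digits of level n changes the position at level n + 1 only
  in that digit, so \<open>level_back\<close> recovers everything below level n unchanged.\<close>

lemma action_change_symbol:
  assumes p: "p \<in> chacon_points \<omega>" and l: "has_level m p" "m \<le> n" and s: "s \<in> symbols"
  defines "q \<equiv> chacon_action \<omega> (digit \<omega> n s - digit \<omega> n (symb n p)) p"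
  shows "q \<in> chacon_points \<omega>" "has_level m q" "pos m q = pos m p" "symb n q = s"
    "m \<le> N \<Longrightarrow> N < n \<Longrightarrow> symb N q = symb N p"
proof -
  have n: "has_level n p" using has_level_mono[OF p l] .
  note ps = pos_step[OF p n]
  let ?g = "digit \<omega> n s - digit \<omega> n (symb n p)"
  have eq: "pos (Suc n) p + ?g = pos n p + digit \<omega> n s" using ps(3) by simp
  have "\<bar>pos (Suc n) p + ?g\<bar> \<le> radius (Suc n)" unfolding eq by (rule add_digit_bound[OF ps(1) s])
  from chacon_action[OF p coords_Suc(1)[OF p n] this] eq
  have q: "q \<in> chacon_points \<omega>" "has_level (Suc n) q" "pos (Suc n) q = pos n p + digit \<omega> n s"
    by (auto simp: q_def)
  show "q \<in> chacon_points \<omega>" by (rule q(1))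
  have b: "has_level n q" "pos n q = pos n p" "symb n q = s" using level_back[OF q ps(1) s] by auto
  show "symb n q = s" by (rule b(3))
  from same_cylinder[OF p q(1) l b(1,2)]
  show "has_level m q" "pos m q = pos m p" "m \<le> N \<Longrightarrow> N < n \<Longrightarrow> symb N q = symb N p" by auto
qed

lemma digit_jump:
  assumes "s \<in> symbols" "s + t \<in> symbols" "t = 1 \<or> t = -1"
  shows "digit \<omega> n (s + t) - digit \<omega> n s - t * height n \<in> {0, t}"
  using assms by (auto simp: symbols_def digit_def of_bool_def)

context chacon_product
begin

definition syms :: "nat set \<Rightarrow> nat \<Rightarrow> (nat \<Rightarrow> chacon_point) \<Rightarrow> nat \<Rightarrow> int" where
  "syms J n z = (\<lambda>j\<in>J. symb n (z j))"

definition level_set :: "nat set \<Rightarrow> nat \<Rightarrow> (nat \<Rightarrow> chacon_point) set" where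
  "level_set J n = {z \<in> points. \<forall>j\<in>J. has_level n (z j)}"

lemma coord_measurable [measurable]: "i \<in> I \<Longrightarrow> (\<lambda>z. z i) \<in> measurable borel_prod (chacon_borel (w i))"
  unfolding borel_prod_def by measurable

text \<open>A finite tuple of integers takes only countably many values, so an arbitrary property
  \<open>P\<close> of it is measurable.\<close>

lemma pred_discrete:
  fixes h :: "chacon_point \<Rightarrow> int"
  assumes J: "J \<subseteq> I" and h: "\<And>\<omega>. h \<in> measurable (chacon_borel \<omega>) (count_space UNIV)"
  shows "Measurable.pred borel_prod (\<lambda>z. P (\<lambda>j\<in>J. h (z j)))"
proof -
  have fJ: "finite J" using J finite_I by (rule finite_subset)
  have "{z \<in> points. \<forall>j\<in>J. h (z j) = \<sigma> j} \<in> sets borel_prod" for \<sigma>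
  proof -
    have 1: "(\<lambda>z. h (z j)) \<in> measurable borel_prod (count_space UNIV)" if "j \<in> J" for j
      using that J by (intro measurable_compose[OF coord_measurable h]) auto
    have "{z \<in> space borel_prod. h (z j) = \<sigma> j} \<in> sets borel_prod" if "j \<in> J" for j
      using measurable_sets[OF 1[OF that], of "{\<sigma> j}"] by (simp add: vimage_def Int_def conj_commute)
    then have "{z \<in> space borel_prod. \<forall>j\<in>J. h (z j) = \<sigma> j} \<in> sets borel_prod"
      using fJ by (intro sets.sets_Collect_finite_All)
    then show ?thesis by simp
  qed
  then have "(\<Union>\<sigma>\<in>{\<sigma> \<in> (\<Pi>\<^sub>E j\<in>J. UNIV). P \<sigma>}. {z \<in> points. \<forall>j\<in>J. h (z j) = \<sigma> j}) \<in> sets borel_prod"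
    by (intro sets.countable_UN') (auto intro!: countable_subset[OF _ countable_PiE[OF fJ]])
  moreover have "{z \<in> points. P (\<lambda>j\<in>J. h (z j))} = (\<Union>\<sigma>\<in>{\<sigma> \<in> (\<Pi>\<^sub>E j\<in>J. UNIV). P \<sigma>}. {z \<in> points. \<forall>j\<in>J. h (z j) = \<sigma> j})"
  proof (intro set_eqI iffI)
    fix z assume "z \<in> (\<Union>\<sigma>\<in>{\<sigma> \<in> (\<Pi>\<^sub>E j\<in>J. UNIV). P \<sigma>}. {z \<in> points. \<forall>j\<in>J. h (z j) = \<sigma> j})"
    then obtain \<sigma> where \<sigma>: "\<sigma> \<in> (\<Pi>\<^sub>E j\<in>J. UNIV)" "P \<sigma>" "z \<in> points" "\<forall>j\<in>J. h (z j) = \<sigma> j" by blast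
    have "(\<lambda>j\<in>J. h (z j)) = \<sigma>" using \<sigma>(1,4) by (auto simp: fun_eq_iff PiE_iff extensional_def)
    then show "z \<in> {z \<in> points. P (\<lambda>j\<in>J. h (z j))}" using \<sigma> by simp
  next
    fix z assume "z \<in> {z \<in> points. P (\<lambda>j\<in>J. h (z j))}"
    then show "z \<in> (\<Union>\<sigma>\<in>{\<sigma> \<in> (\<Pi>\<^sub>E j\<in>J. UNIV). P \<sigma>}. {z \<in> points. \<forall>j\<in>J. h (z j) = \<sigma> j})"
      by (intro UN_I[of "\<lambda>j\<in>J. h (z j)"]) auto
  qed
  ultimately show ?thesis by (simp add: pred_def)
qed

lemma pred_syms: "J \<subseteq> I \<Longrightarrow> Measurable.pred borel_prod (\<lambda>z. P (syms J n z))"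
  unfolding syms_def by (rule pred_discrete[OF _ symb_measurable])

lemma level_set_sets: "J \<subseteq> I \<Longrightarrow> level_set J n \<in> sets borel_prod"
proof -
  assume J: "J \<subseteq> I"
  have "(\<lambda>z. has_level n (z j)) \<in> measurable borel_prod (count_space UNIV)" if "j \<in> J" for j
    using that J by (intro measurable_compose[OF coord_measurable pred_has_level]) auto
  then have "{z \<in> space borel_prod. \<forall>j\<in>J. has_level n (z j)} \<in> sets borel_prod"
    using J finite_I by (intro sets.sets_Collect_finite_All) (auto intro: finite_subset simp: pred_def)
  then show ?thesis by (simp add: level_set_def)
qed

lemma emeasure_level_set:
  assumes L: "locally_finite L"
  shows "emeasure L (level_set I n) < \<infinity>"
proof -
  let ?R = "PiE I (\<lambda>_. {- radius n .. radius n})"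
  have fin: "finite ?R" using finite_I by (intro finite_PiE) auto
  have "level_set I n \<subseteq> (\<Union>f\<in>?R. pbox n f)"
  proof
    fix z assume "z \<in> level_set I n"
    then have z: "z \<in> points" "\<And>i. i \<in> I \<Longrightarrow> has_level n (z i)" by (auto simp: level_set_def)
    have "(\<lambda>i\<in>I. pos n (z i)) \<in> ?R"
      using pos_step(1)[OF points_mem[OF z(1)] z(2)] by (auto simp: abs_le_iff minus_le_iff)
    then show "z \<in> (\<Union>f\<in>?R. pbox n f)" using z
      by (intro UN_I[of "\<lambda>i\<in>I. pos n (z i)"]) (simp_all add: mem_box)
  qed
  then have "emeasure L (level_set I n) \<le> emeasure L (\<Union>f\<in>?R. pbox n f)"
    using fin locally_finite_sets[OF L] by (intro emeasure_mono) auto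
  also have "\<dots> \<le> (\<Sum>f\<in>?R. emeasure L (pbox n f))"
    using fin locally_finite_sets[OF L] by (intro emeasure_subadditive_finite) auto
  also have "\<dots> < \<infinity>" using L fin by (auto simp: locally_finite_def)
  finally show ?thesis .
qed

lemma act_level_set:
  assumes "m < n" "\<And>i. i \<in> I \<Longrightarrow> \<bar>v i\<bar> \<le> int n"
  shows "act v -` level_set I m \<inter> points \<subseteq> level_set I n"
proof
  fix z assume "z \<in> act v -` level_set I m \<inter> points"
  then have z: "z \<in> points" "act v z \<in> level_set I m" by auto
  have "has_level n (z i)" if i: "i \<in> I" for i
  proof -
    define q where "q = chacon_action (w i) (v i) (z i)"
    have q: "q \<in> chacon_points (w i)" "has_level m q"
      using z i points_mem[OF z(1) i] by (auto simp: q_def level_set_def act_def chacon_action_in)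
    have n: "has_level n q" using has_level_mono[OF q] assms(1) by simp
    have "\<bar>pos n q + - v i\<bar> \<le> radius n" using pos_margin[OF q assms(1)] assms(2)[OF i] by linarith
    from chacon_action(2)[OF q(1) n this] show ?thesis
      using points_mem[OF z(1) i] by (simp add: q_def chacon_action_add chacon_action_0)
  qed
  then show "z \<in> level_set I n" using z(1) by (simp add: level_set_def)
qed

text \<open>The preimage of a box may fail to be a box of the same level, but it lies in a higher
  level, and a level is a finite union of boxes.\<close>

lemma locally_finite_translate:
  assumes L: "locally_finite L"
  shows "locally_finite (distr L borel_prod (act v))"
proof -
  have Ls: "sets L = sets borel_prod" "space L = points" using L locally_finite_sets locally_finite_space by auto
  have meas: "act v \<in> measurable L borel_prod" using act_measurable by (simp cong: measurable_cong_sets add: Ls)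
  have "emeasure (distr L borel_prod (act v)) (pbox m f) < \<infinity>" for m f
  proof -
    \<comment> \<open>Strictly above \<open>m\<close> and at least every |v i|:
      \<open>pos_margin\<close>, on which \<open>act_level_set\<close> rests, gives its margin only
      above a level of the point.\<close>
    define n where "n = Suc (Max (insert m ((\<lambda>i. nat \<bar>v i\<bar>) ` I)))"
    have "\<bar>v i\<bar> \<le> int n" if "i \<in> I" for i
    proof -
      have "nat \<bar>v i\<bar> \<le> Max (insert m ((\<lambda>i. nat \<bar>v i\<bar>) ` I))" using that finite_I by (intro Max_ge) auto
      then show ?thesis by (simp add: n_def)
    qed
    moreover have "m < n" using finite_I by (simp add: n_def less_Suc_eq_le)
    ultimately have "act v -` level_set I m \<inter> points \<subseteq> level_set I n" by (intro act_level_set)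
    moreover have "pbox m f \<subseteq> level_set I m" by (auto simp: mem_box level_set_def)
    ultimately have "act v -` pbox m f \<inter> points \<subseteq> level_set I n" by blast
    then have "emeasure L (act v -` pbox m f \<inter> points) \<le> emeasure L (level_set I n)"
      using Ls level_set_sets[OF subset_refl] by (intro emeasure_mono) auto
    also have "\<dots> < \<infinity>" by (rule emeasure_level_set[OF L])
    finally show ?thesis by (subst emeasure_distr[OF meas]) (simp_all add: Ls)
  qed
  then show ?thesis by (simp add: locally_finite_def)
qed

section \<open>Good symbols and the moves they allow\<close>

definition jump :: "nat set \<Rightarrow> nat \<Rightarrow> (nat \<Rightarrow> int) \<Rightarrow> (nat \<Rightarrow> int) \<Rightarrow> int \<Rightarrow> bool" where
  "jump J n v s t \<longleftrightarrow> (t = 1 \<or> t = -1) \<and>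
    (\<forall>j\<in>J. s j \<in> symbols \<and> s j + t \<in> symbols \<and>
      digit (w j) n (s j + t) - digit (w j) n (s j) = t * height n + v j) \<and>
    (\<exists>i\<in>J. \<exists>j\<in>J. v i \<noteq> v j)"

definition good :: "nat set \<Rightarrow> nat \<Rightarrow> (nat \<Rightarrow> int) \<Rightarrow> bool" where
  "good J n s \<longleftrightarrow> (\<exists>v t. jump J n v s t)"

definition often_good :: "nat set \<Rightarrow> (nat \<Rightarrow> chacon_point) \<Rightarrow> bool" where
  "often_good J z \<longleftrightarrow> (\<forall>m. \<exists>n\<ge>m. good J n (syms J n z))"

text \<open>A list, independent of the level, of all moves that can occur, with vectors normalised
  to 0 outside \<open>J\<close>. Because it is finite, the dominating sum is again locally
  finite.\<close>

definition jumps :: "nat set \<Rightarrow> ((nat \<Rightarrow> int) \<times> (nat \<Rightarrow> int) \<times> int) set" where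
  "jumps J = {(v, s, t). v \<in> PiE I (\<lambda>_. symbols) \<and> s \<in> PiE J (\<lambda>_. symbols) \<and> (t = 1 \<or> t = -1) \<and>
    (\<forall>i\<in>I - J. v i = 0) \<and> (\<forall>j\<in>J. v j \<in> {0, t}) \<and> (\<exists>i\<in>J. \<exists>j\<in>J. v i \<noteq> v j)}"

lemma finite_jumps:
  assumes "J \<subseteq> I"
  shows "finite (jumps J)"
proof -
  have "jumps J \<subseteq> PiE I (\<lambda>_. symbols) \<times> PiE J (\<lambda>_. symbols) \<times> {1, -1}" by (auto simp: jumps_def)
  moreover have "finite (PiE I (\<lambda>_. symbols) \<times> PiE J (\<lambda>_. symbols) \<times> {1, -1 :: int})"
    using finite_subset[OF assms finite_I] finite_I by (intro finite_SigmaI finite_PiE) (auto simp: symbols_def)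
  ultimately show ?thesis by (rule finite_subset)
qed

lemma jump_cong:
  assumes "\<And>j. j \<in> J \<Longrightarrow> v j = v' j" "\<And>j. j \<in> J \<Longrightarrow> s j = s' j"
  shows "jump J n v s t \<longleftrightarrow> jump J n v' s' t"
  using assms by (auto simp: jump_def)

lemma good_cong: "(\<And>j. j \<in> J \<Longrightarrow> s j = s' j) \<Longrightarrow> good J n s \<longleftrightarrow> good J n s'"
  unfolding good_def using jump_cong[of J _ _ s s'] by metis

text \<open>Undoing a move is a move with opposite sign, so the target symbols are good too. A point
  moved at its first good level thus keeps that level as its first good one.\<close>

lemma jump_reverse: "jump J n v s t \<Longrightarrow> good J n (\<lambda>j. s j + t)"
  unfolding good_def
  by (intro exI[of _ "\<lambda>j. - v j"] exI[of _ "- t"]) (auto simp: jump_def algebra_simps)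

lemma jump_in_jumps:
  assumes "J \<subseteq> I" "jump J n v s t"
  shows "((\<lambda>i\<in>I. if i \<in> J then v i else 0), restrict s J, t) \<in> jumps J"
proof -
  have t: "t = 1 \<or> t = -1" using assms(2) by (simp add: jump_def)
  have v: "v j \<in> {0, t}" if "j \<in> J" for j
    using digit_jump[of "s j" t "w j" n] assms(2) that by (auto simp: jump_def)
  have "v j \<in> symbols" if "j \<in> J" for j using v[OF that] t by (auto simp: symbols_def)
  then have "(\<lambda>i\<in>I. if i \<in> J then v i else 0) \<in> PiE I (\<lambda>_. symbols)"
    unfolding restrict_PiE_iff by (auto simp: symbols_def)
  moreover have "\<exists>i\<in>J. \<exists>j\<in>J. (\<lambda>i\<in>I. if i \<in> J then v i else 0) i \<noteq> (\<lambda>i\<in>I. if i \<in> J then v i else 0) j"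
    using assms by (auto simp: jump_def subset_iff)
  moreover have "restrict s J \<in> PiE J (\<lambda>_. symbols)" using assms(2) by (auto simp: jump_def)
  ultimately show ?thesis
    using t v assms(1) by (auto simp: jumps_def)
qed

text \<open>Each point of the box is moved at its first good level \<open>n \<ge> m\<close>. Lower
  symbols stay, so the image remains in the box and still has n as its first good level. For one
  fixed move the images from different levels are therefore disjoint, and all of them fit into one
  translate of the box.\<close>

lemma domination_box:
  assumes L: "locally_finite L" and J: "J \<subseteq> I" and inv: "scales L (restr J 1) 1"
    and io: "AE z in L. often_good J z"
  shows "emeasure L (pbox m f) \<le> (\<Sum>q\<in>jumps J. emeasure L (act (fst q) -` pbox m f \<inter> points))"
proof -
  have Ls: "sets L = sets borel_prod" "space L = points" using L locally_finite_sets locally_finite_space by auto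
  define pre where "pre n = {z \<in> pbox m f. \<forall>k\<in>{m..<n}. \<not> good J k (syms J k z)}" for n
  define A where "A q n = (case q of (v, s, t) \<Rightarrow> {z \<in> pre n. m \<le> n \<and> (\<forall>j\<in>J. syms J n z j = s j) \<and> jump J n v s t})" for q n
  define B where "B q n = (case q of (v, s, t) \<Rightarrow> {z \<in> pre n. m \<le> n \<and> (\<forall>j\<in>J. syms J n z j = s j + t) \<and> jump J n v s t})" for q n
  have pre_sets: "pre n \<in> sets borel_prod" for n
  proof -
    have "{z \<in> space borel_prod. \<forall>k\<in>{m..<n}. \<not> good J k (syms J k z)} \<in> sets borel_prod"
      using pred_syms[OF J, of "\<lambda>s. \<not> good J _ s"] by (intro sets.sets_Collect_finite_All) (auto simp: pred_def)
    moreover have "pre n = pbox m f \<inter> {z \<in> space borel_prod. \<forall>k\<in>{m..<n}. \<not> good J k (syms J k z)}"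
      by (auto simp: pre_def mem_box)
    ultimately show ?thesis by auto
  qed
  have sym_sets: "{z \<in> pre n. m \<le> n \<and> (\<forall>j\<in>J. syms J n z j = s j) \<and> P} \<in> sets borel_prod" for n s P
  proof -
    have "{z \<in> space borel_prod. (\<forall>j\<in>J. syms J n z j = s j) \<and> P \<and> m \<le> n} \<in> sets borel_prod"
      using pred_syms[OF J, of "\<lambda>x. (\<forall>j\<in>J. x j = s j) \<and> P \<and> m \<le> n" n] by (simp add: pred_def)
    moreover have "{z \<in> pre n. m \<le> n \<and> (\<forall>j\<in>J. syms J n z j = s j) \<and> P} =
        pre n \<inter> {z \<in> space borel_prod. (\<forall>j\<in>J. syms J n z j = s j) \<and> P \<and> m \<le> n}"
      by (auto simp: pre_def mem_box)
    ultimately show ?thesis using pre_sets by auto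
  qed
  have A_sets: "A q n \<in> sets borel_prod" for q n unfolding A_def by (cases q) (simp add: sym_sets)
  have B_sets: "B q n \<in> sets borel_prod" for q n
  proof -
    obtain v s t where q: "q = (v, s, t)" by (metis prod.exhaust)
    show ?thesis unfolding B_def q case_prod_conv by (rule sym_sets)
  qed
  have AB: "emeasure L (A q n) \<le> emeasure L (act (fst q) -` B q n \<inter> points)" if q: "q \<in> jumps J" for q n
  proof -
    obtain v s t where qv: "q = (v, s, t)" by (metis prod.exhaust)
    \<comment> \<open>The full displacement of the coordinates; its common part
      \<open>t * height n\<close> disappears below by the invariance of \<open>L\<close> under
      translation of \<open>J\<close>.\<close>
    define u where "u = (\<lambda>i. restr J (t * height n) i + v i)"
    have "A q n \<subseteq> act u -` B q n \<inter> points"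
    proof
      fix z assume "z \<in> A q n"
      then have z: "z \<in> points" "\<And>i. i \<in> I \<Longrightarrow> has_level m (z i) \<and> pos m (z i) = f i"
        "\<And>k. m \<le> k \<Longrightarrow> k < n \<Longrightarrow> \<not> good J k (syms J k z)" "m \<le> n"
        "\<And>j. j \<in> J \<Longrightarrow> symb n (z j) = s j" "jump J n v s t"
        by (auto simp: A_def qv pre_def mem_box syms_def)
      have out: "act u z i = z i" if "i \<in> I - J" for i
        using that q points_mem[OF z(1), of i] by (auto simp: act_def u_def restr_def qv jumps_def chacon_action_0)
      have inn: "has_level m (act u z j)" "pos m (act u z j) = pos m (z j)" "symb n (act u z j) = s j + t"
        "m \<le> k \<Longrightarrow> k < n \<Longrightarrow> symb k (act u z j) = symb k (z j)" if j: "j \<in> J" for j k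
      proof -
        have jI: "j \<in> I" using j J by blast
        have "u j = digit (w j) n (s j + t) - digit (w j) n (symb n (z j))"
          using z(5)[OF j] z(6) j by (auto simp: u_def restr_def jump_def)
        then have eq: "act u z j = chacon_action (w j) (digit (w j) n (s j + t) - digit (w j) n (symb n (z j))) (z j)"
          using jI by (simp add: act_def)
        have "s j + t \<in> symbols" using z(6) j by (auto simp: jump_def)
        from action_change_symbol[OF points_mem[OF z(1) jI] conjunct1[OF z(2)[OF jI]] z(4) this]
        show "has_level m (act u z j)" "pos m (act u z j) = pos m (z j)" "symb n (act u z j) = s j + t"
          "m \<le> k \<Longrightarrow> k < n \<Longrightarrow> symb k (act u z j) = symb k (z j)" unfolding eq by auto
      qed
      have "act u z \<in> pbox m f"
        unfolding mem_box using act_points[OF z(1)] z(2) inn(1,2) out by (metis DiffI)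
      moreover have "syms J k (act u z) = syms J k z" if "m \<le> k" "k < n" for k
        using inn(4) that by (auto simp: syms_def)
      ultimately have "act u z \<in> pre n" using z(3) by (simp add: pre_def)
      then show "z \<in> act u -` B q n \<inter> points"
        using z(1,4,6) inn(3) by (simp add: B_def qv syms_def)
    qed
    then have "emeasure L (A q n) \<le> emeasure L (act u -` B q n \<inter> points)"
      using Ls(1) act_vimage[OF B_sets] by (intro emeasure_mono) simp_all
    also have "act u -` B q n \<inter> points = act (restr J (t * height n)) -` (act v -` B q n \<inter> points) \<inter> points"
      unfolding act_vimage_comp u_def ..
    also have "emeasure L \<dots> = emeasure L (act v -` B q n \<inter> points)"
      using scalesD[OF invariant_multiple[OF inv] act_vimage[OF B_sets]] by simp
    finally show ?thesis by (simp add: qv)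
  qed
  have disj: "disjoint_family (\<lambda>n. act (fst q) -` B q n \<inter> points)" for q
  proof -
    obtain v s t where qv: "q = (v, s, t)" by (metis prod.exhaust)
    have "False" if "n < n'" "z \<in> B q n" "z \<in> B q n'" for n n' z
    proof -
      have *: "\<forall>j\<in>J. syms J n z j = s j + t" "jump J n v s t" "m \<le> n" "z \<in> pre n'"
        using that(2,3) by (auto simp: B_def qv)
      have "good J n (syms J n z)" using jump_reverse[OF *(2)] *(1) good_cong[of J "syms J n z" "\<lambda>j. s j + t"] by blast
      then show False using *(3,4) that(1) by (auto simp: pre_def)
    qed
    then have "B q n \<inter> B q n' = {}" if "n \<noteq> n'" for n n' using that by (meson disjoint_iff linorder_neqE_nat)
    then show ?thesis unfolding disjoint_family_on_def by blast
  qed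
  have UA: "emeasure L (\<Union>n. A q n) \<le> emeasure L (act (fst q) -` pbox m f \<inter> points)" if q: "q \<in> jumps J" for q
  proof -
    have "emeasure L (\<Union>n. A q n) \<le> (\<Sum>n. emeasure L (A q n))"
      using A_sets[of q] Ls by (intro emeasure_subadditive_countably) auto
    also have "\<dots> \<le> (\<Sum>n. emeasure L (act (fst q) -` B q n \<inter> points))"
      using AB[OF q] by (intro suminf_le) auto
    also have "\<dots> = emeasure L (\<Union>n. act (fst q) -` B q n \<inter> points)"
      using Ls act_vimage[OF B_sets[of q]] by (intro suminf_emeasure disj) auto
    also have "\<dots> \<le> emeasure L (act (fst q) -` pbox m f \<inter> points)"
    proof (intro emeasure_mono)
      show "act (fst q) -` pbox m f \<inter> points \<in> sets L" using Ls(1) act_vimage[OF box_sets] by simp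
    qed (auto simp: B_def pre_def split: prod.splits)
    finally show ?thesis .
  qed
  have "AE z in L. z \<in> pbox m f \<longrightarrow> z \<in> (\<Union>q\<in>jumps J. \<Union>n. A q n)"
    using io
  proof eventually_elim
    case (elim z)
    show ?case
    proof
      assume z: "z \<in> pbox m f"
      define n where "n = (LEAST n. n \<ge> m \<and> good J n (syms J n z))"
      have ex: "\<exists>n. n \<ge> m \<and> good J n (syms J n z)" using elim by (auto simp: often_good_def)
      have n: "n \<ge> m" "good J n (syms J n z)" using LeastI_ex[OF ex] by (auto simp: n_def)
      have "\<not> good J k (syms J k z)" if "k \<in> {m..<n}" for k
        using not_less_Least[of k "\<lambda>n. n \<ge> m \<and> good J n (syms J n z)"] that by (auto simp: n_def)
      then have pre: "z \<in> pre n" using z by (auto simp: pre_def)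
      obtain v t where j: "jump J n v (syms J n z) t" using n(2) by (auto simp: good_def)
      define v' where "v' = (\<lambda>i\<in>I. if i \<in> J then v i else 0)"
      have "(v', restrict (syms J n z) J, t) \<in> jumps J" unfolding v'_def by (rule jump_in_jumps[OF J j])
      moreover have "jump J n v' (restrict (syms J n z) J) t"
        using j J by (subst jump_cong[of J v' v _ "syms J n z"]) (auto simp: v'_def)
      ultimately show "z \<in> (\<Union>q\<in>jumps J. \<Union>n. A q n)"
        using pre n(1) by (intro UN_I[of "(v', restrict (syms J n z) J, t)"] UN_I[of n]) (auto simp: A_def)
    qed
  qed
  then have "emeasure L (pbox m f) \<le> emeasure L (\<Union>q\<in>jumps J. \<Union>n. A q n)"
    using Ls(1) A_sets finite_jumps[OF J] by (intro emeasure_mono_AE) (simp_all add: sets.finite_UN image_subset_iff)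
  also have "\<dots> \<le> (\<Sum>q\<in>jumps J. emeasure L (\<Union>n. A q n))"
    using Ls(1) A_sets finite_jumps[OF J] by (intro emeasure_subadditive_finite) (simp_all add: image_subset_iff)
  also have "\<dots> \<le> (\<Sum>q\<in>jumps J. emeasure L (act (fst q) -` pbox m f \<inter> points))"
    by (intro sum_mono UA)
  finally show ?thesis .
qed

lemma domination:
  assumes L: "locally_finite L" and J: "J \<subseteq> I" and inv: "scales L (restr J 1) 1"
    and io: "AE z in L. often_good J z" and E: "E \<in> sets borel_prod"
  shows "emeasure L E \<le> (\<Sum>q\<in>jumps J. emeasure L (act (fst q) -` E \<inter> points))"
proof -
  have Ls: "sets L = sets borel_prod" "space L = points" using L locally_finite_sets locally_finite_space by auto
  define N where "N = sum_measure borel_prod (jumps J) (\<lambda>q. distr L borel_prod (act (fst q)))"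
  have meas: "act v \<in> measurable L borel_prod" for v using act_measurable by (simp cong: measurable_cong_sets add: Ls)
  have N: "emeasure N E = (\<Sum>q\<in>jumps J. emeasure L (act (fst q) -` E \<inter> points))" if "E \<in> sets borel_prod" for E
    unfolding N_def using that by (subst emeasure_sum_measure) (auto simp: emeasure_distr[OF meas] Ls)
  have "emeasure N (pbox n f) < \<infinity>" for n f
  proof -
    have "emeasure N (pbox n f) = (\<Sum>q\<in>jumps J. emeasure (distr L borel_prod (act (fst q))) (pbox n f))"
      unfolding N_def by (subst emeasure_sum_measure) auto
    also have "\<dots> < \<infinity>"
      using locally_finite_translate[OF L] finite_jumps[OF J] by (auto simp: locally_finite_def)
    finally show ?thesis .
  qed
  then have "locally_finite N" by (simp add: locally_finite_def N_def)
  from measure_le_boxes[OF L this _ E, of 0] show ?thesis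
    using domination_box[OF L J inv io] N[OF E] N[OF box_sets] by simp
qed

end

section \<open>Ergodic joinings are not scaled by partial translations\<close>

context chacon_product
begin

text \<open>The union of the diagonal orbits through a label class of positive measure is invariant,
  hence conull. Any point of \<open>E\<close> on such an orbit carries the same label.\<close>

lemma label_constant:
  fixes g :: "(nat \<Rightarrow> chacon_point) \<Rightarrow> 'c"
  assumes Ls: "sets L = sets borel_prod" and erg: "ergodic L (act (\<lambda>_. 1))"
    and E: "E \<in> sets borel_prod" and ne: "emeasure L E \<noteq> 0"
    and gm: "\<And>c. {z \<in> E. g z = c} \<in> sets borel_prod" and gc: "countable (g ` E)"
    and inv: "\<And>z k. z \<in> E \<Longrightarrow> act (\<lambda>_. k) z \<in> E \<Longrightarrow> g (act (\<lambda>_. k) z) = g z"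
  shows "\<exists>c. emeasure L {z \<in> E. g z \<noteq> c} = 0"
proof -
  have sp: "space L = points" using Ls sets_eq_imp_space_eq[OF Ls] by simp
  have Esub: "E \<subseteq> points" using sets.sets_into_space[OF E] by simp
  have "\<exists>c\<in>g ` E. emeasure L {z \<in> E. g z = c} \<noteq> 0"
  proof (rule ccontr)
    assume no: "\<not> ?thesis"
    have "(\<Union>c\<in>g ` E. {z \<in> E. g z = c}) \<in> null_sets L"
      using gc no gm Ls by (intro null_sets_UN') (auto intro!: null_setsI)
    moreover have "(\<Union>c\<in>g ` E. {z \<in> E. g z = c}) = E" by auto
    ultimately show False using ne by auto
  qed
  then obtain c where c: "emeasure L {z \<in> E. g z = c} \<noteq> 0" by blast
  define B where "B = {z \<in> E. g z = c}"
  define S where "S = (\<Union>k. act (\<lambda>_. k) -` B \<inter> points)"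
  have B: "B \<in> sets borel_prod" using gm by (simp add: B_def)
  have S: "S \<in> sets borel_prod" unfolding S_def using act_vimage[OF B] by (intro sets.countable_UN') auto
  have "act (\<lambda>_. 1) -` S \<inter> points = (\<Union>k. act (\<lambda>_. 1) -` (act (\<lambda>_. k) -` B \<inter> points) \<inter> points)"
    by (auto simp: S_def)
  also have "\<dots> = (\<Union>k. act (\<lambda>_. 1 + k) -` B \<inter> points)" unfolding act_vimage_comp ..
  also have "\<dots> = S"
  proof
    show "S \<subseteq> (\<Union>k. act (\<lambda>_. 1 + k) -` B \<inter> points)"
    proof
      fix z assume "z \<in> S"
      then obtain k where "z \<in> act (\<lambda>_. k) -` B \<inter> points" by (auto simp: S_def)
      then have "z \<in> act (\<lambda>_. 1 + (k - 1)) -` B \<inter> points" by simp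
      then show "z \<in> (\<Union>k. act (\<lambda>_. 1 + k) -` B \<inter> points)" by blast
    qed
  qed (auto simp: S_def)
  finally have "S \<in> null_sets L \<or> points - S \<in> null_sets L"
    using erg S Ls sp by (auto simp: ergodic_def)
  moreover have "B \<subseteq> S"
  proof
    fix z assume z: "z \<in> B"
    then have "z \<in> points" using Esub by (auto simp: B_def)
    then have "z \<in> act (\<lambda>_. 0) -` B \<inter> points" using z act_zero[of z "\<lambda>_. 0"] by simp
    then show "z \<in> S" unfolding S_def by blast
  qed
  then have "emeasure L B \<le> emeasure L S" using S Ls by (intro emeasure_mono) auto
  then have "S \<notin> null_sets L" using c by (auto simp: B_def)
  ultimately have "points - S \<in> null_sets L" by blast
  moreover have "{z \<in> E. g z \<noteq> c} \<subseteq> points - S"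
  proof
    fix z assume z: "z \<in> {z \<in> E. g z \<noteq> c}"
    have "False" if "act (\<lambda>_. k) z \<in> B" for k
      using inv[of z k] z that by (auto simp: B_def)
    then show "z \<in> points - S" using z Esub by (auto simp: S_def)
  qed
  moreover have "{z \<in> E. g z \<noteq> c} = E - {z \<in> E. g z = c}" by auto
  then have "{z \<in> E. g z \<noteq> c} \<in> sets L" using E gm Ls by auto
  ultimately show ?thesis using null_sets_subset[of "points - S" L "{z \<in> E. g z \<noteq> c}"] by (intro exI[of _ c]) auto
qed

text \<open>The projections enter through preimages of null sets, because they need not be
  sigma-finite; positivity excludes the zero measure.\<close>

definition ergodic_joining :: "(nat \<Rightarrow> chacon_point) measure \<Rightarrow> bool" where
  "ergodic_joining L \<longleftrightarrow> locally_finite L \<and> scales L (\<lambda>_. 1) 1 \<and> ergodic L (act (\<lambda>_. 1)) \<and>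
    emeasure L points \<noteq> 0 \<and>
    (\<forall>i\<in>I. \<forall>N\<in>null_sets (chacon_measure (w i)). emeasure L {z \<in> points. z i \<in> N} = 0)"

lemma coord_vimage_sets:
  assumes "i \<in> I" "A \<in> sets (chacon_borel (w i))"
  shows "{z \<in> points. z i \<in> A} \<in> sets borel_prod"
  using measurable_sets[OF coord_measurable[OF assms(1)] assms(2)]
  by (simp add: vimage_def Int_def conj_commute)

lemma positive_box:
  assumes L: "locally_finite L" and ne: "emeasure L points \<noteq> 0"
  shows "\<exists>n f. emeasure L (pbox n f) \<noteq> 0 \<and> (\<forall>i\<in>I. \<bar>f i\<bar> \<le> radius n)"
proof (rule ccontr)
  assume no: "\<not> ?thesis"
  have Ls: "sets L = sets borel_prod" using L by (rule locally_finite_sets)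
  have "C \<in> null_sets L" if C: "C \<in> tree.cells 0" for C
  proof -
    obtain n z where z: "C = pbox n (\<lambda>i. pos n (z i))" "pdeep 0 n z"
      using C by (auto simp: tree.cells_def tree_cell)
    have "\<forall>i\<in>I. \<bar>pos n (z i)\<bar> \<le> radius n" using z(2) by (auto simp: pdeep_def deep_def)
    then have "emeasure L C = 0" using no z(1) by blast
    then show ?thesis using z(1) Ls by (auto intro: null_setsI)
  qed
  then have "(\<Union>C\<in>tree.cells 0. C) \<in> null_sets L" by (intro null_sets_UN' tree.countable_cells)
  then show False using ne tree.Union_cells[of 0] by auto
qed

lemma distr_act:
  assumes Ls: "sets L = sets borel_prod" and sc: "scales L v 1"
  shows "distr L L (act v) = L"
proof (rule measure_eqI)
  have sp: "space L = points" using sets_eq_imp_space_eq[OF Ls] by simp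
  have meas: "act v \<in> measurable L L" using act_measurable by (simp cong: measurable_cong_sets add: Ls)
  fix E assume "E \<in> sets (distr L L (act v))"
  then have E: "E \<in> sets L" "E \<in> sets borel_prod" using Ls by auto
  show "emeasure (distr L L (act v)) E = emeasure L E"
    using scalesD[OF sc E(2)] by (simp add: emeasure_distr[OF meas E(1)] sp)
qed simp

text \<open>Translates of \<open>L\<close> are ergodic, so each is singular or proportional to
  \<open>L\<close>. If all those in \<open>jumps J\<close> were singular, they would vanish together
  off one \<open>L\<close>-null set, and domination would make \<open>L\<close> vanish there too.
  The vector of a proportional one takes both values 0 and t on \<open>J\<close>, which singles out
  \<open>V\<close>.\<close>

lemma split_joining:
  assumes jo: "ergodic_joining L" and J: "J \<subseteq> I" and inv: "scales L (restr J 1) 1"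
    and io: "AE z in L. often_good J z"
  shows "\<exists>V c. V \<subseteq> J \<and> V \<noteq> {} \<and> V \<noteq> J \<and> c \<noteq> 0 \<and> c \<noteq> \<infinity> \<and> scales L (restr V 1) c"
proof -
  have L: "locally_finite L" and sc: "scales L (\<lambda>_. 1) 1" and erg: "ergodic L (act (\<lambda>_. 1))"
    and ne: "emeasure L points \<noteq> 0" using jo by (auto simp: ergodic_joining_def)
  have Ls: "sets L = sets borel_prod" "space L = points" using L locally_finite_sets locally_finite_space by auto
  have meas: "act v \<in> measurable M N" if "sets M = sets borel_prod" "sets N = sets borel_prod" for v M N
    using act_measurable that by (simp cong: measurable_cong_sets)
  define N where "N v = distr L borel_prod (act v)" for v
  have emN: "emeasure (N v) E = emeasure L (act v -` E \<inter> points)" if "E \<in> sets borel_prod" for v E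
    unfolding N_def using that meas[of L borel_prod] Ls by (subst emeasure_distr) auto
  have Ns: "sets (N v) = sets borel_prod" "space (N v) = points" for v by (auto simp: N_def)
  have lfN: "locally_finite (N v)" for v unfolding N_def by (rule locally_finite_translate[OF L])
  have scN: "scales (N v) (\<lambda>_. 1) 1" for v
    unfolding scales_def
  proof
    fix E assume E: "E \<in> sets borel_prod"
    have "emeasure (N v) (act (\<lambda>_. 1) -` E \<inter> points) = emeasure L (act (\<lambda>i. v i + 1) -` E \<inter> points)"
      unfolding emN[OF act_vimage[OF E]] act_vimage_comp ..
    also have "(\<lambda>i. v i + 1) = (\<lambda>i. 1 + v i)" by auto
    also have "emeasure L (act (\<lambda>i. 1 + v i) -` E \<inter> points) = emeasure L (act (\<lambda>_. 1) -` (act v -` E \<inter> points) \<inter> points)"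
      unfolding act_vimage_comp ..
    also have "\<dots> = emeasure (N v) E" using scalesD[OF sc act_vimage[OF E]] by (simp add: emN[OF E])
    finally show "emeasure (N v) (act (\<lambda>_. 1) -` E \<inter> points) = 1 * emeasure (N v) E" by simp
  qed
  have ergN: "ergodic (N v) (act (\<lambda>_. 1))" for v
    unfolding ergodic_def
  proof (intro ballI impI)
    fix A assume "A \<in> sets (N v)" and inv: "act (\<lambda>_. 1) -` A \<inter> space (N v) = A"
    then have A: "A \<in> sets borel_prod" "act (\<lambda>_. 1) -` A \<inter> points = A" by (auto simp: Ns)
    let ?B = "act v -` A \<inter> points"
    have "act (\<lambda>_. 1) -` ?B \<inter> points = act (\<lambda>i. v i + 1) -` A \<inter> points"
      unfolding act_vimage_comp by (simp add: add.commute)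
    also have "\<dots> = act v -` (act (\<lambda>_. 1) -` A \<inter> points) \<inter> points" unfolding act_vimage_comp ..
    finally have "act (\<lambda>_. 1) -` ?B \<inter> space L = ?B" using A(2) Ls by simp
    then have "?B \<in> null_sets L \<or> space L - ?B \<in> null_sets L"
      using erg act_vimage[OF A(1)] Ls unfolding ergodic_def by blast
    moreover have "points - ?B = act v -` (points - A) \<inter> points" using act_points by auto
    moreover have A': "points - A \<in> sets borel_prod" using sets.compl_sets[OF A(1)] by simp
    ultimately show "A \<in> null_sets (N v) \<or> space (N v) - A \<in> null_sets (N v)"
      unfolding null_sets_def using A(1) by (auto simp: Ns emN Ls)
  qed
  have dich: "(\<exists>A\<in>sets L. emeasure L (space L - A) = 0 \<and> emeasure (N v) A = 0) \<or> (\<exists>d. N v = scale_measure d L)" for v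
  proof (rule ergodic_dichotomy[where T = "act (\<lambda>_. 1)" and T' = "act (\<lambda>_. -1)"])
    show "sigma_finite_measure L" "sigma_finite_measure (N v)"
      using sigma_finite_locally_finite L lfN by auto
    show "distr L L (act (\<lambda>_. 1)) = L" "distr (N v) (N v) (act (\<lambda>_. 1)) = N v"
      using distr_act[OF _ sc] distr_act[OF _ scN] Ls Ns by auto
  qed (use erg ergN Ls Ns meas act_act act_zero in auto)
  have "\<exists>q\<in>jumps J. \<exists>d. N (fst q) = scale_measure d L"
  proof (rule ccontr)
    assume "\<not> ?thesis"
    then have "\<forall>q\<in>jumps J. \<exists>A. A \<in> sets borel_prod \<and> emeasure L (points - A) = 0 \<and> emeasure (N (fst q)) A = 0"
      using dich Ls by metis
    from bchoice[OF this] obtain A where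
      A: "\<And>q. q \<in> jumps J \<Longrightarrow> A q \<in> sets borel_prod"
        "\<And>q. q \<in> jumps J \<Longrightarrow> emeasure L (points - A q) = 0"
        "\<And>q. q \<in> jumps J \<Longrightarrow> emeasure (N (fst q)) (A q) = 0" by auto
    \<comment> \<open>One \<open>L\<close>-null set off which all the finitely many translates
      vanish.\<close>
    define B where "B = (\<Union>q\<in>jumps J. points - A q)"
    have compl: "points - A q \<in> sets borel_prod" if "q \<in> jumps J" for q using sets.compl_sets[OF A(1)[OF that]] by simp
    have "B \<in> null_sets L" unfolding B_def
    proof (rule null_sets_UN')
      show "countable (jumps J)" using finite_jumps[OF J] by (rule countable_finite)
      fix q assume "q \<in> jumps J"
      then show "points - A q \<in> null_sets L" using A(2) compl Ls by (intro null_setsI) simp_all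
    qed
    then have B: "B \<in> sets borel_prod" "emeasure L B = 0" using Ls by auto
    have C: "points - B \<in> sets borel_prod" using sets.compl_sets[OF B(1)] by simp
    have "emeasure L (points - B) \<le> (\<Sum>q\<in>jumps J. emeasure (N (fst q)) (points - B))"
      using domination[OF L J inv io C] by (simp add: emN[OF C])
    also have "\<dots> \<le> (\<Sum>q\<in>jumps J. emeasure (N (fst q)) (A q))"
    proof (rule sum_mono)
      fix q assume q: "q \<in> jumps J"
      have "points - B \<subseteq> A q" using q by (auto simp: B_def)
      then show "emeasure (N (fst q)) (points - B) \<le> emeasure (N (fst q)) (A q)"
        using A(1)[OF q] Ns by (intro emeasure_mono) simp_all
    qed
    also have "\<dots> = 0" using A(3) by (intro sum.neutral) simp
    finally have "emeasure L (points - B) = 0" by simp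
    moreover have "emeasure L points \<le> emeasure L B + emeasure L (points - B)"
      using emeasure_subadditive[of B L "points - B"] B(1) C Ls sets.sets_into_space[OF B(1)]
      by (simp add: Un_absorb1)
    ultimately show False using ne B(2) by simp
  qed
  then obtain v s t d where q: "(v, s, t) \<in> jumps J" and d: "N v = scale_measure d L" by fastforce
  have scv: "scales L v d"
    unfolding scales_def
  proof
    fix E assume E: "E \<in> sets borel_prod"
    have "emeasure (N v) E = d * emeasure L E" unfolding d using E Ls by simp
    then show "emeasure L (act v -` E \<inter> points) = d * emeasure L E" using emN[OF E] by simp
  qed
  have d0: "d \<noteq> 0"
  proof
    assume "d = 0"
    moreover have "act v -` points \<inter> points = points" using act_points by auto
    moreover have "points \<in> sets borel_prod" using sets.top[of borel_prod] by simp
    ultimately show False using scalesD[OF scv, of points] ne by simp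
  qed
  have d1: "d \<noteq> \<infinity>"
  proof
    assume "d = \<infinity>"
    obtain n f where nf: "emeasure L (pbox n f) \<noteq> 0" using positive_box[OF L ne] by blast
    have "emeasure (N v) (pbox n f) < \<infinity>" using lfN[of v] by (simp add: locally_finite_def)
    moreover have "emeasure (N v) (pbox n f) = \<infinity>" using nf
      using emN[OF box_sets, of v n f] scalesD[OF scv box_sets, of n f] \<open>d = \<infinity>\<close> by (simp add: ennreal_top_mult)
    ultimately show False by simp
  qed
  define V where "V = {j \<in> J. v j = t}"
  have t: "t = 1 \<or> t = -1" and v: "\<And>j. j \<in> J \<Longrightarrow> v j \<in> {0, t}" "\<And>i. i \<in> I - J \<Longrightarrow> v i = 0"
    and nc: "\<exists>i\<in>J. \<exists>j\<in>J. v i \<noteq> v j" using q by (auto simp: jumps_def)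
  have vV: "v i = restr V t i" if "i \<in> I" for i
    using v that by (cases "i \<in> J") (auto simp: V_def restr_def)
  obtain i j where ij: "i \<in> J" "j \<in> J" "v i \<noteq> v j" using nc by blast
  have "v i = t \<or> v j = t" "v i \<noteq> t \<or> v j \<noteq> t" using v(1)[OF ij(1)] v(1)[OF ij(2)] ij(3) by auto
  then have V: "V \<subseteq> J" "V \<noteq> {}" "V \<noteq> J" using ij(1,2) by (auto simp: V_def)
  have scV: "scales L (restr V t) d" using scv scales_cong[of v "restr V t" L d] vV by blast
  show ?thesis
  proof (cases "t = 1")
    case True
    then show ?thesis using scV V d0 d1 by blast
  next
    case False
    then have "t = -1" using t by simp
    have "(\<lambda>i. - restr V (-1) i) = restr V 1" by (auto simp: restr_def)
    then have "scales L (restr V 1) (inverse d)" using scales_uminus[OF scV d0 d1] \<open>t = -1\<close> by simp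
    moreover have "inverse d \<noteq> 0" "inverse d \<noteq> \<infinity>" using d0 d1 by (auto simp: ennreal_inverse_eq_0_iff)
    ultimately show ?thesis using V by blast
  qed
qed

text \<open>Contraction makes the visits to a box summable, so by Borel-Cantelli almost every point
  of it has a last visit. Last visits lie on distinct diagonal orbits, so every label on them is
  vacuously invariant and hence almost constant. Then all positions of some coordinate are
  prescribed, which confines it to a null set.\<close>

lemma wandering_contradiction:
  assumes jo: "ergodic_joining L" and V: "V \<subseteq> I" "V \<noteq> {}" and sc: "scales L (restr V e) c"
    and e: "e = 1 \<or> e = -1" and c: "c < 1" "c \<noteq> 0"
  shows False
proof -
  have L: "locally_finite L" and erg: "ergodic L (act (\<lambda>_. 1))"
    and ne: "emeasure L points \<noteq> 0"
    and nul: "\<And>i N. i \<in> I \<Longrightarrow> N \<in> null_sets (chacon_measure (w i)) \<Longrightarrow> emeasure L {z \<in> points. z i \<in> N} = 0"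
    using jo by (auto simp: ergodic_joining_def)
  have Ls: "sets L = sets borel_prod" "space L = points" using L locally_finite_sets locally_finite_space by auto
  obtain m f where K: "emeasure L (pbox m f) \<noteq> 0" using positive_box[OF L ne] by blast
  have Kfin: "emeasure L (pbox m f) < \<infinity>" using L by (simp add: locally_finite_def)
  define a where "a n = act (restr V (e * int n))" for n
  have sca: "scales L (restr V (e * int n)) (c ^ n)" for n
    using scales_power[OF sc, of n] scales_cong[of "\<lambda>i. int n * restr V e i" "restr V (e * int n)"]
    by (simp add: restr_def)
  have sc_a: "emeasure L (a n -` E \<inter> points) = c ^ n * emeasure L E" if "E \<in> sets borel_prod" for n E
    unfolding a_def using scalesD[OF sca that] .
  have a_meas: "a n -` E \<inter> points \<in> sets borel_prod" if "E \<in> sets borel_prod" for n E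
    unfolding a_def by (rule act_vimage[OF that])
  have a_pts: "z \<in> points \<Longrightarrow> a n z \<in> points" for n z unfolding a_def by (rule act_points)
  have a_V: "a n z j = act (\<lambda>_. e * int n) z j" if "j \<in> V" for n z j
    using that V(1) by (auto simp: a_def act_def restr_def)
  have a_out: "a n z i = z i" if "z \<in> points" "i \<in> I" "i \<notin> V" for n z i
    using that points_mem[OF that(1,2)] by (simp add: a_def act_def restr_def chacon_action_0)
  have a_add: "a n (a k z) = a (n + k) z" if "z \<in> points" for n k z
  proof -
    have "(\<lambda>i. restr V (e * int n) i + restr V (e * int k) i) = restr V (e * int (n + k))"
      by (auto simp: restr_def algebra_simps)
    then show ?thesis unfolding a_def act_act[OF that] by simp
  qed
  \<comment> \<open>Only the coordinates in \<open>V\<close> are restricted, and on these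
    \<open>a\<close> and the diagonal action agree. For a point of the box the other coordinates are
    not moved by \<open>a\<close>, so visits to \<open>KV\<close> are visits to the box.\<close>
  define KV where "KV = {z \<in> points. \<forall>j\<in>V. z j \<in> cylinder (w j) m (f j)}"
  have KV_dep: "z' \<in> KV" if "z \<in> KV" "z' \<in> points" "\<And>j. j \<in> V \<Longrightarrow> z' j = z j" for z z'
    using that by (auto simp: KV_def)
  have KV_sets: "KV \<in> sets borel_prod"
  proof -
    have "{z \<in> space borel_prod. \<forall>j\<in>V. z j \<in> cylinder (w j) m (f j)} \<in> sets borel_prod"
      using V(1) finite_I coord_vimage_sets[OF _ cylinder_sets]
      by (intro sets.sets_Collect_finite_All) (auto intro: finite_subset)
    then show ?thesis by (simp add: KV_def)
  qed
  have box_KV: "pbox m f \<subseteq> KV"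
    using V(1) points_mem by (fastforce simp: mem_box KV_def mem_cylinder)
  \<comment> \<open>Points of \<open>KV\<close> that never return to it under \<open>a\<close>: the
    last visits.\<close>
  define W where "W = KV - (\<Union>n\<in>{0<..}. a n -` KV \<inter> points)"
  have W_sets: "W \<in> sets borel_prod"
    unfolding W_def using KV_sets a_meas[OF KV_sets] by (intro sets.Diff sets.countable_UN') auto
  have Wp: "W \<subseteq> points" by (auto simp: W_def KV_def)
  have W0: "emeasure L W \<noteq> 0"
  proof
    assume W0: "emeasure L W = 0"
    have "emeasure L (a n -` pbox m f \<inter> points) = c ^ n * emeasure L (pbox m f)" for n
      by (rule sc_a) simp
    then have An: "emeasure L (a n -` pbox m f \<inter> points) = ennreal (enn2real c ^ n * measure L (pbox m f))" for n
      using c Kfin by (simp add: ennreal_mult ennreal_power[symmetric] emeasure_eq_ennreal_measure less_top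
          ennreal_enn2real order_less_trans[OF c(1)])
    have "AE z in L. eventually (\<lambda>n. z \<in> space L - (a n -` pbox m f \<inter> points)) sequentially"
    proof (rule borel_cantelli_AE1)
      show "a n -` pbox m f \<inter> points \<in> sets L" for n using a_meas[OF box_sets] Ls by simp
      show "emeasure L (a n -` pbox m f \<inter> points) < \<infinity>" for n unfolding An by simp
      have "enn2real c < 1" using c(1) by (cases c) (auto simp: ennreal_less_one_iff)
      then show "summable (\<lambda>n. measure L (a n -` pbox m f \<inter> points))"
        unfolding measure_def An by (auto intro!: summable_mult2 summable_geometric)
    qed
    then have "AE z in L. z \<in> pbox m f \<longrightarrow> z \<in> (\<Union>n. a n -` W \<inter> points)"
    proof eventually_elim
      case (elim z)
      show ?case
      proof
        assume z: "z \<in> pbox m f"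
        then have zp: "z \<in> points" by (simp add: mem_box)
        obtain N where N: "\<And>n. n \<ge> N \<Longrightarrow> a n z \<notin> pbox m f"
          using elim zp by (auto simp: eventually_sequentially)
        have KVbox: "a n z \<in> pbox m f" if "a n z \<in> KV" for n
          unfolding mem_box
        proof (intro conjI ballI a_pts[OF zp])
          fix i assume i: "i \<in> I"
          show "has_level m (a n z i)" "pos m (a n z i) = f i"
            using that z a_out[OF zp i] i by (cases "i \<in> V"; simp add: KV_def mem_box mem_cylinder)+
        qed
        have fin: "finite {n. a n z \<in> KV}"
          by (rule finite_subset[of _ "{..<N}"]) (use N KVbox in \<open>auto simp: not_less[symmetric]\<close>)
        have "a 0 z = z" unfolding a_def using zp by (intro act_zero) (auto simp: restr_def)
        then have 0: "0 \<in> {n. a n z \<in> KV}" using box_KV z by auto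
        define n where "n = Max {n. a n z \<in> KV}"
        have n: "a n z \<in> KV" using Max_in[OF fin] 0 by (auto simp: n_def)
        have "a k (a n z) \<notin> KV" if "k > 0" for k
        proof
          assume "a k (a n z) \<in> KV"
          then have "k + n \<in> {n. a n z \<in> KV}" using a_add[OF zp] by simp
          then have "k + n \<le> n" unfolding n_def using fin by (rule Max_ge[rotated])
          then show False using that by simp
        qed
        then have "a n z \<in> W" using n by (auto simp: W_def)
        then show "z \<in> (\<Union>n. a n -` W \<inter> points)" using zp by auto
      qed
    qed
    then have "emeasure L (pbox m f) \<le> emeasure L (\<Union>n. a n -` W \<inter> points)"
      using a_meas[OF W_sets] Ls(1) by (intro emeasure_mono_AE sets.countable_UN') (simp_all add: image_subset_iff)
    moreover have "(\<Union>n. a n -` W \<inter> points) \<in> null_sets L"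
      using a_meas[OF W_sets] Ls sc_a[OF W_sets] W0 by (intro null_sets_UN) (auto intro!: null_setsI)
    ultimately show False using K by auto
  qed
  obtain j where j: "j \<in> V" using V(2) by blast
  then have jI: "j \<in> I" using V(1) by blast
  \<comment> \<open>On \<open>V\<close> the diagonal translation by \<open>k\<close> agrees with
    \<open>a\<close> at time |k| or with its inverse, and \<open>KV\<close> sees only
    \<open>V\<close>. A second point of the orbit in \<open>W\<close> would be a forbidden
    return.\<close>
  have one_orbit: "k = 0" if z: "z \<in> W" and z': "act (\<lambda>_. k) z \<in> W" for z k
  proof (rule ccontr)
    assume k: "k \<noteq> 0"
    have zp: "z \<in> points" "act (\<lambda>_. k) z \<in> points" using z z' Wp by auto
    have no: "a n x \<notin> KV" if "x \<in> W" "n > 0" for x n using that Wp by (auto simp: W_def)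
    have KVW: "x \<in> KV" if "x \<in> W" for x using that by (simp add: W_def)
    define n where "n = nat \<bar>k\<bar>"
    have n: "n > 0" using k by (simp add: n_def)
    show False
    proof (cases "k = e * int n")
      case True
      have "a n z \<in> KV"
        by (rule KV_dep[OF KVW[OF z'] a_pts[OF zp(1)]]) (simp add: a_V True)
      then show False using no[OF z n] by blast
    next
      case False
      then have "e * int n = - k" using e by (auto simp: n_def abs_if split: if_splits)
      moreover have "act (\<lambda>_. - k) (act (\<lambda>_. k) z) = z" using act_act[OF zp(1)] act_zero[OF zp(1)] by simp
      ultimately have "a n (act (\<lambda>_. k) z) i = z i" if "i \<in> V" for i using a_V[OF that, of n "act (\<lambda>_. k) z"] by simp
      then have "a n (act (\<lambda>_. k) z) \<in> KV"
        by (intro KV_dep[OF KVW[OF z] a_pts[OF zp(2)]])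
      then show False using no[OF z' n] by blast
    qed
  qed
  have "\<exists>p. emeasure L {z \<in> W. pos n (z j) \<noteq> p} = 0" for n
  proof (rule label_constant[OF Ls(1) erg W_sets W0])
    fix p
    have "{z \<in> points. (\<lambda>i\<in>{j}. pos n (z i)) j = p} \<in> sets borel_prod"
      using pred_discrete[OF _ pos_measurable, of "{j}" "\<lambda>x. x j = p" n] jI by (simp add: pred_def)
    moreover have "{z \<in> W. pos n (z j) = p} = W \<inter> {z \<in> points. (\<lambda>i\<in>{j}. pos n (z i)) j = p}" using Wp by auto
    ultimately show "{z \<in> W. pos n (z j) = p} \<in> sets borel_prod" using W_sets by auto
  next
    fix z k assume "z \<in> W" "act (\<lambda>_. k) z \<in> W"
    moreover from this have "k = 0" by (rule one_orbit)
    ultimately show "pos n (act (\<lambda>_. k) z j) = pos n (z j)" using act_zero[of z "\<lambda>_. 0"] Wp by auto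
  qed (auto intro: countableI_type)
  then have "\<forall>n. \<exists>p. emeasure L {z \<in> W. pos n (z j) \<noteq> p} = 0" by blast
  from choice[OF this] obtain F where "\<forall>n. emeasure L {z \<in> W. pos n (z j) \<noteq> F n} = 0" ..
  then have F: "emeasure L {z \<in> W. pos n (z j) \<noteq> F n} = 0" for n ..
  have "AE z in L. z \<in> W \<longrightarrow> pos n (z j) = F n" for n
  proof -
    have "{z \<in> points. (\<lambda>i\<in>{j}. pos n (z i)) j \<noteq> F n} \<in> sets borel_prod"
      using pred_discrete[OF _ pos_measurable, of "{j}" "\<lambda>x. x j \<noteq> F n" n] jI by (simp add: pred_def)
    moreover have "{z \<in> W. pos n (z j) \<noteq> F n} = W \<inter> {z \<in> points. (\<lambda>i\<in>{j}. pos n (z i)) j \<noteq> F n}" using Wp by auto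
    ultimately have "{z \<in> W. pos n (z j) \<noteq> F n} \<in> sets borel_prod" using W_sets by auto
    then have "{z \<in> W. pos n (z j) \<noteq> F n} \<in> null_sets L" using F[of n] Ls by (intro null_setsI) auto
    from AE_not_in[OF this] show ?thesis by eventually_elim auto
  qed
  then have aeF: "AE z in L. \<forall>n. z \<in> W \<longrightarrow> pos n (z j) = F n" unfolding AE_all_countable by blast
  \<comment> \<open>All positions from level m on are prescribed, so this set lies in cylinders of
    measure tending to 0.\<close>
  define N where "N = (\<Inter>n\<in>{m..}. cylinder (w j) n (F n))"
  have Nsets: "N \<in> sets (chacon_borel (w j))" unfolding N_def by (intro sets.countable_INT') auto
  have "emeasure (chacon_measure (w j)) N \<le> ennreal ((1/3)^n)" if "n \<ge> m" for n
  proof -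
    have "emeasure (chacon_measure (w j)) N \<le> emeasure (chacon_measure (w j)) (cylinder (w j) n (F n))"
      using that by (intro emeasure_mono) (auto simp: N_def)
    also have "\<dots> \<le> ennreal ((1/3)^n)"
      using emeasure_cylinder[of "F n" n "w j"] cylinder_empty[of n "F n" "w j"] by (cases "\<bar>F n\<bar> \<le> radius n") auto
    finally show ?thesis .
  qed
  then have "eventually (\<lambda>n. emeasure (chacon_measure (w j)) N \<le> ennreal ((1/3)^n)) sequentially"
    unfolding eventually_sequentially by blast
  moreover have "(\<lambda>n. ennreal ((1/3)^n)) \<longlonglongrightarrow> ennreal 0" by (intro tendsto_ennrealI LIMSEQ_power_zero) auto
  ultimately have "emeasure (chacon_measure (w j)) N \<le> ennreal 0"
    by (intro tendsto_lowerbound[of _ _ sequentially]) auto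
  then have "N \<in> null_sets (chacon_measure (w j))" using Nsets by (intro null_setsI) auto
  from nul[OF jI this] have "{z \<in> points. z j \<in> N} \<in> null_sets L"
    using coord_vimage_sets[OF jI Nsets] Ls by (intro null_setsI) auto
  from AE_not_in[OF this] aeF have "AE z in L. z \<notin> W"
  proof eventually_elim
    case (elim z)
    show ?case
    proof
      assume z: "z \<in> W"
      then have zp: "z \<in> points" and "z j \<in> cylinder (w j) m (f j)" using Wp j by (auto simp: W_def KV_def)
      then have l: "z j \<in> chacon_points (w j)" "has_level m (z j)" by (auto simp: mem_cylinder)
      have "z j \<in> cylinder (w j) n (F n)" if "n \<ge> m" for n
        using has_level_mono[OF l that] l(1) elim(2) z by (simp add: mem_cylinder)
      then have "z j \<in> N" by (auto simp: N_def)
      then show False using elim(1) zp by blast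
    qed
  qed
  then have "emeasure L W = 0" using W_sets Ls AE_iff_null_sets[of W L] by auto
  then show False using W0 by blast
qed

text \<open>A factor above 1 is a contraction in the opposite direction, which is why the wandering
  argument admits \<open>e = -1\<close>.\<close>

lemma scaling_trivial:
  assumes jo: "ergodic_joining L" and V: "V \<subseteq> I" "V \<noteq> {}" and sc: "scales L (restr V 1) c"
    and c: "c \<noteq> 0" "c \<noteq> \<infinity>"
  shows "c = 1"
proof (rule ccontr)
  assume "c \<noteq> 1"
  then consider "c < 1" | "c > 1" by (meson linorder_neqE)
  then show False
  proof cases
    case 1
    then show False using wandering_contradiction[OF jo V sc _ _ c(1)] by simp
  next
    case 2
    have "(\<lambda>i. - restr V 1 i) = restr V (-1)" by (auto simp: restr_def)
    then have sc': "scales L (restr V (-1)) (inverse c)" using scales_uminus[OF sc c] by simp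
    have "inverse c < 1"
    proof (rule ccontr)
      assume "\<not> inverse c < 1"
      then have "c * 1 \<le> c * inverse c" by (intro mult_left_mono) auto
      also have "c * inverse c = 1" using c ennreal_divide_self[of c] by (simp add: divide_ennreal_def less_top)
      finally show False using 2 by simp
    qed
    moreover have "inverse c \<noteq> 0" using c by (simp add: ennreal_inverse_eq_0_iff)
    ultimately show False using wandering_contradiction[OF jo V sc'] by simp
  qed
qed

end

section \<open>Structure of ergodic joinings\<close>

text \<open>Two levels above a level that contains the point, the position is a position of level n
  - 2 plus digits of levels n - 2 and n - 1, hence small against h_n = 6 h_(n-1) + 1. The bound is
  chosen so that four such positions and the unit corrections of the digits stay below one
  height.\<close>

lemma small_pos:
  assumes "p \<in> chacon_points \<omega>" "has_level m p" "n \<ge> m + 2"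
  shows "4 * \<bar>pos n p\<bar> < height n - 2"
proof -
  obtain k where n: "n = Suc (Suc k)" "m \<le> k"
  proof
    show "n = Suc (Suc (n - 2))" "m \<le> n - 2" using assms(3) by auto
  qed
  have k: "has_level k p" using has_level_mono[OF assms(1,2) n(2)] .
  note k1 = coords_Suc(1)[OF assms(1) k]
  note a = pos_step[OF assms(1) k] and b = pos_step[OF assms(1) k1]
  have "\<bar>pos n p\<bar> \<le> radius k + (height k + 1) + (height (Suc k) + 1)"
    using a(1,3) b(3) digit_bounds[OF a(2), of \<omega> k] digit_bounds[OF b(2), of \<omega> "Suc k"]
    unfolding n(1) by linarith
  then show ?thesis
    using height_radius[of k] radius_nonneg[of k] by (simp add: n(1))
qed

lemma digit_diff:
  assumes "s \<in> symbols" "s' \<in> symbols"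
  shows "\<bar>digit \<omega> n s' - digit \<omega> n s - height n * (s' - s)\<bar> \<le> 1"
  using assms by (auto simp: digit_def symbols_def of_bool_def)

text \<open>Unequal symbol differences would contribute at least one full height, while the four
  positions contribute less than h_n - 2 and the unit corrections of the digits at most 2.\<close>

lemma rigidity_step:
  assumes st: "s \<in> symbols" "s' \<in> symbols" "t \<in> symbols" "t' \<in> symbols"
    and eq: "(p' + digit \<omega> n s') - (p + digit \<omega> n s) = (q' + digit \<omega>' n t') - (q + digit \<omega>' n t)"
    and small: "4 * \<bar>p\<bar> < height n - 2" "4 * \<bar>p'\<bar> < height n - 2" "4 * \<bar>q\<bar> < height n - 2" "4 * \<bar>q'\<bar> < height n - 2"
  shows "s' - s = t' - t"
proof (rule ccontr)
  assume "s' - s \<noteq> t' - t"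
  then have "\<bar>(s' - s) - (t' - t)\<bar> \<ge> 1" by linarith
  then have "height n * 1 \<le> height n * \<bar>(s' - s) - (t' - t)\<bar>"
    using height_pos[of n] by (intro mult_left_mono) auto
  also have "\<dots> = \<bar>height n * (s' - s) - height n * (t' - t)\<bar>"
    using height_pos[of n] by (simp add: abs_mult right_diff_distrib[symmetric])
  finally show False
    using eq small digit_diff[OF st(1,2), of \<omega> n] digit_diff[OF st(3,4), of \<omega>' n] by linarith
qed

text \<open>A move across both gaps always contains the long one, so its length is the same for
  every parameter and it separates no coordinates.\<close>

lemma digit_full: "digit \<omega> n 1 - digit \<omega> n (- 1) = 2 * height n + 1"
  by (simp add: digit_def of_bool_def)

context chacon_product
begin

section \<open>Prescribed symbols are met almost surely\<close>

lemma syms_all_sets: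
  assumes "J \<subseteq> I"
  shows "{z \<in> points. \<forall>n\<in>A. P n (syms J n z)} \<in> sets borel_prod"
proof -
  have "{z \<in> space borel_prod. \<forall>n. n \<in> A \<longrightarrow> P n (syms J n z)} \<in> sets borel_prod"
  proof (rule sets.sets_Collect_countable_All)
    fix n show "{z \<in> space borel_prod. n \<in> A \<longrightarrow> P n (syms J n z)} \<in> sets borel_prod"
      using pred_syms[OF assms, of "\<lambda>s. n \<in> A \<longrightarrow> P n s" n] by (simp add: pred_def)
  qed
  then show ?thesis by (simp add: Ball_def)
qed

text \<open>
  The union of the sets over which the point \<open>\<tau> n\<close> is avoided shrinks by the factor
  \<open>1 - 3\<^sup>-\<^sup>d\<close> at every level in \<open>B\<close>.
\<close>

lemma avoid_box:
  assumes \<tau>: "\<And>n. \<tau> n \<in> PiE I (\<lambda>_. symbols)" and "N \<le> M" and "\<And>i. i \<in> I \<Longrightarrow> \<bar>f i\<bar> \<le> radius N"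
  shows "emeasure chacon_prod {z \<in> pbox N f. \<forall>n\<in>{N..<M}. n \<in> B \<longrightarrow> syms I n z \<noteq> \<tau> n} \<le>
    ennreal ((1 / 3) ^ (N * card I) * (1 - (1 / 3) ^ card I) ^ card (B \<inter> {N..<M}))"
  using assms(2,3)
proof (induction N arbitrary: f rule: inc_induct)
  case base
  then show ?case by (simp add: emeasure_chacon_prod_box)
next
  case (step N)
  define \<theta> where "\<theta> = 1 - (1 / 3 :: real) ^ card I"
  have \<theta>: "\<theta> \<ge> 0" by (simp add: \<theta>_def power_le_one)
  define U where "U N f = {z \<in> pbox N f. \<forall>n\<in>{N..<M}. n \<in> B \<longrightarrow> syms I n z \<noteq> \<tau> n}" for N f
  define c where "c = (1 / 3) ^ (Suc N * card I) * \<theta> ^ card (B \<inter> {Suc N..<M})"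
  have c0: "c \<ge> 0" using \<theta> by (simp add: c_def)
  let ?S = "PiE I (\<lambda>_. symbols)"
  define S where "S = (if N \<in> B then ?S - {\<tau> N} else ?S)"
  have finS: "finite ?S" using finite_I by (intro finite_PiE) (auto simp: symbols_def)
  have card: "card ?S = 3 ^ card I" using finite_I by (simp add: card_PiE symbols_def numeral_3_eq_3)
  let ?f = "\<lambda>s i. f i + digit (w i) N (s i)"
  have bound: "\<bar>?f s i\<bar> \<le> radius (Suc N)" if "s \<in> ?S" "i \<in> I" for s i
    using add_digit_bound[OF step.prems[OF that(2)], of "s i"] that by auto
  have Usets: "U N f \<in> sets borel_prod" for N f
  proof -
    have "{z \<in> points. \<forall>n\<in>{N..<M}. n \<in> B \<longrightarrow> syms I n z \<noteq> \<tau> n} \<in> sets borel_prod"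
      by (rule syms_all_sets) simp
    moreover have "U N f = pbox N f \<inter> {z \<in> points. \<forall>n\<in>{N..<M}. n \<in> B \<longrightarrow> syms I n z \<noteq> \<tau> n}"
      by (auto simp: U_def mem_box)
    ultimately show ?thesis by simp
  qed
  have "U N f \<subseteq> (\<Union>s\<in>S. U (Suc N) (?f s))"
  proof
    fix z assume z: "z \<in> U N f"
    then have zb: "z \<in> pbox N f" by (simp add: U_def)
    define s where "s = syms I N z"
    have "symb N (z i) \<in> symbols" if "i \<in> I" for i
      using zb that pos_step(2)[of "z i" "w i" N] points_mem[of z i] by (auto simp: mem_box)
    then have s: "s \<in> ?S" by (auto simp: s_def syms_def)
    then have "s \<in> S" using z step.hyps by (auto simp: S_def U_def s_def)
    moreover have "z \<in> pbox (Suc N) (?f s)"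
      using zb s step.prems by (subst mem_box_Suc) (auto simp: s_def syms_def)
    then have "z \<in> U (Suc N) (?f s)" using z by (auto simp: U_def)
    ultimately show "z \<in> (\<Union>s\<in>S. U (Suc N) (?f s))" by blast
  qed
  then have "emeasure chacon_prod (U N f) \<le> emeasure chacon_prod (\<Union>s\<in>S. U (Suc N) (?f s))"
    using finS Usets by (intro emeasure_mono sets.finite_UN) (auto simp: S_def)
  also have "\<dots> \<le> (\<Sum>s\<in>S. emeasure chacon_prod (U (Suc N) (?f s)))"
    using finS Usets by (intro emeasure_subadditive_finite) (auto simp: S_def)
  also have "\<dots> \<le> (\<Sum>s\<in>S. ennreal c)"
  proof (rule sum_mono)
    fix s assume "s \<in> S"
    then have "s \<in> ?S" by (auto simp: S_def split: if_splits)
    from step.IH[OF bound[OF this]] show "emeasure chacon_prod (U (Suc N) (?f s)) \<le> ennreal c"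
      by (simp add: U_def c_def \<theta>_def)
  qed
  also have "\<dots> = ennreal (real (card S) * c)" using c0 by (simp add: ennreal_mult ennreal_of_nat_eq_real_of_nat)
  also have "real (card S) * c = (1 / 3) ^ (N * card I) * \<theta> ^ card (B \<inter> {N..<M})"
  proof (cases "N \<in> B")
    case True
    have "B \<inter> {N..<M} = insert N (B \<inter> {Suc N..<M})" using True step.hyps by auto
    then have k: "card (B \<inter> {N..<M}) = Suc (card (B \<inter> {Suc N..<M}))" by simp
    have "card S = 3 ^ card I - 1" using True \<tau> finS card by (simp add: S_def)
    then have "real (card S) = 3 ^ card I - 1" by (simp add: of_nat_diff)
    also have "\<dots> = 3 ^ card I * \<theta>" by (simp add: \<theta>_def right_diff_distrib power_mult_distrib[symmetric])
    finally show ?thesis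
      by (simp add: c_def k power_add power_one_over field_simps)
  next
    case False
    then have "B \<inter> {N..<M} = B \<inter> {Suc N..<M}" using atLeastLessThan_eq_iff step.hyps
      by (auto simp: le_eq_less_or_eq Suc_le_eq)
    then show ?thesis using False card by (simp add: S_def c_def power_add power_one_over)
  qed
  finally show ?case by (simp add: U_def \<theta>_def)
qed

text \<open>Infinitely many levels of \<open>B\<close> lie above \<open>m\<close>, so
  \<open>avoid_box\<close> bounds the measure by every power of a number below 1; finitely many
  boxes exhaust the level.\<close>

lemma null_avoid:
  assumes \<tau>: "\<And>n. \<tau> n \<in> PiE I (\<lambda>_. symbols)" and B: "infinite B"
  shows "{z \<in> level_set I m. \<forall>n\<ge>m. n \<in> B \<longrightarrow> syms I n z \<noteq> \<tau> n} \<in> null_sets chacon_prod"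
proof -
  define \<theta> where "\<theta> = 1 - (1 / 3 :: real) ^ card I"
  have \<theta>: "0 \<le> \<theta>" "\<theta> < 1" by (auto simp: \<theta>_def power_le_one)
  define U where "U f = {z \<in> pbox m f. \<forall>n\<ge>m. n \<in> B \<longrightarrow> syms I n z \<noteq> \<tau> n}" for f
  have Usets: "U f \<in> sets borel_prod" for f
  proof -
    have "{z \<in> points. \<forall>n\<in>{m..}. n \<in> B \<longrightarrow> syms I n z \<noteq> \<tau> n} \<in> sets borel_prod"
      by (rule syms_all_sets) simp
    moreover have "U f = pbox m f \<inter> {z \<in> points. \<forall>n\<in>{m..}. n \<in> B \<longrightarrow> syms I n z \<noteq> \<tau> n}"
      by (auto simp: U_def mem_box)
    ultimately show ?thesis by simp
  qed
  have null: "U f \<in> null_sets chacon_prod" if f: "\<And>i. i \<in> I \<Longrightarrow> \<bar>f i\<bar> \<le> radius m" for f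
  proof -
    have "emeasure chacon_prod (U f) \<le> ennreal (\<theta> ^ k)" for k
    proof -
      have "infinite (B \<inter> {m..})"
      proof
        assume "finite (B \<inter> {m..})"
        then have "finite (B \<inter> {m..} \<union> {..<m})" by simp
        then have "finite B" by (rule finite_subset[rotated]) auto
        then show False using B by blast
      qed
      then obtain F where F: "F \<subseteq> B \<inter> {m..}" "finite F" "card F = k" using infinite_arbitrarily_large by blast
      define M where "M = Suc (Max (insert m F))"
      have M: "m \<le> M" "F \<subseteq> B \<inter> {m..<M}" using F(1,2) by (auto simp: M_def less_Suc_eq_le le_SucI)
      have ck: "k \<le> card (B \<inter> {m..<M})" using card_mono[OF _ M(2)] F(3) by simp
      have "{z \<in> pbox m f. \<forall>n\<in>{m..<M}. n \<in> B \<longrightarrow> syms I n z \<noteq> \<tau> n} =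
        pbox m f \<inter> {z \<in> points. \<forall>n\<in>{m..<M}. n \<in> B \<longrightarrow> syms I n z \<noteq> \<tau> n}" by (auto simp: mem_box)
      moreover have "{z \<in> points. \<forall>n\<in>{m..<M}. n \<in> B \<longrightarrow> syms I n z \<noteq> \<tau> n} \<in> sets borel_prod"
        by (rule syms_all_sets) simp
      ultimately have "emeasure chacon_prod (U f) \<le>
          emeasure chacon_prod {z \<in> pbox m f. \<forall>n\<in>{m..<M}. n \<in> B \<longrightarrow> syms I n z \<noteq> \<tau> n}"
        by (intro emeasure_mono) (auto simp: U_def)
      also have "\<dots> \<le> ennreal ((1 / 3) ^ (m * card I) * \<theta> ^ card (B \<inter> {m..<M}))"
        unfolding \<theta>_def by (rule avoid_box[OF \<tau> M(1) f])
      also have "\<dots> \<le> ennreal (1 * \<theta> ^ k)"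
        using \<theta> ck by (intro ennreal_leI mult_mono power_decreasing power_le_one) auto
      finally show ?thesis by simp
    qed
    then have "\<forall>\<^sub>F k in sequentially. emeasure chacon_prod (U f) \<le> ennreal (\<theta> ^ k)" by simp
    moreover have "(\<lambda>k. ennreal (\<theta> ^ k)) \<longlonglongrightarrow> ennreal 0" using \<theta> by (intro tendsto_ennrealI LIMSEQ_power_zero) auto
    ultimately have "emeasure chacon_prod (U f) \<le> ennreal 0"
      by (intro tendsto_lowerbound[of _ _ sequentially]) auto
    then show ?thesis using Usets by (intro null_setsI) auto
  qed
  let ?R = "PiE I (\<lambda>_. {- radius m .. radius m})"
  have "(\<Union>f\<in>?R. U f) \<in> null_sets chacon_prod"
  proof (rule null_sets_UN')
    have "finite ?R" using finite_I by (intro finite_PiE) auto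
    then show "countable ?R" by (rule countable_finite)
    fix f assume f: "f \<in> ?R"
    show "U f \<in> null_sets chacon_prod"
    proof (rule null)
      fix i assume "i \<in> I"
      then have "f i \<in> {- radius m .. radius m}" using f by blast
      then show "\<bar>f i\<bar> \<le> radius m" by auto
    qed
  qed
  moreover have "{z \<in> level_set I m. \<forall>n\<ge>m. n \<in> B \<longrightarrow> syms I n z \<noteq> \<tau> n} = (\<Union>f\<in>?R. U f)"
  proof
    show "{z \<in> level_set I m. \<forall>n\<ge>m. n \<in> B \<longrightarrow> syms I n z \<noteq> \<tau> n} \<subseteq> (\<Union>f\<in>?R. U f)"
    proof
      fix z assume z: "z \<in> {z \<in> level_set I m. \<forall>n\<ge>m. n \<in> B \<longrightarrow> syms I n z \<noteq> \<tau> n}"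
      then have zl: "z \<in> points" "\<And>i. i \<in> I \<Longrightarrow> has_level m (z i)" by (auto simp: level_set_def)
      have "(\<lambda>i\<in>I. pos m (z i)) \<in> ?R"
        using pos_step(1)[OF points_mem[OF zl(1)] zl(2)] by (auto simp: abs_le_iff minus_le_iff)
      moreover have "z \<in> U (\<lambda>i\<in>I. pos m (z i))" using z zl by (auto simp: U_def mem_box)
      ultimately show "z \<in> (\<Union>f\<in>?R. U f)" by blast
    qed
  qed (auto simp: U_def mem_box level_set_def)
  ultimately show ?thesis by simp
qed

end

lemma null_avoid_point:
  assumes "\<And>n. \<tau> n \<in> symbols" and "infinite B"
  shows "{p \<in> chacon_points \<omega>. has_level m p \<and> (\<forall>n\<ge>m. n \<in> B \<longrightarrow> symb n p \<noteq> \<tau> n)} \<in> null_sets (chacon_measure \<omega>)"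
    (is "?N \<in> _")
proof -
  \<comment> \<open>A single system is a product with one factor, so the estimate for products
    applies to it.\<close>
  interpret one: chacon_product "\<lambda>_. \<omega>" "{0}" by unfold_locales simp
  have N: "?N \<in> sets (chacon_borel \<omega>)"
  proof -
    have "{p \<in> space (chacon_borel \<omega>). has_level m p \<and> (\<forall>n\<ge>m. n \<in> B \<longrightarrow> symb n p \<noteq> \<tau> n)} \<in> sets (chacon_borel \<omega>)"
      by measurable
    then show ?thesis unfolding space_chacon_borel .
  qed
  have sy: "one.syms {0} n z = (\<lambda>i\<in>{0}. \<tau> n) \<longleftrightarrow> symb n (z 0) = \<tau> n" for n z
    by (simp add: one.syms_def restrict_def fun_eq_iff)
  have "PiE {0} (\<lambda>_. ?N) = {z \<in> one.level_set {0} m. \<forall>n\<ge>m. n \<in> B \<longrightarrow> one.syms {0} n z \<noteq> (\<lambda>i\<in>{0}. \<tau> n)}"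
  proof (rule set_eqI)
    fix z
    show "z \<in> PiE {0} (\<lambda>_. ?N) \<longleftrightarrow> z \<in> {z \<in> one.level_set {0} m. \<forall>n\<ge>m. n \<in> B \<longrightarrow> one.syms {0} n z \<noteq> (\<lambda>i\<in>{0}. \<tau> n)}"
      unfolding sy one.level_set_def one.points_def PiE_iff mem_Collect_eq ball_simps by blast
  qed
  moreover have "\<dots> \<in> null_sets one.chacon_prod"
    using assms by (intro one.null_avoid) auto
  ultimately have "PiE {0} (\<lambda>_. ?N) \<in> null_sets one.chacon_prod" by (simp only:)
  then have "emeasure one.chacon_prod (PiE {0} (\<lambda>_. ?N)) = 0" by (rule null_setsD1)
  moreover have "emeasure one.chacon_prod (PiE {0} (\<lambda>_. ?N)) = (\<Prod>i\<in>{0 :: nat}. emeasure (chacon_measure \<omega>) ?N)"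
    by (rule one.emeasure_chacon_prod) (rule N)
  ultimately have "emeasure (chacon_measure \<omega>) ?N = 0" by (simp only: prod.insert finite.emptyI empty_iff prod.empty mult_1_right not_False_eq_True)
  then show ?thesis by (rule null_setsI) (unfold sets_chacon_measure, rule N)
qed

section \<open>Rigidity of coordinates without good moves\<close>

context chacon_product
begin

text \<open>Descending induction from a level where all coordinates of \<open>J\<close> have moved
  by the same \<open>k\<close>. If the positions at level n + 1 moved alike,
  \<open>rigidity_step\<close> gives a common change t of the symbols. Then the digits change alike
  as well: trivially for t = 0, by \<open>digit_full\<close> for t = 2 or -2, and otherwise because
  a disagreement would be a good move. So the positions at level n moved alike.\<close>

lemma rigidity:
  assumes J: "J \<subseteq> I" and z: "z \<in> level_set J m" and z': "act (\<lambda>_. k) z \<in> level_set J m"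
    and ng: "\<And>n. n \<ge> m \<Longrightarrow> \<not> good J n (syms J n z)" and n: "n \<ge> m + 2"
  shows "\<exists>t. \<forall>j\<in>J. symb n (act (\<lambda>_. k) z j) = symb n (z j) + t"
proof -
  define y where "y = act (\<lambda>_. k) z"
  have zp: "z \<in> points" "y \<in> points" using z z' by (auto simp: level_set_def y_def)
  have pt: "z j \<in> chacon_points (w j)" "y j \<in> chacon_points (w j)" "has_level m (z j)" "has_level m (y j)" if "j \<in> J" for j
    using points_mem[OF zp(1)] points_mem[OF zp(2)] z z' that J by (auto simp: level_set_def y_def)
  have lev: "has_level n (z j)" "has_level n (y j)" if "j \<in> J" "n \<ge> m" for j n
    using has_level_mono pt[OF that(1)] that(2) by blast+
  have sy: "symb n (z j) \<in> symbols" "symb n (y j) \<in> symbols" if "j \<in> J" "n \<ge> m" for j n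
    using pos_step(2)[OF pt(1)[OF that(1)] lev(1)[OF that]] pos_step(2)[OF pt(2)[OF that(1)] lev(2)[OF that]] by auto
  obtain N where N: "N \<ge> n" "pdeep \<bar>k\<bar> N z" using exists_pdeep[OF zp(1)] by blast
  have "pos N (y j) = pos N (z j) + k" if j: "j \<in> J" for j
  proof -
    have jI: "j \<in> I" using j J by blast
    then have d: "has_level N (z j)" "\<bar>pos N (z j)\<bar> + \<bar>k\<bar> \<le> radius N" using N(2) by (auto simp: pdeep_def deep_def)
    then show ?thesis
      using chacon_action(3)[OF pt(1)[OF j] d(1), of k] jI by (simp add: y_def act_def)
  qed
  then have top: "\<exists>\<kappa>. \<forall>j\<in>J. pos N (y j) = pos N (z j) + \<kappa>" by blast
  have down: "(\<exists>t. \<forall>j\<in>J. symb n (y j) = symb n (z j) + t) \<and> (\<exists>\<kappa>. \<forall>j\<in>J. pos n (y j) = pos n (z j) + \<kappa>)"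
    if n: "n \<ge> m + 2" and ex: "\<exists>\<kappa>. \<forall>j\<in>J. pos (Suc n) (y j) = pos (Suc n) (z j) + \<kappa>" for n
  proof (cases "J = {}")
    case False
    then obtain i where i: "i \<in> J" by blast
    obtain \<kappa> where \<kappa>: "\<And>j. j \<in> J \<Longrightarrow> pos (Suc n) (y j) = pos (Suc n) (z j) + \<kappa>" using ex by blast
    have nm: "n \<ge> m" using n by simp
    have step: "pos (Suc n) (z j) = pos n (z j) + digit (w j) n (symb n (z j))"
      "pos (Suc n) (y j) = pos n (y j) + digit (w j) n (symb n (y j))" if "j \<in> J" for j
      using pos_step(3)[OF pt(1)[OF that] lev(1)[OF that nm]] pos_step(3)[OF pt(2)[OF that] lev(2)[OF that nm]] by auto
    have small: "4 * \<bar>pos n (z j)\<bar> < height n - 2" "4 * \<bar>pos n (y j)\<bar> < height n - 2" if "j \<in> J" for j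
      using small_pos[OF pt(1)[OF that] pt(3)[OF that] n] small_pos[OF pt(2)[OF that] pt(4)[OF that] n] by auto
    define t where "t = symb n (y i) - symb n (z i)"
    have t: "symb n (y j) = symb n (z j) + t" if j: "j \<in> J" for j
    proof -
      have "symb n (y j) - symb n (z j) = symb n (y i) - symb n (z i)"
        using \<kappa>[OF j] \<kappa>[OF i] step[OF j] step[OF i]
        by (intro rigidity_step[where \<omega> = "w j" and \<omega>' = "w i", OF sy(1)[OF j nm] sy(2)[OF j nm] sy(1)[OF i nm] sy(2)[OF i nm] _
              small(1)[OF j] small(2)[OF j] small(1)[OF i] small(2)[OF i]]) linarith
      then show ?thesis by (simp add: t_def)
    qed
    have "\<exists>a. \<forall>j\<in>J. digit (w j) n (symb n (y j)) - digit (w j) n (symb n (z j)) = a"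
    proof -
      have "t \<in> {-2, -1, 0, 1, 2}" using sy[OF i nm] by (auto simp: t_def symbols_def)
      then consider "t = 0" | "t = 1 \<or> t = -1" | "t = 2" | "t = -2" by auto
      then show ?thesis
      proof cases
        case 1
        then show ?thesis using t by auto
      next
        case 2
        define v where "v j = digit (w j) n (symb n (z j) + t) - digit (w j) n (symb n (z j)) - t * height n" for j
        have "\<not> jump J n v (syms J n z) t" using ng[OF nm] unfolding good_def by blast
        moreover have "syms J n z j \<in> symbols \<and> syms J n z j + t \<in> symbols \<and>
          digit (w j) n (syms J n z j + t) - digit (w j) n (syms J n z j) = t * height n + v j" if j: "j \<in> J" for j
          using sy(1)[OF j nm] sy(2)[OF j nm] t[OF j] j by (simp add: syms_def v_def)
        \<comment> \<open>All conjuncts of \<open>jump\<close> hold except possibly the last, so its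
          failure says that the remainder is constant on \<open>J\<close>.\<close>
        ultimately have "\<forall>a\<in>J. \<forall>b\<in>J. v a = v b" using 2 unfolding jump_def by blast
        then have "v j = v i" if "j \<in> J" for j using that i by blast
        then have "digit (w j) n (symb n (y j)) - digit (w j) n (symb n (z j)) = v i + t * height n" if "j \<in> J" for j
          using t[OF that] that unfolding v_def[of j, symmetric] by (simp add: v_def)
        then show ?thesis by blast
      next
        case 3
        have "symb n (z j) = -1 \<and> symb n (y j) = 1" if "j \<in> J" for j
          using t[OF that] 3 sy[OF that nm] by (auto simp: symbols_def)
        then show ?thesis using digit_full by (intro exI[of _ "2 * height n + 1"]) simp
      next
        case 4
        have "symb n (z j) = 1 \<and> symb n (y j) = -1" if "j \<in> J" for j
          using t[OF that] 4 sy[OF that nm] by (auto simp: symbols_def)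
        then show ?thesis using digit_full[of _ n]
          by (intro exI[of _ "- (2 * height n + 1)"]) (metis minus_diff_eq)
      qed
    qed
    then obtain a where "\<And>j. j \<in> J \<Longrightarrow> digit (w j) n (symb n (y j)) - digit (w j) n (symb n (z j)) = a" by blast
    then have "pos n (y j) = pos n (z j) + (\<kappa> - a)" if "j \<in> J" for j
      using step[OF that] \<kappa>[OF that] that by force
    then show ?thesis using t by blast
  qed auto
  \<comment> \<open>The range reaches \<open>Suc N\<close> so that n = N is covered: the statement
    at n uses the positions at level n + 1.\<close>
  have "\<exists>\<kappa>. \<forall>j\<in>J. pos k' (y j) = pos k' (z j) + \<kappa>" if "m + 2 \<le> k'" "k' \<le> Suc N" for k'
    using that(2,1)
  proof (induction k' rule: inc_induct)
    case base
    have Nm: "N \<ge> m" using N(1) n by simp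
    have "pos (Suc N) (y j) = pos (Suc N) (z j) + k" if j: "j \<in> J" for j
    proof -
      have jI: "j \<in> I" using j J by blast
      then have d: "has_level N (z j)" "\<bar>pos N (z j) + k\<bar> \<le> radius N" using N(2) by (auto simp: pdeep_def deep_def)
      then show ?thesis
        using chacon_action_pos(2)[OF pt(1)[OF j] d, of "Suc N"] jI by (simp add: y_def act_def)
    qed
    then show ?case by blast
  next
    case (step k')
    then show ?case using down[of k'] by simp
  qed
  from this[of "Suc n"] have "\<exists>\<kappa>. \<forall>j\<in>J. pos (Suc n) (y j) = pos (Suc n) (z j) + \<kappa>" using n N(1) by simp
  then show ?thesis using down[OF n] by (simp add: y_def)
qed

text \<open>Where good symbols have ceased, the symbol differences are invariant labels, hence
  almost everywhere constants \<open>\<sigma> n\<close>. If infinitely many were nonzero, the symbol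
  at \<open>i\<close> would avoid a prescribed value at each of these levels, which happens on a
  null set only. So from some level on all symbols in \<open>J\<close> agree.\<close>

lemma tied_levels:
  assumes jo: "ergodic_joining L" and J: "J \<subseteq> I" "J \<noteq> {}" and io: "\<not> (AE z in L. often_good J z)"
  shows "\<exists>m. {z \<in> level_set J m. \<forall>n\<ge>m. \<not> good J n (syms J n z) \<and> (\<exists>a. \<forall>j\<in>J. symb n (z j) = a)} \<in> sets borel_prod \<and>
    emeasure L {z \<in> level_set J m. \<forall>n\<ge>m. \<not> good J n (syms J n z) \<and> (\<exists>a. \<forall>j\<in>J. symb n (z j) = a)} \<noteq> 0"
proof -
  have L: "locally_finite L" and erg: "ergodic L (act (\<lambda>_. 1))"
    and nul: "\<And>i N. i \<in> I \<Longrightarrow> N \<in> null_sets (chacon_measure (w i)) \<Longrightarrow> emeasure L {z \<in> points. z i \<in> N} = 0"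
    using jo by (auto simp: ergodic_joining_def)
  have Ls: "sets L = sets borel_prod" "space L = points" using L locally_finite_sets locally_finite_space by auto
  define E where "E m = {z \<in> level_set J m. \<forall>n\<ge>m. \<not> good J n (syms J n z)}" for m
  have E_sets: "E m \<in> sets borel_prod" for m
  proof -
    have "{z \<in> points. \<forall>n\<in>{m..}. \<not> good J n (syms J n z)} \<in> sets borel_prod"
      by (rule syms_all_sets[OF J(1)])
    moreover have "E m = level_set J m \<inter> {z \<in> points. \<forall>n\<in>{m..}. \<not> good J n (syms J n z)}"
      by (auto simp: E_def level_set_def)
    ultimately show ?thesis using level_set_sets[OF J(1)] by simp
  qed
  have "\<exists>m. emeasure L (E m) \<noteq> 0"
  proof (rule ccontr)
    assume "\<nexists>m. emeasure L (E m) \<noteq> 0"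
    then have "(\<Union>m. E m) \<in> null_sets L" using E_sets Ls by (intro null_sets_UN) (auto intro!: null_setsI)
    from AE_not_in[OF this] AE_space have "AE z in L. often_good J z"
    proof eventually_elim
      case (elim z)
      then have zp: "z \<in> points" using Ls by simp
      obtain m0 where m0: "pdeep 0 m0 z" using exists_pdeep[OF zp] by blast
      show ?case
      proof (rule ccontr)
        assume "\<not> often_good J z"
        then obtain m1 where m1: "\<And>n. n \<ge> m1 \<Longrightarrow> \<not> good J n (syms J n z)" by (auto simp: often_good_def)
        have "has_level (max m0 m1) (z j)" if "j \<in> J" for j
          using has_level_mono[OF points_mem[OF zp], of j m0 "max m0 m1"] m0 that J(1) by (auto simp: pdeep_def deep_def)
        then have "z \<in> E (max m0 m1)" using m1 zp by (auto simp: E_def level_set_def)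
        then show False using elim by blast
      qed
    qed
    then show False using io by blast
  qed
  then obtain m where m: "emeasure L (E m) \<noteq> 0" by blast
  have Ep: "E m \<subseteq> points" by (auto simp: E_def level_set_def)
  obtain i where i: "i \<in> J" using J(2) by blast
  define g where "g n z = (\<lambda>j\<in>J. symb n (z j) - symb n (z i))" for n and z :: "nat \<Rightarrow> chacon_point"
  have g_syms: "g n z = (\<lambda>j\<in>J. syms J n z j - syms J n z i)" for n z using i by (auto simp: g_def syms_def)
  have g_sets: "{z \<in> E m. P (g n z)} \<in> sets borel_prod" for P n
  proof -
    have "{z \<in> points. P (g n z)} \<in> sets borel_prod"
      unfolding g_syms using pred_syms[OF J(1), of "\<lambda>s. P (\<lambda>j\<in>J. s j - s i)" n] by (simp add: pred_def)
    moreover have "{z \<in> E m. P (g n z)} = E m \<inter> {z \<in> points. P (g n z)}" using Ep by auto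
    ultimately show ?thesis using E_sets by simp
  qed
  have "\<exists>\<sigma>. emeasure L {z \<in> E m. g n z \<noteq> \<sigma>} = 0" if n: "n \<ge> m + 2" for n
  proof (rule label_constant[OF Ls(1) erg E_sets m])
    show "{z \<in> E m. g n z = c} \<in> sets borel_prod" for c by (rule g_sets)
    have "g n ` E m \<subseteq> PiE J (\<lambda>_. UNIV)" by (auto simp: g_def)
    moreover have "countable (PiE J (\<lambda>_. UNIV :: int set))"
      using finite_subset[OF J(1) finite_I] by (intro countable_PiE) auto
    ultimately show "countable (g n ` E m)" by (rule countable_subset)
    fix z k assume z: "z \<in> E m" "act (\<lambda>_. k) z \<in> E m"
    then obtain t where "\<And>j. j \<in> J \<Longrightarrow> symb n (act (\<lambda>_. k) z j) = symb n (z j) + t"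
      using rigidity[OF J(1), of z m k n] n by (auto simp: E_def)
    then show "g n (act (\<lambda>_. k) z) = g n z" using i by (auto simp: g_def)
  qed
  then have "\<forall>n. \<exists>\<sigma>. n \<ge> m + 2 \<longrightarrow> emeasure L {z \<in> E m. g n z \<noteq> \<sigma>} = 0" by blast
  from choice[OF this] obtain \<sigma> where "\<forall>n. n \<ge> m + 2 \<longrightarrow> emeasure L {z \<in> E m. g n z \<noteq> \<sigma> n} = 0" ..
  then have \<sigma>: "emeasure L {z \<in> E m. g n z \<noteq> \<sigma> n} = 0" if "n \<ge> m + 2" for n using that by blast
  have "AE z in L. n \<ge> m + 2 \<longrightarrow> z \<in> E m \<longrightarrow> g n z = \<sigma> n" for n
  proof (cases "n \<ge> m + 2")
    case True
    have "{z \<in> E m. g n z \<noteq> \<sigma> n} \<in> null_sets L" using \<sigma>[OF True] g_sets Ls by (intro null_setsI) auto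
    from AE_not_in[OF this] show ?thesis by eventually_elim auto
  qed simp
  then have ae: "AE z in L. \<forall>n. n \<ge> m + 2 \<longrightarrow> z \<in> E m \<longrightarrow> g n z = \<sigma> n" unfolding AE_all_countable by blast
  define B where "B = {n. n \<ge> m + 2 \<and> (\<exists>j\<in>J. \<sigma> n j \<noteq> 0)}"
  have pE: "symb n (z j) \<in> symbols" "has_level n (z j)" "z j \<in> chacon_points (w j)" if "z \<in> E m" "n \<ge> m" "j \<in> J" for z n j
  proof -
    have z: "z j \<in> chacon_points (w j)" "has_level m (z j)"
      using that J(1) points_mem[of z j] by (auto simp: E_def level_set_def)
    then show "z j \<in> chacon_points (w j)" "has_level n (z j)" "symb n (z j) \<in> symbols"
      using has_level_mono[OF z that(2)] pos_step(2) by auto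
  qed
  have "finite B"
  proof (rule ccontr)
    assume B: "infinite B"
    \<comment> \<open>A nonzero difference added to the extreme symbol of the same sign leaves the
      set of three symbols, so that extreme symbol cannot occur at \<open>i\<close>.\<close>
    have "\<exists>\<tau>\<in>symbols. \<exists>j\<in>J. \<tau> + \<sigma> n j \<notin> symbols" if n: "n \<in> B" for n
    proof -
      obtain j where j: "j \<in> J" "\<sigma> n j \<noteq> 0" using n by (auto simp: B_def)
      then consider "\<sigma> n j > 0" | "\<sigma> n j < 0" by linarith
      then show ?thesis
      proof cases
        case 1 then show ?thesis using j(1) by (intro bexI[of _ 1] bexI[of _ j]) (auto simp: symbols_def)
      next
        case 2 then show ?thesis using j(1) by (intro bexI[of _ "-1"] bexI[of _ j]) (auto simp: symbols_def)
      qed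
    qed
    moreover have "0 \<in> symbols" by (simp add: symbols_def)
    ultimately have "\<forall>n. \<exists>\<tau>. \<tau> \<in> symbols \<and> (n \<in> B \<longrightarrow> (\<exists>j\<in>J. \<tau> + \<sigma> n j \<notin> symbols))" by blast
    from choice[OF this] obtain \<tau> where "\<forall>n. \<tau> n \<in> symbols \<and> (n \<in> B \<longrightarrow> (\<exists>j\<in>J. \<tau> n + \<sigma> n j \<notin> symbols))" ..
    then have \<tau>: "\<tau> n \<in> symbols" "n \<in> B \<Longrightarrow> \<exists>j\<in>J. \<tau> n + \<sigma> n j \<notin> symbols" for n by blast+
    define N where "N = {p \<in> chacon_points (w i). has_level m p \<and> (\<forall>n\<ge>m. n \<in> B \<longrightarrow> symb n p \<noteq> \<tau> n)}"
    have N: "N \<in> null_sets (chacon_measure (w i))" unfolding N_def by (rule null_avoid_point[OF \<tau>(1) B])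
    have iI: "i \<in> I" using i J(1) by blast
    have "{z \<in> points. z i \<in> N} \<in> null_sets L"
      using nul[OF iI N] coord_vimage_sets[OF iI, of N] N Ls by (intro null_setsI) auto
    from AE_not_in[OF this] ae have "AE z in L. z \<notin> E m"
    proof eventually_elim
      case (elim z)
      show ?case
      proof
        assume z: "z \<in> E m"
        have "symb n (z i) \<noteq> \<tau> n" if n: "n \<ge> m" "n \<in> B" for n
        proof
          assume eq: "symb n (z i) = \<tau> n"
          obtain j where j: "j \<in> J" "\<tau> n + \<sigma> n j \<notin> symbols" using \<tau>(2)[OF n(2)] by blast
          have "g n z j = \<sigma> n j" using elim(2) z n(2) by (auto simp: B_def)
          then have "symb n (z j) = \<tau> n + \<sigma> n j" using j(1) eq by (simp add: g_def)
          then show False using pE(1)[OF z n(1) j(1)] j(2) by simp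
        qed
        then have "z i \<in> N" using pE(2,3)[OF z order_refl i] by (auto simp: N_def)
        then show False using elim(1) z Ep by blast
      qed
    qed
    then have "emeasure L (E m) = 0" using E_sets Ls AE_iff_null_sets[of "E m" L] by auto
    then show False using m by blast
  qed
  then obtain m' where m': "\<And>n. n \<in> B \<Longrightarrow> n < m'" using finite_nat_set_iff_bounded by auto
  \<comment> \<open>From m + 2 on \<open>rigidity\<close> makes the labels invariant, and m' lies
    beyond the last level with a nonzero difference.\<close>
  define M where "M = max (m + 2) m'"
  let ?T = "{z \<in> level_set J M. \<forall>n\<ge>M. \<not> good J n (syms J n z) \<and> (\<exists>a. \<forall>j\<in>J. symb n (z j) = a)}"
  have T_sets: "?T \<in> sets borel_prod"
  proof -
    have "{z \<in> points. \<forall>n\<in>{M..}. \<not> good J n (syms J n z) \<and> (\<exists>a. \<forall>j\<in>J. syms J n z j = a)} \<in> sets borel_prod"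
      by (rule syms_all_sets[OF J(1)])
    moreover have "?T = level_set J M \<inter> {z \<in> points. \<forall>n\<in>{M..}. \<not> good J n (syms J n z) \<and> (\<exists>a. \<forall>j\<in>J. syms J n z j = a)}"
      by (auto simp: level_set_def syms_def)
    ultimately show ?thesis using level_set_sets[OF J(1), of M] by simp
  qed
  have "AE z in L. z \<in> E m \<longrightarrow> z \<in> ?T"
    using ae
  proof eventually_elim
    case (elim z)
    show ?case
    proof
      assume z: "z \<in> E m"
      have "\<forall>j\<in>J. symb n (z j) = symb n (z i)" if n: "n \<ge> M" for n
      proof
        fix j assume j: "j \<in> J"
        have "n \<notin> B" "n \<ge> m + 2" using n m'[of n] by (auto simp: M_def)
        then have "\<sigma> n j = 0" using j by (auto simp: B_def)
        moreover have "g n z j = \<sigma> n j" using elim z \<open>n \<ge> m + 2\<close> by simp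
        ultimately show "symb n (z j) = symb n (z i)" using j by (simp add: g_def)
      qed
      moreover have "z \<in> level_set J M" using pE(2)[OF z] Ep z by (auto simp: level_set_def M_def)
      moreover have "\<not> good J n (syms J n z)" if "n \<ge> M" for n using z that by (auto simp: E_def M_def)
      ultimately show "z \<in> ?T" by blast
    qed
  qed
  then have "emeasure L (E m) \<le> emeasure L ?T"
    by (rule emeasure_mono_AE) (unfold Ls(1), rule T_sets)
  then have "emeasure L ?T \<noteq> 0" using m le_zero_eq by metis
  with T_sets show ?thesis by (intro exI conjI)
qed

text \<open>Take a partition into invariant blocks with the greatest number of blocks. A block with
  good symbols infinitely often would split further: the factor of its part \<open>V\<close> is 1 by
  \<open>scaling_trivial\<close>, so both \<open>V\<close> and \<open>J - V\<close> are
  invariant.\<close>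

theorem joining_partition:
  assumes jo: "ergodic_joining L" and I: "I \<noteq> {}"
  shows "\<exists>P. partition_on I P \<and> (\<forall>J\<in>P. scales L (restr J 1) 1 \<and> \<not> (AE z in L. often_good J z))"
proof -
  define Q where "Q P \<longleftrightarrow> partition_on I P \<and> (\<forall>J\<in>P. scales L (restr J 1) 1)" for P
  have "scales L (restr I 1) 1"
    using jo scales_cong[of "restr I 1" "\<lambda>_. 1"] by (simp add: ergodic_joining_def restr_def)
  then have "Q {I}" using I by (simp add: Q_def partition_on_space)
  moreover have "\<forall>P. Q P \<longrightarrow> card P < Suc (card (Pow I))"
  proof (intro allI impI)
    fix P assume "Q P"
    then have "P \<subseteq> Pow I" by (auto simp: Q_def partition_on_def)
    then show "card P < Suc (card (Pow I))" using finite_I by (simp add: card_mono le_imp_less_Suc)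
  qed
  ultimately obtain P where P: "Q P" and max: "\<And>P'. Q P' \<Longrightarrow> card P' \<le> card P"
    using Lattices_Big.ex_has_greatest_nat[of Q "{I}" card] by blast
  have part: "partition_on I P" and inv: "\<And>J. J \<in> P \<Longrightarrow> scales L (restr J 1) 1" using P by (auto simp: Q_def)
  have finP: "finite P" using finite_elements[OF finite_I part] .
  have "\<not> (AE z in L. often_good J z)" if J: "J \<in> P" for J
  proof
    assume io: "AE z in L. often_good J z"
    have JI: "J \<subseteq> I" using J part by (auto simp: partition_on_def)
    obtain V c where V: "V \<subseteq> J" "V \<noteq> {}" "V \<noteq> J" "c \<noteq> 0" "c \<noteq> \<infinity>" "scales L (restr V 1) c"
      using split_joining[OF jo JI inv[OF J] io] by blast
    have "c = 1" using scaling_trivial[OF jo _ V(2,6,4,5)] V(1) JI by blast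
    then have scV: "scales L (restr V 1) 1" using V(6) by simp
    have "(\<lambda>i. restr J 1 i + - restr V 1 i) = restr (J - V) 1"
      using V(1) by (intro ext) (auto simp: restr_def)
    then have scJV: "scales L (restr (J - V) 1) 1"
      using scales_add[OF inv[OF J] scales_uminus[OF scV]] by simp
    define P' where "P' = insert V (insert (J - V) (P - {J}))"
    have disj: "K \<inter> J = {}" if "K \<in> P - {J}" for K using part J that by (auto simp: partition_on_def disjoint_def)
    have "partition_on I P'"
    proof (rule partition_onI)
      show "\<Union> P' = I" using part J V(1) by (auto simp: P'_def partition_on_def)
      show "{} \<notin> P'" using part V(1-3) by (auto simp: P'_def partition_on_def)
      fix p q assume pq: "p \<in> P'" "q \<in> P'" "p \<noteq> q"
      have PP: "p \<inter> q = {}" if "p \<in> P" "q \<in> P" using part that pq(3) by (auto simp: partition_on_def disjoint_def)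
      show "disjnt p q"
        using pq PP disj V(1) unfolding P'_def disjnt_def by blast
    qed
    then have "Q P'" using scV scJV inv by (auto simp: Q_def P'_def)
    moreover have "card P' = Suc (card P)"
    proof -
      have "V \<notin> P - {J}" "J - V \<notin> P - {J}" using disj[of V] disj[of "J - V"] V(1-3) by blast+
      moreover have "V \<noteq> J - V" using V(2) by blast
      moreover have "card P > 0" using finP J by (auto simp: card_gt_0_iff)
      ultimately show ?thesis using finP J by (simp add: P'_def)
    qed
    ultimately show False using max[of P'] by simp
  qed
  then show ?thesis using part inv by blast
qed

end

lemma action_has_level:
  assumes "p \<in> chacon_points \<omega>" "has_level m p" "m < n" "\<bar>k\<bar> \<le> int n"
  shows "has_level n (chacon_action \<omega> k p)"
proof -
  have "\<bar>pos n p + k\<bar> \<le> radius n" using pos_margin[OF assms(1-3)] assms(4) by linarith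
  then show ?thesis using chacon_action(2)[OF assms(1) has_level_mono[OF assms(1,2) less_imp_le[OF assms(3)]]] by blast
qed

text \<open>Expresses equality through countably many measurable readings, which makes graphs of the
  action measurable sets.\<close>

lemma point_eq_iff:
  assumes "p \<in> chacon_points \<omega>" "q \<in> chacon_points \<omega>"
  shows "p = q \<longleftrightarrow> (\<forall>n. (has_level n p \<longleftrightarrow> has_level n q) \<and> pos n p = pos n q)"
proof
  assume *: "\<forall>n. (has_level n p \<longleftrightarrow> has_level n q) \<and> pos n p = pos n q"
  obtain n where n: "has_level n p" using has_some_level[OF assms(1)] by blast
  show "p = q" by (rule point_eqI_pos[OF assms n]) (use * n in auto)
qed simp

context chacon_product
begin

text \<open>Equal symbols and equal parameters freeze the differences of positions from level m on.
  These differences are invariant labels, hence almost constant on \<open>E\<close>; the graph they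
  define is an invariant set of positive measure and therefore conull.\<close>

lemma tied_graph:
  assumes jo: "ergodic_joining L" and J: "J \<subseteq> I" "i \<in> J" and io: "\<not> (AE z in L. often_good J z)"
    and w: "\<And>j. j \<in> J \<Longrightarrow> w j = \<omega>"
  shows "\<exists>k. k i = 0 \<and> (AE z in L. \<forall>j\<in>J. z j = chacon_action \<omega> (k j) (z i))"
proof -
  have L: "locally_finite L" and erg: "ergodic L (act (\<lambda>_. 1))" using jo by (auto simp: ergodic_joining_def)
  have Ls: "sets L = sets borel_prod" "space L = points" using L locally_finite_sets locally_finite_space by auto
  have iI: "i \<in> I" using J by blast
  obtain m where m: "{z \<in> level_set J m. \<forall>n\<ge>m. \<not> good J n (syms J n z) \<and> (\<exists>a. \<forall>j\<in>J. symb n (z j) = a)} \<in> sets borel_prod"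
    "emeasure L {z \<in> level_set J m. \<forall>n\<ge>m. \<not> good J n (syms J n z) \<and> (\<exists>a. \<forall>j\<in>J. symb n (z j) = a)} \<noteq> 0"
    using tied_levels[OF jo J(1) _ io] J(2) by blast
  define E where "E = {z \<in> level_set J m. \<forall>n\<ge>m. \<not> good J n (syms J n z) \<and> (\<exists>a. \<forall>j\<in>J. symb n (z j) = a)}"
  have E: "E \<in> sets borel_prod" "emeasure L E \<noteq> 0" unfolding E_def by (rule m(1), rule m(2))
  have Ep: "E \<subseteq> points" by (auto simp: E_def level_set_def)
  have pt: "z j \<in> chacon_points \<omega>" if "z \<in> points" "j \<in> J" for z j using points_mem[OF that(1), of j] J(1) w[OF that(2)] that(2) by auto
  have diff: "pos n (z j) - pos n (z i) = pos m (z j) - pos m (z i)" if z: "z \<in> E" and n: "n \<ge> m" and j: "j \<in> J" for z n j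
    using n
  proof (induction n rule: dec_induct)
    case (step n)
    have l: "z j \<in> chacon_points \<omega>" "z i \<in> chacon_points \<omega>" "has_level m (z j)" "has_level m (z i)"
      using z j J(2) pt Ep by (auto simp: E_def level_set_def)
    have "symb n (z j) = symb n (z i)" using z step(1) j J(2) by (auto simp: E_def)
    then show ?case
      using step pos_step(3)[OF l(1) has_level_mono[OF l(1,3) step(1)]] pos_step(3)[OF l(2) has_level_mono[OF l(2,4) step(1)]]
      by simp
  qed simp
  define g where "g z = (\<lambda>j\<in>J. pos m (z j) - pos m (z i))" for z :: "nat \<Rightarrow> chacon_point"
  have g_sets: "{z \<in> E. g z = c} \<in> sets borel_prod" for c
  proof -
    have "g z = (\<lambda>j\<in>J. (\<lambda>j\<in>J. pos m (z j)) j - (\<lambda>j\<in>J. pos m (z j)) i)" for z using J(2) by (auto simp: g_def)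
    then have "{z \<in> points. g z = c} \<in> sets borel_prod"
      using pred_discrete[OF J(1) pos_measurable, of "\<lambda>x. (\<lambda>j\<in>J. x j - x i) = c" m] by (simp add: pred_def)
    moreover have "{z \<in> E. g z = c} = E \<inter> {z \<in> points. g z = c}" using Ep by blast
    ultimately show ?thesis using E(1) by simp
  qed
  have "\<exists>c. emeasure L {z \<in> E. g z \<noteq> c} = 0"
  proof (rule label_constant[OF Ls(1) erg E g_sets])
    have "g ` E \<subseteq> PiE J (\<lambda>_. UNIV)" by (auto simp: g_def)
    moreover have "countable (PiE J (\<lambda>_. UNIV :: int set))"
      using finite_subset[OF J(1) finite_I] by (intro countable_PiE) auto
    ultimately show "countable (g ` E)" by (rule countable_subset)
    fix z k assume z: "z \<in> E" "act (\<lambda>_. k) z \<in> E"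
    then have zp: "z \<in> points" using Ep by blast
    obtain N where N: "N \<ge> m" "pdeep \<bar>k\<bar> N z" using exists_pdeep[OF zp] by blast
    have "pos N (act (\<lambda>_. k) z j) = pos N (z j) + k" if j: "j \<in> J" for j
    proof -
      have jI: "j \<in> I" using j J(1) by blast
      then have "has_level N (z j)" "\<bar>pos N (z j)\<bar> + \<bar>k\<bar> \<le> radius N" using N(2) by (auto simp: pdeep_def deep_def)
      then show ?thesis using chacon_action(3)[OF points_mem[OF zp jI], of N k] jI by (simp add: act_def)
    qed
    then show "g (act (\<lambda>_. k) z) = g z"
      using diff[OF z(1) N(1)] diff[OF z(2) N(1)] J(2) unfolding g_def by (intro restrict_ext) force
  qed
  then obtain c where c: "emeasure L {z \<in> E. g z \<noteq> c} = 0" by blast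
  define k where "k j = (if j \<in> J \<and> j \<noteq> i then c j else 0)" for j
  define S where "S = {z \<in> points. \<forall>j\<in>J. z j = chacon_action \<omega> (k j) (z i)}"
  have S_sets: "S \<in> sets borel_prod"
  proof -
    have [measurable]: "(\<lambda>z. z j) \<in> measurable borel_prod (chacon_borel \<omega>)" if "j \<in> J" for j
      using coord_measurable[of j] that J(1) w[OF that] by auto
    have "{z \<in> space borel_prod. z j = chacon_action \<omega> (k j) (z i)} \<in> sets borel_prod" if j: "j \<in> J" for j
    proof -
      note [measurable] = \<open>j \<in> J\<close> J(2)
      have "{z \<in> space borel_prod. \<forall>n. (has_level n (z j) \<longleftrightarrow> has_level n (chacon_action \<omega> (k j) (z i))) \<and>
          pos n (z j) = pos n (chacon_action \<omega> (k j) (z i))} \<in> sets borel_prod"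
        by measurable
      moreover have "z j = chacon_action \<omega> (k j) (z i) \<longleftrightarrow>
         (\<forall>n. (has_level n (z j) \<longleftrightarrow> has_level n (chacon_action \<omega> (k j) (z i))) \<and> pos n (z j) = pos n (chacon_action \<omega> (k j) (z i)))"
        if "z \<in> space borel_prod" for z
        by (rule point_eq_iff[OF pt[OF _ j] chacon_action_in[OF pt[OF _ J(2)]]]) (use that in simp_all)
      ultimately show ?thesis by (simp cong: conj_cong)
    qed
    then have "{z \<in> space borel_prod. \<forall>j\<in>J. z j = chacon_action \<omega> (k j) (z i)} \<in> sets borel_prod"
      by (intro sets.sets_Collect_finite_All finite_subset[OF J(1) finite_I])
    then show ?thesis by (simp add: S_def)
  qed
  have "act (\<lambda>_. 1) -` S \<inter> points = S"
  proof -
    have eqv: "chacon_action \<omega> 1 (z j) = chacon_action \<omega> (k j) (chacon_action \<omega> 1 (z i)) \<longleftrightarrow> z j = chacon_action \<omega> (k j) (z i)"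
      if z: "z \<in> points" and j: "j \<in> J" for z j
    proof -
      note p = pt[OF z j] pt[OF z J(2)]
      have "chacon_action \<omega> (k j) (chacon_action \<omega> 1 (z i)) = chacon_action \<omega> 1 (chacon_action \<omega> (k j) (z i))"
        using p by (simp add: chacon_action_add add.commute)
      moreover have "chacon_action \<omega> (-1) (chacon_action \<omega> 1 x) = x" if "x \<in> chacon_points \<omega>" for x
        using that by (simp add: chacon_action_add chacon_action_0)
      ultimately show ?thesis using p chacon_action_in by metis
    qed
    have ac: "act (\<lambda>_. 1) z j = chacon_action \<omega> 1 (z j)" if "j \<in> J" for z j using that J(1) w by (auto simp: act_def)
    show ?thesis
    proof (rule set_eqI)
      fix z
      have "(\<forall>j\<in>J. act (\<lambda>_. 1) z j = chacon_action \<omega> (k j) (act (\<lambda>_. 1) z i)) \<longleftrightarrow>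
          (\<forall>j\<in>J. z j = chacon_action \<omega> (k j) (z i))" if "z \<in> points"
        by (rule ball_cong[OF refl]) (simp only: ac J(2) eqv[OF that])
      then show "z \<in> act (\<lambda>_. 1) -` S \<inter> points \<longleftrightarrow> z \<in> S"
        using act_points[of z "\<lambda>_. 1"] unfolding S_def by blast
    qed
  qed
  then have S01: "S \<in> null_sets L \<or> points - S \<in> null_sets L"
    using erg S_sets Ls by (auto simp: ergodic_def)
  have "{z \<in> E. g z = c} \<subseteq> S"
  proof
    fix z assume z: "z \<in> {z \<in> E. g z = c}"
    then have zE: "z \<in> E" and zp: "z \<in> points" and gz: "g z = c" using Ep by auto
    have "z j = chacon_action \<omega> (k j) (z i)" if j: "j \<in> J" for j
    proof (cases "j = i")
      case True
      then show ?thesis using pt[OF zp J(2)] by (simp add: k_def chacon_action_0)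
    next
      case False
      then have kj: "k j = pos m (z j) - pos m (z i)" using j gz by (auto simp: k_def g_def)
      obtain N where N: "N \<ge> m" "has_level N (z i)" "\<bar>pos N (z i) + k j\<bar> \<le> radius N"
        using exists_margin_level[OF pt[OF zp J(2)]] by blast
      note act = chacon_action_pos[OF pt[OF zp J(2)] N(2,3)]
      have lj: "has_level m (z j)" using zE j by (auto simp: E_def level_set_def)
      show ?thesis
      proof (rule point_eqI_pos[OF pt[OF zp j] chacon_action_in[OF pt[OF zp J(2)]]])
        show "has_level N (z j)" by (rule has_level_mono[OF pt[OF zp j] lj N(1)])
        show "has_level N (chacon_action \<omega> (k j) (z i))" by (rule act(1)) simp
        fix n assume "N \<le> n"
        then show "pos n (z j) = pos n (chacon_action \<omega> (k j) (z i))"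
          using act(2)[of n] diff[OF zE _ j, of n] N(1) kj by simp
      qed
    qed
    then show "z \<in> S" using zp by (simp add: S_def)
  qed
  then have "emeasure L {z \<in> E. g z = c} \<le> emeasure L S" using S_sets Ls by (intro emeasure_mono) simp_all
  moreover have "emeasure L E \<le> emeasure L {z \<in> E. g z = c} + emeasure L {z \<in> E. g z \<noteq> c}"
  proof -
    have "{z \<in> E. g z \<noteq> c} = E - {z \<in> E. g z = c}" by blast
    then have "{z \<in> E. g z \<noteq> c} \<in> sets borel_prod" using E(1) g_sets by auto
    moreover have "{z \<in> E. g z = c} \<union> {z \<in> E. g z \<noteq> c} = E" by blast
    ultimately show ?thesis using emeasure_subadditive[of "{z \<in> E. g z = c}" L "{z \<in> E. g z \<noteq> c}"] g_sets[of c] Ls(1) by metis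
  qed
  ultimately have "emeasure L S \<noteq> 0" using E(2) c by auto
  then have "points - S \<in> null_sets L" using S01 by auto
  from AE_not_in[OF this] AE_space have "AE z in L. \<forall>j\<in>J. z j = chacon_action \<omega> (k j) (z i)"
    by eventually_elim (use Ls in \<open>auto simp: S_def\<close>)
  then show ?thesis by (intro exI[of _ k]) (simp add: k_def)
qed

end

section \<open>Joinings whose blocks are graphs\<close>

definition graph_map :: "(nat \<Rightarrow> bool) \<Rightarrow> (nat \<Rightarrow> int) \<Rightarrow> nat set \<Rightarrow> chacon_point \<Rightarrow> nat \<Rightarrow> chacon_point" where
  "graph_map \<omega> k J x = (\<lambda>j\<in>J. chacon_action \<omega> (k j) x)"

text \<open>The outcome of the structure theory as hypotheses: invariant blocks, each almost surely
  a graph over its least index, the distinguished index of \<open>graph_joining\<close>. From these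
  data the measure is computed.\<close>

locale tied_joining = chacon_product "\<lambda>_. \<omega>" I for \<omega> I +
  fixes L :: "(nat \<Rightarrow> chacon_point) measure" and P :: "nat set set" and k :: "nat \<Rightarrow> int"
  assumes locally_finite: "locally_finite L" and positive: "emeasure L points \<noteq> 0"
    and part: "partition_on I P" and invariant: "\<And>J. J \<in> P \<Longrightarrow> scales L (restr J 1) 1"
    and k_Min: "\<And>J. J \<in> P \<Longrightarrow> k (Min J) = 0"
    and tied: "\<And>J. J \<in> P \<Longrightarrow> AE z in L. \<forall>j\<in>J. z j = chacon_action \<omega> (k j) (z (Min J))"
begin

definition reps :: "nat set" where
  "reps = Min ` P"

lemma block_sub: "J \<in> P \<Longrightarrow> J \<subseteq> I"
  using part by (auto simp: partition_on_def)

lemma finite_P: "finite P"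
  using finite_elements[OF finite_I part] .

lemma block_finite: "J \<in> P \<Longrightarrow> finite J"
  using block_sub finite_I finite_subset by blast

lemma Min_block: "J \<in> P \<Longrightarrow> Min J \<in> J"
  using part block_finite by (intro Min_in) (auto simp: partition_on_def)

lemma reps_sub: "reps \<subseteq> I"
  using Min_block block_sub by (auto simp: reps_def)

lemma block_unique: "J \<in> P \<Longrightarrow> K \<in> P \<Longrightarrow> j \<in> J \<Longrightarrow> j \<in> K \<Longrightarrow> J = K"
  using part by (auto simp: partition_on_def disjoint_def)

lemma inj_Min: "inj_on Min P"
  using block_unique Min_block by (metis inj_onI)

lemma reps_block: "J \<in> P \<Longrightarrow> r \<in> reps \<Longrightarrow> r \<in> J \<longleftrightarrow> r = Min J"
  using block_unique Min_block by (auto simp: reps_def)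

sublocale R: chacon_product "\<lambda>_. \<omega>" reps
  by unfold_locales (simp add: reps_def finite_P)

lemma L_sets: "sets L = sets borel_prod" "space L = points"
  using locally_finite locally_finite_sets locally_finite_space by auto

text \<open>One coordinate per block determines the others almost everywhere, so this projection
  keeps all information on \<open>L\<close>.\<close>

definition marginal :: "(nat \<Rightarrow> chacon_point) measure" where
  "marginal = distr L R.borel_prod (\<lambda>z. restrict z reps)"

lemma restrict_measurable: "(\<lambda>z. restrict z reps) \<in> measurable L R.borel_prod"
proof -
  have "(\<lambda>z. restrict z reps) \<in> measurable borel_prod R.borel_prod"
    unfolding borel_prod_def R.borel_prod_def using reps_sub by (rule measurable_restrict_subset)
  then show ?thesis by (simp cong: measurable_cong_sets add: L_sets)
qed

lemma emeasure_marginal: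
  "E \<in> sets R.borel_prod \<Longrightarrow> emeasure marginal E = emeasure L {z \<in> points. restrict z reps \<in> E}"
  unfolding marginal_def
  by (subst emeasure_distr[OF restrict_measurable])
    (auto simp: L_sets vimage_def Int_def conj_commute)

lemma tied_all: "AE z in L. \<forall>J\<in>P. \<forall>j\<in>J. z j = chacon_action \<omega> (k j) (z (Min J))"
  by (rule AE_finite_allI[OF finite_P]) (rule tied)

text \<open>Projections of a Radon measure may fail to be locally finite. Here the forgotten
  coordinates are translates of kept ones by the fixed amounts \<open>k\<close>, so the preimage of
  a box lies, up to a null set, in one level, which has finite measure.\<close>

lemma marginal_locally_finite: "R.locally_finite marginal"
proof -
  have "emeasure marginal (R.pbox m f) < \<infinity>" for m f
  proof -
    define n where "n = Suc (Max (insert m ((\<lambda>i. nat \<bar>k i\<bar>) ` I)))"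
    have n: "\<bar>k i\<bar> \<le> int n" if "i \<in> I" for i
    proof -
      have "nat \<bar>k i\<bar> \<le> Max (insert m ((\<lambda>i. nat \<bar>k i\<bar>) ` I))" using that finite_I by (intro Max_ge) auto
      then show ?thesis by (simp add: n_def)
    qed
    have mn: "m < n" using finite_I by (simp add: n_def less_Suc_eq_le)
    have "AE z in L. z \<in> {z \<in> points. restrict z reps \<in> R.pbox m f} \<longrightarrow> z \<in> level_set I n"
      using tied_all
    proof eventually_elim
      case (elim z)
      show ?case
      proof
        assume z: "z \<in> {z \<in> points. restrict z reps \<in> R.pbox m f}"
        have "has_level n (z i)" if i: "i \<in> I" for i
        proof -
          obtain J where J: "J \<in> P" "i \<in> J" using i part by (auto simp: partition_on_def)
          have r: "Min J \<in> reps" using J by (auto simp: reps_def)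
          have "z (Min J) \<in> chacon_points \<omega>" "has_level m (z (Min J))"
            using z r by (auto simp: R.mem_box dest: R.points_mem)
          then show ?thesis using elim J action_has_level[OF _ _ mn n[OF i]] by auto
        qed
        then show "z \<in> level_set I n" using z by (simp add: level_set_def)
      qed
    qed
    then have "emeasure L {z \<in> points. restrict z reps \<in> R.pbox m f} \<le> emeasure L (level_set I n)"
      by (rule emeasure_mono_AE) (use level_set_sets[OF subset_refl] L_sets in simp)
    also have "\<dots> < \<infinity>" by (rule emeasure_level_set[OF locally_finite])
    finally show ?thesis by (simp add: emeasure_marginal)
  qed
  then show ?thesis by (simp add: R.locally_finite_def marginal_def)
qed

text \<open>Moving one representative is the projection of moving its whole block, which leaves
  \<open>L\<close> invariant.\<close>

lemma marginal_invariant: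
  assumes r: "r \<in> reps"
  shows "R.scales marginal (restr {r} 1) 1"
  unfolding R.scales_def
proof
  obtain J where J: "J \<in> P" "r = Min J" using r by (auto simp: reps_def)
  fix E assume E: "E \<in> sets R.borel_prod"
  define D where "D = {z \<in> points. restrict z reps \<in> E}"
  have D: "D \<in> sets borel_prod"
    using measurable_sets[OF restrict_measurable E] L_sets by (simp add: D_def vimage_def Int_def conj_commute)
  have "{z \<in> points. restrict z reps \<in> R.act (restr {r} 1) -` E \<inter> R.points} = act (restr J 1) -` D \<inter> points"
  proof -
    have "R.act (restr {r} 1) (restrict z reps) = restrict (act (restr J 1) z) reps" for z
      using reps_block[OF J(1)] reps_sub J(2) by (auto simp: R.act_def act_def restr_def fun_eq_iff)
    moreover have "restrict z reps \<in> R.points" if "z \<in> points" for z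
      using points_mem[OF that] reps_sub by (auto simp: R.points_def)
    ultimately show ?thesis using act_points by (auto simp: D_def)
  qed
  then have "emeasure marginal (R.act (restr {r} 1) -` E \<inter> R.points) = emeasure L (act (restr J 1) -` D \<inter> points)"
    using R.act_vimage[OF E] by (simp add: emeasure_marginal)
  also have "\<dots> = emeasure L D" using scalesD[OF invariant[OF J(1)] D] by simp
  finally show "emeasure marginal (R.act (restr {r} 1) -` E \<inter> R.points) = 1 * emeasure marginal E"
    by (simp add: emeasure_marginal[OF E] D_def)
qed

definition mass :: ennreal where
  "mass = emeasure marginal (R.pbox 0 (\<lambda>_. 0))"

lemma marginal_eq: "marginal = scale_measure mass R.chacon_prod"
  unfolding mass_def by (rule R.invariant_unique[OF marginal_locally_finite marginal_invariant])

lemma mass_finite: "mass < \<infinity>"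
  using marginal_locally_finite by (simp add: mass_def R.locally_finite_def)

lemma mass_positive: "mass \<noteq> 0"
proof
  assume "mass = 0"
  then have "emeasure marginal R.points = 0" by (simp add: marginal_eq)
  moreover have "R.points \<in> sets R.borel_prod" using sets.top[of R.borel_prod] by simp
  moreover have "{z \<in> points. restrict z reps \<in> R.points} = points"
    using points_mem reps_sub by (auto simp: R.points_def)
  ultimately show False using positive emeasure_marginal[of R.points] by simp
qed

text \<open>The preimage of a rectangle over \<open>J\<close> under the graph map.\<close>

definition block_set :: "(nat \<Rightarrow> chacon_point set) \<Rightarrow> nat set \<Rightarrow> chacon_point set" where
  "block_set A J = {x \<in> chacon_points \<omega>. \<forall>j\<in>J. chacon_action \<omega> (k j) x \<in> A j}"

lemma block_set_sets:
  assumes "J \<in> P" "\<And>j. j \<in> J \<Longrightarrow> A j \<in> sets (chacon_borel \<omega>)"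
  shows "block_set A J \<in> sets (chacon_borel \<omega>)"
proof -
  have "{x \<in> space (chacon_borel \<omega>). chacon_action \<omega> (k j) x \<in> A j} \<in> sets (chacon_borel \<omega>)" if "j \<in> J" for j
    using measurable_sets[OF chacon_action_measurable assms(2)[OF that], of "k j"]
    by (simp add: vimage_def Int_def conj_commute)
  then have "{x \<in> space (chacon_borel \<omega>). \<forall>j\<in>J. chacon_action \<omega> (k j) x \<in> A j} \<in> sets (chacon_borel \<omega>)"
    by (intro sets.sets_Collect_finite_All block_finite[OF assms(1)])
  then show ?thesis unfolding block_set_def space_chacon_borel .
qed

text \<open>On each block the conditions on the coordinates combine into a single condition on the
  representative, and the marginal is a multiple of the product measure by
  \<open>marginal_eq\<close>.\<close>

theorem emeasure_rectangle:
  assumes A: "\<And>i. i \<in> I \<Longrightarrow> A i \<in> sets (chacon_borel \<omega>)"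
  shows "emeasure L (PiE I A) = mass * (\<Prod>J\<in>P. emeasure (chacon_measure \<omega>) (block_set A J))"
proof -
  define A' where "A' r = block_set A (the_inv_into P Min r)" for r
  have A'Min: "A' (Min J) = block_set A J" if "J \<in> P" for J
    using the_inv_into_f_f[OF inj_Min that] by (simp add: A'_def)
  have bs: "block_set A J \<in> sets (chacon_borel \<omega>)" if "J \<in> P" for J
    by (rule block_set_sets[OF that]) (use A block_sub[OF that] in blast)
  have A's: "A' r \<in> sets (chacon_borel \<omega>)" if "r \<in> reps" for r
    using that A'Min bs by (auto simp: reps_def)
  have RA: "PiE reps A' \<in> sets R.borel_prod"
    unfolding R.borel_prod_def by (intro sets_PiM_I_finite R.finite_I A's)
  have "emeasure L (PiE I A) = emeasure L {z \<in> points. restrict z reps \<in> PiE reps A'}"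
  proof (rule emeasure_eq_AE)
    show "AE z in L. z \<in> PiE I A \<longleftrightarrow> z \<in> {z \<in> points. restrict z reps \<in> PiE reps A'}"
      using tied_all AE_space
    proof eventually_elim
      case (elim z)
      then have zp: "z \<in> points" using L_sets by simp
      have Psub: "x \<in> I \<longleftrightarrow> (\<exists>J\<in>P. x \<in> J)" for x using part by (auto simp: partition_on_def)
      have "z \<in> PiE I A \<longleftrightarrow> (\<forall>i\<in>I. z i \<in> A i)" using zp by (auto simp: points_def PiE_iff)
      also have "\<dots> \<longleftrightarrow> (\<forall>J\<in>P. \<forall>j\<in>J. z j \<in> A j)" using Psub by blast
      also have "\<dots> \<longleftrightarrow> (\<forall>J\<in>P. z (Min J) \<in> block_set A J)"
      proof (rule ball_cong[OF refl])
        fix J assume J: "J \<in> P"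
        have "z (Min J) \<in> chacon_points \<omega>" using points_mem[OF zp, of "Min J"] Min_block[OF J] block_sub[OF J] by blast
        then show "(\<forall>j\<in>J. z j \<in> A j) \<longleftrightarrow> z (Min J) \<in> block_set A J"
          using elim(1) J by (simp add: block_set_def)
      qed
      also have "\<dots> \<longleftrightarrow> (\<forall>r\<in>reps. z r \<in> A' r)" using A'Min by (auto simp: reps_def)
      also have "\<dots> \<longleftrightarrow> z \<in> {z \<in> points. restrict z reps \<in> PiE reps A'}" using zp by auto
      finally show ?case .
    qed
    show "PiE I A \<in> sets L" unfolding L_sets borel_prod_def by (intro sets_PiM_I_finite finite_I A)
    show "{z \<in> points. restrict z reps \<in> PiE reps A'} \<in> sets L"
      using measurable_sets[OF restrict_measurable RA] L_sets by (simp add: vimage_def Int_def conj_commute)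
  qed
  also have "\<dots> = emeasure marginal (PiE reps A')" by (rule emeasure_marginal[OF RA, symmetric])
  also have "\<dots> = mass * (\<Prod>r\<in>reps. emeasure (chacon_measure \<omega>) (A' r))"
    using RA R.emeasure_chacon_prod[OF A's] by (simp add: marginal_eq)
  also have "(\<Prod>r\<in>reps. emeasure (chacon_measure \<omega>) (A' r)) = (\<Prod>J\<in>P. emeasure (chacon_measure \<omega>) (block_set A J))"
    unfolding reps_def by (subst prod.reindex[OF inj_Min]) (simp add: A'Min)
  finally show ?thesis .
qed

end

section \<open>Ergodicity of products\<close>

text \<open>Boxes with a margin of at least every |v i| are carried to boxes of the same level, and
  these have equal product measure.\<close>

lemma (in chacon_product) scales_chacon_prod: "scales chacon_prod v 1"
proof -
  have meas: "act v \<in> measurable chacon_prod borel_prod" using act_measurable by (simp cong: measurable_cong_sets)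
  define g where "g = Max (insert 0 ((\<lambda>i. \<bar>v i\<bar>) ` I))"
  have g: "\<bar>v i\<bar> \<le> g" if "i \<in> I" for i using that finite_I by (auto simp: g_def)
  have g0: "g \<ge> 0" using finite_I by (auto simp: g_def)
  have "chacon_prod = distr chacon_prod borel_prod (act v)"
  proof (rule measure_eq_boxes[OF locally_finite_chacon_prod, where g = g])
    fix n f assume f: "\<And>i. i \<in> I \<Longrightarrow> \<bar>f i\<bar> + g \<le> radius n"
    have b: "\<bar>f i\<bar> \<le> radius n" "\<bar>f i - v i\<bar> \<le> radius n" if "i \<in> I" for i using f[OF that] g[OF that] g0 by auto
    then show "emeasure chacon_prod (pbox n f) = emeasure (distr chacon_prod borel_prod (act v)) (pbox n f)"
      by (simp add: emeasure_distr[OF meas] box_act emeasure_chacon_prod_box)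
  qed simp
  then show ?thesis unfolding scales_def using emeasure_distr[OF meas] by (metis mult_1 space_chacon_prod)
qed

locale chacon_pair = chacon_product +
  fixes a b :: nat
  assumes I_eq: "I = {a, b}" and ab: "a \<noteq> b"
begin

lemma ab_mem [simp]: "a \<in> I" "b \<in> I"
  by (auto simp: I_eq)

lemma I_cases: "i \<in> I \<longleftrightarrow> i = a \<or> i = b"
  by (auto simp: I_eq)

lemma prod_I: "(\<Prod>i\<in>I. f i) = f a * f b"
  using ab by (simp add: I_eq)

text \<open>With equal parameters, raising -1 in one coordinate and 0 in the other crosses two gaps
  of different length. With different parameters the gaps are in opposite order, so raising -1 in
  both coordinates already separates them.\<close>

lemma good_exists: "\<exists>s\<in>PiE I (\<lambda>_. symbols). good I n s"
proof (cases "w a n = w b n")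
  case True
  define s where "s = (\<lambda>i\<in>I. if i = a then -1 else 0 :: int)"
  define v where "v j = digit (w j) n (s j + 1) - digit (w j) n (s j) - height n" for j
  have "jump I n v s 1"
    using True ab by (auto simp: I_eq jump_def v_def s_def symbols_def digit_def of_bool_def)
  then show ?thesis by (intro bexI[of _ s]) (auto simp: good_def s_def symbols_def)
next
  case False
  define s where "s = (\<lambda>i\<in>I. -1 :: int)"
  define v where "v j = digit (w j) n (s j + 1) - digit (w j) n (s j) - height n" for j
  have "jump I n v s 1"
    using False ab by (auto simp: I_eq jump_def v_def s_def symbols_def digit_def of_bool_def)
  then show ?thesis by (intro bexI[of _ s]) (auto simp: good_def s_def symbols_def)
qed

lemma AE_often_good: "AE z in chacon_prod. often_good I z"
proof -
  have "\<forall>n. \<exists>s. s \<in> PiE I (\<lambda>_. symbols) \<and> good I n s" using good_exists by blast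
  from choice[OF this] obtain \<tau> where \<tau>: "\<forall>n. \<tau> n \<in> PiE I (\<lambda>_. symbols) \<and> good I n (\<tau> n)" ..
  define N where "N m = {z \<in> level_set I m. \<forall>n\<ge>m. n \<in> UNIV \<longrightarrow> syms I n z \<noteq> \<tau> n}" for m
  have "(\<Union>m. N m) \<in> null_sets chacon_prod"
    unfolding N_def by (rule null_sets_UN, rule null_avoid) (use \<tau> in auto)
  from AE_not_in[OF this] AE_space show ?thesis
  proof eventually_elim
    case (elim z)
    show ?case
      unfolding often_good_def
    proof
      fix m
      have zp: "z \<in> points" using elim by simp
      then obtain m' where m': "m' \<ge> m" "pdeep 0 m' z" using exists_pdeep by blast
      then have "z \<in> level_set I m'" using zp by (auto simp: level_set_def pdeep_def deep_def)
      then obtain n where "n \<ge> m'" "syms I n z = \<tau> n" using elim unfolding N_def by blast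
      then show "\<exists>n\<ge>m. good I n (syms I n z)" using \<tau> m'(1) by (intro exI[of _ n]) auto
    qed
  qed
qed

lemma locally_finite_density:
  assumes B: "B \<in> sets borel_prod"
  shows "locally_finite (density chacon_prod (indicator B))"
    and "E \<in> sets borel_prod \<Longrightarrow> emeasure (density chacon_prod (indicator B)) E = emeasure chacon_prod (B \<inter> E)"
proof -
  have em: "emeasure (density chacon_prod (indicator B)) E = emeasure chacon_prod (B \<inter> E)"
    if E: "E \<in> sets borel_prod" for E
  proof -
    have s: "B \<in> sets chacon_prod" "E \<in> sets chacon_prod" "B \<inter> E \<in> sets chacon_prod" using B E by auto
    have "emeasure (density chacon_prod (indicator B)) E = (\<integral>\<^sup>+x. indicator B x * indicator E x \<partial>chacon_prod)"
      by (rule emeasure_density[OF borel_measurable_indicator[OF s(1)] s(2)])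
    also have "\<dots> = (\<integral>\<^sup>+x. indicator (B \<inter> E) x \<partial>chacon_prod)" by (simp add: indicator_inter_arith)
    finally show ?thesis using nn_integral_indicator[OF s(3)] by simp
  qed
  then show "E \<in> sets borel_prod \<Longrightarrow> emeasure (density chacon_prod (indicator B)) E = emeasure chacon_prod (B \<inter> E)" .
  have "emeasure (density chacon_prod (indicator B)) (pbox n f) < \<infinity>" for n f
  proof -
    have "emeasure chacon_prod (B \<inter> pbox n f) \<le> emeasure chacon_prod (pbox n f)" by (intro emeasure_mono) auto
    also have "\<dots> < \<infinity>" using locally_finite_chacon_prod by (simp add: locally_finite_def)
    finally show ?thesis by (simp add: em)
  qed
  then show "locally_finite (density chacon_prod (indicator B))" by (simp add: locally_finite_def)
qed

text \<open>
  If \<open>B\<close> is invariant and disjoint from its translate along one coordinate, then the restriction of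
  the product measure to \<open>B\<close> is dominated by measures living on translates disjoint from \<open>B\<close>.
\<close>

lemma wandering_translate_null:
  assumes A: "A \<in> sets borel_prod" and inv: "act (\<lambda>_. 1) -` A \<inter> points = A"
  shows "A - act (restr {b} 1) -` A \<in> null_sets chacon_prod"
proof -
  define B where "B = A - act (restr {b} 1) -` A"
  have Ap: "A \<subseteq> points" using sets.sets_into_space[OF A] by simp
  have Beq: "B = A - (act (restr {b} 1) -` A \<inter> points)" using Ap by (auto simp: B_def)
  have B: "B \<in> sets borel_prod" unfolding Beq by (intro sets.Diff A act_vimage)
  have Bp: "B \<subseteq> points" using Ap by (auto simp: B_def)
  have A1: "act (\<lambda>_. 1) z \<in> A \<longleftrightarrow> z \<in> A" if "z \<in> points" for z using inv that by blast
  have B1: "act (\<lambda>_. 1) z \<in> B \<longleftrightarrow> z \<in> B" if z: "z \<in> points" for z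
  proof -
    have "act (restr {b} 1) (act (\<lambda>_. 1) z) = act (\<lambda>_. 1) (act (restr {b} 1) z)"
      using z by (simp add: act_act add.commute)
    then show ?thesis using A1[OF z] A1[OF act_points[OF z]] by (simp add: B_def)
  qed
  define L where "L = density chacon_prod (indicator B)"
  have lf: "locally_finite L" and em: "\<And>E. E \<in> sets borel_prod \<Longrightarrow> emeasure L E = emeasure chacon_prod (B \<inter> E)"
    unfolding L_def using locally_finite_density[OF B] by auto
  have sc: "scales L (restr I 1) 1"
    unfolding scales_def
  proof
    fix E assume E: "E \<in> sets borel_prod"
    have eq: "act (restr I 1) = act (\<lambda>_. 1)" by (rule act_cong) (auto simp: restr_def)
    have "B \<inter> (act (\<lambda>_. 1) -` E \<inter> points) = act (\<lambda>_. 1) -` (B \<inter> E) \<inter> points" using B1 Bp by auto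
    then show "emeasure L (act (restr I 1) -` E \<inter> points) = 1 * emeasure L E"
      using scalesD[OF scales_chacon_prod, of "B \<inter> E" "\<lambda>_. 1"] B E unfolding eq
      by (simp add: em act_vimage)
  qed
  have io: "AE z in L. often_good I z"
  proof -
    have "(indicator B :: _ \<Rightarrow> ennreal) \<in> borel_measurable chacon_prod"
      by (rule borel_measurable_indicator) (use B in simp)
    then show ?thesis unfolding L_def using AE_often_good by (subst AE_density) (auto elim: eventually_mono)
  qed
  have "B \<inter> (act (fst q) -` B \<inter> points) = {}" if q: "q \<in> jumps I" for q
  proof (rule ccontr)
    assume "B \<inter> (act (fst q) -` B \<inter> points) \<noteq> {}"
    then obtain z where z: "z \<in> B" "act (fst q) z \<in> B" by blast
    have zp: "z \<in> points" using z(1) Bp by blast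
    obtain v s t where qv: "q = (v, s, t)" by (metis prod.exhaust)
    have "\<forall>j\<in>I. v j \<in> {0, t}" "\<exists>i\<in>I. \<exists>j\<in>I. v i \<noteq> v j" and t: "t = 1 \<or> t = -1"
      using q by (auto simp: jumps_def qv)
    then have v: "v a \<in> {0, t}" "v b \<in> {0, t}" "v a \<noteq> v b" unfolding I_eq by auto
    have no: False if "y \<in> B" "act (restr {b} 1) y \<in> B" for y using that by (auto simp: B_def)
    \<comment> \<open>\<open>v\<close> is the constant vector \<open>v a\<close> plus
      \<open>e\<close> at the coordinate \<open>b\<close>. The constant part preserves
      \<open>B\<close>, and \<open>e\<close> is 1 or -1 because the values of \<open>v\<close> are 0
      and t.\<close>
    define e where "e = v b - v a"
    have "act v z = act (\<lambda>_. v a) (act (restr {b} e) z)"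
      unfolding act_act[OF zp] by (rule fun_cong[OF act_cong]) (use ab in \<open>auto simp: restr_def e_def I_cases\<close>)
    moreover have "act (\<lambda>_. v a) y \<in> B \<longleftrightarrow> y \<in> B" if y: "y \<in> points" for y
    proof -
      have "v a = 0 \<or> v a = 1 \<or> v a = -1" using v t by auto
      moreover have "act (\<lambda>_. 1) (act (\<lambda>_. - 1) y) = y" using act_act[OF y] act_zero[OF y] by simp
      ultimately show ?thesis using B1[OF y] B1[OF act_points[OF y], of "\<lambda>_. -1"] act_zero[OF y] by auto
    qed
    ultimately have ez: "act (restr {b} e) z \<in> B" using z(2) act_points[OF zp] by (simp add: qv)
    have "e = 1 \<or> e = -1" using v t by (auto simp: e_def)
    then show False
    proof
      assume "e = 1" then show False using no[OF z(1)] ez by simp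
    next
      assume e: "e = -1"
      have "act (restr {b} 1) (act (restr {b} (-1)) z) = z"
        using act_act[OF zp] by (simp add: act_zero[OF zp] restr_def)
      then show False using no[OF ez] z(1) e by simp
    qed
  qed
  then have "emeasure L (act (fst q) -` B \<inter> points) = 0" if "q \<in> jumps I" for q
    using that em[OF act_vimage[OF B]] by simp
  then have "emeasure L B \<le> 0" using domination[OF lf subset_refl sc io B] by simp
  then have "emeasure chacon_prod B = 0" using em[OF B] by simp
  then show ?thesis using B by (auto simp: B_def)
qed

text \<open>Applied to \<open>A\<close> and to its complement,
  \<open>wandering_translate_null\<close> makes \<open>A\<close> invariant up to null sets under
  coordinate \<open>b\<close>, and together with the diagonal also under \<open>a\<close>. The
  product measure restricted to \<open>A\<close> is then invariant in each coordinate, hence a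
  multiple of the product measure, yet it vanishes off \<open>A\<close>.\<close>

theorem product_ergodic: "ergodic chacon_prod (act (\<lambda>_. 1))"
  unfolding ergodic_def
proof (intro ballI impI)
  fix A assume "A \<in> sets chacon_prod" and "act (\<lambda>_. 1) -` A \<inter> space chacon_prod = A"
  then have A: "A \<in> sets borel_prod" and inv: "act (\<lambda>_. 1) -` A \<inter> points = A" by auto
  have Ap: "A \<subseteq> points" using sets.sets_into_space[OF A] by simp
  have C: "points - A \<in> sets borel_prod" using sets.compl_sets[OF A] by simp
  have invC: "act (\<lambda>_. 1) -` (points - A) \<inter> points = points - A" using inv act_points by auto
  have A1: "act (\<lambda>_. 1) z \<in> A \<longleftrightarrow> z \<in> A" if "z \<in> points" for z using inv that by blast
  define e where "e i = restr {i} 1" for i :: nat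
  have aeb: "AE z in chacon_prod. act (e b) z \<in> A \<longleftrightarrow> z \<in> A"
    using AE_not_in[OF wandering_translate_null[OF A inv]] AE_not_in[OF wandering_translate_null[OF C invC]] AE_space
  proof eventually_elim
    case (elim z)
    then show ?case using act_points[of z "e b"] by (auto simp: e_def)
  qed
  have aea: "AE z in chacon_prod. act (e a) z \<in> A \<longleftrightarrow> z \<in> A"
  proof -
    have meas: "act (e a) \<in> measurable chacon_prod chacon_prod" using act_measurable by (simp cong: measurable_cong_sets)
    have "AE z in chacon_prod. act (e b) (act (e a) z) \<in> A \<longleftrightarrow> act (e a) z \<in> A"
      by (rule AE_preimage[OF meas distr_act[OF sets_chacon_prod scales_chacon_prod] aeb])
    then show ?thesis
      using AE_space
    proof eventually_elim
      case (elim z)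
      then have zp: "z \<in> points" by simp
      have "act (e b) (act (e a) z) = act (\<lambda>_. 1) z"
        unfolding act_act[OF zp] by (rule fun_cong[OF act_cong]) (use ab in \<open>auto simp: restr_def e_def I_cases\<close>)
      then show ?case using elim(1) A1[OF zp] by simp
    qed
  qed
  have ae: "AE z in chacon_prod. act (e i) z \<in> A \<longleftrightarrow> z \<in> A" if "i \<in> I" for i
    using that aea aeb by (auto simp: I_cases)
  define L where "L = density chacon_prod (indicator A)"
  have lf: "locally_finite L" and em: "\<And>E. E \<in> sets borel_prod \<Longrightarrow> emeasure L E = emeasure chacon_prod (A \<inter> E)"
    unfolding L_def using locally_finite_density[OF A] by auto
  have sc: "scales L (e i) 1" if i: "i \<in> I" for i
    unfolding scales_def
  proof
    fix E assume E: "E \<in> sets borel_prod"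
    have "emeasure chacon_prod (A \<inter> (act (e i) -` E \<inter> points)) = emeasure chacon_prod (act (e i) -` (A \<inter> E) \<inter> points)"
    proof (rule emeasure_eq_AE)
      show "AE z in chacon_prod. z \<in> A \<inter> (act (e i) -` E \<inter> points) \<longleftrightarrow> z \<in> act (e i) -` (A \<inter> E) \<inter> points"
        using ae[OF i] by eventually_elim auto
      show "A \<inter> (act (e i) -` E \<inter> points) \<in> sets chacon_prod" using A act_vimage[OF E] by simp
      show "act (e i) -` (A \<inter> E) \<inter> points \<in> sets chacon_prod" using act_vimage[OF sets.Int[OF A E]] by simp
    qed
    then show "emeasure L (act (e i) -` E \<inter> points) = 1 * emeasure L E"
      using scalesD[OF scales_chacon_prod sets.Int[OF A E]] by (simp add: em act_vimage[OF E] E)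
  qed
  have Leq: "L = scale_measure (emeasure L (pbox 0 (\<lambda>_. 0))) chacon_prod"
    by (rule invariant_unique[OF lf]) (use sc in \<open>auto simp: e_def\<close>)
  define c where "c = emeasure L (pbox 0 (\<lambda>_. 0))"
  have Lc: "emeasure L E = c * emeasure chacon_prod E" if "E \<in> sets borel_prod" for E
    using that arg_cong[OF Leq, of "\<lambda>M. emeasure M E"] by (simp add: c_def)
  have "A \<inter> (points - A) = {}" by blast
  then have "emeasure L (points - A) = 0" using em[OF C] by simp
  then have "c = 0 \<or> emeasure chacon_prod (points - A) = 0" using Lc[OF C] by simp
  moreover have "emeasure chacon_prod A = 0" if "c = 0" using Lc[OF A] em[OF A] that by simp
  ultimately show "A \<in> null_sets chacon_prod \<or> space chacon_prod - A \<in> null_sets chacon_prod"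
    using A C by auto
qed

end

section \<open>Total ergodicity\<close>

lemma action_power:
  assumes "p \<in> chacon_points \<omega>"
  shows "(chacon_action \<omega> g ^^ n) p = chacon_action \<omega> (int n * g) p"
  by (induction n) (auto simp: assms chacon_action_0 chacon_action_add algebra_simps)

text \<open>Negative iterates use \<open>inv_into\<close>, which agrees with the action of -1 only
  on the space; the induction therefore also records that the orbit stays in it.\<close>

lemma int_iter_action:
  assumes p: "p \<in> chacon_points \<omega>"
  shows "int_iter (chacon_points \<omega>) (chacon_action \<omega> 1) m p = chacon_action \<omega> m p"
proof (cases "m \<ge> 0")
  case True
  then show ?thesis using action_power[OF p, where g = 1 and n = "nat m"] by (simp add: int_iter_def)
next
  case False
  let ?T = "chacon_action \<omega> 1"
  have inj: "inj_on ?T (chacon_points \<omega>)"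
  proof (rule inj_onI)
    fix x y assume x: "x \<in> chacon_points \<omega>" and y: "y \<in> chacon_points \<omega>" and eq: "?T x = ?T y"
    have cancel: "chacon_action \<omega> (-1) (?T q) = q" if "q \<in> chacon_points \<omega>" for q
      using that by (simp add: chacon_action_add chacon_action_0)
    show "x = y" using cancel[OF x] cancel[OF y] unfolding eq by simp
  qed
  have inv: "inv_into (chacon_points \<omega>) ?T x = chacon_action \<omega> (-1) x" if "x \<in> chacon_points \<omega>" for x
    using that by (intro inv_into_f_eq[OF inj]) (auto simp: chacon_action_in chacon_action_add chacon_action_0)
  have "(inv_into (chacon_points \<omega>) ?T ^^ n) p = (chacon_action \<omega> (-1) ^^ n) p \<and>
      (chacon_action \<omega> (-1) ^^ n) p \<in> chacon_points \<omega>" for n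
    by (induction n) (auto simp: p inv chacon_action_in)
  then show ?thesis using False action_power[OF p, where g = "-1" and n = "nat (- m)"] by (simp add: int_iter_def)
qed

text \<open>Two points are compared by their itineraries through \<open>A\<close>. Agreement is
  invariant under the diagonal action, and it has positive measure because itineraries have period
  m, so one of finitely many has positive measure. Ergodicity of the product makes agreement almost
  sure, so \<open>A\<close> times its complement is null.\<close>

theorem chacon_power_ergodic:
  assumes m: "m \<noteq> 0" and A: "A \<in> sets (chacon_borel \<omega>)"
    and inv: "\<And>p. p \<in> chacon_points \<omega> \<Longrightarrow> chacon_action \<omega> m p \<in> A \<longleftrightarrow> p \<in> A"
  shows "A \<in> null_sets (chacon_measure \<omega>) \<or> chacon_points \<omega> - A \<in> null_sets (chacon_measure \<omega>)"
proof -
  obtain a b :: nat where ab: "a \<noteq> b" using zero_neq_one by blast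
  define I where "I = {a, b}"
  interpret chacon_pair "\<lambda>_. \<omega>" I a b by unfold_locales (use ab in \<open>auto simp: I_def\<close>)
  let ?T = "chacon_action \<omega>"
  let ?M = "chacon_measure \<omega>"
  have Ap: "A \<subseteq> chacon_points \<omega>" using sets.sets_into_space[OF A] by simp
  have pow: "?T (m * k) p \<in> A \<longleftrightarrow> p \<in> A" if p: "p \<in> chacon_points \<omega>" for p and k
  proof -
    have nat: "?T (m * int n) p \<in> A \<longleftrightarrow> p \<in> A" if p: "p \<in> chacon_points \<omega>" for n p
    proof (induction n)
      case 0
      then show ?case using p by (simp add: chacon_action_0)
    next
      case (Suc n)
      have "?T (m * int (Suc n)) p = ?T m (?T (m * int n) p)" using p by (simp add: chacon_action_add algebra_simps)
      then show ?case using Suc inv[OF chacon_action_in[OF p]] by simp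
    qed
    show ?thesis
    proof (cases "k \<ge> 0")
      case True
      then show ?thesis using nat[OF p, of "nat k"] by simp
    next
      case False
      have "?T (m * int (nat (- k))) (?T (m * k) p) = p" using False p by (simp add: chacon_action_add chacon_action_0)
      then show ?thesis using nat[OF chacon_action_in[OF p], of "nat (-k)" "m * k"] by simp
    qed
  qed
  have red: "?T j p \<in> A \<longleftrightarrow> ?T (j mod m) p \<in> A" if p: "p \<in> chacon_points \<omega>" for j p
  proof -
    have "?T j p = ?T (m * (j div m)) (?T (j mod m) p)" using p by (simp add: chacon_action_add)
    then show ?thesis using pow[OF chacon_action_in[OF p]] by simp
  qed
  define D where "D = {z \<in> points. \<forall>j. ?T j (z a) \<in> A \<longleftrightarrow> ?T j (z b) \<in> A}"
  have TA: "{p \<in> chacon_points \<omega>. ?T j p \<in> A} \<in> sets (chacon_borel \<omega>)" for j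
    using measurable_sets[OF chacon_action_measurable A, of j] by (simp add: vimage_def Int_def conj_commute)
  have D: "D \<in> sets borel_prod"
  proof -
    have s: "{z \<in> space borel_prod. ?T j (z i) \<in> A} \<in> sets borel_prod" if "i \<in> I" for i j
    proof -
      have "{z \<in> space borel_prod. ?T j (z i) \<in> A} = {z \<in> points. z i \<in> {p \<in> chacon_points \<omega>. ?T j p \<in> A}}"
        using points_mem[of _ i] that by auto
      then show ?thesis using coord_vimage_sets[OF that TA] by simp
    qed
    have "{z \<in> space borel_prod. \<forall>j. ?T j (z a) \<in> A \<longleftrightarrow> ?T j (z b) \<in> A} \<in> sets borel_prod"
    proof (rule sets.sets_Collect_countable_All)
      fix j
      have "{z \<in> space borel_prod. ?T j (z a) \<in> A \<longleftrightarrow> ?T j (z b) \<in> A} =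
         {z \<in> space borel_prod. ?T j (z a) \<in> A} \<inter> {z \<in> space borel_prod. ?T j (z b) \<in> A} \<union>
         (space borel_prod - ({z \<in> space borel_prod. ?T j (z a) \<in> A} \<union> {z \<in> space borel_prod. ?T j (z b) \<in> A}))"
        by blast
      then show "{z \<in> space borel_prod. ?T j (z a) \<in> A \<longleftrightarrow> ?T j (z b) \<in> A} \<in> sets borel_prod"
        using s[of a j] s[of b j] by (simp only:) (intro sets.Un sets.Int sets.compl_sets, auto)
    qed
    then show ?thesis by (simp add: D_def)
  qed
  have "act (\<lambda>_. 1) -` D \<inter> points = D"
  proof (rule set_eqI)
    fix z
    have "(\<forall>j. ?T j (?T 1 (z a)) \<in> A \<longleftrightarrow> ?T j (?T 1 (z b)) \<in> A) \<longleftrightarrow> (\<forall>j. ?T j (z a) \<in> A \<longleftrightarrow> ?T j (z b) \<in> A)"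
      if z: "z \<in> points"
    proof -
      have p: "z a \<in> chacon_points \<omega>" "z b \<in> chacon_points \<omega>" using points_mem[OF z] by auto
      show ?thesis
        unfolding chacon_action_add[OF p(1)] chacon_action_add[OF p(2)] by (metis diff_add_cancel)
    qed
    moreover have "act (\<lambda>_. 1) z a = ?T 1 (z a)" "act (\<lambda>_. 1) z b = ?T 1 (z b)" by (auto simp: act_def)
    ultimately show "z \<in> act (\<lambda>_. 1) -` D \<inter> points \<longleftrightarrow> z \<in> D"
      using act_points[of z "\<lambda>_. 1"] unfolding D_def by auto
  qed
  then have D01: "D \<in> null_sets chacon_prod \<or> points - D \<in> null_sets chacon_prod"
    using product_ergodic D unfolding ergodic_def by simp
  \<comment> \<open>A residue \<open>j mod m\<close> has the sign of \<open>m\<close>, so the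
    symmetric window serves both signs.\<close>
  define \<pi> where "\<pi> p = {j \<in> {- \<bar>m\<bar>..\<bar>m\<bar>}. ?T j p \<in> A}" for p
  have \<pi>sets: "{p \<in> chacon_points \<omega>. \<pi> p = s} \<in> sets (chacon_borel \<omega>)" if "s \<subseteq> {- \<bar>m\<bar>..\<bar>m\<bar>}" for s
  proof -
    have "{p \<in> space (chacon_borel \<omega>). \<forall>j\<in>{- \<bar>m\<bar>..\<bar>m\<bar>}. (?T j p \<in> A) = (j \<in> s)} \<in> sets (chacon_borel \<omega>)"
    proof (rule sets.sets_Collect_finite_All)
      fix j
      have "{p \<in> space (chacon_borel \<omega>). (?T j p \<in> A) = (j \<in> s)} = (if j \<in> s then {p \<in> chacon_points \<omega>. ?T j p \<in> A}
          else space (chacon_borel \<omega>) - {p \<in> chacon_points \<omega>. ?T j p \<in> A})" by auto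
      then show "{p \<in> space (chacon_borel \<omega>). (?T j p \<in> A) = (j \<in> s)} \<in> sets (chacon_borel \<omega>)"
        using TA[of j] sets.compl_sets[OF TA[of j]] by auto
    qed simp
    moreover have "{p \<in> space (chacon_borel \<omega>). \<forall>j\<in>{- \<bar>m\<bar>..\<bar>m\<bar>}. (?T j p \<in> A) = (j \<in> s)} =
        {p \<in> chacon_points \<omega>. \<pi> p = s}" using that by (auto simp: \<pi>_def)
    ultimately show ?thesis by simp
  qed
  have "\<exists>s\<in>Pow {- \<bar>m\<bar>..\<bar>m\<bar>}. emeasure ?M {p \<in> chacon_points \<omega>. \<pi> p = s} \<noteq> 0"
  proof (rule ccontr)
    assume "\<not> ?thesis"
    then have "(\<Union>s\<in>Pow {- \<bar>m\<bar>..\<bar>m\<bar>}. {p \<in> chacon_points \<omega>. \<pi> p = s}) \<in> null_sets ?M"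
      using \<pi>sets by (intro null_sets_UN') (auto intro!: null_setsI countable_finite)
    moreover have "\<pi> p \<in> Pow {- \<bar>m\<bar>..\<bar>m\<bar>}" for p unfolding \<pi>_def by blast
    then have "(\<Union>s\<in>Pow {- \<bar>m\<bar>..\<bar>m\<bar>}. {p \<in> chacon_points \<omega>. \<pi> p = s}) = chacon_points \<omega>" by blast
    ultimately have "chacon_points \<omega> \<in> null_sets ?M" by (simp only:)
    then have "emeasure ?M (chacon_points \<omega>) = 0" by (rule null_setsD1)
    moreover have "emeasure ?M (cylinder \<omega> 0 0) \<le> emeasure ?M (chacon_points \<omega>)"
      using sets.top[of "chacon_borel \<omega>"] by (intro emeasure_mono) (auto simp: mem_cylinder)
    ultimately show False using emeasure_cylinder[of 0 0 \<omega>] radius_nonneg[of 0] by simp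
  qed
  then obtain s where s: "s \<subseteq> {- \<bar>m\<bar>..\<bar>m\<bar>}" "emeasure ?M {p \<in> chacon_points \<omega>. \<pi> p = s} \<noteq> 0" by blast
  define C where "C = {p \<in> chacon_points \<omega>. \<pi> p = s}"
  have C: "C \<in> sets (chacon_borel \<omega>)" unfolding C_def by (rule \<pi>sets[OF s(1)])
  have "PiE I (\<lambda>_. C) \<subseteq> D"
  proof
    fix z assume z: "z \<in> PiE I (\<lambda>_. C)"
    then have zC: "z a \<in> C" "z b \<in> C" by auto
    have "?T j (z a) \<in> A \<longleftrightarrow> ?T j (z b) \<in> A" for j
    proof -
      have "\<bar>j mod m\<bar> < \<bar>m\<bar>" using m by (rule abs_mod_less)
      then have "j mod m \<in> {- \<bar>m\<bar>..\<bar>m\<bar>}" by auto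
      then have "?T (j mod m) (z a) \<in> A \<longleftrightarrow> ?T (j mod m) (z b) \<in> A" using zC unfolding C_def \<pi>_def by blast
      moreover have "z a \<in> chacon_points \<omega>" "z b \<in> chacon_points \<omega>" using zC by (simp_all add: C_def)
      ultimately show ?thesis using red[of "z a" j] red[of "z b" j] by blast
    qed
    moreover have "z \<in> points" using z by (auto simp: points_def C_def PiE_iff)
    ultimately show "z \<in> D" by (simp add: D_def)
  qed
  then have "emeasure chacon_prod (PiE I (\<lambda>_. C)) \<le> emeasure chacon_prod D" using D by (intro emeasure_mono) auto
  moreover have "emeasure chacon_prod (PiE I (\<lambda>_. C)) \<noteq> 0" using C s(2) by (subst emeasure_chacon_prod) (auto simp: C_def prod_I)
  ultimately have "points - D \<in> null_sets chacon_prod" using D01 by auto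
  \<comment> \<open>A point of \<open>A\<close> and a point of the complement disagree already at
    power 0.\<close>
  moreover define R where "R i = (if i = a then A else chacon_points \<omega> - A)" for i :: nat
  have R: "R i \<in> sets (chacon_borel \<omega>)" for i using A sets.compl_sets[OF A] by (simp add: R_def)
  have "PiE I R \<subseteq> points - D"
  proof
    fix z assume z: "z \<in> PiE I R"
    then have "z a \<in> R a" "z b \<in> R b" by (simp_all add: PiE_iff)
    then have z01: "z a \<in> A" "z b \<in> chacon_points \<omega> - A" using ab by (simp_all add: R_def)
    then have "?T 0 (z a) \<in> A" "?T 0 (z b) \<notin> A" using Ap by (auto simp: chacon_action_0)
    moreover have "z \<in> points" using z z01 Ap by (auto simp: points_def PiE_iff I_cases)
    ultimately show "z \<in> points - D" by (auto simp: D_def)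
  qed
  ultimately have "emeasure chacon_prod (PiE I R) \<le> 0"
    using emeasure_mono[of "PiE I R" "points - D" chacon_prod] null_setsD1[of "points - D" chacon_prod]
      null_setsD2[of "points - D" chacon_prod] by metis
  then have "emeasure chacon_prod (PiE I R) = 0" by simp
  then have "emeasure ?M (R a) * emeasure ?M (R b) = 0" using R by (subst (asm) emeasure_chacon_prod) (simp_all add: prod_I)
  then show ?thesis using A sets.compl_sets[OF A] ab by (auto simp: R_def null_sets_def)
qed

lemma chacon_totally_ergodic: "totally_ergodic (chacon_measure \<omega>) (chacon_action \<omega> 1)"
  unfolding totally_ergodic_def ergodic_def
proof (intro allI impI ballI)
  fix m :: int and A
  assume m: "m \<noteq> 0" and A: "A \<in> sets (chacon_measure \<omega>)"
    and inv: "int_iter (space (chacon_measure \<omega>)) (chacon_action \<omega> 1) m -` A \<inter> space (chacon_measure \<omega>) = A"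
  have "chacon_action \<omega> m p \<in> A \<longleftrightarrow> p \<in> A" if "p \<in> chacon_points \<omega>" for p
    using inv that unfolding int_iter_action[OF that, of m, symmetric] space_chacon_measure by blast
  from chacon_power_ergodic[OF m _ this]
  show "A \<in> null_sets (chacon_measure \<omega>) \<or> space (chacon_measure \<omega>) - A \<in> null_sets (chacon_measure \<omega>)"
    using A by simp
qed

lemma chacon_ergodic: "ergodic (chacon_measure \<omega>) (chacon_action \<omega> 1)"
  unfolding ergodic_def
proof (intro ballI impI)
  fix A assume A: "A \<in> sets (chacon_measure \<omega>)" and inv: "chacon_action \<omega> 1 -` A \<inter> space (chacon_measure \<omega>) = A"
  have "chacon_action \<omega> 1 p \<in> A \<longleftrightarrow> p \<in> A" if "p \<in> chacon_points \<omega>" for p using inv that by auto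
  from chacon_power_ergodic[OF _ _ this]
  show "A \<in> null_sets (chacon_measure \<omega>) \<or> space (chacon_measure \<omega>) - A \<in> null_sets (chacon_measure \<omega>)"
    using A by simp
qed

section \<open>Minimal self-joinings and the centralizer\<close>

lemma finite_product_space:
  assumes "finite J"
  shows "sets (borel_of (power_space (chacon_space \<omega>) J)) = sets (PiM J (\<lambda>_. chacon_borel \<omega>))"
    and "topspace (power_space (chacon_space \<omega>) J) = (\<Pi>\<^sub>E j\<in>J. chacon_points \<omega>)"
proof -
  interpret chacon_product "\<lambda>_. \<omega>" J by unfold_locales (rule assms)
  show "sets (borel_of (power_space (chacon_space \<omega>) J)) = sets (PiM J (\<lambda>_. chacon_borel \<omega>))"
    using sets_borel_of_product by (simp add: power_space_def borel_prod_def)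
  show "topspace (power_space (chacon_space \<omega>) J) = (\<Pi>\<^sub>E j\<in>J. chacon_points \<omega>)"
    by (simp add: power_space_def)
qed

lemma AE_action:
  "AE x in chacon_measure \<omega>. P x \<Longrightarrow> AE x in chacon_measure \<omega>. P (chacon_action \<omega> k x)"
  by (rule AE_preimage[OF chacon_action_measurable' distr_chacon_action])

lemma action_in_centralizer:
  assumes S: "S \<in> measurable (chacon_measure \<omega>) (chacon_measure \<omega>)"
    and eq: "AE x in chacon_measure \<omega>. S x = chacon_action \<omega> k x"
  shows "S \<in> centralizer (chacon_measure \<omega>) (chacon_action \<omega> 1)"
proof -
  let ?M = "chacon_measure \<omega>"
  have "AE x in ?M. chacon_action \<omega> (-k) (S x) = x"
    using eq AE_space by eventually_elim (simp add: chacon_action_add chacon_action_0)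
  moreover have "AE x in ?M. S (chacon_action \<omega> (-k) x) = x"
    using AE_action[OF eq, of "-k"] AE_space
    by eventually_elim (simp add: chacon_action_add chacon_action_0)
  moreover have "distr ?M ?M S = distr ?M ?M (chacon_action \<omega> k)"
    using S eq by (intro distr_cong_AE) auto
  then have "null_sets (distr ?M ?M S) = null_sets ?M" by (simp add: distr_chacon_action)
  moreover have "AE x in ?M. S (chacon_action \<omega> 1 x) = chacon_action \<omega> 1 (S x)"
    using AE_action[OF eq, of 1] eq AE_space
    by eventually_elim (simp add: chacon_action_add add.commute)
  ultimately show ?thesis
    unfolding centralizer_def using S chacon_action_measurable'[of \<omega> "-k"] by blast
qed

context chacon_product
begin

text \<open>The exponents found block by block fit together to one function \<open>k\<close>,
  because the blocks are disjoint; the least indices serve as base points.\<close>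

lemma ergodic_joining_structure:
  assumes jo: "ergodic_joining L" and I: "I \<noteq> {}" and w: "w = (\<lambda>_. \<omega>)"
  shows "\<exists>P k. tied_joining \<omega> I L P k"
proof -
  obtain P where part: "partition_on I P"
    and P: "\<And>J. J \<in> P \<Longrightarrow> scales L (restr J 1) 1" "\<And>J. J \<in> P \<Longrightarrow> \<not> (AE z in L. often_good J z)"
    using joining_partition[OF jo I] by blast
  have sub: "J \<subseteq> I" "finite J" "Min J \<in> J" if "J \<in> P" for J
  proof -
    show 1: "J \<subseteq> I" using part that by (auto simp: partition_on_def)
    then show 2: "finite J" using finite_I finite_subset by blast
    show "Min J \<in> J" using part that 2 by (intro Min_in) (auto simp: partition_on_def)
  qed
  have "\<forall>J\<in>P. \<exists>k. k (Min J) = 0 \<and> (AE z in L. \<forall>j\<in>J. z j = chacon_action \<omega> (k j) (z (Min J)))"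
    using tied_graph[OF jo sub(1,3) P(2), of _ \<omega>] w by simp
  from bchoice[OF this] obtain K where
    K: "\<forall>J\<in>P. K J (Min J) = 0 \<and> (AE z in L. \<forall>j\<in>J. z j = chacon_action \<omega> (K J j) (z (Min J)))" ..
  define k where "k j = K (THE J. J \<in> P \<and> j \<in> J) j" for j
  have kK: "k j = K J j" if "J \<in> P" "j \<in> J" for J j
  proof -
    have "(THE J. J \<in> P \<and> j \<in> J) = J"
      using part that by (intro the_equality) (auto simp: partition_on_def disjoint_def)
    then show ?thesis by (simp add: k_def)
  qed
  have lf: "locally_finite L" and pos: "emeasure L points \<noteq> 0" using jo by (auto simp: ergodic_joining_def)
  have "tied_joining \<omega> I L P k"
  proof (unfold_locales)
    fix J assume J: "J \<in> P"
    show "k (Min J) = 0" using kK[OF J sub(3)[OF J]] K J by simp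
    have "AE z in L. \<forall>j\<in>J. z j = chacon_action \<omega> (K J j) (z (Min J))" using K J by blast
    then show "AE z in L. \<forall>j\<in>J. z j = chacon_action \<omega> (k j) (z (Min J))"
      by eventually_elim (simp add: kK[OF J])
    show "chacon_product.scales (\<lambda>_. \<omega>) I L (restr J 1) 1" using P(1)[OF J] unfolding w .
  qed (use lf[unfolded w] pos[unfolded w] part in simp_all)
  then show ?thesis by blast
qed

end

section \<open>Decomposition into graph joinings\<close>

context tied_joining
begin

definition graph_measure :: "nat set \<Rightarrow> (nat \<Rightarrow> chacon_point) measure" where
  "graph_measure J = distr (chacon_measure \<omega>) (borel_of (power_space (chacon_space \<omega>) J)) (graph_map \<omega> k J)"

lemma graph_map_measurable:
  assumes "J \<in> P"
  shows "graph_map \<omega> k J \<in> measurable (chacon_measure \<omega>) (borel_of (power_space (chacon_space \<omega>) J))"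
proof -
  have "graph_map \<omega> k J \<in> measurable (chacon_borel \<omega>) (PiM J (\<lambda>_. chacon_borel \<omega>))"
    unfolding graph_map_def by measurable
  then show ?thesis
    using finite_product_space(1)[OF block_finite[OF assms]] by (simp cong: measurable_cong_sets)
qed

lemma rectangle_sets:
  assumes "J \<in> P" "\<And>j. j \<in> J \<Longrightarrow> A j \<in> sets (chacon_borel \<omega>)"
  shows "PiE J A \<in> sets (borel_of (power_space (chacon_space \<omega>) J))"
  using assms block_finite[OF assms(1)] finite_product_space(1)[OF block_finite[OF assms(1)]]
  by (simp add: sets_PiM_I_finite)

lemma emeasure_graph_measure:
  assumes "J \<in> P" "\<And>j. j \<in> J \<Longrightarrow> A j \<in> sets (chacon_borel \<omega>)"
  shows "emeasure (graph_measure J) (PiE J A) = emeasure (chacon_measure \<omega>) (block_set A J)"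
proof -
  have "graph_map \<omega> k J -` PiE J A \<inter> chacon_points \<omega> = block_set A J"
    by (auto simp: graph_map_def block_set_def PiE_iff)
  then show ?thesis
    unfolding graph_measure_def
    by (subst emeasure_distr[OF graph_map_measurable[OF assms(1)] rectangle_sets[OF assms]]) simp_all
qed

text \<open>For a block with a single index the exponent is 0, so its graph measure is the
  transported \<open>chacon_measure\<close>, as \<open>msj_factor\<close> demands for
  singletons.\<close>

lemma msj_factor_graph:
  assumes J: "J \<in> P" and c: "c > 0"
  shows "msj_factor (chacon_space \<omega>) (chacon_measure \<omega>) (chacon_action \<omega> 1) J
    (scale_measure (ennreal c) (graph_measure J))"
proof -
  have "if card J > 1 then graph_joining (chacon_space \<omega>) (chacon_measure \<omega>) (chacon_action \<omega> 1) J (graph_measure J)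
         else graph_measure J = distr (chacon_measure \<omega>) (borel_of (power_space (chacon_space \<omega>) J)) (\<lambda>x. \<lambda>j\<in>J. x)"
  proof (cases "card J > 1")
    case True
    have ne: "J - {Min J} \<noteq> {}"
    proof
      assume "J - {Min J} = {}"
      then have "J \<subseteq> {Min J}" by blast
      then have "card J \<le> 1" using card_mono[of "{Min J}" J] by simp
      then show False using True by simp
    qed
    have "block_set A J = A (Min J) \<inter> (\<Inter>j \<in> J - {Min J}. chacon_action \<omega> (k j) -` A j \<inter> space (chacon_measure \<omega>))"
      if A: "\<And>j. j \<in> J \<Longrightarrow> A j \<in> sets (chacon_measure \<omega>)" for A
    proof -
      have "A (Min J) \<subseteq> chacon_points \<omega>" using sets.sets_into_space[OF A[OF Min_block[OF J]]] by simp
      then show ?thesis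
        using ne Min_block[OF J] k_Min[OF J] by (auto simp: block_set_def chacon_action_0)
    qed
    moreover have "chacon_action \<omega> (k j) \<in> centralizer (chacon_measure \<omega>) (chacon_action \<omega> 1)" for j
      by (rule action_in_centralizer[OF chacon_action_measurable', where k = "k j"]) simp
    moreover have "space (graph_measure J) = topspace (power_space (chacon_space \<omega>) J)"
      "sets (graph_measure J) = sets (borel_of (power_space (chacon_space \<omega>) J))"
      by (simp_all add: graph_measure_def)
    ultimately have "graph_joining (chacon_space \<omega>) (chacon_measure \<omega>) (chacon_action \<omega> 1) J (graph_measure J)"
      unfolding graph_joining_def
      by (intro conjI exI[of _ "\<lambda>j. chacon_action \<omega> (k j)"]) (simp_all add: emeasure_graph_measure[OF J])
    then show ?thesis using True by simp
  next
    case False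
    have "J = {Min J}"
    proof -
      have "card J > 0" using J block_finite[OF J] Min_block[OF J] by (auto simp: card_gt_0_iff)
      then have "card J = 1" using False by simp
      then obtain x where "J = {x}" by (auto simp: card_1_singleton_iff)
      then show ?thesis by simp
    qed
    then have "graph_map \<omega> k J x = (\<lambda>j\<in>J. x)" if "x \<in> space (chacon_measure \<omega>)" for x
      using that k_Min[OF J] unfolding graph_map_def
      by (intro restrict_ext) (metis chacon_action_0 singletonD space_chacon_measure)
    then have "graph_measure J = distr (chacon_measure \<omega>) (borel_of (power_space (chacon_space \<omega>) J)) (\<lambda>x. \<lambda>j\<in>J. x)"
      unfolding graph_measure_def by (intro distr_cong refl)
    then show ?thesis using False by simp
  qed
  then show ?thesis unfolding msj_factor_def using c by blast
qed

text \<open>Both measures are locally determined by boxes, where \<open>emeasure_rectangle\<close>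
  gives a product over the blocks. The constant \<open>mass\<close> must be attributed to one
  factor, here to an arbitrary block \<open>J0\<close>.\<close>

theorem product_of_graphs:
  assumes "I \<noteq> {}"
  shows "\<exists>F. (\<forall>J\<in>P. msj_factor (chacon_space \<omega>) (chacon_measure \<omega>) (chacon_action \<omega> 1) J (F J)) \<and>
    L = block_product (chacon_space \<omega>) I P F"
proof -
  obtain J0 where J0: "J0 \<in> P" using assms part by (auto simp: partition_on_def)
  obtain c where c: "mass = ennreal c" "c > 0"
    using mass_finite mass_positive by (cases mass) auto
  define s where "s J = (if J = J0 then c else 1)" for J
  have s: "s J > 0" for J using c by (simp add: s_def)
  \<comment> \<open>The value \<open>count_space {}\<close> outside \<open>P\<close> keeps every
    member of the family sigma-finite, as \<open>product_sigma_finite\<close> demands.\<close>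
  define F where "F J = (if J \<in> P then scale_measure (ennreal (s J)) (graph_measure J) else count_space {})" for J
  have FP: "F J = scale_measure (ennreal (s J)) (graph_measure J)" if "J \<in> P" for J using that by (simp add: F_def)
  have setsF: "sets (F J) = sets (borel_of (power_space (chacon_space \<omega>) J))" if "J \<in> P" for J
    using that by (simp add: FP graph_measure_def)
  have spF: "space (F J) = (\<Pi>\<^sub>E j\<in>J. chacon_points \<omega>)" if "J \<in> P" for J
    using sets_eq_imp_space_eq[OF setsF[OF that]] finite_product_space(2)[OF block_finite[OF that]] by simp
  have emF: "emeasure (F J) (PiE J A) = ennreal (s J) * emeasure (chacon_measure \<omega>) (block_set A J)"
    if "J \<in> P" "\<And>j. j \<in> J \<Longrightarrow> A j \<in> sets (chacon_borel \<omega>)" for J A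
    using rectangle_sets[OF that] by (simp add: FP[OF that(1)] emeasure_graph_measure[OF that])
  have sf: "sigma_finite_measure (F J)" for J
  proof (cases "J \<in> P")
    case True
    interpret B: chacon_product "\<lambda>_. \<omega>" J by unfold_locales (rule block_finite[OF True])
    have "emeasure (F J) (B.pbox n f) < \<infinity>" for n f
    proof -
      have "block_set (\<lambda>j. cylinder \<omega> n (f j)) J \<subseteq> cylinder \<omega> n (f (Min J))"
        using Min_block[OF True] k_Min[OF True] by (auto simp: block_set_def chacon_action_0 dest!: bspec)
      then have "emeasure (chacon_measure \<omega>) (block_set (\<lambda>j. cylinder \<omega> n (f j)) J) \<le>
          emeasure (chacon_measure \<omega>) (cylinder \<omega> n (f (Min J)))" by (intro emeasure_mono) auto
      also have "\<dots> < \<infinity>" by (rule emeasure_cylinder_finite)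
      finally show ?thesis
        unfolding B.pbox_def by (subst emF[OF True]) (auto simp: ennreal_mult_less_top)
    qed
    moreover have "sets (F J) = sets B.borel_prod"
      using setsF[OF True] finite_product_space(1)[OF block_finite[OF True]] by (simp add: B.borel_prod_def)
    ultimately have "B.locally_finite (F J)" by (simp add: B.locally_finite_def)
    then show ?thesis by (rule B.sigma_finite_locally_finite)
  next
    case False
    then show ?thesis by (simp add: F_def sigma_finite_measure_count_space_finite)
  qed
  interpret F: product_sigma_finite F by (simp add: product_sigma_finite_def sf)
  define b where "b i = (THE J. J \<in> P \<and> i \<in> J)" for i
  have b: "b i = J" if "J \<in> P" "i \<in> J" for i J
    unfolding b_def using that block_unique by (intro the_equality) blast+
  have bP: "b i \<in> P \<and> i \<in> b i" if i: "i \<in> I" for i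
  proof -
    obtain J where "J \<in> P" "i \<in> J" using i part by (auto simp: partition_on_def)
    then show ?thesis using b by simp
  qed
  define h where "h y = (\<lambda>i\<in>I. y (b i) i)" for y :: "nat set \<Rightarrow> nat \<Rightarrow> chacon_point"
  have hm: "h \<in> measurable (PiM P F) borel_prod"
    unfolding h_def borel_prod_def
  proof (rule measurable_restrict)
    fix i assume i: "i \<in> I"
    have 1: "(\<lambda>y. y (b i)) \<in> measurable (PiM P F) (F (b i))" using bP[OF i] by (intro measurable_component_singleton) blast
    have "(\<lambda>x. x i) \<in> measurable (PiM (b i) (\<lambda>_. chacon_borel \<omega>)) (chacon_borel \<omega>)"
      using bP[OF i] by (intro measurable_component_singleton) blast
    moreover have "sets (F (b i)) = sets (PiM (b i) (\<lambda>_. chacon_borel \<omega>))"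
      using bP[OF i] setsF finite_product_space(1) block_finite by metis
    ultimately have "(\<lambda>x. x i) \<in> measurable (F (b i)) (chacon_borel \<omega>)" by (simp cong: measurable_cong_sets)
    from measurable_compose[OF 1 this] show "(\<lambda>y. y (b i) i) \<in> measurable (PiM P F) (chacon_borel \<omega>)" .
  qed
  have bp_sets: "sets (borel_of (power_space (chacon_space \<omega>) I)) = sets borel_prod"
    using sets_borel_of_product by (simp add: power_space_def)
  have hm': "h \<in> measurable (PiM P F) (borel_of (power_space (chacon_space \<omega>) I))"
    using hm bp_sets by (simp cong: measurable_cong_sets)
  have "L = block_product (chacon_space \<omega>) I P F"
  proof (rule measure_eq_boxes[OF locally_finite, where g = 0])
    show "sets (block_product (chacon_space \<omega>) I P F) = sets borel_prod"
      by (simp add: block_product_def bp_sets)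
    fix n and f :: "nat \<Rightarrow> int"
    define A where "A i = cylinder \<omega> n (f i)" for i
    have A: "A i \<in> sets (chacon_borel \<omega>)" for i by (simp add: A_def)
    have pre: "h -` pbox n f \<inter> space (PiM P F) = PiE P (\<lambda>J. PiE J A)"
    proof (rule set_eqI)
      fix y
      have I_P: "(\<forall>i\<in>I. Q (b i) i) \<longleftrightarrow> (\<forall>J\<in>P. \<forall>j\<in>J. Q J j)" for Q
      proof -
        have "I = \<Union>P" using part by (simp add: partition_on_def)
        then show ?thesis using b by auto
      qed
      have ext: "y J \<in> extensional J" if "y \<in> space (PiM P F)" "J \<in> P" for J
        using that spF[OF that(2)] by (auto simp: space_PiM PiE_iff)
      have inP: "y \<in> space (PiM P F)" if y: "y \<in> PiE P (\<lambda>J. PiE J A)"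
      proof -
        have "y J \<in> space (F J)" if J: "J \<in> P" for J
        proof -
          have "y J \<in> PiE J A" using y J by blast
          then show ?thesis unfolding spF[OF J] by (auto simp: A_def mem_cylinder PiE_iff)
        qed
        then show ?thesis using y by (auto simp: space_PiM PiE_iff)
      qed
      have "h y \<in> pbox n f \<longleftrightarrow> (\<forall>i\<in>I. y (b i) i \<in> A i)" by (simp add: pbox_def h_def A_def PiE_iff)
      also have "\<dots> \<longleftrightarrow> (\<forall>J\<in>P. \<forall>j\<in>J. y J j \<in> A j)" by (rule I_P)
      finally have h: "h y \<in> pbox n f \<longleftrightarrow> (\<forall>J\<in>P. \<forall>j\<in>J. y J j \<in> A j)" .
      show "y \<in> h -` pbox n f \<inter> space (PiM P F) \<longleftrightarrow> y \<in> PiE P (\<lambda>J. PiE J A)"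
      proof
        assume y: "y \<in> h -` pbox n f \<inter> space (PiM P F)"
        then have "y J \<in> PiE J A" if "J \<in> P" for J using ext[OF _ that] h that by (auto simp: PiE_iff)
        moreover have "y \<in> extensional P" using y by (auto simp: space_PiM PiE_iff)
        ultimately show "y \<in> PiE P (\<lambda>J. PiE J A)" by (auto simp: PiE_iff)
      next
        assume y: "y \<in> PiE P (\<lambda>J. PiE J A)"
        then have "\<forall>J\<in>P. \<forall>j\<in>J. y J j \<in> A j" by (auto simp: PiE_iff)
        then show "y \<in> h -` pbox n f \<inter> space (PiM P F)" using h inP[OF y] by simp
      qed
    qed
    have box: "pbox n f \<in> sets (borel_of (power_space (chacon_space \<omega>) I))" using bp_sets by simp
    have hd: "(\<lambda>y. \<lambda>i\<in>I. y (THE J. J \<in> P \<and> i \<in> J) i) = h" by (simp add: h_def b_def fun_eq_iff)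
    have "emeasure (block_product (chacon_space \<omega>) I P F) (pbox n f) = emeasure (PiM P F) (PiE P (\<lambda>J. PiE J A))"
      unfolding block_product_def hd emeasure_distr[OF hm' box] pre ..
    also have "\<dots> = (\<Prod>J\<in>P. emeasure (F J) (PiE J A))"
      using rectangle_sets A setsF by (intro F.emeasure_PiM finite_P) simp
    also have "\<dots> = (\<Prod>J\<in>P. ennreal (s J)) * (\<Prod>J\<in>P. emeasure (chacon_measure \<omega>) (block_set A J))"
      by (simp add: emF A prod.distrib)
    also have "(\<Prod>J\<in>P. ennreal (s J)) = mass"
      using J0 finite_P by (simp add: s_def c(1) prod.remove[OF finite_P J0])
    also have "mass * (\<Prod>J\<in>P. emeasure (chacon_measure \<omega>) (block_set A J)) = emeasure L (pbox n f)"
      unfolding pbox_def A_def[symmetric] using emeasure_rectangle[of A] A by simp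
    finally show "emeasure L (pbox n f) = emeasure (block_product (chacon_space \<omega>) I P F) (pbox n f)" ..
  qed
  moreover have "\<forall>J\<in>P. msj_factor (chacon_space \<omega>) (chacon_measure \<omega>) (chacon_action \<omega> 1) J (F J)"
    using msj_factor_graph s FP by simp
  ultimately show ?thesis by blast
qed

end

lemma chacon_points_not_null: "chacon_points \<omega> \<notin> null_sets (chacon_measure \<omega>)"
proof
  assume "chacon_points \<omega> \<in> null_sets (chacon_measure \<omega>)"
  then have 0: "emeasure (chacon_measure \<omega>) (chacon_points \<omega>) = 0" by (rule null_setsD1)
  have "cylinder \<omega> 0 0 \<subseteq> chacon_points \<omega>" by (auto simp: mem_cylinder)
  then have "emeasure (chacon_measure \<omega>) (cylinder \<omega> 0 0) \<le> emeasure (chacon_measure \<omega>) (chacon_points \<omega>)"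
    using sets.top[of "chacon_measure \<omega>"] by (intro emeasure_mono) simp_all
  then show False using 0 emeasure_cylinder[of 0 0 \<omega>] radius_nonneg[of 0] by simp
qed

text \<open>Boxes are compact, which turns the Radon property into local finiteness. The measure is
  nonzero because one of its projections has the null sets of \<open>chacon_measure\<close>.\<close>

lemma radon_self_joining_ergodic_joining:
  assumes "radon_self_joining (chacon_space \<omega>) (chacon_measure \<omega>) (chacon_action \<omega> 1) d L"
    and "ergodic L (power_map (chacon_action \<omega> 1) {1..d})" and "d \<ge> 1"
  shows "chacon_product.ergodic_joining (\<lambda>_. \<omega>) {1..d} L"
proof -
  define I where "I = {1..d}"
  interpret chacon_product "\<lambda>_. \<omega>" I by unfold_locales (simp add: I_def)
  have T: "power_map (chacon_action \<omega> 1) I = act (\<lambda>_. 1)" by (simp add: power_map_def act_def fun_eq_iff)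
  have top: "topspace (power_space (chacon_space \<omega>) I) = points" by (simp add: power_space_def points_def)
  have rad: "radon_measure (power_space (chacon_space \<omega>) I) L" and inv: "invariant_measure L (act (\<lambda>_. 1))"
    and nul: "\<And>j. j \<in> I \<Longrightarrow> null_sets (distr L (chacon_measure \<omega>) (\<lambda>x. x j)) = null_sets (chacon_measure \<omega>)"
    using assms(1) unfolding radon_self_joining_def I_def[symmetric] T by auto
  have erg: "ergodic L (act (\<lambda>_. 1))" using assms(2) unfolding I_def[symmetric] T .
  have Ls: "sets L = sets borel_prod"
    using rad sets_borel_of_product by (simp add: radon_measure_def power_space_def)
  have sp: "space L = points" using sets_eq_imp_space_eq[OF Ls] by simp
  have comp: "(\<lambda>x. x j) \<in> measurable L (chacon_measure \<omega>)" if "j \<in> I" for j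
    using coord_measurable[OF that] by (simp cong: measurable_cong_sets add: Ls)
  have lf: "locally_finite L"
    using rad compactin_box Ls by (auto simp: locally_finite_def radon_measure_def power_space_def)
  have sc: "scales L (\<lambda>_. 1) 1"
    unfolding scales_def
  proof
    fix E assume "E \<in> sets borel_prod"
    then have E: "E \<in> sets L" using Ls by simp
    have "act (\<lambda>_. 1) \<in> measurable L L" and d: "distr L L (act (\<lambda>_. 1)) = L" using inv by (auto simp: invariant_measure_def)
    from emeasure_distr[OF this(1) E] show "emeasure L (act (\<lambda>_. 1) -` E \<inter> points) = 1 * emeasure L E"
      unfolding d sp by simp
  qed
  have null: "emeasure L {z \<in> points. z j \<in> N} = 0" if j: "j \<in> I" and N: "N \<in> null_sets (chacon_measure \<omega>)" for j N
  proof -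
    have "N \<in> null_sets (distr L (chacon_measure \<omega>) (\<lambda>x. x j))" using N nul[OF j] by simp
    then have "emeasure (distr L (chacon_measure \<omega>) (\<lambda>x. x j)) N = 0" by (rule null_setsD1)
    moreover have "N \<in> sets (chacon_measure \<omega>)" using N by blast
    ultimately have "emeasure L ((\<lambda>x. x j) -` N \<inter> space L) = 0" using emeasure_distr[OF comp[OF j]] by simp
    then show ?thesis by (simp add: sp vimage_def Int_def conj_commute)
  qed
  have pos: "emeasure L points \<noteq> 0"
  proof
    assume 0: "emeasure L points = 0"
    have j: "d \<in> I" using assms(3) by (simp add: I_def)
    have X: "chacon_points \<omega> \<in> sets (chacon_measure \<omega>)" using sets.top[of "chacon_measure \<omega>"] by simp
    have "emeasure (distr L (chacon_measure \<omega>) (\<lambda>x. x d)) (chacon_points \<omega>) \<le> emeasure L (space L)"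
      using emeasure_distr[OF comp[OF j] X] by (simp add: emeasure_space)
    then have "chacon_points \<omega> \<in> null_sets (distr L (chacon_measure \<omega>) (\<lambda>x. x d))"
      using 0 X sp by (intro null_setsI) auto
    then show False using nul[OF j] chacon_points_not_null by blast
  qed
  have "ergodic_joining L" unfolding ergodic_joining_def using lf sc erg pos null by blast
  then show ?thesis by (simp add: I_def)
qed

text \<open>The image of the measure under x \<mapsto> (x, S x) is an ergodic joining of two copies.
  If its coordinates are tied, \<open>S\<close> is a power of the action. Otherwise it would be a
  multiple of the product measure, and \<open>S\<close> would send almost all of one cylinder into
  each of two disjoint cylinders.\<close>

theorem centralizer_powers:
  "centralizer (chacon_measure \<omega>) (chacon_action \<omega> 1) = mod_null (chacon_measure \<omega>) (range (chacon_action \<omega>))"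
proof
  show "mod_null (chacon_measure \<omega>) (range (chacon_action \<omega>)) \<subseteq> centralizer (chacon_measure \<omega>) (chacon_action \<omega> 1)"
    unfolding mod_null_def using action_in_centralizer by auto
next
  let ?M = "chacon_measure \<omega>" let ?T = "chacon_action \<omega> 1"
  show "centralizer ?M ?T \<subseteq> mod_null ?M (range (chacon_action \<omega>))"
  proof
    fix S assume "S \<in> centralizer ?M ?T"
    then have S: "S \<in> measurable ?M ?M" and nS: "null_sets (distr ?M ?M S) = null_sets ?M"
      and com: "AE x in ?M. S (?T x) = ?T (S x)" by (auto simp: centralizer_def)
    \<comment> \<open>The order makes \<open>a\<close> the least index, so that a tied block
      expresses the second coordinate through the first.\<close>
    obtain a b :: nat where less: "a < b" using zero_less_one by blast
    define I where "I = {a, b}"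
    interpret chacon_pair "\<lambda>_. \<omega>" I a b by unfold_locales (use less in \<open>auto simp: I_def\<close>)
    define h where "h x = (\<lambda>i\<in>I. if i = a then x else S x)" for x
    have ha: "h x a = x" "h x b = S x" for x using ab by (auto simp: h_def)
    have Sp: "S x \<in> chacon_points \<omega>" if "x \<in> chacon_points \<omega>" for x using measurable_space[OF S, of x] that by simp
    have S': "S \<in> measurable ?M (chacon_borel \<omega>)" using S by (simp cong: measurable_cong_sets)
    have hm: "h \<in> measurable ?M borel_prod"
      unfolding h_def borel_prod_def
    proof (rule measurable_restrict)
      fix i assume "i \<in> I"
      show "(\<lambda>x. if i = a then x else S x) \<in> measurable ?M (chacon_borel \<omega>)"
        using S' by (cases "i = a") (auto cong: measurable_cong_sets)
    qed
    define L where "L = distr ?M borel_prod h"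
    have Ls: "sets L = sets borel_prod" by (simp add: L_def)
    have emL: "emeasure L E = emeasure ?M (h -` E \<inter> chacon_points \<omega>)" if "E \<in> sets borel_prod" for E
      unfolding L_def using emeasure_distr[OF hm that] by simp
    have hE: "h -` E \<inter> chacon_points \<omega> \<in> sets ?M" if "E \<in> sets borel_prod" for E
      using measurable_sets[OF hm that] by simp
    have actT: "AE x in ?M. act (\<lambda>_. 1) (h x) = h (?T x)"
      using com
    proof eventually_elim
      case (elim x)
      show ?case
      proof
        fix i show "act (\<lambda>_. 1) (h x) i = h (?T x) i"
          using elim ab by (cases "i \<in> I") (auto simp: act_def h_def)
      qed
    qed
    have hpt: "h x \<in> points" if "x \<in> chacon_points \<omega>" for x using measurable_space[OF hm, of x] that by simp
    have lf: "locally_finite L"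
    proof -
      have "emeasure L (pbox n f) < \<infinity>" for n f
      proof -
        have "h -` pbox n f \<inter> chacon_points \<omega> \<subseteq> cylinder \<omega> n (f a)"
          using ha by (auto simp: mem_box mem_cylinder dest!: bspec[of I _ a])
        then have "emeasure ?M (h -` pbox n f \<inter> chacon_points \<omega>) \<le> emeasure ?M (cylinder \<omega> n (f a))"
          by (intro emeasure_mono) auto
        also have "\<dots> < \<infinity>" by (rule emeasure_cylinder_finite)
        finally show ?thesis by (simp add: emL)
      qed
      then show ?thesis by (simp add: locally_finite_def Ls)
    qed
    have sc: "scales L (\<lambda>_. 1) 1"
      unfolding scales_def
    proof
      fix E assume E: "E \<in> sets borel_prod"
      have "emeasure ?M (h -` (act (\<lambda>_. 1) -` E \<inter> points) \<inter> chacon_points \<omega>) =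
          emeasure ?M (?T -` (h -` E \<inter> chacon_points \<omega>) \<inter> space ?M)"
      proof (rule emeasure_eq_AE)
        show "AE x in ?M. x \<in> h -` (act (\<lambda>_. 1) -` E \<inter> points) \<inter> chacon_points \<omega> \<longleftrightarrow>
            x \<in> ?T -` (h -` E \<inter> chacon_points \<omega>) \<inter> space ?M"
          using actT AE_space by eventually_elim (simp add: hpt chacon_action_in)
        show "h -` (act (\<lambda>_. 1) -` E \<inter> points) \<inter> chacon_points \<omega> \<in> sets ?M" by (rule hE[OF act_vimage[OF E]])
        show "?T -` (h -` E \<inter> chacon_points \<omega>) \<inter> space ?M \<in> sets ?M"
          by (rule measurable_sets[OF chacon_action_measurable' hE[OF E]])
      qed
      also have "\<dots> = emeasure (distr ?M ?M ?T) (h -` E \<inter> chacon_points \<omega>)"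
        by (rule emeasure_distr[OF chacon_action_measurable' hE[OF E], symmetric])
      finally show "emeasure L (act (\<lambda>_. 1) -` E \<inter> points) = 1 * emeasure L E"
        by (simp add: emL act_vimage E distr_chacon_action)
    qed
    have erg: "ergodic L (act (\<lambda>_. 1))"
      unfolding ergodic_def
    proof (intro ballI impI)
      fix A assume "A \<in> sets L" and inv: "act (\<lambda>_. 1) -` A \<inter> space L = A"
      then have A: "A \<in> sets borel_prod" "act (\<lambda>_. 1) -` A \<inter> points = A" by (auto simp: L_def)
      have C: "points - A \<in> sets borel_prod" using sets.compl_sets[OF A(1)] by simp
      have "AE x in ?M. ?T x \<in> h -` A \<inter> chacon_points \<omega> \<longleftrightarrow> x \<in> h -` A \<inter> chacon_points \<omega>"
        using actT AE_space
      proof eventually_elim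
        case (elim x)
        then have x: "x \<in> chacon_points \<omega>" by simp
        have "act (\<lambda>_. 1) (h x) \<in> A \<longleftrightarrow> h x \<in> A" using A(2) hpt[OF x] by blast
        then show ?case using elim(1) x chacon_action_in[OF x] by simp
      qed
      from ergodic_mod_null[OF chacon_ergodic chacon_action_measurable' distr_chacon_action hE[OF A(1)] this]
      have "emeasure L A = 0 \<or> emeasure ?M (chacon_points \<omega> - (h -` A \<inter> chacon_points \<omega>)) = 0"
        using emL[OF A(1)] by auto
      moreover have "chacon_points \<omega> - (h -` A \<inter> chacon_points \<omega>) = h -` (points - A) \<inter> chacon_points \<omega>"
        using hpt by auto
      ultimately show "A \<in> null_sets L \<or> space L - A \<in> null_sets L"
        using emL[OF C] A(1) C by (auto simp: null_sets_def L_def)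
    qed
    have pos: "emeasure L points \<noteq> 0"
    proof -
      have "h -` points \<inter> chacon_points \<omega> = chacon_points \<omega>" using hpt by auto
      moreover have "points \<in> sets borel_prod" using sets.top[of borel_prod] by simp
      moreover have "chacon_points \<omega> \<in> sets ?M" using sets.top[of ?M] by simp
      ultimately show ?thesis using chacon_points_not_null[of \<omega>] emL[of points] by (auto simp: null_sets_def)
    qed
    have null: "emeasure L {z \<in> points. z i \<in> N} = 0" if i: "i \<in> I" and N: "N \<in> null_sets ?M" for i N
    proof -
      have Ns: "N \<in> sets (chacon_borel \<omega>)" using N by auto
      have eq: "emeasure L {z \<in> points. z i \<in> N} = emeasure ?M {x \<in> chacon_points \<omega>. h x i \<in> N}"
      proof -
        have "h -` {z \<in> points. z i \<in> N} \<inter> chacon_points \<omega> = {x \<in> chacon_points \<omega>. h x i \<in> N}" using hpt by auto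
        then show ?thesis using emL[OF coord_vimage_sets[OF i Ns]] by simp
      qed
      show ?thesis
      proof (cases "i = a")
        case True
        have "{x \<in> chacon_points \<omega>. h x i \<in> N} = N" using True ha sets.sets_into_space[OF Ns] by auto
        then show ?thesis using eq N by auto
      next
        case False
        then have "i = b" using i by (simp add: I_cases)
        then have "{x \<in> chacon_points \<omega>. h x i \<in> N} = S -` N \<inter> space ?M" using ha by auto
        moreover have "emeasure (distr ?M ?M S) N = 0" using N nS by blast
        then have "emeasure ?M (S -` N \<inter> space ?M) = 0" using emeasure_distr[OF S, of N] Ns by simp
        ultimately show ?thesis using eq by simp
      qed
    qed
    have jo: "ergodic_joining L" unfolding ergodic_joining_def using lf sc erg pos null by blast
    have "I \<noteq> {}" using ab_mem by blast
    then obtain P k where "tied_joining \<omega> I L P k" using ergodic_joining_structure[OF jo] by blast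
    then interpret t: tied_joining \<omega> I L P k .
    show "S \<in> mod_null ?M (range (chacon_action \<omega>))"
    proof (cases "\<exists>J\<in>P. a \<in> J \<and> b \<in> J")
      case True
      then obtain J where J: "J \<in> P" "a \<in> J" "b \<in> J" by blast
      have "J \<subseteq> I" by (rule t.block_sub[OF J(1)])
      then have "J = {a, b}" using J I_cases by blast
      then have "Min J = a" using less by simp
      then have "AE z in L. z b = chacon_action \<omega> (k b) (z a)" using t.tied[OF J(1)] J(3) by (auto elim: eventually_mono)
      then have "AE x in ?M. h x b = chacon_action \<omega> (k b) (h x a)" unfolding L_def by (rule AE_distrD[OF hm])
      then have "AE x in ?M. S x = chacon_action \<omega> (k b) x" by (simp add: ha)
      then show ?thesis using S by (auto simp: mod_null_def)
    next
      case False
      have single: "{i} \<in> P" if i: "i \<in> I" for i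
      proof -
        obtain J where J: "J \<in> P" "i \<in> J" using i t.part by (auto simp: partition_on_def)
        have "J \<subseteq> {a, b}" using t.block_sub[OF J(1)] by (simp add: I_def)
        moreover have "\<not> (a \<in> J \<and> b \<in> J)" using False J(1) by blast
        ultimately have "J = {i}" using J(2) by blast
        then show ?thesis using J(1) by simp
      qed
      have "L = scale_measure (emeasure L (pbox 0 (\<lambda>_. 0))) chacon_prod"
        by (rule invariant_unique[OF lf]) (rule t.invariant[OF single])
      then obtain c where c: "L = scale_measure c chacon_prod" by blast
      have c0: "c \<noteq> 0" using pos by (auto simp: c)
      have rect: "emeasure ?M (A \<inter> (S -` B \<inter> chacon_points \<omega>)) = c * (emeasure ?M A * emeasure ?M B)"
        if A: "A \<in> sets (chacon_borel \<omega>)" and B: "B \<in> sets (chacon_borel \<omega>)" for A B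
      proof -
        define R where "R i = (if i = a then A else B)" for i
        have R: "R i \<in> sets (chacon_borel \<omega>)" for i using A B by (simp add: R_def)
        have Rs: "PiE I R \<in> sets borel_prod" unfolding borel_prod_def by (intro sets_PiM_I_finite finite_I R)
        have Ap: "A \<subseteq> chacon_points \<omega>" using sets.sets_into_space[OF A] by simp
        have "h -` PiE I R \<inter> chacon_points \<omega> = A \<inter> (S -` B \<inter> chacon_points \<omega>)"
        proof (rule set_eqI)
          fix x
          have "h x \<in> PiE I R \<longleftrightarrow> (\<forall>i\<in>I. h x i \<in> R i)" by (auto simp: h_def PiE_iff)
          also have "\<dots> \<longleftrightarrow> h x a \<in> R a \<and> h x b \<in> R b" by (auto simp: I_cases)
          also have "\<dots> \<longleftrightarrow> x \<in> A \<and> S x \<in> B" using ab by (simp add: ha R_def)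
          finally show "x \<in> h -` PiE I R \<inter> chacon_points \<omega> \<longleftrightarrow> x \<in> A \<inter> (S -` B \<inter> chacon_points \<omega>)" using Ap by auto
        qed
        then have "emeasure ?M (A \<inter> (S -` B \<inter> chacon_points \<omega>)) = emeasure L (PiE I R)" using emL[OF Rs] by simp
        also have "\<dots> = c * emeasure chacon_prod (PiE I R)" unfolding c using Rs by simp
        also have "emeasure chacon_prod (PiE I R) = emeasure ?M (R a) * emeasure ?M (R b)"
          using R by (subst emeasure_chacon_prod) (simp_all add: prod_I)
        finally show ?thesis using ab by (simp add: R_def)
      qed
      let ?Z = "cylinder \<omega> 0 0"
      have r1: "radius 1 = 3" "radius 0 = 0" by (simp_all add: radius_def)
      have m1: "emeasure ?M (cylinder \<omega> 1 i) \<noteq> 0" if "\<bar>i\<bar> \<le> 3" for i using emeasure_cylinder[of i 1 \<omega>] that r1 by simp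
      \<comment> \<open>The part of \<open>?Z\<close> not sent into the cylinder does not meet the
        preimage of the cylinder, so \<open>rect\<close> makes a product of measures vanish in which
        the second factor is positive.\<close>
      have sub: "?Z - S -` cylinder \<omega> 1 i \<in> null_sets ?M" if i: "\<bar>i\<bar> \<le> 3" for i
      proof -
        let ?C = "cylinder \<omega> 1 i"
        have SC: "S -` ?C \<inter> chacon_points \<omega> \<in> sets (chacon_borel \<omega>)" using measurable_sets[OF S, of ?C] by simp
        have Zp: "?Z \<subseteq> chacon_points \<omega>" by (auto simp: mem_cylinder)
        have eq: "?Z - S -` ?C = ?Z - (S -` ?C \<inter> chacon_points \<omega>)" using Zp by auto
        have s: "?Z - S -` ?C \<in> sets (chacon_borel \<omega>)" unfolding eq using SC by auto
        have "(?Z - S -` ?C) \<inter> (S -` ?C \<inter> chacon_points \<omega>) = {}" by auto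
        then have "c * (emeasure ?M (?Z - S -` ?C) * emeasure ?M ?C) = 0" using rect[OF s cylinder_sets, of 1 i] by simp
        then have "emeasure ?M (?Z - S -` ?C) = 0" using c0 m1[OF i] by simp
        then show ?thesis using s by (intro null_setsI) auto
      qed
      \<comment> \<open>No point is sent into two disjoint cylinders, so the two null sets cover
        \<open>?Z\<close>.\<close>
      have "(?Z - S -` cylinder \<omega> 1 0) \<union> (?Z - S -` cylinder \<omega> 1 1) \<in> null_sets ?M"
        using sub[of 0] sub[of 1] by (intro null_sets.Un) auto
      moreover have "(?Z - S -` cylinder \<omega> 1 0) \<union> (?Z - S -` cylinder \<omega> 1 1) = ?Z" by (auto simp: mem_cylinder)
      ultimately have "emeasure ?M ?Z = 0" by auto
      then show ?thesis using emeasure_cylinder[of 0 0 \<omega>] r1 by simp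
    qed
  qed
qed

lemma mod_null_int_iter:
  "mod_null (chacon_measure \<omega>) (range (int_iter (space (chacon_measure \<omega>)) (chacon_action \<omega> 1))) =
    mod_null (chacon_measure \<omega>) (range (chacon_action \<omega>))"
proof -
  have "(AE x in chacon_measure \<omega>. S x = int_iter (space (chacon_measure \<omega>)) (chacon_action \<omega> 1) k x) \<longleftrightarrow>
      (AE x in chacon_measure \<omega>. S x = chacon_action \<omega> k x)" for S k
    by (rule AE_cong) (simp add: int_iter_action)
  then show ?thesis by (simp add: mod_null_def)
qed

theorem chacon_radon_msj: "radon_msj (chacon_space \<omega>) (chacon_measure \<omega>) (chacon_action \<omega> 1)"
  unfolding radon_msj_def radon_msj_d_def
proof (intro allI impI conjI)
  show "centralizer (chacon_measure \<omega>) (chacon_action \<omega> 1) =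
      mod_null (chacon_measure \<omega>) (range (int_iter (space (chacon_measure \<omega>)) (chacon_action \<omega> 1)))"
    unfolding mod_null_int_iter by (rule centralizer_powers)
next
  fix d :: nat and L
  assume d: "1 < d" and L: "radon_self_joining (chacon_space \<omega>) (chacon_measure \<omega>) (chacon_action \<omega> 1) d L \<and>
    ergodic L (power_map (chacon_action \<omega> 1) {1..d})"
  interpret chacon_product "\<lambda>_. \<omega>" "{1..d}" by unfold_locales simp
  have jo: "ergodic_joining L" using radon_self_joining_ergodic_joining[of \<omega> d L] L d by simp
  have ne: "{1..d} \<noteq> {}" using d by simp
  obtain P k where "tied_joining \<omega> {1..d} L P k"
    using ergodic_joining_structure[OF jo ne refl] by blast
  then interpret t: tied_joining \<omega> "{1..d}" L P k .
  show "\<exists>P F. partition_on {1..d} P \<and>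
      (\<forall>J\<in>P. msj_factor (chacon_space \<omega>) (chacon_measure \<omega>) (chacon_action \<omega> 1) J (F J)) \<and>
      L = block_product (chacon_space \<omega>) {1..d} P F"
    using t.product_of_graphs[OF ne] t.part by blast
qed

section \<open>Tail equivalent parameters\<close>

text \<open>When the parameters agree from level \<open>N\<close> on, both systems use the same
  digits there, and every point is present at some such level; position and later symbols carry over
  unchanged. The value 0 below the starting level only keeps the sequence inside
  \<open>symbols\<close>.\<close>

definition transfer :: "nat \<Rightarrow> (nat \<Rightarrow> bool) \<Rightarrow> chacon_point \<Rightarrow> chacon_point" where
  "transfer N \<omega>' p = (let n = (LEAST n. n \<ge> N \<and> has_level n p) in
     point_of \<omega>' n (pos n p) (\<lambda>k. if n \<le> k then symb k p else 0))"

lemma transfer: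
  assumes agree: "\<And>n. n \<ge> N \<Longrightarrow> \<omega> n = \<omega>' n" and p: "p \<in> chacon_points \<omega>" and n: "n \<ge> N" "has_level n p"
  shows "transfer N \<omega>' p \<in> chacon_points \<omega>'" "has_level n (transfer N \<omega>' p)"
    "pos n (transfer N \<omega>' p) = pos n p"
proof -
  define m where "m = (LEAST n. n \<ge> N \<and> has_level n p)"
  have m: "m \<ge> N" "has_level m p" "m \<le> n"
    using LeastI[of "\<lambda>n. n \<ge> N \<and> has_level n p", OF conjI[OF n]] Least_le[of "\<lambda>n. n \<ge> N \<and> has_level n p", OF conjI[OF n]]
    unfolding m_def by auto
  define s where "s k = (if m \<le> k then symb k p else 0)" for k
  have lev: "has_level k p" if "m \<le> k" for k using has_level_mono[OF p m(2) that] .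
  have s: "s k \<in> symbols" for k using pos_step(2)[OF p lev] by (auto simp: s_def symbols_def)
  have q: "transfer N \<omega>' p = point_of \<omega>' m (pos m p) s" by (simp add: transfer_def m_def[symmetric] s_def[abs_def] Let_def)
  note pt = point_of[where f = "pos m p" and n = m and s = s and \<omega> = \<omega>', OF pos_step(1)[OF p m(2)] s, folded q]
  show in': "transfer N \<omega>' p \<in> chacon_points \<omega>'" by (rule pt(1))
  have lev': "has_level k (transfer N \<omega>' p)" if "m \<le> k" for k using has_level_mono[OF in' pt(2) that] .
  show "has_level n (transfer N \<omega>' p)" by (rule lev'[OF m(3)])
  have dig: "digit \<omega>' k t = digit \<omega> k t" if "m \<le> k" for k t using agree[of k] m(1) that by (simp add: digit_def)
  show "pos n (transfer N \<omega>' p) = pos n p"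
    using m(3)
  proof (induction n rule: dec_induct)
    case base
    show ?case by (rule pt(3))
  next
    case (step k)
    have "symb k (transfer N \<omega>' p) = symb k p" using pt(4)[OF step(1)] step(1) by (simp add: s_def)
    then show ?case
      using pos_step(3)[OF in' lev'[OF step(1)]] pos_step(3)[OF p lev[OF step(1)]] step(3) dig[OF step(1)] by simp
  qed
qed

lemma exists_level_ge:
  assumes "p \<in> chacon_points \<omega>"
  shows "\<exists>n\<ge>m. has_level n p"
  using exists_margin_level[OF assms, of m 0] by blast

lemma transfer_inverse:
  assumes agree: "\<And>n. n \<ge> N \<Longrightarrow> \<omega> n = \<omega>' n" and p: "p \<in> chacon_points \<omega>"
  shows "transfer N \<omega> (transfer N \<omega>' p) = p"
proof -
  obtain n where n: "n \<ge> N" "has_level n p" using exists_level_ge[OF p] by blast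
  note q = transfer[OF agree p n]
  have agree': "\<And>n. n \<ge> N \<Longrightarrow> \<omega>' n = \<omega> n" using agree by simp
  note r = transfer[OF agree' q(1) n(1) q(2)]
  show ?thesis
  proof (rule point_eqI_pos[OF r(1) p r(2) n(2)])
    fix k assume k: "k \<ge> n"
    then have k': "k \<ge> N" "has_level k p" using n has_level_mono[OF p n(2)] by auto
    note qk = transfer[OF agree p k']
    show "pos k (transfer N \<omega> (transfer N \<omega>' p)) = pos k p"
      using transfer(3)[OF agree' qk(1) k'(1) qk(2)] qk(3) by simp
  qed
qed

lemma transfer_level:
  assumes agree: "\<And>n. n \<ge> N \<Longrightarrow> \<omega> n = \<omega>' n" and p: "p \<in> chacon_points \<omega>" and n: "n \<ge> N"
  shows "has_level n (transfer N \<omega>' p) \<longleftrightarrow> has_level n p"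
proof
  assume l: "has_level n (transfer N \<omega>' p)"
  obtain m where m: "m \<ge> N" "has_level m p" using exists_level_ge[OF p] by blast
  have agree': "\<And>n. n \<ge> N \<Longrightarrow> \<omega>' n = \<omega> n" using agree by simp
  have "has_level n (transfer N \<omega> (transfer N \<omega>' p))"
    by (rule transfer(2)[OF agree' transfer(1)[OF agree p m] n l])
  then show "has_level n p" by (simp add: transfer_inverse[OF agree p])
qed (rule transfer(2)[OF agree p n])

lemma transfer_in:
  assumes agree: "\<And>n. n \<ge> N \<Longrightarrow> \<omega> n = \<omega>' n" and p: "p \<in> chacon_points \<omega>"
  shows "transfer N \<omega>' p \<in> chacon_points \<omega>'"
  using exists_level_ge[OF p, of N] transfer(1)[OF agree p] by blast

lemma transfer_vimage:
  assumes agree: "\<And>n. n \<ge> N \<Longrightarrow> \<omega> n = \<omega>' n" and n: "n \<ge> N"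
  shows "transfer N \<omega>' -` cylinder \<omega>' n f \<inter> chacon_points \<omega> = cylinder \<omega> n f"
proof (rule set_eqI)
  fix p
  show "p \<in> transfer N \<omega>' -` cylinder \<omega>' n f \<inter> chacon_points \<omega> \<longleftrightarrow> p \<in> cylinder \<omega> n f"
  proof (cases "p \<in> chacon_points \<omega> \<and> has_level n p")
    case True
    then have p: "p \<in> chacon_points \<omega>" "has_level n p" by auto
    show ?thesis using transfer[OF agree p(1) n p(2)] p by (simp add: mem_cylinder)
  next
    case False
    then show ?thesis using transfer_level[OF agree _ n, where p = p] by (auto simp: mem_cylinder)
  qed
qed

lemma transfer_continuous:
  assumes agree: "\<And>n. n \<ge> N \<Longrightarrow> \<omega> n = \<omega>' n"
  shows "continuous_map (chacon_space \<omega>) (chacon_space \<omega>') (transfer N \<omega>')"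
proof (unfold continuous_map_def, intro conjI allI impI)
  show "transfer N \<omega>' \<in> topspace (chacon_space \<omega>) \<rightarrow> topspace (chacon_space \<omega>')"
    using transfer_in[OF agree] by (auto simp: topspace_chacon_space)
  fix U assume U: "openin (chacon_space \<omega>') U"
  show "openin (chacon_space \<omega>) {x \<in> topspace (chacon_space \<omega>). transfer N \<omega>' x \<in> U}"
    unfolding openin_chacon_cylinders topspace_chacon_space
  proof (intro conjI ballI)
    fix p assume "p \<in> {x \<in> chacon_points \<omega>. transfer N \<omega>' x \<in> U}"
    then have p: "p \<in> chacon_points \<omega>" "transfer N \<omega>' p \<in> U" by auto
    note q = transfer_in[OF agree p(1)]
    obtain n where n: "has_level n (transfer N \<omega>' p)" "cylinder \<omega>' n (pos n (transfer N \<omega>' p)) \<subseteq> U"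
      using U p(2) unfolding openin_chacon_cylinders by blast
    define m where "m = max n N"
    have m: "m \<ge> n" "m \<ge> N" by (auto simp: m_def)
    have lq: "has_level m (transfer N \<omega>' p)" by (rule has_level_mono[OF q n(1) m(1)])
    then have lp: "has_level m p" using transfer_level[OF agree p(1) m(2)] by simp
    have "cylinder \<omega> m (pos m p) \<subseteq> {x \<in> chacon_points \<omega>. transfer N \<omega>' x \<in> U}"
    proof
      fix x assume "x \<in> cylinder \<omega> m (pos m p)"
      then have x: "x \<in> chacon_points \<omega>" "has_level m x" "pos m x = pos m p" by (auto simp: mem_cylinder)
      note y = transfer[OF agree x(1) m(2) x(2)]
      have "pos m (transfer N \<omega>' x) = pos m (transfer N \<omega>' p)" using y(3) x(3) transfer(3)[OF agree p(1) m(2) lp] by simp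
      then have "transfer N \<omega>' x \<in> cylinder \<omega>' n (pos n (transfer N \<omega>' p))"
        using same_cylinder(1,2)[OF q y(1) n(1) m(1) y(2)] y(1) by (simp add: mem_cylinder)
      then show "x \<in> {x \<in> chacon_points \<omega>. transfer N \<omega>' x \<in> U}" using x(1) n(2) by auto
    qed
    then show "\<exists>n. has_level n p \<and> cylinder \<omega> n (pos n p) \<subseteq> {x \<in> chacon_points \<omega>. transfer N \<omega>' x \<in> U}"
      using lp by blast
  qed auto
qed

lemma transfer_measurable:
  assumes "\<And>n. n \<ge> N \<Longrightarrow> \<omega> n = \<omega>' n"
  shows "transfer N \<omega>' \<in> measurable (chacon_measure \<omega>) (chacon_measure \<omega>')"
  using continuous_map_measurable[OF transfer_continuous, of N \<omega> \<omega>'] assms by (simp cong: measurable_cong_sets)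

lemma transfer_action:
  assumes agree: "\<And>n. n \<ge> N \<Longrightarrow> \<omega> n = \<omega>' n" and p: "p \<in> chacon_points \<omega>"
  shows "transfer N \<omega>' (chacon_action \<omega> g p) = chacon_action \<omega>' g (transfer N \<omega>' p)"
proof -
  obtain n where n: "n \<ge> N" "has_level n p" "\<bar>pos n p + g\<bar> \<le> radius n" using exists_margin_level[OF p] by blast
  note q = transfer[OF agree p n(1,2)]
  have gq: "\<bar>pos n (transfer N \<omega>' p) + g\<bar> \<le> radius n" using n(3) q(3) by simp
  note act = chacon_action[OF p n(2,3)] and actq = chacon_action[OF q(1,2) gq]
  note r = transfer[OF agree act(1) n(1) act(2)]
  show ?thesis
  proof (rule point_eqI_pos[OF r(1) actq(1) r(2) actq(2)])
    fix k assume k: "k \<ge> n"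
    have kN: "k \<ge> N" using k n(1) by simp
    note ak = chacon_action_pos[OF p n(2,3) k]
    have "pos k (transfer N \<omega>' (chacon_action \<omega> g p)) = pos k p + g"
      using transfer(3)[OF agree act(1) kN ak(1)] ak(2) by simp
    also have "pos k p = pos k (transfer N \<omega>' p)"
      using transfer(3)[OF agree p kN has_level_mono[OF p n(2) k]] by simp
    finally show "pos k (transfer N \<omega>' (chacon_action \<omega> g p)) = pos k (chacon_action \<omega>' g (transfer N \<omega>' p))"
      using chacon_action_pos(2)[OF q(1,2) gq k] by simp
  qed
qed

lemma strict_mono_radius: "strict_mono radius"
  unfolding strict_mono_Suc_iff
proof
  fix n show "radius n < radius (Suc n)" using height_radius[of n] radius_nonneg[of n] by (simp add: radius_Suc)
qed

lemma distr_transfer: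
  assumes agree: "\<And>n. n \<ge> N \<Longrightarrow> \<omega> n = \<omega>' n"
  shows "distr (chacon_measure \<omega>) (chacon_measure \<omega>') (transfer N \<omega>') = chacon_measure \<omega>'"
proof -
  let ?D = "distr (chacon_measure \<omega>) (chacon_measure \<omega>') (transfer N \<omega>')"
  have eq: "emeasure ?D (cylinder \<omega>' n f) = emeasure (chacon_measure \<omega>') (cylinder \<omega>' n f)"
    if "\<bar>f\<bar> + radius N \<le> radius n" for n f
  proof -
    have "radius N \<le> radius n" using that by simp
    then have n: "n \<ge> N" using strict_mono_less_eq[OF strict_mono_radius] by blast
    have f: "\<bar>f\<bar> \<le> radius n" using that radius_nonneg[of N] by simp
    have m: "transfer N \<omega>' \<in> measurable (chacon_measure \<omega>) (chacon_measure \<omega>')" by (rule transfer_measurable) (rule agree)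
    have "cylinder \<omega>' n f \<in> sets (chacon_measure \<omega>')" by (simp add: cylinder_sets)
    from emeasure_distr[OF m this] show ?thesis
      using transfer_vimage[OF agree n, where f = f] emeasure_cylinder[OF f] by simp
  qed
  show ?thesis
  \<comment> \<open>The margin \<open>radius N\<close> leaves only cylinders of level at least
    \<open>N\<close>, since the radii increase strictly; on these \<open>transfer\<close> matches
    cylinders.\<close>
  proof (rule measure_eq_cylinders[where g = "radius N" and \<omega> = \<omega>'])
    show "emeasure ?D (cylinder \<omega>' n f) = emeasure (chacon_measure \<omega>') (cylinder \<omega>' n f)"
      if "\<bar>f\<bar> + radius N \<le> radius n" for n f
      by (rule eq[OF that])
    show "emeasure ?D (cylinder \<omega>' n f) \<noteq> \<infinity>" if "\<bar>f\<bar> + radius N \<le> radius n" for n f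
      unfolding eq[OF that] using emeasure_cylinder_finite[of \<omega>' n f] by simp
  qed simp_all
qed

theorem tail_equivalent_isomorphic:
  assumes "tail_equivalent \<omega> \<omega>'"
  shows "isomorphic_systems (chacon_measure \<omega>) (chacon_action \<omega> 1) (chacon_measure \<omega>') (chacon_action \<omega>' 1)"
proof -
  obtain K where K: "\<forall>n>K. \<omega> n = \<omega>' n" using assms by (auto simp: tail_equivalent_def)
  define N where "N = Suc K"
  have agree: "\<omega> n = \<omega>' n" if "n \<ge> N" for n using K that by (simp add: N_def)
  have agree': "\<omega>' n = \<omega> n" if "n \<ge> N" for n using agree[OF that] by simp
  show ?thesis
    unfolding isomorphic_systems_def
  proof (rule bexI[of _ "transfer N \<omega>'"], rule bexI[of _ "transfer N \<omega>"], intro conjI)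
    show "AE x in chacon_measure \<omega>. transfer N \<omega> (transfer N \<omega>' x) = x"
      by (rule AE_I2) (simp add: transfer_inverse[OF agree])
    show "AE x in chacon_measure \<omega>'. transfer N \<omega>' (transfer N \<omega> x) = x"
      by (rule AE_I2) (simp add: transfer_inverse[OF agree'])
    show "distr (chacon_measure \<omega>) (chacon_measure \<omega>') (transfer N \<omega>') = chacon_measure \<omega>'"
      by (rule distr_transfer) (rule agree)
    show "AE x in chacon_measure \<omega>. transfer N \<omega>' (chacon_action \<omega> 1 x) = chacon_action \<omega>' 1 (transfer N \<omega>' x)"
      by (rule AE_I2) (simp add: transfer_action[OF agree])
    show "transfer N \<omega>' \<in> measurable (chacon_measure \<omega>) (chacon_measure \<omega>')"
      by (rule transfer_measurable) (rule agree)
    show "transfer N \<omega> \<in> measurable (chacon_measure \<omega>') (chacon_measure \<omega>)"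
      by (rule transfer_measurable) (rule agree')
  qed
qed


section \<open>Radon disjointness\<close>

context chacon_pair
begin

section \<open>Passage between families with two coordinates and pairs\<close>

definition to_pair :: "(nat \<Rightarrow> chacon_point) \<Rightarrow> chacon_point \<times> chacon_point" where
  "to_pair z = (z a, z b)"

definition of_pair :: "chacon_point \<times> chacon_point \<Rightarrow> nat \<Rightarrow> chacon_point" where
  "of_pair q = (\<lambda>i\<in>I. if i = a then fst q else snd q)"

abbreviation pair_topology :: "(chacon_point \<times> chacon_point) topology" where
  "pair_topology \<equiv> prod_topology (chacon_space (w a)) (chacon_space (w b))"

abbreviation pair_borel :: "(chacon_point \<times> chacon_point) measure" where
  "pair_borel \<equiv> borel_of pair_topology"

abbreviation pair_chacon :: "(chacon_point \<times> chacon_point) measure" where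
  "pair_chacon \<equiv> chacon_measure (w a) \<Otimes>\<^sub>M chacon_measure (w b)"

abbreviation pair_act :: "chacon_point \<times> chacon_point \<Rightarrow> chacon_point \<times> chacon_point" where
  "pair_act \<equiv> map_prod (chacon_action (w a) 1) (chacon_action (w b) 1)"

abbreviation pairs :: "(chacon_point \<times> chacon_point) set" where
  "pairs \<equiv> chacon_points (w a) \<times> chacon_points (w b)"

lemma of_pair_apply: "of_pair q a = fst q" "of_pair q b = snd q"
  using ab by (simp_all add: of_pair_def)

lemma to_of_pair [simp]: "to_pair (of_pair q) = q"
  by (simp add: to_pair_def of_pair_apply)

lemma points_ab: "z \<in> points \<longleftrightarrow> z \<in> extensional I \<and> z a \<in> chacon_points (w a) \<and> z b \<in> chacon_points (w b)"
  by (auto simp: points_def PiE_iff I_cases)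

lemma of_pair_points: "of_pair q \<in> points \<longleftrightarrow> q \<in> pairs"
proof -
  have "of_pair q \<in> extensional I" by (simp add: of_pair_def)
  then show ?thesis by (cases q) (simp add: points_ab of_pair_apply)
qed

lemma to_pair_pairs: "z \<in> points \<Longrightarrow> to_pair z \<in> pairs"
  by (simp add: to_pair_def points_ab)

lemma of_pair_act: "of_pair (pair_act q) = act (\<lambda>_. 1) (of_pair q)"
  using ab by (auto simp: fun_eq_iff of_pair_def act_def I_cases)

lemma to_pair_act: "to_pair (act (\<lambda>_. 1) z) = pair_act (to_pair z)"
  by (simp add: to_pair_def act_def)

lemma pair_act_pairs: "q \<in> pairs \<Longrightarrow> pair_act q \<in> pairs"
  by (auto simp: chacon_action_in)

lemma space_pair [simp]: "space pair_borel = pairs" "space pair_chacon = pairs"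
  by (simp_all add: space_pair_measure)

lemma to_pair_measurable: "to_pair \<in> measurable borel_prod pair_chacon"
proof -
  have "(\<lambda>z. z i) \<in> measurable borel_prod (chacon_measure (w i))" if "i \<in> I" for i
    using coord_measurable[OF that] by (simp cong: measurable_cong_sets)
  then show ?thesis unfolding to_pair_def by (intro measurable_Pair) simp_all
qed

lemma of_pair_measurable: "of_pair \<in> measurable pair_chacon borel_prod"
  unfolding of_pair_def borel_prod_def
proof (rule measurable_restrict)
  fix i assume "i \<in> I"
  then consider "i = a" | "i = b" "i \<noteq> a" using I_cases by blast
  then show "(\<lambda>q. if i = a then fst q else snd q) \<in> measurable pair_chacon (chacon_borel (w i))"
  proof cases
    case 1
    then show ?thesis using measurable_fst[of "chacon_measure (w a)" "chacon_measure (w b)"]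
      by (simp cong: measurable_cong_sets)
  next
    case 2
    then show ?thesis using measurable_snd[of "chacon_measure (w a)" "chacon_measure (w b)"]
      by (simp cong: measurable_cong_sets)
  qed
qed

lemma to_pair_borel: "to_pair \<in> measurable borel_prod pair_borel"
proof -
  let ?X = "product_topology (\<lambda>i. chacon_space (w i)) I"
  have "continuous_map ?X pair_topology to_pair"
    unfolding to_pair_def by (intro continuous_map_pairedI continuous_map_product_projection ab_mem)
  then have "to_pair \<in> measurable (borel_of ?X) pair_borel" by (rule continuous_map_measurable)
  then show ?thesis by (simp cong: measurable_cong_sets add: sets_borel_of_product)
qed

lemma of_pair_borel: "of_pair \<in> measurable pair_borel borel_prod"
proof -
  let ?X = "product_topology (\<lambda>i. chacon_space (w i)) I"
  have "continuous_map pair_topology (chacon_space (w i)) (\<lambda>q. of_pair q i)" if "i \<in> I" for i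
  proof (cases "i = a")
    case True
    then show ?thesis by (simp add: of_pair_apply continuous_map_fst)
  next
    case False
    then have "i = b" using that I_cases by blast
    then show ?thesis by (simp add: of_pair_apply continuous_map_snd)
  qed
  moreover have "of_pair ` topspace pair_topology \<subseteq> extensional I" by (auto simp: of_pair_def)
  ultimately have "continuous_map pair_topology ?X of_pair" by (auto simp: continuous_map_componentwise)
  then have "of_pair \<in> measurable pair_borel (borel_of ?X)" by (rule continuous_map_measurable)
  then show ?thesis by (simp cong: measurable_cong_sets add: sets_borel_of_product)
qed

lemma pair_vimage: "of_pair -` (to_pair -` X \<inter> points) \<inter> pairs = X \<inter> pairs"
  using of_pair_points by auto

text \<open>\<open>to_pair\<close> and \<open>of_pair\<close> are measurable for both structures on
  pairs, so a set of either kind can be pulled back to \<open>borel_prod\<close> and returned as a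
  set of the other kind.\<close>

lemma sets_pair_borel: "sets pair_borel = sets pair_chacon"
proof (rule set_eqI)
  fix X
  have eq: "of_pair -` (to_pair -` X \<inter> points) \<inter> pairs = X" if "X \<subseteq> pairs" using pair_vimage[of X] that by blast
  show "X \<in> sets pair_borel \<longleftrightarrow> X \<in> sets pair_chacon"
  proof
    assume X: "X \<in> sets pair_borel"
    have "to_pair -` X \<inter> points \<in> sets borel_prod" using measurable_sets[OF to_pair_borel X] by simp
    from measurable_sets[OF of_pair_measurable this] show "X \<in> sets pair_chacon"
      using eq sets.sets_into_space[OF X] by simp
  next
    assume X: "X \<in> sets pair_chacon"
    have "to_pair -` X \<inter> points \<in> sets borel_prod" using measurable_sets[OF to_pair_measurable X] by simp
    from measurable_sets[OF of_pair_borel this] show "X \<in> sets pair_borel"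
      using eq sets.sets_into_space[OF X] by simp
  qed
qed

lemma to_pair_sets: "X \<in> sets pair_chacon \<Longrightarrow> to_pair -` X \<inter> points \<in> sets borel_prod"
  using measurable_sets[OF to_pair_measurable] by simp

lemma emeasure_pair_chacon:
  assumes "X \<in> sets pair_chacon"
  shows "emeasure pair_chacon X = emeasure chacon_prod (to_pair -` X \<inter> points)"
proof -
  have m: "to_pair \<in> measurable chacon_prod pair_chacon"
    using to_pair_measurable by (simp cong: measurable_cong_sets)
  have "pair_chacon = distr chacon_prod pair_chacon to_pair"
  proof (rule pair_measure_eqI[OF sigma_finite_chacon sigma_finite_chacon])
    fix A B assume A: "A \<in> sets (chacon_measure (w a))" and B: "B \<in> sets (chacon_measure (w b))"
    define R where "R i = (if i = a then A else B)" for i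
    have Rs: "R i \<in> sets (chacon_borel (w i))" if "i \<in> I" for i using that A B ab by (auto simp: R_def I_cases)
    have R: "R a = A" "R b = B" using ab by (simp_all add: R_def)
    have AB: "A \<subseteq> chacon_points (w a)" "B \<subseteq> chacon_points (w b)"
      using sets.sets_into_space[OF A] sets.sets_into_space[OF B] by auto
    have "emeasure (distr chacon_prod pair_chacon to_pair) (A \<times> B) = emeasure chacon_prod (to_pair -` (A \<times> B) \<inter> points)"
      using A B by (subst emeasure_distr[OF m]) auto
    also have "to_pair -` (A \<times> B) \<inter> points = PiE I R"
    proof (rule set_eqI)
      fix z
      have "z \<in> PiE I R \<longleftrightarrow> z \<in> extensional I \<and> z a \<in> A \<and> z b \<in> B"
        unfolding PiE_iff using I_cases R by metis
      then show "z \<in> to_pair -` (A \<times> B) \<inter> points \<longleftrightarrow> z \<in> PiE I R"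
        using AB by (auto simp only: to_pair_def points_ab vimage_eq Int_iff mem_Times_iff fst_conv snd_conv)
    qed
    also have "emeasure chacon_prod (PiE I R) = emeasure (chacon_measure (w a)) A * emeasure (chacon_measure (w b)) B"
      using emeasure_chacon_prod[OF Rs] by (simp add: prod_I R)
    finally show "emeasure (chacon_measure (w a)) A * emeasure (chacon_measure (w b)) B =
      emeasure (distr chacon_prod pair_chacon to_pair) (A \<times> B)" ..
  qed simp
  then show ?thesis using emeasure_distr[OF m assms] by simp
qed


lemma chacon_points_positive:
  "chacon_points (w i) \<in> sets (chacon_measure (w i))" "emeasure (chacon_measure (w i)) (chacon_points (w i)) \<noteq> 0"
proof -
  show s: "chacon_points (w i) \<in> sets (chacon_measure (w i))" using sets.top[of "chacon_measure (w i)"] by simp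
  show "emeasure (chacon_measure (w i)) (chacon_points (w i)) \<noteq> 0"
    using chacon_points_not_null[of "w i"] s by (auto simp: null_sets_def)
qed

lemma pair_act_measurable: "pair_act \<in> measurable pair_chacon pair_chacon"
proof -
  have "(\<lambda>q. (chacon_action (w a) 1 (fst q), chacon_action (w b) 1 (snd q))) \<in> measurable pair_chacon pair_chacon"
    by (intro measurable_Pair measurable_compose[OF measurable_fst] measurable_compose[OF measurable_snd]
        chacon_action_measurable')
  then show ?thesis by (simp add: map_prod_def case_prod_beta)
qed

lemma product_is_joining:
  assumes c: "c > 0"
  defines "L \<equiv> scale_measure (ennreal c) pair_chacon"
  shows "radon_joining (chacon_space (w a)) (chacon_measure (w a)) (chacon_action (w a) 1)
    (chacon_space (w b)) (chacon_measure (w b)) (chacon_action (w b) 1) L"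
    and "ergodic L pair_act"
proof -
  have Ls: "sets L = sets pair_chacon" by (simp add: L_def)
  have sp: "space L = pairs" using sets_eq_imp_space_eq[OF Ls] by simp
  have emL: "emeasure L X = ennreal c * emeasure pair_chacon X" for X by (simp add: L_def)
  have c0: "ennreal c \<noteq> 0" "ennreal c < \<infinity>" using c by (auto simp: ennreal_eq_0_iff)
  interpret M: sigma_finite_measure "chacon_measure (w a)" by (rule sigma_finite_chacon)
  interpret N: sigma_finite_measure "chacon_measure (w b)" by (rule sigma_finite_chacon)
  have times: "emeasure pair_chacon (A \<times> B) = emeasure (chacon_measure (w a)) A * emeasure (chacon_measure (w b)) B"
    if "A \<in> sets (chacon_measure (w a))" "B \<in> sets (chacon_measure (w b))" for A B
    by (rule N.emeasure_pair_measure_Times[OF that])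
  have radon: "radon_measure pair_topology L"
    unfolding radon_measure_def
  proof (intro conjI allI impI)
    show "space L = topspace pair_topology" by (simp add: sp topspace_chacon_space)
    show "sets L = sets pair_borel" by (simp add: Ls sets_pair_borel)
    fix K assume K: "compactin pair_topology K"
    \<comment> \<open>Open rectangles of finite measure; finitely many of them cover a compact
      set.\<close>
    define \<U> where "\<U> = {cylinder (w a) n f \<times> cylinder (w b) m g | n f m g. True}"
    have "openin pair_topology U" if "U \<in> \<U>" for U
      using that openin_cylinder by (auto simp: \<U>_def openin_prod_Times_iff)
    moreover have "K \<subseteq> \<Union>\<U>"
    proof
      fix q assume "q \<in> K"
      then have "q \<in> topspace pair_topology" using compactin_subset_topspace[OF K] by blast
      then have q: "fst q \<in> chacon_points (w a)" "snd q \<in> chacon_points (w b)" by (auto simp: topspace_chacon_space)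
      obtain n m where "has_level n (fst q)" "has_level m (snd q)" using has_some_level[OF q(1)] has_some_level[OF q(2)] by blast
      then have "q \<in> cylinder (w a) n (pos n (fst q)) \<times> cylinder (w b) m (pos m (snd q))"
        using q by (simp add: mem_Times_iff mem_cylinder)
      moreover have "cylinder (w a) n (pos n (fst q)) \<times> cylinder (w b) m (pos m (snd q)) \<in> \<U>"
        unfolding \<U>_def by blast
      ultimately show "q \<in> \<Union>\<U>" by blast
    qed
    ultimately obtain \<F> where F: "finite \<F>" "\<F> \<subseteq> \<U>" "K \<subseteq> \<Union>\<F>" using compactinD[OF K] by meson
    have U: "U \<in> sets pair_chacon \<and> emeasure L U < \<infinity>" if mem: "U \<in> \<U>" for U
    proof -
      obtain n f m g where U: "U = cylinder (w a) n f \<times> cylinder (w b) m g" using mem unfolding \<U>_def by blast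
      have "cylinder (w a) n f \<in> sets (chacon_measure (w a))" "cylinder (w b) m g \<in> sets (chacon_measure (w b))"
        by (simp_all add: cylinder_sets)
      then show ?thesis
        unfolding U emL using emeasure_cylinder_finite[of "w a" n f] emeasure_cylinder_finite[of "w b" m g] c0(2)
        by (auto simp: times ennreal_mult_less_top)
    qed
    have "emeasure L K \<le> emeasure L (\<Union>\<F>)"
    proof (rule emeasure_mono[OF F(3)])
      show "\<Union>\<F> \<in> sets L" unfolding Ls using F(1,2) U by (intro sets.finite_Union) auto
    qed
    also have "\<dots> \<le> (\<Sum>U\<in>\<F>. emeasure L U)"
      using emeasure_subadditive_finite[of \<F> "\<lambda>U. U" L] F U by (simp add: Ls image_subset_iff subset_iff)
    also have "\<dots> < \<infinity>" using F U by (simp add: subset_iff)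
    finally show "emeasure L K < \<infinity>" .
  qed
  have mL: "pair_act \<in> measurable L L" using pair_act_measurable by (simp cong: measurable_cong_sets add: Ls)
  have vim: "to_pair -` (pair_act -` X \<inter> pairs) \<inter> points = act (\<lambda>_. 1) -` (to_pair -` X \<inter> points) \<inter> points" for X
    using to_pair_act act_points to_pair_pairs by (auto simp del: map_prod_def)
  have inv: "invariant_measure L pair_act"
    unfolding invariant_measure_def
  proof (intro conjI mL measure_eqI)
    fix X assume "X \<in> sets (distr L L pair_act)"
    then have X: "X \<in> sets L" "X \<in> sets pair_chacon" by (simp_all add: Ls)
    have XX: "pair_act -` X \<inter> pairs \<in> sets pair_chacon" using measurable_sets[OF pair_act_measurable X(2)] by simp
    have "emeasure pair_chacon (pair_act -` X \<inter> pairs) = emeasure chacon_prod (act (\<lambda>_. 1) -` (to_pair -` X \<inter> points) \<inter> points)"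
      unfolding emeasure_pair_chacon[OF XX] vim ..
    also have "\<dots> = emeasure pair_chacon X"
      using scalesD[OF scales_chacon_prod to_pair_sets[OF X(2)]] by (simp add: emeasure_pair_chacon[OF X(2)])
    finally show "emeasure (distr L L pair_act) X = emeasure L X"
      unfolding emeasure_distr[OF mL X(1)] sp emL by simp
  qed simp
  have fst: "fst \<in> measurable L (chacon_measure (w a))" and snd: "snd \<in> measurable L (chacon_measure (w b))"
    using measurable_fst measurable_snd by (simp_all cong: measurable_cong_sets add: Ls)
  have "emeasure (distr L (chacon_measure (w a)) fst) A = 0 \<longleftrightarrow> emeasure (chacon_measure (w a)) A = 0"
    if A: "A \<in> sets (chacon_measure (w a))" for A
  proof -
    have "A \<subseteq> chacon_points (w a)" using sets.sets_into_space[OF A] by simp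
    then have "fst -` A \<inter> space L = A \<times> chacon_points (w b)" by (auto simp: sp)
    then show ?thesis
      unfolding emeasure_distr[OF fst A] emL using c0 chacon_points_positive[of b] A by (simp add: times)
  qed
  then have nf: "null_sets (distr L (chacon_measure (w a)) fst) = null_sets (chacon_measure (w a))"
    unfolding null_sets_def by auto
  have "emeasure (distr L (chacon_measure (w b)) snd) A = 0 \<longleftrightarrow> emeasure (chacon_measure (w b)) A = 0"
    if A: "A \<in> sets (chacon_measure (w b))" for A
  proof -
    have "A \<subseteq> chacon_points (w b)" using sets.sets_into_space[OF A] by simp
    then have "snd -` A \<inter> space L = chacon_points (w a) \<times> A" by (auto simp: sp)
    then show ?thesis
      unfolding emeasure_distr[OF snd A] emL using c0 chacon_points_positive[of a] A by (simp add: times)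
  qed
  then have ns: "null_sets (distr L (chacon_measure (w b)) snd) = null_sets (chacon_measure (w b))"
    unfolding null_sets_def by auto
  show "radon_joining (chacon_space (w a)) (chacon_measure (w a)) (chacon_action (w a) 1)
    (chacon_space (w b)) (chacon_measure (w b)) (chacon_action (w b) 1) L"
    unfolding radon_joining_def using radon inv nf ns by blast
  show "ergodic L pair_act"
    unfolding ergodic_def
  proof (intro ballI impI)
    fix A assume "A \<in> sets L" and "pair_act -` A \<inter> space L = A"
    then have A: "A \<in> sets pair_chacon" "pair_act -` A \<inter> pairs = A" by (simp_all add: Ls sp)
    have C: "pairs - A \<in> sets pair_chacon" using sets.compl_sets[OF A(1)] by simp
    have "act (\<lambda>_. 1) -` (to_pair -` A \<inter> points) \<inter> points = to_pair -` A \<inter> points"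
      unfolding vim[symmetric] A(2) ..
    moreover have "to_pair -` A \<inter> points \<in> sets chacon_prod" using to_pair_sets[OF A(1)] by simp
    ultimately have "to_pair -` A \<inter> points \<in> null_sets chacon_prod \<or> points - (to_pair -` A \<inter> points) \<in> null_sets chacon_prod"
      using product_ergodic unfolding ergodic_def by auto
    moreover have "points - (to_pair -` A \<inter> points) = to_pair -` (pairs - A) \<inter> points" using to_pair_pairs by auto
    ultimately have "emeasure pair_chacon A = 0 \<or> emeasure pair_chacon (pairs - A) = 0"
      unfolding emeasure_pair_chacon[OF A(1)] emeasure_pair_chacon[OF C] null_sets_def by auto
    then show "A \<in> null_sets L \<or> space L - A \<in> null_sets L"
      using A(1) C by (auto simp: null_sets_def Ls sp emL)
  qed
qed

lemma joining_transport:
  assumes jo: "radon_joining (chacon_space (w a)) (chacon_measure (w a)) (chacon_action (w a) 1)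
    (chacon_space (w b)) (chacon_measure (w b)) (chacon_action (w b) 1) L"
    and erg: "ergodic L pair_act"
  shows "sets L = sets pair_chacon" and "ergodic_joining (distr L borel_prod of_pair)"
    and "X \<in> sets pair_chacon \<Longrightarrow> emeasure L X = emeasure (distr L borel_prod of_pair) (to_pair -` X \<inter> points)"
proof -
  let ?D = "distr L borel_prod of_pair"
  have rad: "radon_measure pair_topology L" and inv: "invariant_measure L pair_act"
    and nf: "null_sets (distr L (chacon_measure (w a)) fst) = null_sets (chacon_measure (w a))"
    and ns: "null_sets (distr L (chacon_measure (w b)) snd) = null_sets (chacon_measure (w b))"
    using jo unfolding radon_joining_def by auto
  show Ls: "sets L = sets pair_chacon" using rad by (simp add: radon_measure_def sets_pair_borel)
  have sp: "space L = pairs" using sets_eq_imp_space_eq[OF Ls] by simp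
  have m: "of_pair \<in> measurable L borel_prod" using of_pair_measurable by (simp cong: measurable_cong_sets add: Ls)
  have emD: "emeasure ?D E = emeasure L (of_pair -` E \<inter> pairs)" if "E \<in> sets borel_prod" for E
    using emeasure_distr[OF m that] by (simp add: sp)
  have ofs: "of_pair -` E \<inter> pairs \<in> sets L" if "E \<in> sets borel_prod" for E
    using measurable_sets[OF m that] by (simp add: sp)
  show "emeasure L X = emeasure ?D (to_pair -` X \<inter> points)" if X: "X \<in> sets pair_chacon" for X
  proof -
    have "X \<subseteq> pairs" using sets.sets_into_space[OF X] by simp
    then have "X \<inter> pairs = X" by blast
    then show ?thesis unfolding emD[OF to_pair_sets[OF X]] pair_vimage by simp
  qed
  have lf: "locally_finite ?D"
    unfolding locally_finite_def
  proof (intro conjI allI)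
    fix n f
    have "of_pair -` pbox n f \<inter> pairs = cylinder (w a) n (f a) \<times> cylinder (w b) n (f b)"
    proof (rule set_eqI)
      fix q
      have "(\<forall>i\<in>I. Q i) \<longleftrightarrow> Q a \<and> Q b" for Q unfolding Ball_def I_cases by blast
      from this[of "\<lambda>i. has_level n (of_pair q i) \<and> pos n (of_pair q i) = f i"]
      show "q \<in> of_pair -` pbox n f \<inter> pairs \<longleftrightarrow> q \<in> cylinder (w a) n (f a) \<times> cylinder (w b) n (f b)"
        using of_pair_points[of q] of_pair_apply[of q] by (auto simp: mem_box mem_cylinder mem_Times_iff)
    qed
    moreover have "compactin pair_topology (cylinder (w a) n (f a) \<times> cylinder (w b) n (f b))"
      by (simp add: compactin_Times compactin_cylinder)
    then have "emeasure L (cylinder (w a) n (f a) \<times> cylinder (w b) n (f b)) < \<infinity>"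
      using rad unfolding radon_measure_def by blast
    ultimately show "emeasure ?D (pbox n f) < \<infinity>" by (simp add: emD)
  qed simp
  have vim: "of_pair -` (act (\<lambda>_. 1) -` E \<inter> points) \<inter> pairs = pair_act -` (of_pair -` E \<inter> pairs) \<inter> pairs" for E
  proof (rule set_eqI)
    fix q
    show "q \<in> of_pair -` (act (\<lambda>_. 1) -` E \<inter> points) \<inter> pairs \<longleftrightarrow> q \<in> pair_act -` (of_pair -` E \<inter> pairs) \<inter> pairs"
      using of_pair_points[of q] pair_act_pairs[of q] of_pair_act[of q] by (simp only: vimage_eq Int_iff) blast
  qed
  have sc: "scales ?D (\<lambda>_. 1) 1"
    unfolding scales_def
  proof
    fix E assume E: "E \<in> sets borel_prod"
    have "emeasure ?D (act (\<lambda>_. 1) -` E \<inter> points) = emeasure L (pair_act -` (of_pair -` E \<inter> pairs) \<inter> pairs)"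
      unfolding emD[OF act_vimage[OF E]] vim ..
    also have "\<dots> = emeasure (distr L L pair_act) (of_pair -` E \<inter> pairs)"
      using inv emeasure_distr[OF _ ofs[OF E], of pair_act L] by (simp add: invariant_measure_def sp)
    also have "\<dots> = emeasure ?D E" using inv by (simp add: invariant_measure_def emD[OF E])
    finally show "emeasure ?D (act (\<lambda>_. 1) -` E \<inter> points) = 1 * emeasure ?D E" by simp
  qed
  have er: "ergodic ?D (act (\<lambda>_. 1))"
    unfolding ergodic_def
  proof (intro ballI impI)
    fix A assume "A \<in> sets ?D" and "act (\<lambda>_. 1) -` A \<inter> space ?D = A"
    then have A: "A \<in> sets borel_prod" "act (\<lambda>_. 1) -` A \<inter> points = A" by simp_all
    have C: "points - A \<in> sets borel_prod" using sets.compl_sets[OF A(1)] by simp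
    have "pair_act -` (of_pair -` A \<inter> pairs) \<inter> space L = of_pair -` A \<inter> pairs" unfolding sp vim[symmetric] A(2) ..
    then have "of_pair -` A \<inter> pairs \<in> null_sets L \<or> pairs - (of_pair -` A \<inter> pairs) \<in> null_sets L"
      using erg ofs[OF A(1)] unfolding ergodic_def sp by blast
    moreover have "pairs - (of_pair -` A \<inter> pairs) = of_pair -` (points - A) \<inter> pairs" using of_pair_points by blast
    ultimately have "emeasure ?D A = 0 \<or> emeasure ?D (points - A) = 0" by (auto simp: emD A(1) C)
    then show "A \<in> null_sets ?D \<or> space ?D - A \<in> null_sets ?D" using A(1) C by (auto simp: null_sets_def)
  qed
  have fst: "fst \<in> measurable L (chacon_measure (w a))" and snd: "snd \<in> measurable L (chacon_measure (w b))"
    using measurable_fst measurable_snd by (simp_all cong: measurable_cong_sets add: Ls)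
  have null: "emeasure ?D {z \<in> points. z i \<in> N} = 0" if i: "i \<in> I" and N: "N \<in> null_sets (chacon_measure (w i))" for i N
  proof -
    have Ns: "N \<in> sets (chacon_borel (w i))" using N by auto
    note D = emD[OF coord_vimage_sets[OF i Ns]]
    consider "i = a" | "i = b" using i I_cases by blast
    then show ?thesis
    proof cases
      case 1
      have "of_pair -` {z \<in> points. z i \<in> N} \<inter> pairs = fst -` N \<inter> space L"
        using of_pair_points of_pair_apply unfolding sp 1 by auto
      moreover have "emeasure (distr L (chacon_measure (w a)) fst) N = 0" using N nf unfolding 1 by blast
      ultimately show ?thesis using D Ns emeasure_distr[OF fst, of N] unfolding 1 by simp
    next
      case 2
      have "of_pair -` {z \<in> points. z i \<in> N} \<inter> pairs = snd -` N \<inter> space L"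
        using of_pair_points of_pair_apply unfolding sp 2 by auto
      moreover have "emeasure (distr L (chacon_measure (w b)) snd) N = 0" using N ns unfolding 2 by blast
      ultimately show ?thesis using D Ns emeasure_distr[OF snd, of N] unfolding 2 by simp
    qed
  qed
  have pos: "emeasure ?D points \<noteq> 0"
  proof
    assume "emeasure ?D points = 0"
    moreover have "points \<in> sets borel_prod" using sets.top[of borel_prod] by simp
    moreover have "of_pair -` points \<inter> pairs = fst -` chacon_points (w a) \<inter> space L"
      using of_pair_points unfolding sp by auto
    ultimately have "emeasure (distr L (chacon_measure (w a)) fst) (chacon_points (w a)) = 0"
      using emeasure_distr[OF fst chacon_points_positive(1)[of a]] emD[of points] by simp
    then have "chacon_points (w a) \<in> null_sets (chacon_measure (w a))"
      unfolding nf[symmetric] using chacon_points_positive(1)[of a] by (auto simp: null_sets_def)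
    then show False using chacon_points_not_null by blast
  qed
  show "ergodic_joining ?D" unfolding ergodic_joining_def using lf sc er pos null by blast
qed

text \<open>The two parameters put the long gap in opposite places, so a common move from equal
  symbols has different lengths in the two coordinates. Symbol 1 can only move down; the others move
  up.\<close>

lemma constant_symbols_good:
  assumes "w a n \<noteq> w b n" "s \<in> symbols"
  shows "good I n (\<lambda>_. s)"
proof -
  define t :: int where "t = (if s = 1 then -1 else 1)"
  define v where "v j = digit (w j) n (s + t) - digit (w j) n s - t * height n" for j
  have "v a \<noteq> v b" using assms by (auto simp: v_def t_def symbols_def digit_def of_bool_def algebra_simps)
  then have "\<exists>i\<in>I. \<exists>j\<in>I. v i \<noteq> v j" by (intro bexI) auto
  moreover have "s + t \<in> symbols" using assms(2) by (auto simp: t_def symbols_def)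
  ultimately have "jump I n v (\<lambda>_. s) t" using assms(2) by (auto simp: jump_def v_def t_def)
  then show ?thesis by (auto simp: good_def)
qed

text \<open>If both coordinates formed one block, \<open>tied_levels\<close> would give a point with
  equal symbols and no good move from some level on, against \<open>constant_symbols_good\<close> at
  a later level where the parameters differ. So the blocks are singletons and the joining is
  invariant in each coordinate.\<close>

lemma joining_is_product:
  assumes ne: "\<not> tail_equivalent (w a) (w b)" and jo: "ergodic_joining L"
  shows "\<exists>c. c \<noteq> 0 \<and> c < \<infinity> \<and> L = scale_measure c chacon_prod"
proof -
  have I0: "I \<noteq> {}" using ab_mem by blast
  obtain P where P: "partition_on I P" "\<And>J. J \<in> P \<Longrightarrow> scales L (restr J 1) 1"
      "\<And>J. J \<in> P \<Longrightarrow> \<not> (AE z in L. often_good J z)"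
    using joining_partition[OF jo I0] by blast
  have "I \<notin> P"
  proof
    assume "I \<in> P"
    obtain m where m: "emeasure L {z \<in> level_set I m. \<forall>n\<ge>m. \<not> good I n (syms I n z) \<and> (\<exists>s. \<forall>j\<in>I. symb n (z j) = s)} \<noteq> 0"
      using tied_levels[OF jo subset_refl I0 P(3)[OF \<open>I \<in> P\<close>]] by blast
    then have "{z \<in> level_set I m. \<forall>n\<ge>m. \<not> good I n (syms I n z) \<and> (\<exists>s. \<forall>j\<in>I. symb n (z j) = s)} \<noteq> {}"
      by (metis emeasure_empty)
    then obtain z where z: "z \<in> level_set I m"
      "\<And>n. n \<ge> m \<Longrightarrow> \<not> good I n (syms I n z) \<and> (\<exists>s. \<forall>j\<in>I. symb n (z j) = s)" by blast
    \<comment> \<open>\<open>Suc m\<close> in place of \<open>m\<close>, because tail equivalence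
      quantifies over positive bounds.\<close>
    obtain n where n: "n > Suc m" "w a n \<noteq> w b n" using ne unfolding tail_equivalent_def by blast
    obtain s where s: "\<And>j. j \<in> I \<Longrightarrow> symb n (z j) = s" and ng: "\<not> good I n (syms I n z)" using z(2)[of n] n(1) by auto
    have za: "z a \<in> chacon_points (w a)" "has_level m (z a)" using z(1) by (auto simp: level_set_def points_mem)
    have "symb n (z a) \<in> symbols" by (rule pos_step(2)[OF za(1) has_level_mono[OF za]]) (use n in simp)
    then have "good I n (\<lambda>_. s)" using constant_symbols_good[OF n(2)] s[of a] by simp
    moreover have "good I n (syms I n z) \<longleftrightarrow> good I n (\<lambda>_. s)" by (rule good_cong) (simp add: syms_def s)
    ultimately show False using ng by simp
  qed
  have single: "{i} \<in> P" if i: "i \<in> I" for i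
  proof -
    obtain J where J: "J \<in> P" "i \<in> J" "J \<subseteq> I" using i P(1) by (auto simp: partition_on_def)
    have "J \<noteq> I" using J(1) \<open>I \<notin> P\<close> by blast
    then have "J = {i}" using J(2,3) I_eq by auto
    then show ?thesis using J(1) by simp
  qed
  have lf: "locally_finite L" and pos: "emeasure L points \<noteq> 0" using jo by (auto simp: ergodic_joining_def)
  define c where "c = emeasure L (pbox 0 (\<lambda>_. 0))"
  have "L = scale_measure c chacon_prod"
    unfolding c_def by (rule invariant_unique[OF lf]) (rule P(2)[OF single])
  moreover from this have "c \<noteq> 0" using pos by auto
  moreover have "c < \<infinity>" using lf by (simp add: c_def locally_finite_def)
  ultimately show ?thesis by blast
qed

lemma not_tail_equivalent_disjoint:
  assumes ne: "\<not> tail_equivalent (w a) (w b)"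
  shows "radon_disjoint (chacon_space (w a)) (chacon_measure (w a)) (chacon_action (w a) 1)
    (chacon_space (w b)) (chacon_measure (w b)) (chacon_action (w b) 1)"
  unfolding radon_disjoint_def
proof (intro allI iffI)
  fix L
  assume "radon_joining (chacon_space (w a)) (chacon_measure (w a)) (chacon_action (w a) 1)
    (chacon_space (w b)) (chacon_measure (w b)) (chacon_action (w b) 1) L \<and> ergodic L pair_act"
  then have jo: "radon_joining (chacon_space (w a)) (chacon_measure (w a)) (chacon_action (w a) 1)
    (chacon_space (w b)) (chacon_measure (w b)) (chacon_action (w b) 1) L" and erg: "ergodic L pair_act" by auto
  note tr = joining_transport[OF jo erg]
  obtain c where c: "c \<noteq> 0" "c < \<infinity>" "distr L borel_prod of_pair = scale_measure c chacon_prod"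
    using joining_is_product[OF ne tr(2)] by blast
  have "L = scale_measure c pair_chacon"
  proof (rule measure_eqI)
    fix X assume "X \<in> sets L"
    then have X: "X \<in> sets pair_chacon" by (simp add: tr(1))
    show "emeasure L X = emeasure (scale_measure c pair_chacon) X"
      unfolding tr(3)[OF X] c(3) by (simp add: emeasure_pair_chacon[OF X])
  qed (simp add: tr(1))
  moreover have "ennreal (enn2real c) = c" "enn2real c > 0"
    using c(1,2) by (simp_all add: enn2real_positive_iff zero_less_iff_neq_zero)
  ultimately show "\<exists>c>0. L = scale_measure (ennreal c) pair_chacon" by (intro exI[of _ "enn2real c"]) simp
next
  fix L assume "\<exists>c>0. L = scale_measure (ennreal c) pair_chacon"
  then obtain c where "c > 0" "L = scale_measure (ennreal c) pair_chacon" by blast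
  then show "radon_joining (chacon_space (w a)) (chacon_measure (w a)) (chacon_action (w a) 1)
    (chacon_space (w b)) (chacon_measure (w b)) (chacon_action (w b) 1) L \<and> ergodic L pair_act"
    using product_is_joining[of c] by simp
qed

end

theorem tail_inequivalent_disjoint:
  assumes "\<not> tail_equivalent \<omega> \<omega>'"
  shows "radon_disjoint (chacon_space \<omega>) (chacon_measure \<omega>) (chacon_action \<omega> 1)
    (chacon_space \<omega>') (chacon_measure \<omega>') (chacon_action \<omega>' 1)"
proof -
  obtain a b :: nat where ab: "a \<noteq> b" using zero_neq_one by blast
  define w where "w i = (if i = a then \<omega> else \<omega>')" for i
  have w: "w a = \<omega>" "w b = \<omega>'" using ab by (simp_all add: w_def)
  interpret chacon_pair w "{a, b}" a b by unfold_locales (simp_all add: ab)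
  show ?thesis using not_tail_equivalent_disjoint assms by (simp add: w)
qed

theorem theorem6p1:
  "(\<forall>\<omega>. totally_ergodic (chacon_measure \<omega>) (chacon_action \<omega> 1) \<and>
        radon_msj (chacon_space \<omega>) (chacon_measure \<omega>) (chacon_action \<omega> 1) \<and>
        centralizer (chacon_measure \<omega>) (chacon_action \<omega> 1) =
          mod_null (chacon_measure \<omega>) (range (chacon_action \<omega>))) \<and>
   (\<forall>\<omega> \<omega>'. tail_equivalent \<omega> \<omega>' \<longrightarrow>
        isomorphic_systems (chacon_measure \<omega>) (chacon_action \<omega> 1)
          (chacon_measure \<omega>') (chacon_action \<omega>' 1)) \<and>
   (\<forall>\<omega> \<omega>'. \<not> tail_equivalent \<omega> \<omega>' \<longrightarrow>
        radon_disjoint (chacon_space \<omega>) (chacon_measure \<omega>) (chacon_action \<omega> 1)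
          (chacon_space \<omega>') (chacon_measure \<omega>') (chacon_action \<omega>' 1))"
  using chacon_totally_ergodic chacon_radon_msj centralizer_powers tail_equivalent_isomorphic
    tail_inequivalent_disjoint by simp

end
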